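(* Under the standing setup, let $\omega\subset\mathbb R^d$ be open and bounded with $0\in\omega$, and let $b\in\mathcal M$. Then for almost all $x_0\in\Omega$ the limit $\delta J(a;b,x_0,\omega):=\lim_{r\searrow0}\frac{J(a_r)-J(a)}{r^d|\omega|}$ exists and \[ \delta J(a;b,x_0,\omega)=-(b-a(x_0))\nabla y(x_0)\cdot\Big(\nabla p(x_0)+\frac1{|\omega|}\int_\omega\nabla_{x'}Q\,dx'\Big), \] where $Q\in\dot H^1(\mathbb R^d)$ is the unique solution of $\int_{\mathbb R^d}\tilde a\nabla_{x'}v\cdot\nabla_{x'}Q\,dx'+\big((b-a(x_0))\int_\omega\nabla_{x'}v\,dx'\big)\cdot\nabla p(x_0)=0$ for all $v\in\dot H^1(\mathbb R^d)$. The function $Q$ depends only on $a(x_0)$, $b$, $\nabla p(x_0)$ and $\omega$.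
   Context: Standing setup: $\Omega\subset\mathbb R^d$ bounded domain, $\alpha>0$, $y_d,f\in L^2(\Omega)$; $\mathcal M:=\{A\in\mathbb R^{d\times d}:\xi^TA\xi\ge\alpha|\xi|^2\ \forall\xi\}$, $\mathcal A:=\{a\in L^\infty(\Omega;\mathbb R^{d\times d}):a(x)\in\mathcal M\text{ a.e.}\}$; $au\cdot v:=\sum_{i,j}a_{ij}u_jv_i$. Fix $a\in\mathcal A$; $y\in H^1_0(\Omega)$ solves $\int_\Omega a\nabla y\cdot\nabla v=\int_\Omega fv$, $p\in H^1_0(\Omega)$ solves $\int_\Omega a\nabla v\cdot\nabla p=\int_\Omega(y-y_d)v$, for all $v\in H^1_0(\Omega)$; $J(a):=\frac12\|y-y_d\|^2_{L^2(\Omega)}$. $a_r:=a+\chi_{x_0+r\omega}(b-a)$ and $J(a_r)$ is computed with the state for $a_r$. $\tilde a:=\chi_\omega b+\chi_{\mathbb R^d\setminus\omega}a(x_0)$. $\dot H^1(\mathbb R^d):=\{z\in H^1_{loc}:\nabla z\in L^2(\mathbb R^d)\}/\mathbb R$ with norm $\|\nabla z\|_{L^2}$. Pointwise values $a(x_0),\nabla y(x_0),\nabla p(x_0)$ are those of fixed representatives (Lebesgue values). *)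

theory Defs
  imports "HOL-Analysis.Analysis"
begin

coinductive smooth_fun :: "('a::euclidean_space \<Rightarrow> real) \<Rightarrow> bool" where
  "f differentiable_on UNIV \<Longrightarrow>
   (\<forall>i\<in>Basis. smooth_fun (\<lambda>x. frechet_derivative f (at x) i)) \<Longrightarrow> smooth_fun f"

definition grad :: "(real^'n \<Rightarrow> real) \<Rightarrow> real^'n \<Rightarrow> real^'n" where
  "grad \<phi> x = (\<chi> i. frechet_derivative \<phi> (at x) (axis i 1))"

definition test_fun :: "(real^'n) set \<Rightarrow> (real^'n \<Rightarrow> real) \<Rightarrow> bool" where
  "test_fun U \<phi> \<longleftrightarrow> smooth_fun \<phi> \<and> compact (closure {x. \<phi> x \<noteq> 0})
      \<and> closure {x. \<phi> x \<noteq> 0} \<subseteq> U"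

definition loc_integrable :: "(real^'n) set \<Rightarrow> (real^'n \<Rightarrow> 'b::{banach,second_countable_topology}) \<Rightarrow> bool" where
  "loc_integrable U u \<longleftrightarrow> (\<forall>K. compact K \<and> K \<subseteq> U \<longrightarrow> integrable (lebesgue_on K) u)"

definition weak_grad :: "(real^'n) set \<Rightarrow> (real^'n \<Rightarrow> real) \<Rightarrow> (real^'n \<Rightarrow> real^'n) \<Rightarrow> bool" where
  "weak_grad U u g \<longleftrightarrow> loc_integrable U u \<and> loc_integrable U g \<and>
     (\<forall>\<phi>. test_fun U \<phi> \<longrightarrow> (\<forall>i.
        integral\<^sup>L (lebesgue_on U) (\<lambda>x. u x * grad \<phi> x $ i)
        = - integral\<^sup>L (lebesgue_on U) (\<lambda>x. g x $ i * \<phi> x)))"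

definition L2 :: "(real^'n) set \<Rightarrow> (real^'n \<Rightarrow> real) \<Rightarrow> bool" where
  "L2 U u \<longleftrightarrow> u \<in> borel_measurable (lebesgue_on U) \<and> integrable (lebesgue_on U) (\<lambda>x. (u x)\<^sup>2)"

definition L2v :: "(real^'n) set \<Rightarrow> (real^'n \<Rightarrow> real^'n) \<Rightarrow> bool" where
  "L2v U g \<longleftrightarrow> g \<in> borel_measurable (lebesgue_on U) \<and> integrable (lebesgue_on U) (\<lambda>x. (norm (g x))\<^sup>2)"

definition H10 :: "(real^'n) set \<Rightarrow> (real^'n \<Rightarrow> real) \<Rightarrow> (real^'n \<Rightarrow> real^'n) \<Rightarrow> bool" where
  "H10 U u g \<longleftrightarrow> weak_grad U u g \<and> L2 U u \<and> L2v U g \<and>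
     (\<exists>\<phi>. (\<forall>k. test_fun U (\<phi> k)) \<and>
        (\<lambda>k. integral\<^sup>L (lebesgue_on U)
               (\<lambda>x. (u x - \<phi> k x)\<^sup>2 + (norm (g x - grad (\<phi> k) x))\<^sup>2)) \<longlonglongrightarrow> 0)"

text \<open>Q \<in> \<dot>H^1(R^d) (a representative) with weak gradient gQ: Q \<in> H^1_loc, gradient in L^2(R^d).\<close>
definition Hdot :: "(real^'n \<Rightarrow> real) \<Rightarrow> (real^'n \<Rightarrow> real^'n) \<Rightarrow> bool" where
  "Hdot Q gQ \<longleftrightarrow> weak_grad UNIV Q gQ \<and> (\<forall>K. compact K \<longrightarrow> L2 K Q) \<and> L2v UNIV gQ"

definition coercive_mat :: "real \<Rightarrow> real^'n^'n \<Rightarrow> bool" where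
  "coercive_mat \<alpha> A \<longleftrightarrow> (\<forall>\<xi>. \<xi> \<bullet> (A *v \<xi>) \<ge> \<alpha> * (norm \<xi>)\<^sup>2)"

definition admissible :: "real \<Rightarrow> (real^'n) set \<Rightarrow> (real^'n \<Rightarrow> real^'n^'n) \<Rightarrow> bool" where
  "admissible \<alpha> \<Omega> a \<longleftrightarrow> a \<in> borel_measurable (lebesgue_on \<Omega>) \<and>
     (\<exists>C. AE x in lebesgue_on \<Omega>. norm (a x) \<le> C) \<and>
     (AE x in lebesgue_on \<Omega>. coercive_mat \<alpha> (a x))"

definition state_eq :: "(real^'n) set \<Rightarrow> (real^'n \<Rightarrow> real^'n^'n) \<Rightarrow> (real^'n \<Rightarrow> real)
    \<Rightarrow> (real^'n \<Rightarrow> real) \<Rightarrow> (real^'n \<Rightarrow> real^'n) \<Rightarrow> bool" where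
  "state_eq \<Omega> a f y gy \<longleftrightarrow> H10 \<Omega> y gy \<and>
     (\<forall>v gv. H10 \<Omega> v gv \<longrightarrow>
        integral\<^sup>L (lebesgue_on \<Omega>) (\<lambda>x. (a x *v gy x) \<bullet> gv x)
        = integral\<^sup>L (lebesgue_on \<Omega>) (\<lambda>x. f x * v x))"

definition adjoint_eq :: "(real^'n) set \<Rightarrow> (real^'n \<Rightarrow> real^'n^'n) \<Rightarrow> (real^'n \<Rightarrow> real)
    \<Rightarrow> (real^'n \<Rightarrow> real) \<Rightarrow> (real^'n \<Rightarrow> real) \<Rightarrow> (real^'n \<Rightarrow> real^'n) \<Rightarrow> bool" where
  "adjoint_eq \<Omega> a y yd p gp \<longleftrightarrow> H10 \<Omega> p gp \<and>
     (\<forall>v gv. H10 \<Omega> v gv \<longrightarrow>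
        integral\<^sup>L (lebesgue_on \<Omega>) (\<lambda>x. (a x *v gv x) \<bullet> gp x)
        = integral\<^sup>L (lebesgue_on \<Omega>) (\<lambda>x. (y x - yd x) * v x))"

text \<open>J(a) = 1/2 ||y - y_d||^2 with y the state for a (unique up to null sets).\<close>
definition Jcost :: "(real^'n) set \<Rightarrow> (real^'n \<Rightarrow> real) \<Rightarrow> (real^'n \<Rightarrow> real)
    \<Rightarrow> (real^'n \<Rightarrow> real^'n^'n) \<Rightarrow> real" where
  "Jcost \<Omega> f yd a = (THE j. \<exists>y gy. state_eq \<Omega> a f y gy \<and>
      j = 1/2 * integral\<^sup>L (lebesgue_on \<Omega>) (\<lambda>x. (y x - yd x)\<^sup>2))"

definition perturbed :: "(real^'n \<Rightarrow> real^'n^'n) \<Rightarrow> real^'n^'n \<Rightarrow> real^'n \<Rightarrow> (real^'n) set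
    \<Rightarrow> real \<Rightarrow> real^'n \<Rightarrow> real^'n^'n" where
  "perturbed a b x0 \<omega> r x = a x + indicator ((\<lambda>z. x0 + r *\<^sub>R z) ` \<omega>) x *\<^sub>R (b - a x)"

definition atilde :: "real^'n^'n \<Rightarrow> real^'n^'n \<Rightarrow> (real^'n) set \<Rightarrow> real^'n \<Rightarrow> real^'n^'n" where
  "atilde A b \<omega> x = indicator \<omega> x *\<^sub>R b + indicator (UNIV - \<omega>) x *\<^sub>R A"

text \<open>The corrector problem for Q; parameters: A = a(x0), b, P = grad p(x0), omega.\<close>
definition corrector_eq :: "real^'n^'n \<Rightarrow> real^'n^'n \<Rightarrow> real^'n \<Rightarrow> (real^'n) set
    \<Rightarrow> (real^'n \<Rightarrow> real) \<Rightarrow> (real^'n \<Rightarrow> real^'n) \<Rightarrow> bool" where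
  "corrector_eq A b P \<omega> Q gQ \<longleftrightarrow> Hdot Q gQ \<and>
     (\<forall>v gv. Hdot v gv \<longrightarrow>
        integral\<^sup>L lebesgue (\<lambda>x. (atilde A b \<omega> x *v gv x) \<bullet> gQ x)
        + ((b - A) *v integral\<^sup>L (lebesgue_on \<omega>) gv) \<bullet> P = 0)"

end

theory Submission
  imports Defs
begin

text \<open>Let \<open>y\<^sub>r\<close> be the state for the perturbed coefficient and let \<open>p\<^sub>r\<close> solve the adjoint equation for the
  perturbed coefficient with the averaged source \<open>(y\<^sub>r + y)/2 - y\<^sub>d\<close>. Then
  \<open>J(a\<^sub>r) - J(a) = - \<integral> (b - a) \<nabla>y \<cdot> \<nabla>p\<^sub>r\<close> over the inclusion \<open>x\<^sub>0 + r\<omega>\<close>, exactly. Blown up around a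
  common Lebesgue point \<open>x\<^sub>0\<close> of \<open>a\<close>, \<open>(b - a)\<nabla>y\<close>, \<open>(b - a)\<^sup>T\<nabla>p\<close> and \<open>\<nabla>p\<close>, the data converge strongly on
  \<open>\<omega>\<close>, so it suffices that the rescaled gradients of \<open>p\<^sub>r - p\<close>, which energy estimates bound in \<open>L\<^sup>2\<close>,
  converge weakly to \<open>\<nabla>Q\<close>. This is checked by duality against gradients of test functions. The
  corrector equation allows all functions with square-integrable gradient as test functions, so one needs
  that gradients of compactly supported smooth functions are dense among square-integrable gradients in
  every dimension; this follows from a Liouville argument for the correlation of a curl-free with a
  divergence-free field.\<close>

section \<open>Hilbert spaces\<close>

text \<open>The coefficients are not symmetric, so existence rests on Lax-Milgram, and the adjoint
  and corrector problems on the transposed field. Functions on the domain are extended by zero and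
  kept as classes in one L2 space over R^d. There the blow-up x = x_0 + r z is a bounded linear map
  that divides inner products by r^d, so estimates keep their constants; and since only gradients
  are recorded, the quotient by constants in the corrector problem disappears. The obstacle in the
  limit is a product of two factors depending on r: the rescaled gradient converges only weakly, the
  rescaled coefficient only locally and in L2. Testing with a fixed compactly supported gradient
  puts the coefficient on a bounded function, where its strong convergence is enough; the uniform
  energy bound then extends the result to the closure. A cutoff proof of density has to control a
  potential on growing annuli, which in dimension one are even disconnected; the correlation
  argument works with the gradient itself and treats all dimensions alike.\<close>

lemma closest_point_in_closed_subspace:
  fixes V :: "'h::{real_inner,complete_space} set"
  assumes V: "subspace V" "closed V"
  shows "\<exists>p\<in>V. \<forall>v\<in>V. norm (x - p) \<le> norm (x - v)"
proof -
  define d where "d = (INF v\<in>V. (norm (x - v))\<^sup>2)"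
  have ne: "V \<noteq> {}" using V(1) subspace_0 by blast
  have bdd: "bdd_below ((\<lambda>v. (norm (x - v))\<^sup>2) ` V)" by (intro bdd_belowI2[where m=0]) simp
  have d_le: "d \<le> (norm (x - v))\<^sup>2" if "v \<in> V" for v
    unfolding d_def using bdd that by (rule cINF_lower)
  have "\<exists>v\<in>V. (norm (x - v))\<^sup>2 < d + inverse (real (Suc n))" for n
    using cINF_less_iff[OF ne bdd, of "d + inverse (real (Suc n))"] unfolding d_def by auto
  then obtain w where w: "\<And>n. w n \<in> V" "\<And>n. (norm (x - w n))\<^sup>2 < d + inverse (real (Suc n))"
    by metis
  \<comment> \<open>Parallelogram law: the midpoint of \<open>w n\<close> and \<open>w m\<close>
    lies in \<open>V\<close>, so its squared distance to \<open>x\<close> is at least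
    \<open>d\<close>; two nearly minimal points must therefore be close to each other.\<close>
  have par: "(norm (w n - w m))\<^sup>2 \<le> 2 * inverse (real (Suc n)) + 2 * inverse (real (Suc m))" for n m
  proof -
    have "(1/2) *\<^sub>R (w n + w m) \<in> V" using w(1) V(1) by (intro subspace_scale subspace_add)
    from d_le[OF this] have *: "d \<le> (norm (x - (1/2) *\<^sub>R (w n + w m)))\<^sup>2" .
    have "(norm (w n - w m))\<^sup>2 = 2 * (norm (x - w n))\<^sup>2 + 2 * (norm (x - w m))\<^sup>2
        - 4 * (norm (x - (1/2) *\<^sub>R (w n + w m)))\<^sup>2"
      unfolding power2_norm_eq_inner by (simp add: inner_simps inner_commute algebra_simps)
    with * w(2)[of n] w(2)[of m] show ?thesis by linarith
  qed
  have "Cauchy w"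
  proof (rule metric_CauchyI)
    fix e :: real assume "0 < e"
    then have "0 < e\<^sup>2 / 4" by simp
    then obtain N where N: "inverse (real (Suc N)) < e\<^sup>2 / 4" using reals_Archimedean by blast
    have "dist (w m) (w n) < e" if "m \<ge> N" "n \<ge> N" for m n
    proof -
      have "inverse (real (Suc k)) \<le> inverse (real (Suc N))" if "k \<ge> N" for k
        using that by (simp add: field_simps)
      from this[OF that(1)] this[OF that(2)] N par[of m n] have "(norm (w m - w n))\<^sup>2 < e\<^sup>2"
        by linarith
      then show ?thesis using \<open>0 < e\<close> by (simp add: dist_norm power_less_imp_less_base)
    qed
    then show "\<exists>M. \<forall>m\<ge>M. \<forall>n\<ge>M. dist (w m) (w n) < e" by blast
  qed
  then obtain p where p: "w \<longlonglongrightarrow> p" using Cauchy_convergent_iff convergent_def by blast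
  have pV: "p \<in> V" using closed_sequentially[OF V(2) _ p] w(1) by blast
  have lim1: "(\<lambda>n. (norm (x - w n))\<^sup>2) \<longlonglongrightarrow> (norm (x - p))\<^sup>2" by (intro tendsto_intros p)
  have lim2: "(\<lambda>n. d + inverse (real (Suc n))) \<longlonglongrightarrow> d + 0"
    by (intro tendsto_add tendsto_const LIMSEQ_inverse_real_of_nat)
  have le: "(norm (x - p))\<^sup>2 \<le> d + 0"
    by (rule LIMSEQ_le[OF lim1 lim2], intro exI allI impI, rule less_imp_le[OF w(2)])
  have "norm (x - p) \<le> norm (x - v)" if "v \<in> V" for v
    by (rule power2_le_imp_le[OF order_trans[OF le[unfolded add_0_right] d_le[OF that]] norm_ge_zero])
  with pV show ?thesis by blast
qed

lemma orthogonal_projection_exists: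
  fixes V :: "'h::{real_inner,complete_space} set"
  assumes V: "subspace V" "closed V"
  shows "\<exists>p\<in>V. \<forall>v\<in>V. inner (x - p) v = 0"
proof -
  obtain p where p: "p \<in> V" and min: "\<And>v. v \<in> V \<Longrightarrow> norm (x - p) \<le> norm (x - v)"
    using closest_point_in_closed_subspace[OF V] by blast
  have "inner (x - p) v = 0" if v: "v \<in> V" for v
  proof (rule ccontr)
    assume ne: "inner (x - p) v \<noteq> 0"
    then have v0: "v \<noteq> 0" by auto
    \<comment> \<open>This \<open>t\<close> minimises the distance to \<open>x\<close> along the
      line through \<open>p\<close> in direction \<open>v\<close>; a nonzero inner product would
      push that distance below the minimum.\<close>
    define t where "t = inner (x - p) v / inner v v"
    have "p + t *\<^sub>R v \<in> V" using p v V(1) by (intro subspace_add subspace_scale)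
    from min[OF this] have "(norm (x - p))\<^sup>2 \<le> (norm (x - (p + t *\<^sub>R v)))\<^sup>2" by (simp add: power_mono)
    also have "(norm (x - (p + t *\<^sub>R v)))\<^sup>2 = (norm (x - p))\<^sup>2 - 2 * t * inner (x - p) v + t * t * inner v v"
      unfolding power2_norm_eq_inner by (simp add: inner_simps inner_commute algebra_simps)
    also have "\<dots> = (norm (x - p))\<^sup>2 - (inner (x - p) v)\<^sup>2 / inner v v"
      using v0 by (simp add: t_def field_simps power2_eq_square)
    finally show False using ne v0 by (simp add: divide_le_0_iff) (smt (verit) inner_gt_zero_iff zero_less_power2)
  qed
  with p show ?thesis by blast
qed

text \<open>The projection onto \<open>V\<close> leaves a residual orthogonal to \<open>V\<close>.
  The intended \<open>V\<close> is the set of elements against which a given bounded sequence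
  converges weakly.\<close>

lemma closed_subspace_eq_UNIV:
  fixes V :: "'h::{real_inner,complete_space} set"
  assumes V: "subspace V" "closed V" and perp: "\<And>x. (\<And>v. v \<in> V \<Longrightarrow> inner x v = 0) \<Longrightarrow> x = 0"
  shows "x \<in> V"
proof -
  obtain p where p: "p \<in> V" "\<And>v. v \<in> V \<Longrightarrow> inner (x - p) v = 0"
    using orthogonal_projection_exists[OF V] by blast
  have "x - p = 0" by (rule perp) (rule p(2))
  with p show ?thesis by simp
qed

text \<open>Without symmetry of \<open>A\<close> the solution is not the minimiser of a quadratic
  functional. With P the orthogonal projection onto \<open>V\<close>, the equation on
  \<open>V\<close> says P(A u - F) = 0, so u is a fixed point of u - \<rho> P(A u - F); coercivity
  makes this map a contraction of \<open>V\<close> for small \<rho>.\<close>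

theorem lax_milgram:
  fixes V :: "'h::{real_inner,complete_space} set"
  assumes V: "subspace V" "closed V" and A: "bounded_linear A"
    and c: "c > 0" and coer: "\<And>v. v \<in> V \<Longrightarrow> c * (norm v)\<^sup>2 \<le> inner (A v) v"
  shows "\<exists>u\<in>V. \<forall>v\<in>V. inner (A u) v = inner F v"
proof -
  define P where "P x = (SOME p. p \<in> V \<and> (\<forall>v\<in>V. inner (x - p) v = 0))" for x
  have P: "P x \<in> V" "\<And>v. v \<in> V \<Longrightarrow> inner (x - P x) v = 0" for x
    using someI_ex[of "\<lambda>p. p \<in> V \<and> (\<forall>v\<in>V. inner (x - p) v = 0)"] orthogonal_projection_exists[OF V, of x]
    unfolding P_def[symmetric] by blast+
  have Pin: "inner (P x) v = inner x v" if "v \<in> V" for x v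
    using P(2)[OF that] by (simp add: inner_diff_left)
  interpret A: bounded_linear A by fact
  obtain M where M: "M > 0" "\<And>x. norm (A x) \<le> M * norm x"
    using A.pos_bounded by (auto simp: mult.commute)
  \<comment> \<open>The squared Lipschitz constant is at most 1 - 2 \<rho> c + \<rho>^2 M^2. This
    choice gives \<rho> M^2 \<le> c and hence the bound 1 - \<rho> c; the summand c^2 in the
    denominator keeps \<rho> c below 1 even if c exceeds M.\<close>
  define \<rho> where "\<rho> = c / (M\<^sup>2 + c\<^sup>2)"
  define T where "T u = u - \<rho> *\<^sub>R P (A u - F)" for u
  define k where "k = sqrt (1 - \<rho> * c)"
  have \<rho>: "\<rho> > 0" "\<rho> * c < 1" "\<rho> * M\<^sup>2 \<le> c"
    using c M(1) by (auto simp: \<rho>_def field_simps power2_eq_square add_pos_pos)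
  have k: "0 \<le> k" "k < 1" using \<rho> c by (auto simp: k_def)
  have TV: "T u \<in> V" if "u \<in> V" for u unfolding T_def using P(1) that V(1) by (intro subspace_diff subspace_scale)
  have contr: "norm (T u - T w) \<le> k * norm (u - w)" if uw: "u \<in> V" "w \<in> V" for u w
  proof -
    define e where "e = u - w"
    define q where "q = P (A u - F) - P (A w - F)"
    have e: "e \<in> V" and q: "q \<in> V" unfolding e_def q_def using uw P(1) V(1) by (auto intro: subspace_diff)
    have qe: "inner q v = inner (A e) v" if "v \<in> V" for v
      unfolding q_def e_def using Pin[OF that] by (simp add: inner_diff_left A.diff)
    have "(norm q)\<^sup>2 = inner (A e) q" using qe[OF q] by (simp add: power2_norm_eq_inner)
    also have "\<dots> \<le> norm (A e) * norm q" by (rule norm_cauchy_schwarz)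
    finally have "norm q \<le> norm (A e)" by (cases "norm q = 0") (auto simp: power2_eq_square)
    also have "\<dots> \<le> M * norm e" by (rule M(2))
    finally have nq: "(norm q)\<^sup>2 \<le> M\<^sup>2 * (norm e)\<^sup>2" by (metis norm_ge_zero power_mono power_mult_distrib)
    have "T u - T w = e - \<rho> *\<^sub>R q" unfolding T_def e_def q_def by (simp add: algebra_simps)
    then have "(norm (T u - T w))\<^sup>2 = (norm (e - \<rho> *\<^sub>R q))\<^sup>2" by simp
    also have "\<dots> = (norm e)\<^sup>2 - 2 * \<rho> * inner (A e) e + \<rho>\<^sup>2 * (norm q)\<^sup>2"
      unfolding power2_norm_eq_inner qe[OF e, symmetric]
      by (simp add: inner_simps inner_commute algebra_simps power2_eq_square)
    also have "\<dots> \<le> (norm e)\<^sup>2 - 2 * \<rho> * (c * (norm e)\<^sup>2) + \<rho>\<^sup>2 * (M\<^sup>2 * (norm e)\<^sup>2)"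
      using coer[OF e] nq \<rho>(1) by (intro add_mono diff_mono mult_left_mono order_refl) auto
    also have "\<rho>\<^sup>2 * (M\<^sup>2 * (norm e)\<^sup>2) = (\<rho> * (norm e)\<^sup>2) * (\<rho> * M\<^sup>2)" by (simp add: power2_eq_square)
    also have "(\<rho> * (norm e)\<^sup>2) * (\<rho> * M\<^sup>2) \<le> (\<rho> * (norm e)\<^sup>2) * c" using \<rho> by (intro mult_left_mono) auto
    finally have "(norm (T u - T w))\<^sup>2 \<le> (1 - \<rho> * c) * (norm e)\<^sup>2" by (simp add: algebra_simps)
    also have "\<dots> = (k * norm e)\<^sup>2" using \<rho> by (simp add: k_def power_mult_distrib)
    finally have "norm (T u - T w) \<le> k * norm e"
      by (rule power2_le_imp_le) (simp add: k(1))
    then show ?thesis by (simp add: e_def)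
  qed
  have "\<exists>!u. u \<in> V \<and> T u = u"
    by (rule Banach_fix[of V k T])
       (use V k TV contr subspace_0[OF V(1)] in \<open>auto simp: dist_norm complete_eq_closed\<close>)
  then obtain u where u: "u \<in> V" "T u = u" by blast
  then have "P (A u - F) = 0" using \<rho>(1) by (simp add: T_def)
  then have "inner (A u - F) v = 0" if "v \<in> V" for v using Pin[OF that, of "A u - F"] by simp
  with u(1) show ?thesis by (intro bexI[of _ u]) (auto simp: inner_diff_left)
qed

section \<open>The Hilbert space of square-integrable functions\<close>

text \<open>The domain of integration is always the whole space; functions on a measurable set enter
  multiplied by its indicator.\<close>

definition square_integrable :: "('a::euclidean_space \<Rightarrow> 'b::euclidean_space) \<Rightarrow> bool" where
  "square_integrable f \<longleftrightarrow> f \<in> borel_measurable lebesgue \<and> integrable lebesgue (\<lambda>x. (norm (f x))\<^sup>2)"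

lemma square_integrable_measurable[measurable_dest]:
  "square_integrable f \<Longrightarrow> f \<in> borel_measurable lebesgue"
  by (simp add: square_integrable_def)

lemma square_integrable_bound:
  assumes g: "integrable lebesgue g" and f: "f \<in> borel_measurable lebesgue"
    and le: "\<And>x. (norm (f x))\<^sup>2 \<le> g x"
  shows "square_integrable f"
  unfolding square_integrable_def
proof
  show "integrable lebesgue (\<lambda>x. (norm (f x))\<^sup>2)"
  proof (rule Bochner_Integration.integrable_bound[OF g])
    show "(\<lambda>x. (norm (f x))\<^sup>2) \<in> borel_measurable lebesgue" using f by measurable
    show "AE x in lebesgue. norm ((norm (f x))\<^sup>2) \<le> norm (g x)"
      by (rule AE_I2) (simp add: order_trans[OF le abs_ge_self])
  qed
qed (rule f)

lemma square_integrable_bound_norm: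
  assumes g: "square_integrable g" and f: "f \<in> borel_measurable lebesgue"
    and le: "\<And>x. norm (f x) \<le> C * norm (g x)"
  shows "square_integrable f"
proof (rule square_integrable_bound[OF _ f])
  show "integrable lebesgue (\<lambda>x. C\<^sup>2 * (norm (g x))\<^sup>2)" using g by (simp add: square_integrable_def)
  show "(norm (f x))\<^sup>2 \<le> C\<^sup>2 * (norm (g x))\<^sup>2" for x
    using power_mono[OF le norm_ge_zero, of x 2] by (simp add: power_mult_distrib)
qed

lemma square_integrable_zero[simp]: "square_integrable (\<lambda>x. 0)"
  by (simp add: square_integrable_def)

lemma square_integrable_add[simp]:
  assumes f: "square_integrable f" and g: "square_integrable g"
  shows "square_integrable (\<lambda>x. f x + g x)"
proof (rule square_integrable_bound)
  show "integrable lebesgue (\<lambda>x. 2 * (norm (f x))\<^sup>2 + 2 * (norm (g x))\<^sup>2)"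
    using f g by (simp add: square_integrable_def)
  show "(\<lambda>x. f x + g x) \<in> borel_measurable lebesgue" using f g by measurable
  fix x
  have "(norm (f x + g x))\<^sup>2 \<le> (norm (f x) + norm (g x))\<^sup>2" by (intro power_mono norm_triangle_ineq) auto
  also have "\<dots> \<le> 2 * (norm (f x))\<^sup>2 + 2 * (norm (g x))\<^sup>2"
    using sum_squares_bound[of "norm (f x)" "norm (g x)"] by (simp add: power2_sum)
  finally show "(norm (f x + g x))\<^sup>2 \<le> 2 * (norm (f x))\<^sup>2 + 2 * (norm (g x))\<^sup>2" .
qed

lemma square_integrable_scaleR[simp]:
  assumes f: "square_integrable f" shows "square_integrable (\<lambda>x. c *\<^sub>R f x)"
  using f by (auto simp: square_integrable_def power_mult_distrib)

lemma square_integrable_minus[simp]: "square_integrable f \<Longrightarrow> square_integrable (\<lambda>x. - f x)"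
  using square_integrable_scaleR[of f "-1"] by simp

lemma square_integrable_diff[simp]:
  "square_integrable f \<Longrightarrow> square_integrable g \<Longrightarrow> square_integrable (\<lambda>x. f x - g x)"
  using square_integrable_add[of f "\<lambda>x. - g x"] by simp

lemma square_integrable_inner:
  assumes f: "square_integrable f" and g: "square_integrable g"
  shows "integrable lebesgue (\<lambda>x. f x \<bullet> g x)"
proof (rule Bochner_Integration.integrable_bound)
  show "integrable lebesgue (\<lambda>x. (norm (f x))\<^sup>2 + (norm (g x))\<^sup>2)"
    using f g by (simp add: square_integrable_def)
  show "(\<lambda>x. f x \<bullet> g x) \<in> borel_measurable lebesgue" using f g by measurable
  have "norm (f x \<bullet> g x) \<le> norm ((norm (f x))\<^sup>2 + (norm (g x))\<^sup>2)" for x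
  proof -
    have "\<bar>f x \<bullet> g x\<bar> \<le> norm (f x) * norm (g x)" by (rule Cauchy_Schwarz_ineq2)
    also have "\<dots> \<le> (norm (f x))\<^sup>2 + (norm (g x))\<^sup>2"
      using sum_squares_bound[of "norm (f x)" "norm (g x)"]
        mult_nonneg_nonneg[OF norm_ge_zero norm_ge_zero, of "f x" "g x"] by linarith
    finally show ?thesis by simp
  qed
  then show "AE x in lebesgue. norm (f x \<bullet> g x) \<le> norm ((norm (f x))\<^sup>2 + (norm (g x))\<^sup>2)" by simp
qed

\<comment> \<open>Passing to classes yields a genuine type of complete inner product spaces, to
  which projection and Lax-Milgram apply directly. Values may lie in any Euclidean space: scalars,
  gradients, matrices, and pairs of a function with its gradient.\<close>
quotient_type (overloaded) ('a, 'b) l2 =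
  "'a::euclidean_space \<Rightarrow> 'b::euclidean_space" / partial: "\<lambda>f g. square_integrable f \<and> square_integrable g \<and> (AE x in lebesgue. f x = g x)"
proof (rule part_equivpI)
  show "\<exists>x. square_integrable x \<and> square_integrable x \<and> (AE y in lebesgue. x y = x y)"
    by (rule exI[of _ "\<lambda>x. 0"]) simp
  show "symp (\<lambda>f g. square_integrable f \<and> square_integrable g \<and> (AE x in lebesgue. f x = g x))"
    by (auto simp: symp_def eq_commute)
  show "transp (\<lambda>f g. square_integrable f \<and> square_integrable g \<and> (AE x in lebesgue. f x = g x))"
    by (auto simp: transp_def elim: eventually_elim2)
qed

instantiation l2 :: (euclidean_space, euclidean_space) real_inner
begin

lift_definition zero_l2 :: "('a, 'b) l2" is "\<lambda>x. 0" by simp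
lift_definition plus_l2 :: "('a, 'b) l2 \<Rightarrow> ('a, 'b) l2 \<Rightarrow> ('a, 'b) l2" is "\<lambda>f g x. f x + g x"
  by (auto elim: eventually_elim2)
lift_definition minus_l2 :: "('a, 'b) l2 \<Rightarrow> ('a, 'b) l2 \<Rightarrow> ('a, 'b) l2" is "\<lambda>f g x. f x - g x"
  by (auto elim: eventually_elim2)
lift_definition uminus_l2 :: "('a, 'b) l2 \<Rightarrow> ('a, 'b) l2" is "\<lambda>f x. - f x"
  by auto
lift_definition scaleR_l2 :: "real \<Rightarrow> ('a, 'b) l2 \<Rightarrow> ('a, 'b) l2" is "\<lambda>c f x. c *\<^sub>R f x"
  by (auto elim: eventually_mono)
lift_definition inner_l2 :: "('a, 'b) l2 \<Rightarrow> ('a, 'b) l2 \<Rightarrow> real"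
  is "\<lambda>f g. integral\<^sup>L lebesgue (\<lambda>x. f x \<bullet> g x)"
proof -
  fix f1 f2 g1 g2 :: "'a \<Rightarrow> 'b"
  assume a: "square_integrable f1 \<and> square_integrable f2 \<and> (AE x in lebesgue. f1 x = f2 x)"
     "square_integrable g1 \<and> square_integrable g2 \<and> (AE x in lebesgue. g1 x = g2 x)"
  have 1: "(\<lambda>x. f1 x \<bullet> g1 x) \<in> borel_measurable lebesgue" "(\<lambda>x. f2 x \<bullet> g2 x) \<in> borel_measurable lebesgue"
    using a by (simp_all add: borel_measurable_integrable square_integrable_inner)
  have 2: "AE x in lebesgue. f1 x \<bullet> g1 x = f2 x \<bullet> g2 x"
    using a by (auto elim: eventually_elim2)
  show "(LINT x|lebesgue. f1 x \<bullet> g1 x) = (LINT x|lebesgue. f2 x \<bullet> g2 x)"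
    by (rule integral_cong_AE[OF 1 2])
qed
definition "norm (x :: ('a, 'b) l2) = sqrt (inner x x)"
definition "dist (x :: ('a, 'b) l2) y = norm (x - y)"
definition "sgn (x :: ('a, 'b) l2) = scaleR (inverse (norm x)) x"
definition "(uniformity :: (('a, 'b) l2 \<times> ('a, 'b) l2) filter) = (INF e\<in>{0<..}. principal {(x, y). dist x y < e})"
definition "open U = (\<forall>x\<in>U. eventually (\<lambda>(x', y). x' = x \<longrightarrow> y \<in> U) (uniformity :: (('a, 'b) l2 \<times> ('a, 'b) l2) filter))"

instance
proof
  fix x y z :: "('a, 'b) l2" and c d :: real
  show "x + y + z = x + (y + z)" by transfer (simp add: add.assoc)
  show "x + y = y + x" by transfer (simp add: add.commute)
  show "0 + x = x" by transfer simp
  show "- x + x = 0" by transfer simp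
  show "x - y = x + - y" by transfer simp
  show "c *\<^sub>R (x + y) = c *\<^sub>R x + c *\<^sub>R y" by transfer (simp add: scaleR_add_right)
  show "(c + d) *\<^sub>R x = c *\<^sub>R x + d *\<^sub>R x" by transfer (simp add: scaleR_add_left)
  show "c *\<^sub>R d *\<^sub>R x = (c * d) *\<^sub>R x" by transfer simp
  show "1 *\<^sub>R x = x" by transfer simp
  show "dist x y = norm (x - y)" by (simp add: dist_l2_def)
  show "sgn x = scaleR (inverse (norm x)) x" by (simp add: sgn_l2_def)
  show "uniformity = (INF e\<in>{0<..}. principal {(x::('a, 'b) l2, y). dist x y < e})" by (simp add: uniformity_l2_def)
  show "open U = (\<forall>x\<in>U. eventually (\<lambda>(x', y). x' = x \<longrightarrow> y \<in> U) uniformity)" for U :: "('a, 'b) l2 set"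
    by (simp add: open_l2_def)
  show "inner x y = inner y x" by transfer (simp add: inner_commute)
  show "inner (x + y) z = inner x z + inner y z"
    by transfer (simp add: inner_add_left square_integrable_inner)
  show "inner (c *\<^sub>R x) y = c * inner x y" by transfer simp
  show "0 \<le> inner x x" by transfer (simp add: integral_nonneg_AE)
  show "inner x x = 0 \<longleftrightarrow> x = 0"
  proof transfer
    fix f :: "'a \<Rightarrow> 'b"
    assume a: "square_integrable f \<and> square_integrable f \<and> (AE x in lebesgue. f x = f x)"
    have "(LINT x|lebesgue. f x \<bullet> f x) = 0 \<longleftrightarrow> (AE x in lebesgue. f x \<bullet> f x = 0)"
      using a by (intro integral_nonneg_eq_0_iff_AE square_integrable_inner) auto
    then show "((LINT x|lebesgue. f x \<bullet> f x) = 0) = (square_integrable f \<and> square_integrable (\<lambda>x::'a. 0::'b) \<and> (AE x in lebesgue. f x = 0))"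
      using a by simp
  qed
  show "norm x = sqrt (inner x x)" by (simp add: norm_l2_def)
qed

end

definition l2_of :: "('a::euclidean_space \<Rightarrow> 'b::euclidean_space) \<Rightarrow> ('a, 'b) l2" where
  "l2_of f = abs_l2 f"

text \<open>A chosen representative. Pointwise operations on classes are defined through it, and
  \<open>fun_of_AE\<close> makes them independent of the choice.\<close>

definition fun_of :: "('a::euclidean_space, 'b::euclidean_space) l2 \<Rightarrow> 'a \<Rightarrow> 'b" where
  "fun_of U = (SOME f. square_integrable f \<and> l2_of f = U)"

lemma l2_cases: obtains f where "square_integrable f" "U = l2_of f"
proof (induction U rule: l2.abs_induct)
  case (1 y)
  then show ?case unfolding l2_of_def by blast
qed

lemma fun_of: "square_integrable (fun_of U)" "l2_of (fun_of U) = U"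
proof -
  have "\<exists>f. square_integrable f \<and> l2_of f = U" by (rule l2_cases[of U]) auto
  from someI_ex[OF this] show "square_integrable (fun_of U)" "l2_of (fun_of U) = U"
    unfolding fun_of_def by auto
qed

lemma l2_of_eq_iff:
  "square_integrable f \<Longrightarrow> square_integrable g \<Longrightarrow> l2_of f = l2_of g \<longleftrightarrow> (AE x in lebesgue. f x = g x)"
  unfolding l2_of_def using Quotient3_rel[OF Quotient3_l2, of f g] by auto

lemma fun_of_AE: "square_integrable f \<Longrightarrow> AE x in lebesgue. fun_of (l2_of f) x = f x"
  using l2_of_eq_iff[of "fun_of (l2_of f)" f] fun_of[of "l2_of f"] by simp

lemma l2_of_zero: "l2_of (\<lambda>x. 0) = 0"
  by (simp add: l2_of_def zero_l2.abs_eq)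

lemma l2_of_add: "square_integrable f \<Longrightarrow> square_integrable g \<Longrightarrow> l2_of f + l2_of g = l2_of (\<lambda>x. f x + g x)"
  by (simp add: l2_of_def plus_l2.abs_eq)

lemma l2_of_diff: "square_integrable f \<Longrightarrow> square_integrable g \<Longrightarrow> l2_of f - l2_of g = l2_of (\<lambda>x. f x - g x)"
  by (simp add: l2_of_def minus_l2.abs_eq)

lemma l2_of_scaleR: "square_integrable f \<Longrightarrow> c *\<^sub>R l2_of f = l2_of (\<lambda>x. c *\<^sub>R f x)"
  by (simp add: l2_of_def scaleR_l2.abs_eq)

lemma inner_l2_of:
  "square_integrable f \<Longrightarrow> square_integrable g \<Longrightarrow> inner (l2_of f) (l2_of g) = integral\<^sup>L lebesgue (\<lambda>x. f x \<bullet> g x)"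
  by (simp add: l2_of_def inner_l2.abs_eq)

lemma norm_l2_of:
  "square_integrable f \<Longrightarrow> (norm (l2_of f))\<^sup>2 = integral\<^sup>L lebesgue (\<lambda>x. (norm (f x))\<^sup>2)"
  by (simp add: power2_norm_eq_inner inner_l2_of)

lemma nn_norm_l2_of:
  "square_integrable f \<Longrightarrow> ennreal ((norm (l2_of f))\<^sup>2) = (\<integral>\<^sup>+x. ennreal ((norm (f x))\<^sup>2) \<partial>lebesgue)"
  unfolding norm_l2_of by (rule nn_integral_eq_integral[symmetric]) (auto simp: square_integrable_def)

lemma dist_l2_of:
  "square_integrable f \<Longrightarrow> square_integrable g \<Longrightarrow>
   (dist (l2_of f) (l2_of g))\<^sup>2 = integral\<^sup>L lebesgue (\<lambda>x. (norm (f x - g x))\<^sup>2)"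
  by (simp add: dist_norm l2_of_diff norm_l2_of)

lemma norm_l2_of_le:
  assumes f: "square_integrable f" and g: "square_integrable g" and C: "0 \<le> C"
    and le: "\<And>x. norm (f x) \<le> C * norm (g x)"
  shows "norm (l2_of f) \<le> C * norm (l2_of g)"
proof (rule power2_le_imp_le)
  have "(norm (l2_of f))\<^sup>2 \<le> (\<integral>x. C\<^sup>2 * (norm (g x))\<^sup>2 \<partial>lebesgue)"
    unfolding norm_l2_of[OF f]
  proof (rule integral_mono)
    show "(norm (f x))\<^sup>2 \<le> C\<^sup>2 * (norm (g x))\<^sup>2" for x
      using power_mono[OF le norm_ge_zero, of x 2] by (simp add: power_mult_distrib)
  qed (use f g in \<open>auto simp: square_integrable_def\<close>)
  also have "\<dots> = (C * norm (l2_of g))\<^sup>2" by (simp add: norm_l2_of[OF g] power_mult_distrib)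
  finally show "(norm (l2_of f))\<^sup>2 \<le> (C * norm (l2_of g))\<^sup>2" .
qed (use C in simp)

text \<open>Riesz--Fischer: along a subsequence with distances below \<open>4\<^sup>-\<^sup>n\<close>, the sum
  \<open>\<Sum>n. 2\<^sup>n |f\<^sub>n\<^sub>+\<^sub>1 - f\<^sub>n|\<^sup>2\<close> is integrable, hence the increments are almost everywhere
  dominated by a geometric sequence.\<close>

instance l2 :: (euclidean_space, euclidean_space) complete_space
proof
  fix X :: "nat \<Rightarrow> ('a, 'b) l2" assume X: "Cauchy X"
  have "\<forall>n. \<exists>N. \<forall>p\<ge>N. \<forall>q\<ge>N. dist (X p) (X q) < (1/4) ^ n"
    using X unfolding Cauchy_def by simp
  then obtain N where N: "\<And>n p q. p \<ge> N n \<Longrightarrow> q \<ge> N n \<Longrightarrow> dist (X p) (X q) < (1/4) ^ n" by metis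
  \<comment> \<open>The sum dominates every \<open>N k\<close> with \<open>k\<close> up to
    \<open>n\<close>; the extra \<open>n\<close> makes \<open>s\<close> strictly increasing.\<close>
  define s where "s n = (\<Sum>k\<le>n. N k) + n" for n
  have sN: "s m \<ge> N n" if "m \<ge> n" for m n
  proof -
    have "N n \<le> (\<Sum>k\<le>m. N k)" using that by (intro member_le_sum) auto
    then show ?thesis by (simp add: s_def)
  qed
  define f where "f n = fun_of (X (s n))" for n
  have f: "square_integrable (f n)" and Xf: "X (s n) = l2_of (f n)" for n by (simp_all add: f_def fun_of)
  note [measurable] = square_integrable_measurable[OF f]
  have dX: "dist (X (s m)) (X (s n)) \<le> (1/4) ^ k" if "m \<ge> k" "n \<ge> k" for m n k
    using N[OF sN[OF that(1)] sN[OF that(2)]] by simp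
  have df: "(\<integral>\<^sup>+x. ennreal ((norm (f m x - f n x))\<^sup>2) \<partial>lebesgue) \<le> ennreal ((1/16) ^ k)" if "m \<ge> k" "n \<ge> k" for m n k
  proof -
    have "(\<integral>\<^sup>+x. ennreal ((norm (f m x - f n x))\<^sup>2) \<partial>lebesgue) = ennreal ((dist (X (s m)) (X (s n)))\<^sup>2)"
      using nn_norm_l2_of[OF square_integrable_diff[OF f[of m] f[of n]]]
      by (simp add: Xf dist_norm l2_of_diff f)
    also have "\<dots> \<le> ennreal (((1/4) ^ k)\<^sup>2)" using dX[OF that] by (intro ennreal_leI power_mono) auto
    also have "((1/4::real) ^ k)\<^sup>2 = (1/16) ^ k" by (simp add: power2_eq_square power_mult_distrib[symmetric])
    finally show ?thesis .
  qed
  define g where "g n x = 2 ^ n * (norm (f (Suc n) x - f n x))\<^sup>2" for n x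
  have [measurable]: "g n \<in> borel_measurable lebesgue" for n unfolding g_def by measurable
  have "(\<integral>\<^sup>+x. (\<Sum>n. ennreal (g n x)) \<partial>lebesgue) = (\<Sum>n. \<integral>\<^sup>+x. ennreal (g n x) \<partial>lebesgue)"
    by (rule nn_integral_suminf) measurable
  also have "\<dots> \<le> (\<Sum>n. ennreal ((1/8) ^ n))"
  proof (intro suminf_le allI)
    fix n
    have "(\<integral>\<^sup>+x. ennreal (g n x) \<partial>lebesgue) = ennreal (2 ^ n) * (\<integral>\<^sup>+x. ennreal ((norm (f (Suc n) x - f n x))\<^sup>2) \<partial>lebesgue)"
      unfolding g_def by (subst nn_integral_cmult[symmetric]) (auto simp: ennreal_mult)
    also have "\<dots> \<le> ennreal (2 ^ n) * ennreal ((1/16) ^ n)" by (intro mult_left_mono df) auto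
    also have "\<dots> = ennreal ((1/8) ^ n)" by (simp add: ennreal_mult[symmetric] power_mult_distrib[symmetric])
    finally show "(\<integral>\<^sup>+x. ennreal (g n x) \<partial>lebesgue) \<le> ennreal ((1/8) ^ n)" .
  qed auto
  also have "\<dots> < \<infinity>"
    by (subst suminf_ennreal2) (auto simp: summable_geometric)
  finally have fin: "(\<integral>\<^sup>+x. (\<Sum>n. ennreal (g n x)) \<partial>lebesgue) \<noteq> \<infinity>" by simp
  have "AE x in lebesgue. (\<Sum>n. ennreal (g n x)) \<noteq> \<infinity>"
    by (rule nn_integral_PInf_AE[OF _ fin]) measurable
  then have conv: "AE x in lebesgue. convergent (\<lambda>n. f n x)"
  proof eventually_elim
    case (elim x)
    have gpos: "0 \<le> g n x" for n by (simp add: g_def)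
    have gs: "summable (\<lambda>n. g n x)"
      using elim by (intro summable_suminf_not_top gpos) (simp add: top.not_eq_extremum[symmetric])
    define S where "S = (\<Sum>n. g n x)"
    have gS: "g n x \<le> S" for n
      unfolding S_def using sum_le_suminf[OF gs, of "{n}"] by (auto simp: g_def)
    have S0: "0 \<le> S" using order_trans[OF gpos gS] .
    have "summable (\<lambda>n. f (Suc n) x - f n x)"
    proof (rule summable_comparison_test')
      show "summable (\<lambda>n. sqrt S * sqrt (1/2) ^ n)" by (intro summable_mult summable_geometric) simp
      fix n :: nat
      have "(norm (f (Suc n) x - f n x))\<^sup>2 \<le> S * (1/2) ^ n"
        using gS[of n] by (simp add: g_def field_simps power_one_over)
      also have "(1/2) ^ n = (sqrt (1/2) ^ n :: real)\<^sup>2"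
        using power_mult[of "sqrt (1/2)" 2 n] power_mult[of "sqrt (1/2)" n 2] by (simp add: mult.commute)
      also have "S * \<dots> = (sqrt S * sqrt (1/2) ^ n)\<^sup>2"
        using S0 by (simp add: power_mult_distrib)
      finally show "norm (f (Suc n) x - f n x) \<le> sqrt S * sqrt (1/2) ^ n"
        by (rule power2_le_imp_le) (simp add: S0)
    qed
    then have "convergent (\<lambda>n. \<Sum>k<n. f (Suc k) x - f k x)" by (simp add: summable_iff_convergent)
    then have "convergent (\<lambda>n. f n x - f 0 x)" 
      by (simp only: sum_lessThan_telescope[of "\<lambda>k. f k x"])
    then show ?case using convergent_add[of "\<lambda>n. f n x - f 0 x" "\<lambda>n. f 0 x"] by (simp add: convergent_const)
  qed
  define F where "F x = lim (\<lambda>n. f n x)" for x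
  have limF: "AE x in lebesgue. (\<lambda>n. f n x) \<longlonglongrightarrow> F x"
    using conv by eventually_elim (simp add: F_def convergent_LIMSEQ_iff)
  have F_meas[measurable]: "F \<in> borel_measurable lebesgue"
    unfolding F_def by (rule borel_measurable_lim_metric) measurable
  \<comment> \<open>Fatou's lemma in the second index carries the Cauchy bound over to the pointwise
    limit.\<close>
  have FB: "(\<integral>\<^sup>+x. ennreal ((norm (f n x - F x))\<^sup>2) \<partial>lebesgue) \<le> ennreal ((1/16) ^ n)" for n
  proof -
    have "(\<integral>\<^sup>+x. ennreal ((norm (f n x - F x))\<^sup>2) \<partial>lebesgue)
        = (\<integral>\<^sup>+x. liminf (\<lambda>m. ennreal ((norm (f n x - f m x))\<^sup>2)) \<partial>lebesgue)"
    proof (rule nn_integral_cong_AE)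
      show "AE x in lebesgue. ennreal ((norm (f n x - F x))\<^sup>2) = liminf (\<lambda>m. ennreal ((norm (f n x - f m x))\<^sup>2))"
        using limF
      proof eventually_elim
        case (elim x)
        have "(\<lambda>m. ennreal ((norm (f n x - f m x))\<^sup>2)) \<longlonglongrightarrow> ennreal ((norm (f n x - F x))\<^sup>2)"
          by (intro tendsto_intros elim)
        from lim_imp_Liminf[OF trivial_limit_sequentially this] show ?case by (rule sym)
      qed
    qed
    also have "\<dots> \<le> liminf (\<lambda>m. \<integral>\<^sup>+x. ennreal ((norm (f n x - f m x))\<^sup>2) \<partial>lebesgue)"
      by (rule nn_integral_liminf) measurable
    also have "\<dots> \<le> ennreal ((1/16) ^ n)"
      by (rule Liminf_le) (use df[of n n] in \<open>auto intro!: eventually_mono[OF eventually_ge_at_top[of n]]\<close>)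
    finally show ?thesis .
  qed
  have sd: "square_integrable (\<lambda>x. f n x - F x)" for n
    unfolding square_integrable_def integrable_iff_bounded
    using le_less_trans[OF FB[of n] ennreal_less_top] by auto
  have sF: "square_integrable F" using square_integrable_diff[OF f[of 0] sd[of 0]] by simp
  have "norm (X (s n) - l2_of F) \<le> (1/4) ^ n" for n
  proof (rule power2_le_imp_le)
    have "ennreal ((norm (X (s n) - l2_of F))\<^sup>2) \<le> ennreal ((1/16) ^ n)"
      using FB[of n] nn_norm_l2_of[OF sd[of n]] by (simp add: Xf l2_of_diff f sF)
    then have "(norm (X (s n) - l2_of F))\<^sup>2 \<le> (1/16) ^ n" by (subst (asm) ennreal_le_iff) auto
    also have "(1/16) ^ n = ((1/4::real) ^ n)\<^sup>2" by (simp add: power2_eq_square power_mult_distrib[symmetric])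
    finally show "(norm (X (s n) - l2_of F))\<^sup>2 \<le> ((1/4) ^ n)\<^sup>2" .
  qed simp
  then have "(\<lambda>n. X (s n) - l2_of F) \<longlonglongrightarrow> 0"
    by (intro Lim_null_comparison[OF _ LIMSEQ_power_zero[of "1/4::real"]]) auto
  then have sub: "(X \<circ> s) \<longlonglongrightarrow> l2_of F" unfolding o_def by (simp add: LIM_zero_iff)
  have "strict_mono s"
    unfolding strict_mono_Suc_iff by (simp add: s_def)
  then have "X \<longlonglongrightarrow> l2_of F" using Cauchy_converges_subseq[OF X _ sub] by blast
  then show "convergent X" by (rule convergentI)
qed

section \<open>Affine changes of variables\<close>

lemma lebesgue_affine_density:
  fixes t :: "'a::euclidean_space"
  assumes "c \<noteq> 0"
  shows "lebesgue = density (distr lebesgue lebesgue (\<lambda>x. t + c *\<^sub>R x)) (\<lambda>_. ennreal (\<bar>c\<bar> ^ DIM('a)))"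
    and lebesgue_affine_measurable': "(\<lambda>x. t + c *\<^sub>R x) \<in> lebesgue \<rightarrow>\<^sub>M lebesgue"
proof -
  have eq: "(\<lambda>x. t + (\<Sum>j\<in>Basis. (c * (x \<bullet> j)) *\<^sub>R j)) = (\<lambda>x. t + c *\<^sub>R x)"
    unfolding scaleR_scaleR[symmetric] scaleR_sum_right[symmetric] by (simp add: euclidean_representation)
  show "lebesgue = density (distr lebesgue lebesgue (\<lambda>x. t + c *\<^sub>R x)) (\<lambda>_. ennreal (\<bar>c\<bar> ^ DIM('a)))"
    using lebesgue_affine_euclidean[of "\<lambda>_. c" t] assms by (simp add: eq ennreal_power)
  show "(\<lambda>x. t + c *\<^sub>R x) \<in> lebesgue \<rightarrow>\<^sub>M lebesgue"
    using lebesgue_affine_measurable[of "\<lambda>_. c" t] assms by (simp add: eq)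
qed

lemma borel_measurable_affine:
  fixes t :: "'a::euclidean_space"
  shows "f \<in> borel_measurable lebesgue \<Longrightarrow> c \<noteq> 0 \<Longrightarrow> (\<lambda>x. f (t + c *\<^sub>R x)) \<in> borel_measurable lebesgue"
  by (rule measurable_compose[OF lebesgue_affine_measurable'])

lemma AE_lebesgue_affine:
  fixes t :: "'a::euclidean_space"
  assumes ae: "AE x in lebesgue. P x" and c: "c \<noteq> 0"
  shows "AE x in lebesgue. P (t + c *\<^sub>R x)"
proof -
  have "AE x in density (distr lebesgue lebesgue (\<lambda>x. t + c *\<^sub>R x)) (\<lambda>_. ennreal (\<bar>c\<bar> ^ DIM('a))). P x"
    unfolding lebesgue_affine_density(1)[OF c, of t, symmetric] by (rule ae)
  then have "AE x in distr lebesgue lebesgue (\<lambda>x. t + c *\<^sub>R x). P x"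
    using c by (simp add: AE_density)
  then show ?thesis by (rule AE_distrD[OF lebesgue_affine_measurable'[OF c]])
qed

lemma
  fixes f :: "'a::euclidean_space \<Rightarrow> 'b::{banach,second_countable_topology}"
  assumes f: "f \<in> borel_measurable lebesgue" and c: "c \<noteq> 0"
  shows integrable_lebesgue_affine: "integrable lebesgue (\<lambda>x. f (t + c *\<^sub>R x)) \<longleftrightarrow> integrable lebesgue f" (is ?i)
    and integral_lebesgue_affine:
      "integral\<^sup>L lebesgue f = (\<bar>c\<bar> ^ DIM('a)) *\<^sub>R integral\<^sup>L lebesgue (\<lambda>x. f (t + c *\<^sub>R x))" (is ?e)
proof -
  let ?T = "\<lambda>x::'a. t + c *\<^sub>R x" and ?k = "\<bar>c\<bar> ^ DIM('a)"
  have T: "?T \<in> lebesgue \<rightarrow>\<^sub>M lebesgue" by (rule lebesgue_affine_measurable'[OF c])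
  have f': "f \<in> borel_measurable (distr lebesgue lebesgue ?T)" using f by simp
  have k: "?k > 0" using c by simp
  have "integrable lebesgue f \<longleftrightarrow> integrable (density (distr lebesgue lebesgue ?T) (\<lambda>_. ennreal ?k)) f"
    unfolding lebesgue_affine_density(1)[OF c, of t, symmetric] ..
  also have "\<dots> \<longleftrightarrow> integrable (distr lebesgue lebesgue ?T) (\<lambda>x. ?k *\<^sub>R f x)"
    by (rule integrable_density[OF f']) (use k in auto)
  also have "\<dots> \<longleftrightarrow> integrable (distr lebesgue lebesgue ?T) f"
  proof
    assume "integrable (distr lebesgue lebesgue ?T) (\<lambda>x. ?k *\<^sub>R f x)"
    from integrable_scaleR_right[OF this, of "inverse ?k"] k
    show "integrable (distr lebesgue lebesgue ?T) f" by simp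
  qed (rule integrable_scaleR_right)
  also have "\<dots> \<longleftrightarrow> integrable lebesgue (\<lambda>x. f (?T x))" by (rule integrable_distr_eq[OF T f])
  finally show ?i by simp
  have "integral\<^sup>L lebesgue f = integral\<^sup>L (density (distr lebesgue lebesgue ?T) (\<lambda>_. ennreal ?k)) f"
    unfolding lebesgue_affine_density(1)[OF c, of t, symmetric] ..
  also have "\<dots> = integral\<^sup>L (distr lebesgue lebesgue ?T) (\<lambda>x. ?k *\<^sub>R f x)"
    by (rule integral_density[OF f']) (use k in auto)
  also have "\<dots> = ?k *\<^sub>R integral\<^sup>L lebesgue (\<lambda>x. f (?T x))"
    using integral_distr[OF T f] by simp
  finally show ?e .
qed

section \<open>Operators on square-integrable functions\<close>

text \<open>Multiplication by an indicator, bounded matrix fields and constant linear maps such as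
  the projections of a product all have this form. Measurability is demanded of the composition,
  which is what the induced operator on classes uses.\<close>

definition bounded_field :: "real \<Rightarrow> ('a::euclidean_space \<Rightarrow> 'b::euclidean_space \<Rightarrow> 'c::euclidean_space) \<Rightarrow> bool" where
  "bounded_field C T \<longleftrightarrow> 0 \<le> C \<and> (\<forall>x. linear (T x)) \<and> (\<forall>x v. norm (T x v) \<le> C * norm v) \<and>
    (\<forall>f. f \<in> borel_measurable lebesgue \<longrightarrow> (\<lambda>x. T x (f x)) \<in> borel_measurable lebesgue)"

definition pointwise_op :: "('a::euclidean_space \<Rightarrow> 'b::euclidean_space \<Rightarrow> 'c::euclidean_space) \<Rightarrow> ('a, 'b) l2 \<Rightarrow> ('a, 'c) l2" where
  "pointwise_op T U = l2_of (\<lambda>x. T x (fun_of U x))"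

lemma square_integrable_field:
  "bounded_field C T \<Longrightarrow> square_integrable f \<Longrightarrow> square_integrable (\<lambda>x. T x (f x))"
  by (rule square_integrable_bound_norm[where g=f and C=C]) (auto simp: bounded_field_def square_integrable_def)

lemma pointwise_op_l2_of:
  assumes T: "bounded_field C T" and f: "square_integrable f"
  shows "pointwise_op T (l2_of f) = l2_of (\<lambda>x. T x (f x))"
  unfolding pointwise_op_def
proof (subst l2_of_eq_iff)
  show "AE x in lebesgue. T x (fun_of (l2_of f) x) = T x (f x)"
    using fun_of_AE[OF f] by eventually_elim simp
qed (auto intro!: square_integrable_field[OF T] f fun_of)

lemma norm_pointwise_op_le:
  assumes T: "bounded_field C T" shows "norm (pointwise_op T U) \<le> C * norm U"
proof (cases U rule: l2_cases)
  case (1 f)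
  then show ?thesis using T
    by (auto simp: pointwise_op_l2_of[OF T] bounded_field_def intro!: norm_l2_of_le square_integrable_field[OF T])
qed

lemma bounded_linear_pointwise_op:
  assumes T: "bounded_field C T" shows "bounded_linear (pointwise_op T)"
proof (rule bounded_linear_intro)
  note sq = square_integrable_field[OF T]
  have lin: "linear (T x)" for x using T by (simp add: bounded_field_def)
  show "pointwise_op T (U + W) = pointwise_op T U + pointwise_op T W" for U W
  proof (cases U rule: l2_cases, cases W rule: l2_cases)
    fix f g assume *: "square_integrable f" "U = l2_of f" "square_integrable g" "W = l2_of g"
    then show ?thesis by (simp add: l2_of_add pointwise_op_l2_of[OF T] sq linear_add[OF lin])
  qed
  show "pointwise_op T (r *\<^sub>R U) = r *\<^sub>R pointwise_op T U" for r U
  proof (cases U rule: l2_cases)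
    case (1 f)
    then show ?thesis by (simp add: l2_of_scaleR pointwise_op_l2_of[OF T] sq linear_scale[OF lin])
  qed
  show "norm (pointwise_op T U) \<le> norm U * C" for U
    using norm_pointwise_op_le[OF T, of U] by (simp add: mult.commute)
qed

lemma bounded_field_indicator:
  "A \<in> sets lebesgue \<Longrightarrow> bounded_field 1 (\<lambda>x (v::'b::euclidean_space). indicator A x *\<^sub>R v)"
  unfolding bounded_field_def
  by (auto intro!: borel_measurable_scaleR borel_measurable_indicator linear_compose_scale_right linear_id
      simp: indicator_def linear_iff)

lemma bounded_field_const: "bounded_linear (h :: 'b::euclidean_space \<Rightarrow> 'c::euclidean_space) \<Longrightarrow> \<exists>C. bounded_field C (\<lambda>x. h)"
proof -
  assume h: "bounded_linear h"
  then obtain K where "0 < K" "\<And>x. norm (h x) \<le> norm x * K" using bounded_linear.pos_bounded by blast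
  then have "bounded_field K (\<lambda>x. h)"
    using bounded_linear.linear[OF h]
    unfolding bounded_field_def
    by (auto simp: mult.commute[of K] less_imp_le intro: borel_measurable_continuous_on[OF linear_continuous_on[OF h]])
  then show ?thesis by blast
qed

lemma square_integrable_indicator:
  "A \<in> sets lebesgue \<Longrightarrow> square_integrable f \<Longrightarrow> square_integrable (\<lambda>x. indicator A x *\<^sub>R f x)"
  by (rule square_integrable_field[OF bounded_field_indicator])

lemma square_integrable_indicator_const:
  "A \<in> lmeasurable \<Longrightarrow> square_integrable (\<lambda>x. indicator A x *\<^sub>R (v::'b::euclidean_space))"
  unfolding square_integrable_def
proof
  assume A: "A \<in> lmeasurable"
  then show "(\<lambda>x. indicator A x *\<^sub>R v) \<in> borel_measurable lebesgue"
    by (auto intro!: borel_measurable_scaleR borel_measurable_indicator)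
  have "(\<lambda>x. (norm (indicator A x *\<^sub>R v))\<^sup>2) = (\<lambda>x. indicator A x *\<^sub>R (norm v)\<^sup>2)"
    by (auto simp: indicator_def fun_eq_iff)
  then show "integrable lebesgue (\<lambda>x. (norm (indicator A x *\<^sub>R v))\<^sup>2)"
    using fmeasurableD[OF A] fmeasurableD2[OF A]
    by (simp only:) (intro integrable_scaleR_left integrable_real_indicator; simp add: top.not_eq_extremum)
qed

text \<open>With \<open>c = 1\<close> a translation and hence an isometry; with
  \<open>t = x0\<close> and \<open>c = r\<close> the blow-up around \<open>x0\<close>. There is no
  normalising factor, so inner products change by the Jacobian, see
  \<open>inner_affine_op\<close>.\<close>

definition affine_op :: "'a \<Rightarrow> real \<Rightarrow> ('a::euclidean_space, 'b::euclidean_space) l2 \<Rightarrow> ('a, 'b) l2" where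
  "affine_op t c U = l2_of (\<lambda>x. fun_of U (t + c *\<^sub>R x))"

lemma square_integrable_affine:
  "square_integrable f \<Longrightarrow> c \<noteq> 0 \<Longrightarrow> square_integrable (\<lambda>x. f (t + c *\<^sub>R x))"
  unfolding square_integrable_def
  using integrable_lebesgue_affine[of "\<lambda>x. (norm (f x))\<^sup>2" c t] borel_measurable_affine[of f c t]
  by auto

lemma affine_op_l2_of:
  assumes c: "c \<noteq> 0" and f: "square_integrable f"
  shows "affine_op t c (l2_of f) = l2_of (\<lambda>x. f (t + c *\<^sub>R x))"
  unfolding affine_op_def
  using AE_lebesgue_affine[OF fun_of_AE[OF f] c, of t]
  by (subst l2_of_eq_iff) (auto intro!: square_integrable_affine f c fun_of)

lemma inner_affine_op:
  fixes U W :: "('a::euclidean_space, 'b::euclidean_space) l2"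
  assumes c: "c \<noteq> 0"
  shows "inner U W = \<bar>c\<bar> ^ DIM('a) * inner (affine_op t c U) (affine_op t c W)"
proof (cases U rule: l2_cases, cases W rule: l2_cases)
  fix f g assume *: "square_integrable f" "U = l2_of f" "square_integrable g" "W = l2_of g"
  have "integral\<^sup>L lebesgue (\<lambda>x. f x \<bullet> g x)
      = (\<bar>c\<bar> ^ DIM('a)) *\<^sub>R integral\<^sup>L lebesgue (\<lambda>x. f (t + c *\<^sub>R x) \<bullet> g (t + c *\<^sub>R x))"
    by (rule integral_lebesgue_affine) (use * c square_integrable_inner in auto)
  with * show ?thesis by (simp add: affine_op_l2_of c inner_l2_of square_integrable_affine)
qed

lemma bounded_linear_affine_op:
  assumes c: "c \<noteq> 0"
  shows "bounded_linear (affine_op t c :: ('a::euclidean_space, 'b::euclidean_space) l2 \<Rightarrow> _)"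
proof (rule bounded_linear_intro)
  show "affine_op t c (U + W) = affine_op t c U + affine_op t c W" for U W :: "('a, 'b) l2"
  proof (cases U rule: l2_cases, cases W rule: l2_cases)
    fix f g assume *: "square_integrable f" "U = l2_of f" "square_integrable g" "W = l2_of g"
    then show ?thesis by (simp add: l2_of_add affine_op_l2_of c square_integrable_affine)
  qed
  show "affine_op t c (r *\<^sub>R U) = r *\<^sub>R affine_op t c U" for r and U :: "('a, 'b) l2"
  proof (cases U rule: l2_cases)
    case (1 f)
    then show ?thesis by (simp add: l2_of_scaleR affine_op_l2_of c square_integrable_affine)
  qed
  show "norm (affine_op t c U) \<le> norm U * sqrt (inverse (\<bar>c\<bar> ^ DIM('a)))" for U :: "('a, 'b) l2"
    using inner_affine_op[OF c, of U U t] c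
    by (simp add: norm_eq_sqrt_inner real_sqrt_mult[symmetric] field_simps)
qed

lemma norm_translation: "norm (affine_op t 1 U) = norm U"
  using inner_affine_op[of 1 U U t] by (simp add: norm_eq_sqrt_inner)

section \<open>Lebesgue points\<close>

lemma integrable_indicator_mult:
  fixes f :: "'a \<Rightarrow> real"
  shows "A \<in> sets M \<Longrightarrow> integrable M f \<Longrightarrow> integrable M (\<lambda>x. indicator A x * f x)"
  using integrable_real_mult_indicator[of A M f] by (simp add: mult.commute)

text \<open>Outer regularity gives open supersets with excess of small measure; intersecting them
  shrinks the excess to a null set, and dominated convergence turns this into a small
  integral.\<close>

lemma outer_open_small_integral:
  fixes g :: "'a::euclidean_space \<Rightarrow> real"
  assumes g: "integrable lebesgue g" and F: "F \<in> sets lebesgue" and e: "e > 0"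
  shows "\<exists>U. open U \<and> F \<subseteq> U \<and> (LINT x|lebesgue. indicator (U - F) x * g x) < e"
proof -
  have "\<exists>T. open T \<and> F \<subseteq> T \<and> emeasure lebesgue (T - F) < ennreal (inverse (real (Suc n)))" for n
    by (rule sets_lebesgue_outer_open[OF F, of "inverse (real (Suc n))"]) auto
  then obtain T where T: "\<And>n. open (T n)" "\<And>n. F \<subseteq> T n"
     "\<And>n. emeasure lebesgue (T n - F) < ennreal (inverse (real (Suc n)))" by metis
  \<comment> \<open>Finite intersections stay open and decrease with \<open>n\<close>, so the
    indicators of \<open>U n - F\<close> tend to 0 off the limiting null set.\<close>
  define U where "U n = (\<Inter>k\<le>n. T k)" for n
  have U: "open (U n)" "F \<subseteq> U n" for n using T by (auto simp: U_def)
  have UF[measurable]: "U n - F \<in> sets lebesgue" "(\<Inter>n. T n) - F \<in> sets lebesgue" for n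
    using F U(1)[of n] T(1) by (auto intro!: sets.Diff sets.countable_INT')
  have "emeasure lebesgue ((\<Inter>n. T n) - F) \<le> ennreal (inverse (real (Suc n)))" for n
  proof -
    have "T n - F \<in> sets lebesgue" using T(1)[of n] F by auto
    then have "emeasure lebesgue ((\<Inter>n. T n) - F) \<le> emeasure lebesgue (T n - F)"
      by (intro emeasure_mono) auto
    also have "\<dots> \<le> ennreal (inverse (real (Suc n)))" by (rule less_imp_le[OF T(3)])
    finally show ?thesis .
  qed
  moreover have "(\<lambda>n. ennreal (inverse (real (Suc n)))) \<longlonglongrightarrow> 0"
    using tendsto_ennrealI[OF LIMSEQ_inverse_real_of_nat] by simp
  ultimately have "emeasure lebesgue ((\<Inter>n. T n) - F) \<le> 0"
    by (intro LIMSEQ_le_const) blast+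
  then have null: "(\<Inter>n. T n) - F \<in> null_sets lebesgue" using UF(2) by (auto simp: null_sets_def)
  have "(\<lambda>n. LINT x|lebesgue. indicator (U n - F) x * g x) \<longlonglongrightarrow> (LINT x::'a|lebesgue. 0)"
  proof (rule Bochner_Integration.integral_dominated_convergence[where w="\<lambda>x. norm (g x)"])
    show "AE x in lebesgue. (\<lambda>n. indicator (U n - F) x * g x) \<longlonglongrightarrow> 0"
      using AE_not_in[OF null]
    proof eventually_elim
      case (elim x)
      have "\<forall>\<^sub>F n in sequentially. indicator (U n - F) x * g x = 0"
      proof (cases "x \<in> F")
        case False
        with elim obtain k where "x \<notin> T k" by auto
        then show ?thesis by (intro eventually_sequentiallyI[of k]) (auto simp: U_def indicator_def)
      qed simp
      then show ?case by (rule tendsto_eventually)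
    qed
    show "(\<lambda>x. indicator (U n - F) x * g x) \<in> borel_measurable lebesgue" for n
      using g UF by (intro borel_measurable_times borel_measurable_indicator) auto
  qed (use g in \<open>auto simp: indicator_def\<close>)
  then have "\<forall>\<^sub>F n in sequentially. (LINT x|lebesgue. indicator (U n - F) x * g x) < e"
    using e by (intro order_tendstoD(2)[where y=0]) auto
  then obtain n where "(LINT x|lebesgue. indicator (U n - F) x * g x) < e"
    by (auto simp: eventually_sequentially)
  then show ?thesis using U by blast
qed

lemma lmeasurable_ball_pos: "r > 0 \<Longrightarrow> 0 < measure lebesgue (ball (x::'a::euclidean_space) r)"
  by (simp add: content_ball_pos)

text \<open>Vitali: where the upper averages exceed \<open>t\<close> but the function is below \<open>s < t\<close>, disjoint small
  balls inside an open set \<open>U \<supseteq> {f < s}\<close> carry \<open>\<integral>(f - s) \<ge> (t - s) |B|\<close>, which is at most the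
  small integral of \<open>|f - s|\<close> over \<open>U - {f < s}\<close>.\<close>

lemma negligible_upper_average_gt:
  fixes f :: "'a::euclidean_space \<Rightarrow> real"
  assumes f: "integrable lebesgue (\<lambda>x. indicator (ball 0 m) x * f x)"
    and f_meas[measurable]: "f \<in> borel_measurable lebesgue" and st: "s < t"
  shows "negligible {x \<in> ball 0 m. f x < s \<and>
    (\<forall>d>0. \<exists>r>0. r < d \<and> t * measure lebesgue (ball x r) < (LINT y|lebesgue. indicator (ball x r) y * f y))}"
    (is "negligible ?S")
proof -
  define F where "F = ball 0 m \<inter> {x. f x < s}"
  have F: "F \<in> sets lebesgue"
    unfolding F_def using borel_measurable_less[OF f_meas, of "\<lambda>x. s"] by (auto simp: vimage_def)
  define g where "g x = indicator (ball 0 m) x * (f x - s)" for x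
  have g: "integrable lebesgue g"
  proof -
    have "integrable lebesgue (\<lambda>x. indicator (ball 0 m) x * f x - s * indicator (ball 0 m) x)"
      using f by (intro Bochner_Integration.integrable_diff integrable_mult_right integrable_real_indicator)
        (simp_all add: fmeasurableD2[OF lmeasurable_ball] top.not_eq_extremum[symmetric] del: emeasure_completion)
    moreover have "g = (\<lambda>x. indicator (ball 0 m) x * f x - s * indicator (ball 0 m) x)"
      by (auto simp: g_def algebra_simps)
    ultimately show ?thesis by simp
  qed
  show ?thesis unfolding negligible_outer_le
  proof (intro allI impI)
    fix e :: real assume e: "e > 0"
    then have "0 < e * (t - s)" using st by simp
    then obtain U0 where U0: "open U0" "F \<subseteq> U0" "(LINT x|lebesgue. indicator (U0 - F) x * \<bar>g x\<bar>) < e * (t - s)"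
      using outer_open_small_integral[OF integrable_abs[OF g] F] by blast
    define U where "U = U0 \<inter> ball 0 m"
    have U: "open U" "F \<subseteq> U" using U0 by (auto simp: U_def F_def)
    have small: "(LINT x|lebesgue. indicator (U - F) x * \<bar>g x\<bar>) < e * (t - s)"
    proof (rule le_less_trans[OF _ U0(3)], rule integral_mono)
      show "integrable lebesgue (\<lambda>x. indicator (U - F) x * \<bar>g x\<bar>)" "integrable lebesgue (\<lambda>x. indicator (U0 - F) x * \<bar>g x\<bar>)"
        using F U U0 by (intro integrable_indicator_mult integrable_abs g; force)+
    qed (auto simp: U_def indicator_def)
    \<comment> \<open>Pairs of centre and radius. Each exceptional point admits arbitrarily small
      radii, so these balls form a Vitali cover contained in \<open>U\<close>.\<close>
    define K where "K = {(x, r). x \<in> ?S \<and> 0 < r \<and> ball x r \<subseteq> U \<and>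
        t * measure lebesgue (ball x r) < (LINT y|lebesgue. indicator (ball x r) y * f y)}"
    have "\<exists>i. i \<in> K \<and> x \<in> ball (fst i) (snd i) \<and> snd i < d" if "x \<in> ?S" "0 < d" for x d
    proof -
      have "x \<in> U" using that U(2) by (auto simp: F_def)
      then obtain d' where d': "d' > 0" "ball x d' \<subseteq> U" using U(1) openE by blast
      from that obtain r where "0 < r" "r < min d d'"
         "t * measure lebesgue (ball x r) < (LINT y|lebesgue. indicator (ball x r) y * f y)"
        using d'(1) by (auto dest!: spec[of _ "min d d'"])
      moreover have "ball x r \<subseteq> U" using d'(2) \<open>r < min d d'\<close> by (meson le_less_trans less_imp_le min.strict_boundedE order_trans subset_ball)
      ultimately show ?thesis using that(1) by (intro exI[of _ "(x, r)"]) (auto simp: K_def)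
    qed
    then obtain C where C: "countable C" "C \<subseteq> K"
       "pairwise (\<lambda>i j. disjnt (ball (fst i) (snd i)) (ball (fst j) (snd j))) C"
       "negligible (?S - (\<Union>i \<in> C. ball (fst i) (snd i)))"
      by (rule Vitali_covering_theorem_balls[of ?S K fst snd]) auto
    define B where "B i = ball (fst i) (snd i)" for i :: "'a \<times> real"
    have B_meas: "B i \<in> lmeasurable" for i by (simp add: B_def)
    have BU: "B i \<subseteq> U" if "i \<in> C" for i using subsetD[OF C(2) that] by (cases i) (auto simp: B_def K_def)
    \<comment> \<open>A uniform bound over finite subfamilies bounds the measure of the countable
      union.\<close>
    have bound: "measure lebesgue (\<Union>i\<in>I. B i) \<le> e" if I: "I \<subseteq> C" "finite I" for I
    proof -
      have dis: "disjoint_family_on B I"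
        using pairwise_subset[OF C(3) I(1)] unfolding disjoint_family_on_def pairwise_def B_def disjnt_def by blast
      have iB: "integrable lebesgue (\<lambda>x. indicator (B i) x * g x)" for i
        using B_meas[of i] by (intro integrable_indicator_mult g) auto
      have Bi: "(t - s) * measure lebesgue (B i) \<le> (LINT x|lebesgue. indicator (B i) x * g x)" if i: "i \<in> I" for i
      proof -
        have Bm: "B i \<subseteq> ball 0 m" using BU[of i] i I by (auto simp: U_def)
        have 1: "indicator (B i) x * g x = indicator (B i) x * (indicator (ball 0 m) x * f x) - s * indicator (B i) x" for x
          using Bm by (auto simp: g_def indicator_def)
        have 2: "indicator (B i) x * (indicator (ball 0 m) x * f x) = indicator (B i) x * f x" for x
          using Bm by (auto simp: indicator_def)
        have "(LINT x|lebesgue. indicator (B i) x * g x)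
            = (LINT x|lebesgue. indicator (B i) x * (indicator (ball 0 m) x * f x)) - (LINT x|lebesgue. s * indicator (B i) x)"
          unfolding 1 using B_meas[of i]
          by (intro Bochner_Integration.integral_diff integrable_indicator_mult f integrable_mult_right integrable_real_indicator)
             (auto simp: fmeasurable_def)
        also have "\<dots> = (LINT x|lebesgue. indicator (B i) x * f x) - s * measure lebesgue (B i)"
          unfolding 2 by simp
        finally show ?thesis using subsetD[OF C(2) subsetD[OF I(1) i]] by (cases i) (auto simp: K_def B_def algebra_simps)
      qed
      have "(t - s) * measure lebesgue (\<Union>i\<in>I. B i) = (\<Sum>i\<in>I. (t - s) * measure lebesgue (B i))"
        using I(2) dis fmeasurableD[OF B_meas] fmeasurableD2[OF B_meas]
        by (subst measure_finite_Union) (auto simp: sum_distrib_left simp del: emeasure_completion)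
      also have "\<dots> \<le> (\<Sum>i\<in>I. LINT x|lebesgue. indicator (B i) x * g x)" by (intro sum_mono Bi)
      also have "\<dots> = (LINT x|lebesgue. (\<Sum>i\<in>I. indicator (B i) x * g x))"
        by (rule Bochner_Integration.integral_sum[symmetric]) (rule iB)
      also have "\<dots> \<le> (LINT x|lebesgue. indicator (U - F) x * \<bar>g x\<bar>)"
      proof (rule integral_mono)
        show "integrable lebesgue (\<lambda>x. \<Sum>i\<in>I. indicator (B i) x * g x)" by (intro Bochner_Integration.integrable_sum iB)
        show "integrable lebesgue (\<lambda>x. indicator (U - F) x * \<bar>g x\<bar>)"
          using F U by (intro integrable_indicator_mult integrable_abs g; force)
        fix x
        have "(\<Sum>i\<in>I. indicator (B i) x * g x) = indicator (\<Union>i\<in>I. B i) x * g x"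
          by (simp add: indicator_UN_disjoint[OF I(2) dis] sum_distrib_right)
        also have "\<dots> \<le> indicator (U - F) x * \<bar>g x\<bar>"
        proof (cases "x \<in> (\<Union>i\<in>I. B i)")
          case True
          then have "x \<in> U" using BU I(1) by auto
          \<comment> \<open>On \<open>F\<close> the function \<open>g\<close> is negative because f
            < s there, so these points only lower the left-hand side and just the part in
            \<open>U - F\<close> has to be paid for.\<close>
          then show ?thesis using True by (cases "x \<in> F") (auto simp: g_def F_def indicator_def U_def)
        qed (auto simp: indicator_def)
        finally show "(\<Sum>i\<in>I. indicator (B i) x * g x) \<le> indicator (U - F) x * \<bar>g x\<bar>" .
      qed
      also have "\<dots> \<le> (t - s) * e" using small by (simp add: mult.commute)
      finally show ?thesis using st by simp
    qed
    have Ul: "(\<Union>i\<in>C. B i) \<in> lmeasurable" "measure lebesgue (\<Union>i\<in>C. B i) \<le> e"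
      by (rule fmeasurable_UN_bound[OF C(1) B_meas bound] measure_UN_bound[OF C(1) B_meas bound]; assumption)+
    let ?N = "?S - (\<Union>i\<in>C. B i)"
    have N: "negligible ?N" using C(4) by (simp add: B_def)
    show "\<exists>T. ?S \<subseteq> T \<and> T \<in> lmeasurable \<and> measure lebesgue T \<le> e"
    proof (intro exI conjI)
      show "?S \<subseteq> (\<Union>i\<in>C. B i) \<union> ?N" by blast
      show "(\<Union>i\<in>C. B i) \<union> ?N \<in> lmeasurable" using Ul(1) negligible_imp_measurable[OF N] by blast
      show "measure lebesgue ((\<Union>i\<in>C. B i) \<union> ?N) \<le> e"
        using measure_Un_le[of "\<Union>i\<in>C. B i" lebesgue ?N] Ul negligible_imp_measure0[OF N] negligible_imp_measurable[OF N]
        by (simp add: fmeasurableD)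
    qed
  qed
qed

text \<open>Rational levels s < t and integer radii \<open>m\<close> leave countably many
  exceptional null sets; between \<open>f x\<close> and any larger real there is room for two such
  levels.\<close>

lemma eventually_average_le:
  fixes f :: "'a::euclidean_space \<Rightarrow> real"
  assumes f: "\<And>m::nat. integrable lebesgue (\<lambda>x. indicator (ball 0 m) x * f x)"
    and f_meas: "f \<in> borel_measurable lebesgue"
  shows "AE x in lebesgue. \<forall>t>f x. \<forall>\<^sub>F r in at_right 0.
     (LINT y|lebesgue. indicator (ball x r) y * f y) \<le> t * measure lebesgue (ball x r)"
proof -
  let ?S = "\<lambda>m s t. {x \<in> ball 0 m. f x < s \<and>
    (\<forall>d>0. \<exists>r>0. r < d \<and> t * measure lebesgue (ball x r) < (LINT y|lebesgue. indicator (ball x r) y * f y))}"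
  have 1: "AE x in lebesgue. x \<notin> ?S (real m) s t" if "s < t" for m :: nat and s t
  proof -
    have "?S (real m) s t \<in> null_sets lebesgue"
      using negligible_upper_average_gt[OF f f_meas that] by (simp only: negligible_iff_null_sets)
    then show ?thesis by (rule AE_not_in)
  qed
  have "AE x in lebesgue. \<forall>s\<in>\<rat>. \<forall>t\<in>\<rat>. \<forall>m::nat. s < t \<longrightarrow> x \<notin> ?S (real m) s t"
    unfolding AE_ball_countable[OF countable_rat] AE_all_countable using 1 by auto
  then show ?thesis
  proof eventually_elim
    case (elim x)
    show ?case
    proof (intro allI impI)
      fix t assume "t > f x"
      then obtain s t' where st: "s \<in> \<rat>" "t' \<in> \<rat>" "f x < s" "s < t'" "t' < t"
        using Rats_dense_in_real[of "f x" t] Rats_dense_in_real by metis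
      obtain m :: nat where "norm x < real m" using reals_Archimedean2 by blast
      then have "x \<in> ball 0 (real m)" by simp
      moreover have "x \<notin> ?S (real m) s t'" using elim st by blast
      ultimately have "\<not> (\<forall>d>0. \<exists>r>0. r < d \<and> t' * measure lebesgue (ball x r) < (LINT y|lebesgue. indicator (ball x r) y * f y))"
        using st(3) by simp
      then have "\<exists>d>0. \<forall>r. 0 < r \<and> r < d \<longrightarrow>
         (LINT y|lebesgue. indicator (ball x r) y * f y) \<le> t' * measure lebesgue (ball x r)"
        by (meson linorder_not_le)
      then have "\<forall>\<^sub>F r in at_right 0. (LINT y|lebesgue. indicator (ball x r) y * f y) \<le> t' * measure lebesgue (ball x r)"
        by (auto simp: eventually_at_right_field)
      then show "\<forall>\<^sub>F r in at_right 0. (LINT y|lebesgue. indicator (ball x r) y * f y) \<le> t * measure lebesgue (ball x r)"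
      proof eventually_elim
        case (elim r)
        also have "t' * measure lebesgue (ball x r) \<le> t * measure lebesgue (ball x r)"
          using st(5) by (intro mult_right_mono) auto
        finally show ?case .
      qed
    qed
  qed
qed

text \<open>The eventual upper bounds for \<open>f\<close> and for \<open>- f\<close> trap the
  averages from both sides.\<close>

theorem lebesgue_differentiation:
  fixes f :: "'a::euclidean_space \<Rightarrow> real"
  assumes f: "\<And>m::nat. integrable lebesgue (\<lambda>x. indicator (ball 0 m) x * f x)"
    and f_meas: "f \<in> borel_measurable lebesgue"
  shows "AE x in lebesgue. ((\<lambda>r. (LINT y|lebesgue. indicator (ball x r) y * f y) / measure lebesgue (ball x r)) \<longlongrightarrow> f x) (at_right 0)"
proof -
  have f': "integrable lebesgue (\<lambda>x. indicator (ball 0 (real m)) x * - f x)" for m :: nat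
    using Bochner_Integration.integrable_minus[OF f[of m]] by simp
  have pos: "\<forall>\<^sub>F r in at_right 0. 0 < measure lebesgue (ball x r)" for x :: 'a
    by (auto simp: eventually_at_right_field intro!: exI[of _ 1] lmeasurable_ball_pos)
  show ?thesis
    using eventually_average_le[OF f f_meas] eventually_average_le[OF f' borel_measurable_uminus[OF f_meas]]
  proof eventually_elim
    case (elim x)
    let ?I = "\<lambda>r. (LINT y|lebesgue. indicator (ball x r) y * f y)"
    show ?case
    proof (rule order_tendstoI)
      fix a assume "a < f x"
      then obtain a' where a': "a < a'" "a' < f x" using dense by blast
      with elim(2)[rule_format, of "- a'"] have "\<forall>\<^sub>F r in at_right 0. - ?I r \<le> - a' * measure lebesgue (ball x r)" by simp
      with pos[of x] show "\<forall>\<^sub>F r in at_right 0. a < ?I r / measure lebesgue (ball x r)"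
      proof eventually_elim
        case (elim r)
        then have "a' \<le> ?I r / measure lebesgue (ball x r)" by (simp add: pos_le_divide_eq)
        with a' show ?case by linarith
      qed
    next
      fix a assume "f x < a"
      then obtain a' where a': "a' < a" "f x < a'" using dense by blast
      with elim(1) have "\<forall>\<^sub>F r in at_right 0. ?I r \<le> a' * measure lebesgue (ball x r)" by auto
      with pos[of x] show "\<forall>\<^sub>F r in at_right 0. ?I r / measure lebesgue (ball x r) < a"
      proof eventually_elim
        case (elim r)
        then have "?I r / measure lebesgue (ball x r) \<le> a'" by (simp add: pos_divide_le_eq)
        with a' show ?case by linarith
      qed
    qed
  qed
qed

text \<open>The L2 version, phrased as strong convergence of the blow-ups, which is the form in
  which it is used. The shape \<omega> is quantified inside, so the exceptional null set does not
  depend on it.\<close>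

definition lebesgue_point :: "('a::euclidean_space \<Rightarrow> 'b::euclidean_space) \<Rightarrow> 'a \<Rightarrow> bool" where
  "lebesgue_point F x \<longleftrightarrow> (\<forall>\<omega>. bounded \<omega> \<longrightarrow> \<omega> \<in> sets lebesgue \<longrightarrow>
     ((\<lambda>r. l2_of (\<lambda>z. indicator \<omega> z *\<^sub>R F (x + r *\<^sub>R z))) \<longlongrightarrow> l2_of (\<lambda>z. indicator \<omega> z *\<^sub>R F x)) (at_right 0))"

text \<open>Expanding the square gives averages of |F|^2 and of the components of F with
  coefficients frozen at x. Scalar differentiation applies to each of these finitely many functions,
  and the limits cancel.\<close>

lemma mean_square_oscillation_tendsto_0:
  fixes F :: "'a::euclidean_space \<Rightarrow> 'b::euclidean_space"
  assumes F: "square_integrable F"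
  shows "AE x in lebesgue. ((\<lambda>r. (LINT y|lebesgue. indicator (ball x r) y * (norm (F y - F x))\<^sup>2)
     / measure lebesgue (ball x r)) \<longlongrightarrow> 0) (at_right 0)"
proof -
  note F_meas[measurable] = square_integrable_measurable[OF F]
  let ?av = "\<lambda>f (x::'a) r. (LINT y|lebesgue. indicator (ball x r) y * f y) / measure lebesgue (ball x r)"
  have i1: "integrable lebesgue (\<lambda>x. indicator A x * (norm (F x))\<^sup>2)" if "A \<in> sets lebesgue" for A
    using F that by (intro integrable_indicator_mult) (auto simp: square_integrable_def)
  have i2: "integrable lebesgue (\<lambda>x. indicator A x * (F x \<bullet> b))" if "A \<in> lmeasurable" for A b
    using square_integrable_inner[OF F square_integrable_indicator_const[OF that, of b]] by (simp add: mult.commute)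
  have "AE x in lebesgue. (?av (\<lambda>x. (norm (F x))\<^sup>2) x \<longlongrightarrow> (norm (F x))\<^sup>2) (at_right 0)"
    by (rule lebesgue_differentiation) (auto intro!: i1)
  moreover have "AE x in lebesgue. \<forall>b\<in>Basis. (?av (\<lambda>x. F x \<bullet> b) x \<longlongrightarrow> F x \<bullet> b) (at_right 0)"
    by (intro AE_finite_allI lebesgue_differentiation i2) auto
  ultimately show ?thesis
  proof eventually_elim
    case (elim x)
    have pos: "\<forall>\<^sub>F r in at_right 0. (0::real) < r" by (auto simp: eventually_at_right_field intro!: exI[of _ 1])
    have eq: "?av (\<lambda>y. (norm (F y - F x))\<^sup>2) x r
       = ?av (\<lambda>y. (norm (F y))\<^sup>2) x r - 2 * (\<Sum>b\<in>Basis. (F x \<bullet> b) * ?av (\<lambda>y. F y \<bullet> b) x r) + (norm (F x))\<^sup>2"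
      if r: "r > 0" for r
    proof -
      have pw: "indicator (ball x r) y * (norm (F y - F x))\<^sup>2 = indicator (ball x r) y * (norm (F y))\<^sup>2
         - 2 * (\<Sum>b\<in>Basis. (F x \<bullet> b) * (indicator (ball x r) y * (F y \<bullet> b))) + (norm (F x))\<^sup>2 * indicator (ball x r) y" for y
      proof -
        have "(norm (F y - F x))\<^sup>2 = (norm (F y))\<^sup>2 - 2 * (F x \<bullet> F y) + (norm (F x))\<^sup>2"
          by (simp add: power2_norm_eq_inner inner_diff_left inner_diff_right inner_commute)
        moreover have "F x \<bullet> F y = (\<Sum>b\<in>Basis. (F x \<bullet> b) * (F y \<bullet> b))" by (rule euclidean_inner)
        ultimately show ?thesis by (simp add: indicator_def)
      qed
      have m: "measure lebesgue (ball x r) > 0" by (rule lmeasurable_ball_pos[OF r])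
      have ib: "integrable lebesgue (\<lambda>y. indicator (ball x r) y :: real)"
        by (intro integrable_real_indicator)
          (simp_all add: fmeasurableD2[OF lmeasurable_ball] top.not_eq_extremum[symmetric] del: emeasure_completion)
      have "(LINT y|lebesgue. indicator (ball x r) y * (norm (F y - F x))\<^sup>2)
        = (LINT y|lebesgue. indicator (ball x r) y * (norm (F y))\<^sup>2)
         - 2 * (\<Sum>b\<in>Basis. (F x \<bullet> b) * (LINT y|lebesgue. indicator (ball x r) y * (F y \<bullet> b))) + (norm (F x))\<^sup>2 * measure lebesgue (ball x r)"
      proof -
        let ?A = "\<lambda>y. indicator (ball x r) y * (norm (F y))\<^sup>2"
          and ?B = "\<lambda>y. 2 * (\<Sum>b\<in>Basis. (F x \<bullet> b) * (indicator (ball x r) y * (F y \<bullet> b)))"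
          and ?D = "\<lambda>y. (norm (F x))\<^sup>2 * indicator (ball x r) y :: real"
        have AI: "integrable lebesgue ?A" by (rule i1) simp
        have BI': "integrable lebesgue (\<lambda>y. (F x \<bullet> b) * (indicator (ball x r) y * (F y \<bullet> b)))" for b
          by (intro integrable_mult_right i2) simp
        have BI: "integrable lebesgue ?B" by (intro integrable_mult_right Bochner_Integration.integrable_sum BI')
        have DI: "integrable lebesgue ?D" by (intro integrable_mult_right ib)
        have "(LINT y|lebesgue. ?A y - ?B y + ?D y) = (LINT y|lebesgue. ?A y) - (LINT y|lebesgue. ?B y) + (LINT y|lebesgue. ?D y)"
          using Bochner_Integration.integral_add[OF Bochner_Integration.integrable_diff[OF AI BI] DI]
            Bochner_Integration.integral_diff[OF AI BI] by simp
        also have "(LINT y|lebesgue. ?B y) = 2 * (\<Sum>b\<in>Basis. (F x \<bullet> b) * (LINT y|lebesgue. indicator (ball x r) y * (F y \<bullet> b)))"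
          using Bochner_Integration.integral_sum[of Basis lebesgue, OF BI'] by simp
        also have "(LINT y|lebesgue. ?D y) = (norm (F x))\<^sup>2 * measure lebesgue (ball x r)" by simp
        finally show ?thesis unfolding pw .
      qed
      then show ?thesis using m by (simp add: field_simps sum_distrib_left sum_divide_distrib)
    qed
    have "((\<lambda>r. ?av (\<lambda>y. (norm (F y))\<^sup>2) x r - 2 * (\<Sum>b\<in>Basis. (F x \<bullet> b) * ?av (\<lambda>y. F y \<bullet> b) x r) + (norm (F x))\<^sup>2)
       \<longlongrightarrow> (norm (F x))\<^sup>2 - 2 * (\<Sum>b\<in>Basis. (F x \<bullet> b) * (F x \<bullet> b)) + (norm (F x))\<^sup>2) (at_right 0)"
      by (intro tendsto_intros elim(1) bspec[OF elim(2)])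
    also have "(norm (F x))\<^sup>2 - 2 * (\<Sum>b\<in>Basis. (F x \<bullet> b) * (F x \<bullet> b)) + (norm (F x))\<^sup>2 = 0"
      unfolding power2_norm_eq_inner euclidean_inner[of "F x" "F x"] by simp
    finally show ?case
      by (rule Lim_transform_eventually) (rule eventually_mono[OF pos], rule eq[symmetric])
  qed
qed

text \<open>If \<omega> lies in the ball of radius R, the substitution y = x + r z bounds the
  squared distance by the volume of that ball times the mean square oscillation at radius r
  R.\<close>

lemma AE_lebesgue_point:
  fixes F :: "'a::euclidean_space \<Rightarrow> 'b::euclidean_space"
  assumes F: "square_integrable F"
  shows "AE x in lebesgue. lebesgue_point F x"
  using mean_square_oscillation_tendsto_0[OF F]
proof eventually_elim
  case (elim x)
  let ?osc = "\<lambda>r. (LINT y|lebesgue. indicator (ball x r) y * (norm (F y - F x))\<^sup>2)"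
  show ?case unfolding lebesgue_point_def
  proof (intro allI impI)
    fix \<omega> :: "'a set" assume w: "bounded \<omega>" "\<omega> \<in> sets lebesgue"
    then obtain R where R: "R > 0" "\<omega> \<subseteq> ball 0 R" using bounded_subset_ballD[of \<omega> 0] by blast
    have wl: "\<omega> \<in> lmeasurable" using w bounded_set_imp_lmeasurable by blast
    let ?G = "\<lambda>r z. indicator \<omega> z *\<^sub>R F (x + r *\<^sub>R z)" and ?H = "\<lambda>z. indicator \<omega> z *\<^sub>R F x"
    let ?V = "measure lebesgue (ball (0::'a) R)"
    have bnd: "(dist (l2_of (?G r)) (l2_of ?H))\<^sup>2 \<le> ?V * (?osc (r * R) / measure lebesgue (ball x (r * R)))" if r: "r > 0" for r
    proof -
      have sG: "square_integrable (?G r)" "square_integrable ?H"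
        using r by (auto intro!: square_integrable_indicator square_integrable_indicator_const square_integrable_affine F w wl)
      have m0: "measure lebesgue (ball x (r * R)) = r ^ DIM('a) * ?V"
        using r R(1) by (simp add: content_ball power_mult_distrib)
      have Vpos: "?V > 0" by (rule lmeasurable_ball_pos[OF R(1)])
      have sq2: "square_integrable (\<lambda>y. indicator (ball x (r * R)) y *\<^sub>R (F y - F x))"
        using square_integrable_diff[OF square_integrable_indicator[of "ball x (r*R)", OF _ F] square_integrable_indicator_const[of "ball x (r*R)" "F x"]]
        by (simp add: scaleR_diff_right)
      have sq3: "integrable lebesgue (\<lambda>y. indicator (ball x (r * R)) y * (norm (F y - F x))\<^sup>2)"
        using sq2 unfolding square_integrable_def
        by (rule conjunct2[THEN Bochner_Integration.integrable_cong[THEN iffD1, rotated 2]]) (auto simp: indicator_def)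
      have ind: "indicator (ball x (r * R)) (x + r *\<^sub>R z) = (indicator (ball 0 R) z :: real)" for z
        using r by (simp add: indicator_def dist_norm)
      have aff: "?osc (r * R) = r ^ DIM('a) * (LINT z|lebesgue. indicator (ball 0 R) z * (norm (F (x + r *\<^sub>R z) - F x))\<^sup>2)"
        using integral_lebesgue_affine[OF borel_measurable_integrable[OF sq3], of r x] r by (simp add: ind)
      have i4: "integrable lebesgue (\<lambda>z. indicator (ball 0 R) z * (norm (F (x + r *\<^sub>R z) - F x))\<^sup>2)"
        using integrable_lebesgue_affine[OF borel_measurable_integrable[OF sq3], of r x] r sq3 by (simp add: ind)
      have "(dist (l2_of (?G r)) (l2_of ?H))\<^sup>2 = (LINT z|lebesgue. (norm (?G r z - ?H z))\<^sup>2)"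
        by (rule dist_l2_of[OF sG])
      also have "\<dots> \<le> (LINT z|lebesgue. indicator (ball 0 R) z * (norm (F (x + r *\<^sub>R z) - F x))\<^sup>2)"
      proof (rule integral_mono[OF _ i4])
        show "integrable lebesgue (\<lambda>z. (norm (?G r z - ?H z))\<^sup>2)"
          using square_integrable_diff[OF sG] by (simp add: square_integrable_def)
        show "(norm (?G r z - ?H z))\<^sup>2 \<le> indicator (ball 0 R) z * (norm (F (x + r *\<^sub>R z) - F x))\<^sup>2" for z
          using R(2) by (auto simp: indicator_def)
      qed
      also have "\<dots> = ?V * (?osc (r * R) / measure lebesgue (ball x (r * R)))"
        using r Vpos by (simp add: aff m0)
      finally show ?thesis .
    qed
    have scal: "filterlim (\<lambda>r. r * R) (at_right 0) (at_right 0)"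
      unfolding filterlim_at using R(1)
      by (auto intro!: tendsto_eq_intros simp: eventually_at_right_field intro!: exI[of _ 1])
    have lim: "((\<lambda>r. ?V * (?osc (r * R) / measure lebesgue (ball x (r * R)))) \<longlongrightarrow> 0) (at_right 0)"
      using tendsto_mult_right_zero[OF filterlim_compose[OF elim scal]] by simp
    have "((\<lambda>r. (dist (l2_of (?G r)) (l2_of ?H))\<^sup>2) \<longlongrightarrow> 0) (at_right 0)"
    proof (rule tendsto_sandwich[OF _ _ tendsto_const lim])
      show "\<forall>\<^sub>F r in at_right 0. (dist (l2_of (?G r)) (l2_of ?H))\<^sup>2 \<le> ?V * (?osc (r * R) / measure lebesgue (ball x (r * R)))"
        by (rule eventually_mono[OF eventually_at_right_less[of 0]]) (rule bnd)
    qed simp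
    then have "((\<lambda>r. sqrt ((dist (l2_of (?G r)) (l2_of ?H))\<^sup>2)) \<longlongrightarrow> sqrt 0) (at_right 0)"
      by (rule tendsto_real_sqrt)
    then show "((\<lambda>r. l2_of (?G r)) \<longlongrightarrow> l2_of ?H) (at_right 0)"
      by (subst tendsto_dist_iff) simp
  qed
qed

section \<open>Smooth functions and test functions\<close>

lemma smooth_fun_has_derivative:
  assumes "smooth_fun f" shows "(f has_derivative frechet_derivative f (at x)) (at x)"
proof -
  have "f differentiable_on UNIV" using assms by (auto elim: smooth_fun.cases)
  then have "f differentiable (at x)" by (simp add: differentiable_on_def)
  then show ?thesis by (simp add: frechet_derivative_works)
qed

lemma smooth_fun_partial: "smooth_fun f \<Longrightarrow> i \<in> Basis \<Longrightarrow> smooth_fun (\<lambda>x. frechet_derivative f (at x) i)"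
  by (erule smooth_fun.cases) blast

lemma smooth_fun_continuous: "smooth_fun f \<Longrightarrow> continuous_on A f"
  by (meson continuous_at_imp_continuous_on has_derivative_continuous smooth_fun_has_derivative)

text \<open>Coinduction for \<open>smooth_fun\<close> speaks of \<open>frechet_derivative\<close>;
  uniqueness of derivatives lets any explicitly given derivative \<open>f'\<close> take its
  place.\<close>

lemma smooth_fun_coinduct_derivative:
  assumes X: "X f"
    and step: "\<And>f. X f \<Longrightarrow> \<exists>f'. (\<forall>x. (f has_derivative f' x) (at x)) \<and> (\<forall>i\<in>Basis. X (\<lambda>x. f' x i))"
  shows "smooth_fun f"
  using X
proof (coinduction arbitrary: f)
  case (smooth_fun f)
  from step[OF this] obtain f' where f': "\<And>x. (f has_derivative f' x) (at x)" "\<forall>i\<in>Basis. X (\<lambda>x. f' x i)" by blast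
  have "(\<lambda>x. frechet_derivative f (at x) i) = (\<lambda>x. f' x i)" for i
    using frechet_derivative_at[OF f'(1)] by metis
  with f' show ?case by (auto simp: differentiable_on_def differentiable_def)
qed

lemma smooth_fun_affine:
  assumes "smooth_fun f" shows "smooth_fun (\<lambda>x. k * f (t + c *\<^sub>R x))"
proof -
  \<comment> \<open>The class is closed under partial derivatives because the scalar
    \<open>k\<close> absorbs the factor \<open>c\<close> from each chain rule.\<close>
  define X where "X g \<longleftrightarrow> (\<exists>f k. smooth_fun f \<and> g = (\<lambda>x. k * f (t + c *\<^sub>R x)))" for g
  show ?thesis
  proof (rule smooth_fun_coinduct_derivative[of X])
    show "X (\<lambda>x. k * f (t + c *\<^sub>R x))" using assms by (auto simp: X_def)
    fix g assume "X g"
    then obtain f k where f: "smooth_fun f" and g: "g = (\<lambda>x. k * f (t + c *\<^sub>R x))" by (auto simp: X_def)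
    let ?D = "\<lambda>x. frechet_derivative f (at x)"
    have lin: "linear (?D x)" for x
      using smooth_fun_has_derivative[OF f] has_derivative_linear by blast
    have "(g has_derivative (\<lambda>h. k * ?D (t + c *\<^sub>R x) (c *\<^sub>R h))) (at x)" for x
      unfolding g
      by (intro has_derivative_mult_right has_derivative_compose[OF _ smooth_fun_has_derivative[OF f]])
         (auto intro!: derivative_eq_intros)
    moreover have "X (\<lambda>x. k * ?D (t + c *\<^sub>R x) (c *\<^sub>R i))" if "i \<in> Basis" for i
      unfolding X_def
      by (rule exI[of _ "\<lambda>x. ?D x i"], rule exI[of _ "k * c"])
         (simp add: smooth_fun_partial[OF f that] linear_scale[OF lin] mult.assoc)
    ultimately show "\<exists>g'. (\<forall>x. (g has_derivative g' x) (at x)) \<and> (\<forall>i\<in>Basis. X (\<lambda>x. g' x i))"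
      by (intro exI[of _ "\<lambda>x h. k * ?D (t + c *\<^sub>R x) (c *\<^sub>R h)"]) blast
  qed
qed

lemma smooth_fun_add:
  assumes "smooth_fun f" "smooth_fun g" shows "smooth_fun (\<lambda>x. f x + g x)"
proof -
  define X where "X u \<longleftrightarrow> (\<exists>f g. smooth_fun f \<and> smooth_fun g \<and> u = (\<lambda>x. f x + g x))" for u :: "'a \<Rightarrow> real"
  show ?thesis
  proof (rule smooth_fun_coinduct_derivative[of X])
    show "X (\<lambda>x. f x + g x)" using assms by (auto simp: X_def)
    fix u assume "X u"
    then obtain f g where fg: "smooth_fun f" "smooth_fun g" and u: "u = (\<lambda>x. f x + g x)" by (auto simp: X_def)
    have "(u has_derivative (\<lambda>h. frechet_derivative f (at x) h + frechet_derivative g (at x) h)) (at x)" for x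
      unfolding u by (intro has_derivative_add smooth_fun_has_derivative fg)
    moreover have "X (\<lambda>x. frechet_derivative f (at x) i + frechet_derivative g (at x) i)" if "i \<in> Basis" for i
      unfolding X_def using smooth_fun_partial[OF _ that] fg by blast
    ultimately show "\<exists>g'. (\<forall>x. (u has_derivative g' x) (at x)) \<and> (\<forall>i\<in>Basis. X (\<lambda>x. g' x i))"
      by (intro exI[of _ "\<lambda>x h. frechet_derivative f (at x) h + frechet_derivative g (at x) h"]) blast
  qed
qed

lemma has_derivative_grad:
  assumes "smooth_fun \<phi>" shows "(\<phi> has_derivative (\<lambda>h. grad \<phi> x \<bullet> h)) (at x)"
proof -
  have lin: "linear (frechet_derivative \<phi> (at x))"
    using smooth_fun_has_derivative[OF assms] has_derivative_linear by blast
  have "frechet_derivative \<phi> (at x) h = grad \<phi> x \<bullet> h" for h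
  proof -
    have "frechet_derivative \<phi> (at x) h = frechet_derivative \<phi> (at x) (\<Sum>i\<in>UNIV. h $ i *\<^sub>R axis i 1)"
      by (simp add: basis_expansion flip: scalar_mult_eq_scaleR)
    also have "\<dots> = (\<Sum>i\<in>UNIV. h $ i * frechet_derivative \<phi> (at x) (axis i 1))"
      by (simp add: linear_sum[OF lin] linear_scale[OF lin])
    also have "\<dots> = grad \<phi> x \<bullet> h" by (simp add: grad_def inner_vec_def mult.commute)
    finally show ?thesis .
  qed
  then have "frechet_derivative \<phi> (at x) = (\<lambda>h. grad \<phi> x \<bullet> h)" by blast
  with smooth_fun_has_derivative[OF assms, of x] show ?thesis by simp
qed

lemma grad_eqI:
  assumes "(\<phi> has_derivative (\<lambda>h. v \<bullet> h)) (at x)" shows "grad \<phi> x = v"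
  by (simp add: grad_def vec_eq_iff inner_axis frechet_derivative_at[OF assms, symmetric])

lemma smooth_fun_grad_nth: "smooth_fun \<phi> \<Longrightarrow> smooth_fun (\<lambda>x. grad \<phi> x $ i)"
  unfolding grad_def by (simp add: smooth_fun_partial axis_in_Basis_iff)

lemma grad_affine:
  assumes "smooth_fun \<phi>"
  shows "grad (\<lambda>x. k * \<phi> (t + c *\<^sub>R x)) x = (k * c) *\<^sub>R grad \<phi> (t + c *\<^sub>R x)"
proof (rule grad_eqI)
  have "((\<lambda>x. k * \<phi> (t + c *\<^sub>R x)) has_derivative (\<lambda>h. k * (grad \<phi> (t + c *\<^sub>R x) \<bullet> (c *\<^sub>R h)))) (at x)"
    by (intro has_derivative_mult_right has_derivative_compose[OF _ has_derivative_grad[OF assms]])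
       (auto intro!: derivative_eq_intros)
  moreover have "(\<lambda>h. k * (grad \<phi> (t + c *\<^sub>R x) \<bullet> (c *\<^sub>R h))) = (\<bullet>) ((k * c) *\<^sub>R grad \<phi> (t + c *\<^sub>R x))"
    by (simp add: fun_eq_iff)
  ultimately show "((\<lambda>x. k * \<phi> (t + c *\<^sub>R x)) has_derivative (\<bullet>) ((k * c) *\<^sub>R grad \<phi> (t + c *\<^sub>R x))) (at x)"
    by simp
qed

lemma grad_add:
  assumes "smooth_fun \<phi>" "smooth_fun \<psi>"
  shows "grad (\<lambda>x. \<phi> x + \<psi> x) x = grad \<phi> x + grad \<psi> x"
  by (rule grad_eqI) (use has_derivative_add[OF assms[THEN has_derivative_grad]] in \<open>simp add: inner_add_left\<close>)

lemma test_fun_smooth: "test_fun U \<phi> \<Longrightarrow> smooth_fun \<phi>" by (simp add: test_fun_def)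

lemma test_funI:
  assumes "smooth_fun \<phi>" "compact K" "K \<subseteq> U" "\<And>x. x \<notin> K \<Longrightarrow> \<phi> x = 0"
  shows "test_fun U \<phi>"
proof -
  have "closure {x. \<phi> x \<noteq> 0} \<subseteq> K" using assms by (intro closure_minimal compact_imp_closed) auto
  moreover from this have "compact (closure {x. \<phi> x \<noteq> 0})"
    using assms(2) by (meson closed_closure compact_imp_bounded bounded_subset compact_eq_bounded_closed)
  ultimately show ?thesis using assms by (auto simp: test_fun_def)
qed

lemma test_fun_support:
  assumes "test_fun U \<phi>"
  obtains K where "compact K" "K \<subseteq> U" "\<And>x. x \<notin> K \<Longrightarrow> \<phi> x = 0" "\<And>x. x \<notin> K \<Longrightarrow> grad \<phi> x = 0"
proof (rule that[of "closure {x. \<phi> x \<noteq> 0}"])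
  show "compact (closure {x. \<phi> x \<noteq> 0})" "closure {x. \<phi> x \<noteq> 0} \<subseteq> U" using assms by (auto simp: test_fun_def)
  show *: "\<phi> x = 0" if "x \<notin> closure {x. \<phi> x \<noteq> 0}" for x
    using that subsetD[OF closure_subset, of x "{x. \<phi> x \<noteq> 0}"] by blast
  show "grad \<phi> x = 0" if "x \<notin> closure {x. \<phi> x \<noteq> 0}" for x
  proof (rule grad_eqI)
    have "((\<lambda>x. 0::real) has_derivative (\<lambda>h. 0 \<bullet> h)) (at x)" by simp
    moreover have "open (- closure {x. \<phi> x \<noteq> 0})" by (simp add: open_Compl)
    moreover have "x \<in> - closure {x. \<phi> x \<noteq> 0}" using that by simp
    moreover have "0 = \<phi> y" if "y \<in> - closure {x. \<phi> x \<noteq> 0}" for y using *[of y] that by simp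
    ultimately show "(\<phi> has_derivative (\<bullet>) 0) (at x)"
      by (rule has_derivative_transform_within_open)
  qed
qed

lemma test_fun_mono: "test_fun U \<phi> \<Longrightarrow> U \<subseteq> V \<Longrightarrow> test_fun V \<phi>"
  by (auto simp: test_fun_def)

lemma test_fun_grad_nth: "test_fun U \<phi> \<Longrightarrow> test_fun U (\<lambda>x. grad \<phi> x $ i)"
proof -
  assume \<phi>: "test_fun U \<phi>"
  then obtain K where K: "compact K" "K \<subseteq> U" "\<And>x. x \<notin> K \<Longrightarrow> grad \<phi> x = 0" by (rule test_fun_support) blast
  show ?thesis
    by (rule test_funI[OF smooth_fun_grad_nth[OF test_fun_smooth[OF \<phi>]] K(1,2)]) (simp add: K(3))
qed

lemma test_fun_affine:
  assumes \<phi>: "test_fun U \<phi>" and c: "c \<noteq> 0" and UV: "\<And>x. t + c *\<^sub>R x \<in> U \<Longrightarrow> x \<in> V"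
  shows "test_fun V (\<lambda>x. k * \<phi> (t + c *\<^sub>R x))"
proof -
  obtain K where K: "compact K" "K \<subseteq> U" "\<And>x. x \<notin> K \<Longrightarrow> \<phi> x = 0" using \<phi> by (rule test_fun_support) blast
  let ?S = "\<lambda>x. inverse c *\<^sub>R (x - t)"
  show ?thesis
  proof (rule test_funI)
    show "smooth_fun (\<lambda>x. k * \<phi> (t + c *\<^sub>R x))" by (intro smooth_fun_affine test_fun_smooth[OF \<phi>])
    show "compact (?S ` K)" by (intro compact_continuous_image K continuous_intros)
    show "?S ` K \<subseteq> V"
    proof
      fix y assume "y \<in> ?S ` K"
      then obtain k where k: "k \<in> K" "y = ?S k" by blast
      then have "t + c *\<^sub>R y = k" using c by simp
      then show "y \<in> V" using UV k(1) K(2) by blast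
    qed
    fix x assume x: "x \<notin> ?S ` K"
    have "t + c *\<^sub>R x \<notin> K"
    proof
      assume "t + c *\<^sub>R x \<in> K"
      then have "?S (t + c *\<^sub>R x) \<in> ?S ` K" by (rule imageI)
      with x c show False by simp
    qed
    then show "k * \<phi> (t + c *\<^sub>R x) = 0" using K(3) by simp
  qed
qed

lemma test_fun_add:
  assumes "test_fun U \<phi>" "test_fun U \<psi>" shows "test_fun U (\<lambda>x. \<phi> x + \<psi> x)"
proof -
  obtain K where K: "compact K" "K \<subseteq> U" "\<And>x. x \<notin> K \<Longrightarrow> \<phi> x = 0" using assms(1) by (rule test_fun_support) blast
  obtain L where L: "compact L" "L \<subseteq> U" "\<And>x. x \<notin> L \<Longrightarrow> \<psi> x = 0" using assms(2) by (rule test_fun_support) blast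
  show ?thesis
  proof (rule test_funI[of _ "K \<union> L"])
    show "smooth_fun (\<lambda>x. \<phi> x + \<psi> x)" by (intro smooth_fun_add test_fun_smooth[OF assms(1)] test_fun_smooth[OF assms(2)])
    show "compact (K \<union> L)" "K \<union> L \<subseteq> U" using K L by auto
    show "\<phi> x + \<psi> x = 0" if "x \<notin> K \<union> L" for x using that K(3) L(3) by simp
  qed
qed

lemma continuous_grad: "smooth_fun \<phi> \<Longrightarrow> continuous_on A (grad \<phi>)"
proof -
  assume "smooth_fun \<phi>"
  then have "continuous_on A (\<lambda>x. grad \<phi> x $ i)" for i by (intro smooth_fun_continuous smooth_fun_grad_nth)
  then have "continuous_on A (\<lambda>x. \<chi> i. grad \<phi> x $ i)" by (intro continuous_on_vec_lambda)
  then show ?thesis by simp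
qed

lemma continuous_compact_support:
  fixes f :: "'a::euclidean_space \<Rightarrow> 'b::euclidean_space"
  assumes f: "continuous_on UNIV f" and K: "compact K" "\<And>x. x \<notin> K \<Longrightarrow> f x = 0"
  shows "\<exists>B>0. \<forall>x. norm (f x) \<le> B" and "square_integrable f" and "integrable lebesgue f"
proof -
  have "bounded (f ` K)" using f K(1) by (meson compact_continuous_image compact_imp_bounded continuous_on_subset top_greatest)
  then obtain B where B: "B > 0" "\<forall>x\<in>K. norm (f x) \<le> B" unfolding bounded_pos by auto
  have bd: "norm (f x) \<le> B" for x using B K(2)[of x] by (cases "x \<in> K") auto
  then show "\<exists>B>0. \<forall>x. norm (f x) \<le> B" using B by blast
  have Kl: "K \<in> lmeasurable" by (rule lmeasurable_compact[OF K(1)])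
  have meas: "f \<in> borel_measurable lebesgue"
    using f by (simp add: borel_measurable_continuous_onI measurable_completion)
  have iK: "integrable lebesgue (\<lambda>x. C * indicator K x :: real)" for C
    using Kl by (intro integrable_mult_right integrable_real_indicator)
      (auto simp: fmeasurable_def)
  show "integrable lebesgue f"
    by (rule Bochner_Integration.integrable_bound[OF iK[of B] meas])
       (use bd K(2) B in \<open>auto simp: indicator_def\<close>)
  show "square_integrable f"
  proof (rule square_integrable_bound[OF iK[of "B\<^sup>2"] meas])
    show "(norm (f x))\<^sup>2 \<le> B\<^sup>2 * indicator K x" for x
      using power_mono[OF bd[of x] norm_ge_zero, of 2] K(2)[of x] by (auto simp: indicator_def)
  qed
qed

lemma test_fun_bounded:
  assumes "test_fun U \<phi>"
  obtains B where "B > 0" "\<And>x. \<bar>\<phi> x\<bar> \<le> B" "\<And>x. norm (grad \<phi> x) \<le> B"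
proof -
  obtain K where K: "compact K" "\<And>x. x \<notin> K \<Longrightarrow> \<phi> x = 0" "\<And>x. x \<notin> K \<Longrightarrow> grad \<phi> x = 0"
    using assms by (rule test_fun_support) blast
  obtain B1 where 1: "B1 > 0" "\<And>x. norm (\<phi> x) \<le> B1"
    using continuous_compact_support(1)[OF smooth_fun_continuous[OF test_fun_smooth[OF assms]] K(1,2)] by auto
  obtain B2 where 2: "B2 > 0" "\<And>x. norm (grad \<phi> x) \<le> B2"
    using continuous_compact_support(1)[OF continuous_grad[OF test_fun_smooth[OF assms]] K(1,3)] by auto
  show ?thesis by (rule that[of "max B1 B2"]) (use 1 2 in \<open>auto simp: le_max_iff_disj\<close>)
qed

lemma
  assumes "test_fun U \<phi>"
  shows test_fun_square_integrable: "square_integrable \<phi>"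
    and test_fun_integrable: "integrable lebesgue \<phi>"
    and test_fun_grad_square_integrable: "square_integrable (grad \<phi>)"
    and test_fun_grad_integrable: "integrable lebesgue (grad \<phi>)"
proof -
  obtain K where K: "compact K" "\<And>x. x \<notin> K \<Longrightarrow> \<phi> x = 0" "\<And>x. x \<notin> K \<Longrightarrow> grad \<phi> x = 0"
    using assms by (rule test_fun_support) blast
  note c = smooth_fun_continuous[OF test_fun_smooth[OF assms]] continuous_grad[OF test_fun_smooth[OF assms]]
  show "square_integrable \<phi>" "integrable lebesgue \<phi>" "square_integrable (grad \<phi>)" "integrable lebesgue (grad \<phi>)"
    using continuous_compact_support(2,3)[OF c(1) K(1,2)] continuous_compact_support(2,3)[OF c(2) K(1,3)] by auto
qed

lemma test_fun_lipschitz: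
  assumes "test_fun U \<phi>"
  obtains B where "B > 0" "\<And>x h. \<bar>\<phi> (x + h) - \<phi> x\<bar> \<le> B * norm h"
proof -
  obtain B where B: "B > 0" "\<And>x. norm (grad \<phi> x) \<le> B" using assms by (rule test_fun_bounded) blast
  have "norm (\<phi> (x + h) - \<phi> x) \<le> B * norm (x + h - x)" for x h
  proof (rule differentiable_bound[OF convex_UNIV])
    show "(\<phi> has_derivative (\<lambda>h. grad \<phi> x \<bullet> h)) (at x)" for x
      by (rule has_derivative_grad[OF test_fun_smooth[OF assms]])
    show "onorm (\<lambda>h. grad \<phi> x \<bullet> h) \<le> B" for x
      using B by (intro onorm_bound) (auto intro!: order_trans[OF Cauchy_Schwarz_ineq2] mult_right_mono)
  qed auto
  then show ?thesis using B(1) by (intro that[of B]) auto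
qed

section \<open>Difference quotients and integration by parts\<close>

text \<open>Difference quotients along the steps 1/(n+1). Combined with translation invariance of
  the integral they yield integration by parts without iterated integrals.\<close>

definition diff_quot :: "('a::euclidean_space \<Rightarrow> real) \<Rightarrow> 'a \<Rightarrow> nat \<Rightarrow> 'a \<Rightarrow> real" where
  "diff_quot \<phi> h n x = real (Suc n) * (\<phi> (x + (1 / real (Suc n)) *\<^sub>R h) - \<phi> x)"

lemma diff_quot_tendsto:
  assumes "smooth_fun \<phi>" shows "(\<lambda>n. diff_quot \<phi> h n x) \<longlonglongrightarrow> grad \<phi> x \<bullet> h"
proof -
  have l: "((\<lambda>t. x + t *\<^sub>R h) has_derivative (\<lambda>t. t *\<^sub>R h)) (at 0)" by (auto intro!: derivative_eq_intros)
  have "((\<lambda>t. \<phi> (x + t *\<^sub>R h)) has_derivative (\<lambda>t. grad \<phi> x \<bullet> (t *\<^sub>R h))) (at 0)"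
    using has_derivative_compose[OF l, of \<phi> "\<lambda>k. grad \<phi> x \<bullet> k"] has_derivative_grad[OF assms, of x] by simp
  then have "((\<lambda>t. \<phi> (x + t *\<^sub>R h)) has_real_derivative (grad \<phi> x \<bullet> h)) (at 0)"
    by (simp add: has_field_derivative_def mult_commute_abs)
  then have D: "((\<lambda>t. (\<phi> (x + t *\<^sub>R h) - \<phi> x) / t) \<longlongrightarrow> grad \<phi> x \<bullet> h) (at 0)"
    by (simp add: DERIV_def)
  have "filterlim (\<lambda>n. 1 / real (Suc n)) (at 0) sequentially"
    unfolding filterlim_at using LIMSEQ_inverse_real_of_nat by (auto simp: inverse_eq_divide)
  from filterlim_compose[OF D this] show ?thesis by (simp add: diff_quot_def mult.commute)
qed

lemma diff_quot_bound:
  assumes "test_fun U \<phi>"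
  obtains B R where "B > 0" "\<And>n x. \<bar>diff_quot \<phi> h n x\<bar> \<le> B * indicator (ball 0 R) x"
    "\<And>n. continuous_on UNIV (diff_quot \<phi> h n)"
proof -
  obtain B where B: "B > 0" "\<And>x h. \<bar>\<phi> (x + h) - \<phi> x\<bar> \<le> B * norm h" using assms by (rule test_fun_lipschitz) blast
  obtain K where K: "compact K" "\<And>x. x \<notin> K \<Longrightarrow> \<phi> x = 0" using assms by (rule test_fun_support) blast
  obtain R where R: "R > 0" "K \<subseteq> ball 0 R" using compact_imp_bounded[OF K(1)] bounded_subset_ballD by blast
  show ?thesis
  \<comment> \<open>A step has length at most |h|, so the quotient lives in the ball enlarged by
    |h|; the summand 1 keeps the bound positive when h = 0.\<close>
  proof (rule that[of "B * norm h + 1" "R + norm h"])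
    show "B * norm h + 1 > 0" using B(1) by (simp add: add_nonneg_pos)
    fix n x
    show "\<bar>diff_quot \<phi> h n x\<bar> \<le> (B * norm h + 1) * indicator (ball 0 (R + norm h)) x"
    proof (cases "x \<in> ball 0 (R + norm h)")
      case True
      have "\<bar>diff_quot \<phi> h n x\<bar> \<le> real (Suc n) * (B * norm ((1 / real (Suc n)) *\<^sub>R h))"
        unfolding diff_quot_def abs_mult using B(2)[of x "(1 / real (Suc n)) *\<^sub>R h"] by (intro mult_mono) auto
      also have "\<dots> = B * norm h" by (simp add: field_simps)
      finally show ?thesis using True by simp
    next
      case False
      have *: "norm ((1 / real (Suc n)) *\<^sub>R h) \<le> norm h" by (simp add: field_simps mult_left_le)
      have "x \<notin> ball 0 R" using False norm_ge_zero[of h] unfolding mem_ball dist_0_norm by linarith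
      moreover have "x + (1 / real (Suc n)) *\<^sub>R h \<notin> ball 0 R"
        using False * norm_diff_ineq[of x "(1 / real (Suc n)) *\<^sub>R h"] unfolding mem_ball dist_0_norm by linarith
      ultimately have "\<phi> x = 0" "\<phi> (x + (1 / real (Suc n)) *\<^sub>R h) = 0"
        using K(2) subsetD[OF R(2)] by blast+
      then show ?thesis using B(1) by (simp add: diff_quot_def)
    qed
    show "continuous_on UNIV (diff_quot \<phi> h n)"
      unfolding diff_quot_def
      by (intro continuous_intros continuous_on_compose2[OF smooth_fun_continuous[OF test_fun_smooth[OF assms], of UNIV]]) auto
  qed
qed

lemma borel_measurable_lebesgue_continuous:
  "continuous_on UNIV f \<Longrightarrow> f \<in> borel_measurable lebesgue"
  by (simp add: borel_measurable_continuous_onI measurable_completion)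

lemma integral_diff_quot_tendsto:
  fixes \<phi> \<eta> :: "real^'n \<Rightarrow> real"
  assumes \<phi>: "test_fun U \<phi>" and \<eta>: "\<And>R. integrable lebesgue (\<lambda>x. indicator (ball 0 R) x * \<eta> x)"
    and \<eta>_meas: "\<eta> \<in> borel_measurable lebesgue"
  shows "(\<lambda>n. LINT x|lebesgue. diff_quot \<phi> h n x * \<eta> x) \<longlonglongrightarrow> (LINT x|lebesgue. (grad \<phi> x \<bullet> h) * \<eta> x)"
    and "integrable lebesgue (\<lambda>x. diff_quot \<phi> h n x * \<eta> x)"
proof -
  obtain B R where B: "B > 0" "\<And>n x. \<bar>diff_quot \<phi> h n x\<bar> \<le> B * indicator (ball 0 R) x"
    "\<And>n. continuous_on UNIV (diff_quot \<phi> h n)"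
    using \<phi> by (rule diff_quot_bound[of _ _ h]) blast
  have w: "integrable lebesgue (\<lambda>x. B * \<bar>indicator (ball 0 R) x * \<eta> x\<bar>)"
    by (intro integrable_mult_right integrable_abs \<eta>)
  have m1: "(\<lambda>x. diff_quot \<phi> h n x * \<eta> x) \<in> borel_measurable lebesgue" for n
    by (intro borel_measurable_times \<eta>_meas borel_measurable_lebesgue_continuous B)
  have m2: "(\<lambda>x. (grad \<phi> x \<bullet> h) * \<eta> x) \<in> borel_measurable lebesgue"
    by (intro borel_measurable_times \<eta>_meas borel_measurable_lebesgue_continuous continuous_intros
        continuous_grad test_fun_smooth[OF \<phi>])
  have bd: "norm (diff_quot \<phi> h n x * \<eta> x) \<le> B * \<bar>indicator (ball 0 R) x * \<eta> x\<bar>" for n x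
    using mult_right_mono[OF B(2)[of n x] abs_ge_zero[of "\<eta> x"]] by (simp add: abs_mult)
  show "integrable lebesgue (\<lambda>x. diff_quot \<phi> h n x * \<eta> x)"
    by (rule Bochner_Integration.integrable_bound[OF w m1]) (use bd in \<open>auto intro: order_trans[OF _ abs_ge_self]\<close>)
  show "(\<lambda>n. LINT x|lebesgue. diff_quot \<phi> h n x * \<eta> x) \<longlonglongrightarrow> (LINT x|lebesgue. (grad \<phi> x \<bullet> h) * \<eta> x)"
  proof (rule Bochner_Integration.integral_dominated_convergence[OF m2 m1 w])
    show "AE x in lebesgue. (\<lambda>n. diff_quot \<phi> h n x * \<eta> x) \<longlonglongrightarrow> (grad \<phi> x \<bullet> h) * \<eta> x"
      by (intro AE_I2 tendsto_mult tendsto_const diff_quot_tendsto test_fun_smooth[OF \<phi>])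
    show "AE x in lebesgue. norm (diff_quot \<phi> h n x * \<eta> x) \<le> B * \<bar>indicator (ball 0 R) x * \<eta> x\<bar>" for n
      using bd by simp
  qed
qed

lemma square_integrable_diff_quot:
  assumes \<phi>: "test_fun U \<phi>" shows "square_integrable (diff_quot \<phi> h n)"
proof -
  obtain B R where B: "B > 0" "\<And>n x. \<bar>diff_quot \<phi> h n x\<bar> \<le> B * indicator (ball 0 R) x"
    "\<And>n. continuous_on UNIV (diff_quot \<phi> h n)"
    using \<phi> by (rule diff_quot_bound[of _ _ h]) blast
  have "diff_quot \<phi> h n x = 0" if "x \<notin> cball 0 R" for x using B(2)[of n x] that by (simp add: indicator_def)
  from continuous_compact_support(2)[OF B(3) compact_cball this] show ?thesis .
qed

lemma norm_diff_quot_tendsto: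
  fixes \<phi> :: "real^'n \<Rightarrow> real"
  assumes \<phi>: "test_fun U \<phi>"
  shows "(\<lambda>n. norm (l2_of (diff_quot \<phi> h n))) \<longlonglongrightarrow> norm (l2_of (\<lambda>x. grad \<phi> x \<bullet> h))"
proof -
  obtain B R where B: "B > 0" "\<And>n x. \<bar>diff_quot \<phi> h n x\<bar> \<le> B * indicator (ball 0 R) x"
    "\<And>n. continuous_on UNIV (diff_quot \<phi> h n)"
    using \<phi> by (rule diff_quot_bound[of _ _ h]) blast
  have gs: "square_integrable (\<lambda>x. grad \<phi> x \<bullet> h)"
    by (rule square_integrable_bound_norm[OF test_fun_grad_square_integrable[OF \<phi>], of _ "norm h"])
       (auto simp: mult.commute intro!: borel_measurable_lebesgue_continuous continuous_intros
        continuous_grad test_fun_smooth[OF \<phi>] order_trans[OF Cauchy_Schwarz_ineq2])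
  have "(\<lambda>n. LINT x|lebesgue. (norm (diff_quot \<phi> h n x))\<^sup>2) \<longlonglongrightarrow> (LINT x|lebesgue. (norm (grad \<phi> x \<bullet> h))\<^sup>2)"
  proof (rule Bochner_Integration.integral_dominated_convergence[where w="\<lambda>x. B\<^sup>2 * indicator (ball 0 R) x"])
    show "integrable lebesgue (\<lambda>x. B\<^sup>2 * indicator (ball 0 R) x)"
      by (intro integrable_mult_right integrable_real_indicator)
         (simp_all add: fmeasurableD2[OF lmeasurable_ball] top.not_eq_extremum[symmetric] del: emeasure_completion)
    show "AE x in lebesgue. (\<lambda>n. (norm (diff_quot \<phi> h n x))\<^sup>2) \<longlonglongrightarrow> (norm (grad \<phi> x \<bullet> h))\<^sup>2"
      by (intro AE_I2 tendsto_intros diff_quot_tendsto test_fun_smooth[OF \<phi>])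
    show "AE x in lebesgue. norm ((norm (diff_quot \<phi> h n x))\<^sup>2) \<le> B\<^sup>2 * indicator (ball 0 R) x" for n
    proof (rule AE_I2)
      fix x show "norm ((norm (diff_quot \<phi> h n x))\<^sup>2) \<le> B\<^sup>2 * indicator (ball 0 R) x"
        using power_mono[OF B(2)[of n x] abs_ge_zero, of 2] by (auto simp: indicator_def split: if_splits)
    qed
  qed (use gs square_integrable_diff_quot[OF \<phi>] in \<open>auto simp: square_integrable_def intro: borel_measurable_integrable\<close>)
  then have "(\<lambda>n. sqrt (LINT x|lebesgue. (norm (diff_quot \<phi> h n x))\<^sup>2)) \<longlonglongrightarrow> sqrt (LINT x|lebesgue. (norm (grad \<phi> x \<bullet> h))\<^sup>2)"
    by (rule tendsto_real_sqrt)
  then show ?thesis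
    unfolding norm_l2_of[OF gs, symmetric] norm_l2_of[OF square_integrable_diff_quot[OF \<phi>], symmetric] by simp
qed

lemma square_integrable_mult_integrable:
  fixes f g :: "'a::euclidean_space \<Rightarrow> real"
  shows "square_integrable f \<Longrightarrow> square_integrable g \<Longrightarrow> integrable lebesgue (\<lambda>x. f x * g x)"
  using square_integrable_inner[of f g] by simp

lemma integral_translation:
  fixes f :: "'a::euclidean_space \<Rightarrow> real"
  assumes "f \<in> borel_measurable lebesgue"
  shows "(LINT x|lebesgue. f (x + t)) = (LINT x|lebesgue. f x)"
  using integral_lebesgue_affine[OF assms, of 1 t] by (simp add: add.commute)

text \<open>Summation by parts before the limit: translating the product moves the quotient in
  direction \<open>h\<close> from one factor to the quotient in direction \<open>-h\<close> of the
  other.\<close>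

lemma integration_by_parts:
  fixes \<phi> \<eta> :: "real^'n \<Rightarrow> real"
  assumes \<phi>: "test_fun U \<phi>" and \<eta>: "test_fun V \<eta>"
  shows "(LINT x|lebesgue. (grad \<phi> x \<bullet> h) * \<eta> x) = - (LINT x|lebesgue. \<phi> x * (grad \<eta> x \<bullet> h))"
proof -
  note sq = test_fun_square_integrable[OF \<phi>] test_fun_square_integrable[OF \<eta>]
  have loc: "integrable lebesgue (\<lambda>x. indicator (ball 0 R) x * f x)" if "integrable lebesgue f" for R and f :: "real^'n \<Rightarrow> real"
    using that by (intro integrable_indicator_mult) auto
  have 1: "(\<lambda>n. LINT x|lebesgue. diff_quot \<phi> h n x * \<eta> x) \<longlonglongrightarrow> (LINT x|lebesgue. (grad \<phi> x \<bullet> h) * \<eta> x)"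
    using test_fun_integrable[OF \<eta>] by (intro integral_diff_quot_tendsto(1)[OF \<phi>] loc) auto
  have 2: "(\<lambda>n. LINT x|lebesgue. diff_quot \<eta> (-h) n x * \<phi> x) \<longlonglongrightarrow> (LINT x|lebesgue. (grad \<eta> x \<bullet> -h) * \<phi> x)"
    using test_fun_integrable[OF \<phi>] by (intro integral_diff_quot_tendsto(1)[OF \<eta>] loc) auto
  have "(LINT x|lebesgue. diff_quot \<phi> h n x * \<eta> x) = (LINT x|lebesgue. diff_quot \<eta> (-h) n x * \<phi> x)" for n
  proof -
    let ?t = "(1 / real (Suc n)) *\<^sub>R h"
    have s: "square_integrable (\<lambda>x. \<phi> (x + ?t))" "square_integrable (\<lambda>x. \<eta> (x - ?t))"
      using square_integrable_affine[OF sq(1), of 1 ?t] square_integrable_affine[OF sq(2), of 1 "- ?t"]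
      by (simp_all add: add.commute)
    note ints = square_integrable_mult_integrable[OF s(1) sq(2)] square_integrable_mult_integrable[OF sq(1) sq(2)]
      square_integrable_mult_integrable[OF s(2) sq(1)] square_integrable_mult_integrable[OF sq(2) sq(1)]
    have "(LINT x|lebesgue. \<phi> (x + ?t) * \<eta> x) = (LINT x|lebesgue. \<phi> ((x + - ?t) + ?t) * \<eta> (x + - ?t))"
      using integral_translation[of "\<lambda>x. \<phi> (x + ?t) * \<eta> x" "- ?t"] ints(1) by simp
    then have tr: "(LINT x|lebesgue. \<phi> (x + ?t) * \<eta> x) = (LINT x|lebesgue. \<eta> (x - ?t) * \<phi> x)"
      by (simp add: mult.commute)
    have "(LINT x|lebesgue. diff_quot \<phi> h n x * \<eta> x)
       = real (Suc n) * ((LINT x|lebesgue. \<phi> (x + ?t) * \<eta> x) - (LINT x|lebesgue. \<phi> x * \<eta> x))"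
      unfolding Bochner_Integration.integral_diff[OF ints(1,2), symmetric] integral_mult_right_zero[symmetric]
      by (rule Bochner_Integration.integral_cong) (simp_all add: diff_quot_def left_diff_distrib algebra_simps)
    moreover have "(LINT x|lebesgue. diff_quot \<eta> (-h) n x * \<phi> x)
       = real (Suc n) * ((LINT x|lebesgue. \<eta> (x - ?t) * \<phi> x) - (LINT x|lebesgue. \<eta> x * \<phi> x))"
      unfolding Bochner_Integration.integral_diff[OF ints(3,4), symmetric] integral_mult_right_zero[symmetric]
      by (rule Bochner_Integration.integral_cong) (simp_all add: diff_quot_def left_diff_distrib algebra_simps)
    ultimately show ?thesis unfolding tr by (simp only: mult.commute[of "\<phi> _"])
  qed
  with 1 2 have "(LINT x|lebesgue. (grad \<phi> x \<bullet> h) * \<eta> x) = (LINT x|lebesgue. (grad \<eta> x \<bullet> -h) * \<phi> x)"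
    using LIMSEQ_unique by auto
  also have "\<dots> = - (LINT x|lebesgue. \<phi> x * (grad \<eta> x \<bullet> h))"
    by (simp add: mult.commute)
  finally show ?thesis .
qed

text \<open>Integration by parts against the constant 1, which is not a test function. It makes
  additive constants disappear when a potential is tested with a derivative.\<close>

lemma integral_grad_eq_0:
  fixes \<phi> :: "real^'n \<Rightarrow> real"
  assumes \<phi>: "test_fun U \<phi>" shows "(LINT x|lebesgue. grad \<phi> x \<bullet> h) = 0"
proof -
  note i = test_fun_integrable[OF \<phi>]
  have "(\<lambda>n. LINT x|lebesgue. diff_quot \<phi> h n x * 1) \<longlonglongrightarrow> (LINT x|lebesgue. (grad \<phi> x \<bullet> h) * 1)"
    by (rule integral_diff_quot_tendsto[OF \<phi>])
       (auto intro!: integrable_real_indicator simp: fmeasurableD2[OF lmeasurable_ball] top.not_eq_extremum[symmetric] simp del: emeasure_completion)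
  moreover have "(LINT x|lebesgue. diff_quot \<phi> h n x) = 0" for n
  proof -
    let ?t = "(1 / real (Suc n)) *\<^sub>R h"
    have "integrable lebesgue (\<lambda>x. \<phi> (x + ?t))"
      using integrable_lebesgue_affine[OF borel_measurable_integrable[OF i], of 1 ?t] i by (simp add: add.commute)
    then show ?thesis
      using integral_translation[OF borel_measurable_integrable[OF i], of ?t] i
      by (simp add: diff_quot_def Bochner_Integration.integral_diff)
  qed
  ultimately show ?thesis using LIMSEQ_unique[OF _ tendsto_const] by fastforce
qed

text \<open>Telescoping \<open>\<phi>(x + h) - \<phi>(x)\<close> over \<open>n\<close> equal steps of equal norm and letting \<open>n \<rightarrow> \<infinity>\<close>.\<close>

lemma norm_translation_diff_le:
  fixes \<phi> :: "real^'n \<Rightarrow> real"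
  assumes \<phi>: "test_fun U \<phi>"
  shows "norm (l2_of (\<lambda>x. \<phi> (x + h)) - l2_of \<phi>) \<le> norm h * norm (l2_of (grad \<phi>))"
proof -
  note sq = test_fun_square_integrable[OF \<phi>]
  have st: "square_integrable (\<lambda>x. \<phi> (x + t))" for t
    using square_integrable_affine[OF sq, of 1 t] by (simp add: add.commute)
  have le: "norm (l2_of (\<lambda>x. \<phi> (x + h)) - l2_of \<phi>) \<le> norm (l2_of (diff_quot \<phi> h n))" for n
  proof -
    let ?s = "1 / real (Suc n)"
    define u where "u k = l2_of (\<lambda>x. \<phi> (x + (real k * ?s) *\<^sub>R h))" for k :: nat
    have u1: "u 1 - u 0 = ?s *\<^sub>R l2_of (diff_quot \<phi> h n)"
      unfolding l2_of_scaleR[OF square_integrable_diff_quot[OF \<phi>]] u_def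
      by (simp add: l2_of_diff st sq diff_quot_def)
    have uk: "u (Suc k) - u k = affine_op ((real k * ?s) *\<^sub>R h) 1 (u 1 - u 0)" for k
      unfolding u_def by (simp add: l2_of_diff st sq affine_op_l2_of algebra_simps add_divide_distrib)
    have "norm (u m - u 0) \<le> real m * norm (u 1 - u 0)" for m
    proof (induction m)
      case (Suc m)
      have "norm (u (Suc m) - u 0) \<le> norm (u (Suc m) - u m) + norm (u m - u 0)"
        using norm_triangle_ineq[of "u (Suc m) - u m" "u m - u 0"] by simp
      also have "norm (u (Suc m) - u m) = norm (u 1 - u 0)" unfolding uk by (rule norm_translation)
      finally show ?case using Suc by (simp add: algebra_simps)
    qed simp
    from this[of "Suc n"] have "norm (u (Suc n) - u 0) \<le> norm (l2_of (diff_quot \<phi> h n))"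
      unfolding u1 by simp
    then show ?thesis by (simp add: u_def)
  qed
  have "norm (l2_of (\<lambda>x. \<phi> (x + h)) - l2_of \<phi>) \<le> norm (l2_of (\<lambda>x. grad \<phi> x \<bullet> h))"
    by (rule LIMSEQ_le_const[OF norm_diff_quot_tendsto[OF \<phi>]]) (use le in blast)
  also have "\<dots> \<le> norm h * norm (l2_of (grad \<phi>))"
  proof (rule norm_l2_of_le[OF _ test_fun_grad_square_integrable[OF \<phi>]])
    show "norm (grad \<phi> x \<bullet> h) \<le> norm h * norm (grad \<phi> x)" for x
      using Cauchy_Schwarz_ineq2[of "grad \<phi> x" h] by (simp add: mult.commute)
    then show "square_integrable (\<lambda>x. grad \<phi> x \<bullet> h)"
      by (intro square_integrable_bound_norm[OF test_fun_grad_square_integrable[OF \<phi>], of _ "norm h"])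
       (auto intro!: borel_measurable_lebesgue_continuous continuous_intros continuous_grad test_fun_smooth[OF \<phi>])
  qed simp
  finally show ?thesis .
qed

text \<open>Translating by more than the diameter makes \<open>\<phi>(\<cdot> + h)\<close> and \<open>\<phi>\<close> orthogonal.\<close>

lemma poincare_test_fun:
  fixes \<Omega> :: "(real^'n) set"
  assumes "bounded \<Omega>"
  obtains C where "C > 0" "\<And>\<phi>. test_fun \<Omega> \<phi> \<Longrightarrow> norm (l2_of \<phi>) \<le> C * norm (l2_of (grad \<phi>))"
proof -
  obtain R where R: "R > 0" "\<Omega> \<subseteq> ball 0 R" using assms bounded_subset_ballD by blast
  define h :: "real^'n" where "h = (2 * R) *\<^sub>R axis (SOME i. True) 1"
  have nh: "norm h = 2 * R" using R by (simp add: h_def)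
  show ?thesis
  proof (rule that[of "2 * R"])
    fix \<phi> :: "real^'n \<Rightarrow> real" assume \<phi>: "test_fun \<Omega> \<phi>"
    note sq = test_fun_square_integrable[OF \<phi>]
    have st: "square_integrable (\<lambda>x. \<phi> (x + h))"
      using square_integrable_affine[OF sq, of 1 h] by (simp add: add.commute)
    obtain K where K: "K \<subseteq> \<Omega>" "\<And>x. x \<notin> K \<Longrightarrow> \<phi> x = 0" using \<phi> by (rule test_fun_support) blast
    have "\<phi> (x + h) * \<phi> x = 0" for x
    proof (rule ccontr)
      assume "\<phi> (x + h) * \<phi> x \<noteq> 0"
      then have "x + h \<in> K" "x \<in> K" using K(2) by force+
      then have "x + h \<in> ball 0 R" "x \<in> ball 0 R" using K(1) R(2) by blast+
      then have "norm (x + h) < R" "norm x < R" by auto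
      then show False using norm_triangle_ineq4[of "x + h" x] nh by simp
    qed
    then have orth: "inner (l2_of (\<lambda>x. \<phi> (x + h))) (l2_of \<phi>) = 0"
      unfolding inner_l2_of[OF st sq] inner_real_def by (simp only: Bochner_Integration.integral_zero)
    have "l2_of (\<lambda>x. \<phi> (x + h)) = affine_op h 1 (l2_of \<phi>)"
      by (subst affine_op_l2_of) (auto simp: sq add.commute)
    then have n: "norm (l2_of (\<lambda>x. \<phi> (x + h))) = norm (l2_of \<phi>)" by (simp add: norm_translation)
    have "(norm (l2_of \<phi>))\<^sup>2 \<le> (norm (l2_of (\<lambda>x. \<phi> (x + h)) - l2_of \<phi>))\<^sup>2"
      using orth n[unfolded norm_eq_sqrt_inner] by (simp add: power2_norm_eq_inner inner_diff_left inner_diff_right inner_commute)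
    then have "norm (l2_of \<phi>) \<le> norm (l2_of (\<lambda>x. \<phi> (x + h)) - l2_of \<phi>)" by (rule power2_le_imp_le) simp
    also have "\<dots> \<le> 2 * R * norm (l2_of (grad \<phi>))" using norm_translation_diff_le[OF \<phi>, of h] nh by simp
    finally show "norm (l2_of \<phi>) \<le> 2 * R * norm (l2_of (grad \<phi>))" .
  qed (use R in simp)
qed

section \<open>A smooth bump function\<close>

text \<open>By the sum and product rules, smoothness of everything built from the generators
  \<open>G\<close> reduces to their derivatives lying in the same algebra.\<close>

inductive smooth_algebra :: "('a::euclidean_space \<Rightarrow> real) set \<Rightarrow> ('a \<Rightarrow> real) \<Rightarrow> bool" for G where
  gen: "g \<in> G \<Longrightarrow> smooth_algebra G g"
| const: "smooth_algebra G (\<lambda>x. c)"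
| add: "smooth_algebra G f \<Longrightarrow> smooth_algebra G g \<Longrightarrow> smooth_algebra G (\<lambda>x. f x + g x)"
| mult: "smooth_algebra G f \<Longrightarrow> smooth_algebra G g \<Longrightarrow> smooth_algebra G (\<lambda>x. f x * g x)"

lemma smooth_algebra_smooth_fun:
  assumes G: "\<And>g. g \<in> G \<Longrightarrow> \<exists>g'. (\<forall>x. (g has_derivative g' x) (at x)) \<and> (\<forall>i\<in>Basis. smooth_algebra G (\<lambda>x. g' x i))"
    and f: "smooth_algebra G f"
  shows "smooth_fun f"
proof (rule smooth_fun_coinduct_derivative[of "smooth_algebra G", OF f])
  fix f assume "smooth_algebra G f"
  then show "\<exists>f'. (\<forall>x. (f has_derivative f' x) (at x)) \<and> (\<forall>i\<in>Basis. smooth_algebra G (\<lambda>x. f' x i))"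
  proof induction
    case (gen g)
    then show ?case by (rule G)
  next
    case (const c)
    show ?case by (rule exI[of _ "\<lambda>x h. 0"]) (auto intro: smooth_algebra.const)
  next
    case (add f g)
    then obtain f' g' where *: "\<forall>x. (f has_derivative f' x) (at x)" "\<forall>i\<in>Basis. smooth_algebra G (\<lambda>x. f' x i)"
      "\<forall>x. (g has_derivative g' x) (at x)" "\<forall>i\<in>Basis. smooth_algebra G (\<lambda>x. g' x i)" by blast
    show ?case
      by (rule exI[of _ "\<lambda>x h. f' x h + g' x h"]) (use * in \<open>auto intro: has_derivative_add smooth_algebra.add\<close>)
  next
    case (mult f g)
    then obtain f' g' where *: "\<forall>x. (f has_derivative f' x) (at x)" "\<forall>i\<in>Basis. smooth_algebra G (\<lambda>x. f' x i)"
      "\<forall>x. (g has_derivative g' x) (at x)" "\<forall>i\<in>Basis. smooth_algebra G (\<lambda>x. g' x i)" by blast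
    show ?case
    proof (intro exI[of _ "\<lambda>x h. f x * g' x h + f' x h * g x"] conjI allI ballI)
      show "((\<lambda>x. f x * g x) has_derivative (\<lambda>h. f x * g' x h + f' x h * g x)) (at x)" for x
        using * by (intro has_derivative_mult) auto
      show "smooth_algebra G (\<lambda>x. f x * g' x i + f' x i * g x)" if "i \<in> Basis" for i
        using * mult.hyps that by (intro smooth_algebra.add smooth_algebra.mult) auto
    qed
  qed
qed

text \<open>The index makes the family closed under differentiation up to linear combinations; m = 0
  is the classical flat function exp(-1/t).\<close>

definition flat_exp :: "nat \<Rightarrow> real \<Rightarrow> real" where
  "flat_exp m t = (if t > 0 then exp (- 1 / t) / t ^ m else 0)"

lemma flat_exp_tendsto_0: "(flat_exp m \<longlongrightarrow> 0) (at 0)"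
proof -
  have "((\<lambda>s::real. s ^ m / exp s) \<longlongrightarrow> 0) at_top" by (rule tendsto_power_div_exp_0)
  from filterlim_compose[OF this filterlim_inverse_at_top_right]
  have "((\<lambda>t::real. inverse t ^ m / exp (inverse t)) \<longlongrightarrow> 0) (at_right 0)" .
  then have "(flat_exp m \<longlongrightarrow> 0) (at_right 0)"
    by (rule Lim_transform_eventually)
       (auto simp: eventually_at_right_field flat_exp_def exp_minus divide_simps intro!: exI[of _ 1])
  moreover have "(flat_exp m \<longlongrightarrow> 0) (at_left 0)"
    by (rule tendsto_eventually) (auto simp: eventually_at_left_field flat_exp_def intro!: exI[of _ "-1"])
  ultimately show ?thesis by (simp add: filterlim_at_split)
qed

lemma flat_exp_deriv:
  "(flat_exp m has_real_derivative (flat_exp (m + 2) t - real m * flat_exp (m + 1) t)) (at t)"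
proof -
  consider "t > 0" | "t < 0" | "t = 0" by linarith
  then show ?thesis
  proof cases
    case 1
    have "((\<lambda>t. exp (- 1 / t) / t ^ m) has_real_derivative (flat_exp (m + 2) t - real m * flat_exp (m + 1) t)) (at t)"
    proof -
      have "((\<lambda>t. exp (- 1 / t) / t ^ m) has_real_derivative
          (exp (- 1 / t) * (1 / (t * t)) * t ^ m - exp (- 1 / t) * (real m * t ^ (m - 1))) / (t ^ m * t ^ m)) (at t)"
        using 1 by (auto intro!: derivative_eq_intros)
      also have "(exp (- 1 / t) * (1 / (t * t)) * t ^ m - exp (- 1 / t) * (real m * t ^ (m - 1))) / (t ^ m * t ^ m)
          = flat_exp (m + 2) t - real m * flat_exp (m + 1) t"
        using 1 by (cases m) (simp_all add: flat_exp_def field_simps)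
      finally show ?thesis .
    qed
    then show ?thesis
      by (rule has_field_derivative_transform_within_open[of _ _ _ "{0<..}"]) (use 1 in \<open>auto simp: flat_exp_def\<close>)
  next
    case 2
    have "((\<lambda>t. 0) has_real_derivative (flat_exp (m + 2) t - real m * flat_exp (m + 1) t)) (at t)"
      using 2 by (simp add: flat_exp_def)
    then show ?thesis
      by (rule has_field_derivative_transform_within_open[of _ _ _ "{..<0}"]) (use 2 in \<open>auto simp: flat_exp_def\<close>)
  next
    case 3
    \<comment> \<open>At 0 the difference quotient of index \<open>m\<close> is the function of
      index \<open>Suc m\<close>, which tends to 0.\<close>
    have "((\<lambda>h. (flat_exp m (0 + h) - flat_exp m 0) / h) \<longlongrightarrow> 0) (at 0)"
      using flat_exp_tendsto_0[of "Suc m"]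
      by (rule Lim_transform_eventually) (auto simp: flat_exp_def eventually_at_filter mult.commute)
    then show ?thesis using 3 by (simp add: DERIV_def flat_exp_def)
  qed
qed

definition bump :: "'a::euclidean_space \<Rightarrow> real" where
  "bump x = flat_exp 0 (1 - x \<bullet> x)"

lemma flat_exp_radial_has_derivative:
  "((\<lambda>x. flat_exp m (1 - x \<bullet> x)) has_derivative
     (\<lambda>h. (flat_exp (m + 2) (1 - x \<bullet> x) - real m * flat_exp (m + 1) (1 - x \<bullet> x)) * (- 2 * (x \<bullet> h)))) (at x)"
proof -
  have "((\<lambda>x. 1 - x \<bullet> x) has_derivative (\<lambda>h. - 2 * (x \<bullet> h))) (at x)"
    by (auto intro!: derivative_eq_intros simp: inner_commute)
  from has_derivative_compose[OF this flat_exp_deriv[unfolded has_field_derivative_def]]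
  show ?thesis by (simp add: o_def)
qed

lemma smooth_fun_radial:
  fixes f :: "'a::euclidean_space \<Rightarrow> real"
  defines "G \<equiv> range (\<lambda>m x. flat_exp m (1 - x \<bullet> x)) \<union> range (\<lambda>b x. x \<bullet> b)"
  assumes "smooth_algebra G f" shows "smooth_fun f"
proof (rule smooth_algebra_smooth_fun[OF _ assms(2)])
  fix g assume "g \<in> G"
  then consider m where "g = (\<lambda>x. flat_exp m (1 - x \<bullet> x))" | b where "g = (\<lambda>x. x \<bullet> b)" by (auto simp: G_def)
  then show "\<exists>g'. (\<forall>x. (g has_derivative g' x) (at x)) \<and> (\<forall>i\<in>Basis. smooth_algebra G (\<lambda>x. g' x i))"
  proof cases
    case 1
    have "smooth_algebra G (\<lambda>x. (flat_exp (m + 2) (1 - x \<bullet> x) + (- real m) * flat_exp (m + 1) (1 - x \<bullet> x)) * ((- 2) * (x \<bullet> i)))" for i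
      by (intro smooth_algebra.add smooth_algebra.mult smooth_algebra.const smooth_algebra.gen) (auto simp: G_def)
    then show ?thesis using flat_exp_radial_has_derivative[of m] unfolding 1
      by (intro exI conjI allI ballI) (assumption, simp)
  next
    case 2
    have "((\<lambda>x. x \<bullet> b) has_derivative (\<lambda>h. h \<bullet> b)) (at x)" for x by (auto intro!: derivative_eq_intros)
    then show ?thesis unfolding 2 by (intro exI[of _ "\<lambda>x h. h \<bullet> b"]) (auto intro: smooth_algebra.const)
  qed
qed

lemma bump_smooth: "smooth_fun (bump :: 'a::euclidean_space \<Rightarrow> real)"
  by (rule smooth_fun_radial) (auto simp: bump_def[abs_def] intro: smooth_algebra.gen)

lemma bump_nonneg: "0 \<le> bump x" by (simp add: bump_def flat_exp_def)

lemma bump_pos: "norm x < 1 \<Longrightarrow> 0 < bump x"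
  using power_strict_mono[of "norm x" 1 2] by (simp add: bump_def flat_exp_def power2_norm_eq_inner)

lemma bump_eq_0: "norm x \<ge> 1 \<Longrightarrow> bump x = 0"
  using power_mono[of 1 "norm x" 2] by (simp add: bump_def flat_exp_def power2_norm_eq_inner)

lemma test_fun_bump: "test_fun UNIV (bump :: real^'n \<Rightarrow> real)"
  by (rule test_funI[OF bump_smooth compact_cball[of 0 1]]) (auto intro: bump_eq_0)

lemma grad_bump: "grad bump x = (- 2 * flat_exp 2 (1 - x \<bullet> x)) *\<^sub>R x"
  by (rule grad_eqI)
     (use flat_exp_radial_has_derivative[of 0 x] in \<open>simp add: bump_def[abs_def] numeral_2_eq_2 algebra_simps\<close>)

text \<open>The Hessian is explicit: a multiple of the identity plus a multiple of x x^T, hence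
  symmetric. This symmetry is what makes a weak gradient curl-free when tested with dilated
  bumps.\<close>

lemma bump_mixed_partials:
  fixes i j :: "'n::finite"
  shows "grad (\<lambda>x. grad bump x $ i) x $ j = grad (\<lambda>x. grad bump x $ j) x $ i"
proof -
  have "grad (\<lambda>x. grad bump x $ i) x = (- 2 * flat_exp 2 (1 - x \<bullet> x)) *\<^sub>R axis i 1
      + (4 * (x $ i) * (flat_exp 4 (1 - x \<bullet> x) - 2 * flat_exp 3 (1 - x \<bullet> x))) *\<^sub>R x" for i
  proof (rule grad_eqI)
    have "((\<lambda>x::real^'n. (- 2 * flat_exp 2 (1 - x \<bullet> x)) * (x $ i)) has_derivative
       (\<lambda>h. (- 2 * flat_exp 2 (1 - x \<bullet> x)) * (h $ i)
         + (- 2 * ((flat_exp (2 + 2) (1 - x \<bullet> x) - real 2 * flat_exp (2 + 1) (1 - x \<bullet> x)) * (- 2 * (x \<bullet> h)))) * (x $ i))) (at x)"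
      by (intro has_derivative_mult has_derivative_mult_right flat_exp_radial_has_derivative
          bounded_linear.has_derivative[OF bounded_linear_vec_nth] has_derivative_ident)
    moreover have "(\<lambda>x. grad bump x $ i) = (\<lambda>x. (- 2 * flat_exp 2 (1 - x \<bullet> x)) * (x $ i))"
      by (simp add: grad_bump)
    moreover have "(\<lambda>h. (- 2 * flat_exp 2 (1 - x \<bullet> x)) * (h $ i)
         + (- 2 * ((flat_exp (2 + 2) (1 - x \<bullet> x) - real 2 * flat_exp (2 + 1) (1 - x \<bullet> x)) * (- 2 * (x \<bullet> h)))) * (x $ i))
       = (\<bullet>) ((- 2 * flat_exp 2 (1 - x \<bullet> x)) *\<^sub>R axis i 1
      + (4 * (x $ i) * (flat_exp 4 (1 - x \<bullet> x) - 2 * flat_exp 3 (1 - x \<bullet> x))) *\<^sub>R x)"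
      by (simp add: fun_eq_iff inner_add_left inner_axis' algebra_simps flip: numeral_3_eq_3)
    ultimately show "((\<lambda>x. grad bump x $ i) has_derivative (\<bullet>) ((- 2 * flat_exp 2 (1 - x \<bullet> x)) *\<^sub>R axis i 1
      + (4 * (x $ i) * (flat_exp 4 (1 - x \<bullet> x) - 2 * flat_exp 3 (1 - x \<bullet> x))) *\<^sub>R x)) (at x)"
      by simp
  qed
  then show ?thesis by (simp add: axis_def)
qed

section \<open>Weak limits in the space of square-integrable functions\<close>

text \<open>All averages of the components over balls vanish, and by Lebesgue differentiation these
  averages recover the values almost everywhere.\<close>

lemma orthogonal_ball_indicators_eq_0:
  fixes w :: "('a::euclidean_space, 'b::euclidean_space) l2"
  assumes w: "\<And>c r v. r > 0 \<Longrightarrow> inner w (l2_of (\<lambda>x. indicator (ball c r) x *\<^sub>R v)) = 0"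
  shows "w = 0"
proof (cases w rule: l2_cases)
  case (1 f)
  note f = 1(1)
  have loc: "integrable lebesgue (\<lambda>x. indicator (ball c r) x * (f x \<bullet> b))" for c r b
    using square_integrable_inner[OF f square_integrable_indicator_const[OF lmeasurable_ball, of c r b]] by (simp add: mult.commute)
  have z: "(LINT x|lebesgue. indicator (ball c r) x * (f x \<bullet> b)) = 0" if "r > 0" for c r b
    using w[OF that, of c b] unfolding 1(2) inner_l2_of[OF f square_integrable_indicator_const[OF lmeasurable_ball]]
    by (simp add: mult.commute)
  have "AE x in lebesgue. f x \<bullet> b = 0" for b
  proof -
    have "(\<lambda>x. f x \<bullet> b) \<in> borel_measurable lebesgue" using f by measurable
    from lebesgue_differentiation[OF loc this]
    show ?thesis
    proof eventually_elim
      case (elim x)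
      have "\<forall>\<^sub>F r in at_right 0. 0 = (LINT y|lebesgue. indicator (ball x r) y * (f y \<bullet> b)) / measure lebesgue (ball x r)"
        using eventually_at_right_less[of "0::real"] by eventually_elim (simp add: z)
      then have "((\<lambda>r. (LINT y|lebesgue. indicator (ball x r) y * (f y \<bullet> b)) / measure lebesgue (ball x r)) \<longlongrightarrow> 0) (at_right 0)"
        by (rule Lim_transform_eventually[OF tendsto_const])
      from tendsto_unique[OF _ elim this] show ?case by simp
    qed
  qed
  then have "AE x in lebesgue. \<forall>b\<in>Basis. f x \<bullet> b = 0" by (intro AE_finite_allI) auto
  then have "AE x in lebesgue. f x = 0" by eventually_elim (simp add: euclidean_all_zero_iff)
  then show ?thesis unfolding 1(2) l2_of_zero[symmetric] using f by (subst l2_of_eq_iff) auto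
qed

text \<open>The elements \<open>H\<close> for which convergence holds form a subspace, closed thanks
  to the uniform bound, with trivial orthogonal complement because it contains all ball
  indicators.\<close>

lemma weakly_convergent_on_ball_indicators:
  fixes x :: "nat \<Rightarrow> ('a::euclidean_space, 'b::euclidean_space) l2"
  assumes bd: "\<And>n. norm (x n) \<le> M"
    and conv: "\<And>c r v. r > 0 \<Longrightarrow> (\<lambda>n. inner (x n) (l2_of (\<lambda>z. indicator (ball c r) z *\<^sub>R v)))
      \<longlonglongrightarrow> inner L (l2_of (\<lambda>z. indicator (ball c r) z *\<^sub>R v))"
  shows "(\<lambda>n. inner (x n) H) \<longlonglongrightarrow> inner L H"
proof -
  define S where "S = {H. (\<lambda>n. inner (x n) H) \<longlonglongrightarrow> inner L H}"
  have M: "0 \<le> M" using bd[of 0] norm_ge_zero order_trans by blast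
  have "subspace S"
    unfolding S_def subspace_def
    by (auto simp: inner_add_right intro!: tendsto_add tendsto_mult_left)
  moreover have "closed S"
    unfolding closed_sequential_limits
  proof (intro allI impI)
    fix s H assume s: "(\<forall>n. s n \<in> S) \<and> s \<longlonglongrightarrow> H"
    show "H \<in> S" unfolding S_def mem_Collect_eq
    proof (rule LIMSEQ_I)
      fix e :: real assume e: "e > 0"
      define K where "K = M + norm L + 1"
      have K: "K > 0" using M by (simp add: K_def add_nonneg_pos)
      then obtain m where m: "norm (s m - H) < e / (2 * K)"
        using LIMSEQ_D[OF conjunct2[OF s], of "e / (2 * K)"] e by auto
      have "(\<lambda>n. inner (x n) (s m)) \<longlonglongrightarrow> inner L (s m)" using s by (auto simp: S_def)
      then obtain N where N: "\<And>n. n \<ge> N \<Longrightarrow> norm (inner (x n) (s m) - inner L (s m)) < e / 2"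
        using e by (metis LIMSEQ_D half_gt_zero)
      have "norm (inner (x n) H - inner L H) < e" if "n \<ge> N" for n
      proof -
        have "\<bar>inner (x n - L) (H - s m)\<bar> \<le> norm (x n - L) * norm (H - s m)" by (rule Cauchy_Schwarz_ineq2)
        also have "\<dots> \<le> K * (e / (2 * K))"
          using m bd[of n] norm_triangle_ineq4[of "x n" L] K
          by (intro mult_mono) (auto simp: K_def norm_minus_commute)
        also have "\<dots> = e / 2" using K by simp
        finally have "\<bar>inner (x n - L) (H - s m)\<bar> \<le> e / 2" .
        moreover have "inner (x n) H - inner L H = inner (x n - L) (H - s m) + (inner (x n) (s m) - inner L (s m))"
          by (simp add: inner_simps)
        ultimately show ?thesis using N[OF that] by (simp add: abs_if split: if_splits)
      qed
      then show "\<exists>no. \<forall>n\<ge>no. norm (inner (x n) H - inner L H) < e" by blast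
    qed
  qed
  ultimately have "H \<in> S"
  proof (rule closed_subspace_eq_UNIV)
    fix w assume w: "\<And>v. v \<in> S \<Longrightarrow> inner w v = 0"
    show "w = 0" by (rule orthogonal_ball_indicators_eq_0, rule w) (simp add: S_def conv)
  qed
  then show ?thesis by (simp add: S_def)
qed

lemma inner_affine_op_indicator:
  assumes f: "square_integrable f" and A: "A \<in> lmeasurable"
  shows "inner (affine_op t 1 (l2_of f)) (l2_of (\<lambda>z. indicator A z *\<^sub>R v)) = (LINT x|lebesgue. indicator A (x - t) * (f x \<bullet> v))"
    and "integrable lebesgue (\<lambda>x. indicator A (x - t) * (f x \<bullet> v))"
proof -
  have sA: "square_integrable (\<lambda>z. indicator A z *\<^sub>R v)" by (rule square_integrable_indicator_const[OF A])
  have sA': "square_integrable (\<lambda>z. indicator A (z - t) *\<^sub>R v)"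
    using square_integrable_affine[OF sA, of 1 "- t"] by simp
  show i: "integrable lebesgue (\<lambda>x. indicator A (x - t) * (f x \<bullet> v))"
    using square_integrable_inner[OF f sA'] by (simp add: mult.commute)
  have "inner (affine_op t 1 (l2_of f)) (l2_of (\<lambda>z. indicator A z *\<^sub>R v)) = (LINT x|lebesgue. indicator A x * (f (x + t) \<bullet> v))"
    using square_integrable_affine[OF f, of 1 t]
    by (simp add: affine_op_l2_of f inner_l2_of sA mult.commute add.commute)
  also have "\<dots> = (LINT x|lebesgue. indicator A (x - t) * (f x \<bullet> v))"
    using integral_translation[OF borel_measurable_integrable[OF i], of t] by simp
  finally show "inner (affine_op t 1 (l2_of f)) (l2_of (\<lambda>z. indicator A z *\<^sub>R v)) = (LINT x|lebesgue. indicator A (x - t) * (f x \<bullet> v))" .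
qed

text \<open>Against the indicator of a ball, the translation can be put on the ball; as it tends to
  0 the indicator converges off the sphere, a null set.\<close>

lemma translation_weakly_continuous:
  fixes U H :: "('a::euclidean_space, 'b::euclidean_space) l2"
  assumes k: "k \<longlonglongrightarrow> 0"
  shows "(\<lambda>n. inner (affine_op (k n) 1 U) H) \<longlonglongrightarrow> inner U H"
proof (rule weakly_convergent_on_ball_indicators[where M="norm U"])
  show "norm (affine_op (k n) 1 U) \<le> norm U" for n by (simp add: norm_translation)
  fix c :: 'a and r :: real and v :: 'b assume "r > 0"
  show "(\<lambda>n. inner (affine_op (k n) 1 U) (l2_of (\<lambda>z. indicator (ball c r) z *\<^sub>R v)))
      \<longlonglongrightarrow> inner U (l2_of (\<lambda>z. indicator (ball c r) z *\<^sub>R v))"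
  proof (cases U rule: l2_cases)
    case (1 f)
    have U0: "U = affine_op 0 1 (l2_of f)" using 1 by (simp add: affine_op_l2_of)
    obtain K where K: "\<And>n. norm (k n) \<le> K" using convergent_imp_Bseq[OF convergentI[OF k]] unfolding Bseq_def by auto
    note I = inner_affine_op_indicator[OF 1(1) lmeasurable_ball[of c r], of _ v]
    have "(\<lambda>n. LINT x|lebesgue. indicator (ball c r) (x - k n) * (f x \<bullet> v))
      \<longlonglongrightarrow> (LINT x|lebesgue. indicator (ball c r) (x - 0) * (f x \<bullet> v))"
    proof (rule Bochner_Integration.integral_dominated_convergence[where w="\<lambda>x. \<bar>indicator (ball c (r + K)) (x - 0) * (f x \<bullet> v)\<bar>"])
      show "integrable lebesgue (\<lambda>x. \<bar>indicator (ball c (r + K)) (x - 0) * (f x \<bullet> v)\<bar>)"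
        by (intro integrable_abs inner_affine_op_indicator(2)[OF 1(1) lmeasurable_ball])
      have "negligible (sphere c r)" by (rule negligible_sphere)
      then have "AE x in lebesgue. x \<notin> sphere c r" unfolding negligible_iff_null_sets by (rule AE_not_in)
      then show "AE x in lebesgue. (\<lambda>n. indicator (ball c r) (x - k n) * (f x \<bullet> v)) \<longlonglongrightarrow> indicator (ball c r) (x - 0) * (f x \<bullet> v)"
      proof eventually_elim
        case (elim x)
        have d: "(\<lambda>n. dist c (x - k n)) \<longlonglongrightarrow> dist c (x - 0)" by (intro tendsto_intros k)
        have "dist c x < r \<or> dist c x > r" using elim by (auto simp: dist_commute)
        then have "\<forall>\<^sub>F n in sequentially. indicator (ball c r) (x - k n) = (indicator (ball c r) (x - 0) :: real)"
        proof
          assume "dist c x < r"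
          then show ?thesis using order_tendstoD(2)[OF d, of r] by (auto elim!: eventually_mono simp: indicator_def)
        next
          assume "dist c x > r"
          then show ?thesis using order_tendstoD(1)[OF d, of r] by (auto elim!: eventually_mono simp: indicator_def)
        qed
        then show ?case by (intro tendsto_mult tendsto_const tendsto_eventually)
      qed
      show "AE x in lebesgue. norm (indicator (ball c r) (x - k n) * (f x \<bullet> v)) \<le> \<bar>indicator (ball c (r + K)) (x - 0) * (f x \<bullet> v)\<bar>" for n
      proof (rule AE_I2)
        fix x
        have "x \<in> ball c (r + K)" if "x - k n \<in> ball c r"
          using that K[of n] norm_triangle_ineq4[of "c - (x - k n)" "k n"] by (simp add: dist_norm algebra_simps)
        then show "norm (indicator (ball c r) (x - k n) * (f x \<bullet> v)) \<le> \<bar>indicator (ball c (r + K)) (x - 0) * (f x \<bullet> v)\<bar>"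
          by (auto simp: indicator_def)
      qed
    qed (use I(2) I(2)[of 0] in \<open>auto intro: borel_measurable_integrable\<close>)
    then show ?thesis unfolding I(1)[symmetric] unfolding U0[symmetric] unfolding 1(2)[symmetric] .
  qed
qed

text \<open>Against the indicator of a ball only the part of \<open>U\<close> in a ball moving off
  to infinity contributes, and its norm tends to 0.\<close>

lemma translation_weakly_null:
  fixes U H :: "('a::euclidean_space, 'b::euclidean_space) l2"
  assumes k: "filterlim (\<lambda>n. norm (k n)) at_top sequentially"
  shows "(\<lambda>n. inner (affine_op (k n) 1 U) H) \<longlonglongrightarrow> 0"
proof -
  have "(\<lambda>n. inner (affine_op (k n) 1 U) H) \<longlonglongrightarrow> inner 0 H"
  proof (rule weakly_convergent_on_ball_indicators[where M="norm U"])
    show "norm (affine_op (k n) 1 U) \<le> norm U" for n by (simp add: norm_translation)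
    fix c :: 'a and r :: real and v :: 'b assume "r > 0"
    show "(\<lambda>n. inner (affine_op (k n) 1 U) (l2_of (\<lambda>z. indicator (ball c r) z *\<^sub>R v)))
        \<longlonglongrightarrow> inner 0 (l2_of (\<lambda>z. indicator (ball c r) z *\<^sub>R v))"
    proof (cases U rule: l2_cases)
      case (1 f)
      note f = 1(1)
      let ?A = "\<lambda>n x. indicator (ball (c + k n) r) x *\<^sub>R f x"
      have sA: "square_integrable (?A n)" for n by (intro square_integrable_indicator f) simp
      have "(\<lambda>n. LINT x|lebesgue. (norm (?A n x))\<^sup>2) \<longlonglongrightarrow> (LINT x::'a|lebesgue. 0)"
      proof (rule Bochner_Integration.integral_dominated_convergence[where w="\<lambda>x. (norm (f x))\<^sup>2"])
        show "AE x in lebesgue. (\<lambda>n. (norm (?A n x))\<^sup>2) \<longlonglongrightarrow> 0"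
        proof (rule AE_I2)
          fix x
          have "\<forall>\<^sub>F n in sequentially. norm (k n) > r + norm (x - c)"
            using k by (simp add: filterlim_at_top_dense)
          then have "\<forall>\<^sub>F n in sequentially. (norm (?A n x))\<^sup>2 = 0"
          proof eventually_elim
            case (elim n)
            then have "x \<notin> ball (c + k n) r"
              using norm_triangle_ineq2[of "k n" "x - c"] by (simp add: dist_norm algebra_simps)
            then show ?case by simp
          qed
          then show "(\<lambda>n. (norm (?A n x))\<^sup>2) \<longlonglongrightarrow> 0" by (rule tendsto_eventually)
        qed
      qed (use f sA in \<open>auto simp: square_integrable_def indicator_def intro: borel_measurable_integrable\<close>)
      then have "(\<lambda>n. (norm (l2_of (?A n)))\<^sup>2) \<longlonglongrightarrow> 0" by (simp add: norm_l2_of[OF sA])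
      from tendsto_real_sqrt[OF this] have n0: "(\<lambda>n. norm (l2_of (?A n))) \<longlonglongrightarrow> 0" by simp
      let ?V = "l2_of (\<lambda>z. indicator (ball c r) z *\<^sub>R v)"
      have le: "\<bar>inner (affine_op (k n) 1 U) ?V\<bar> \<le> norm (l2_of (?A n)) * norm ?V" for n
      proof -
        have sV: "square_integrable (\<lambda>z. indicator (ball c r) z *\<^sub>R v)" by (simp add: square_integrable_indicator_const)
        have "inner (affine_op (k n) 1 U) ?V = inner (affine_op (k n) 1 (l2_of (?A n))) ?V"
          unfolding 1(2) inner_affine_op_indicator(1)[OF f lmeasurable_ball] inner_affine_op_indicator(1)[OF sA lmeasurable_ball]
          by (rule Bochner_Integration.integral_cong) (auto simp: indicator_def dist_norm algebra_simps)
        also have "\<bar>\<dots>\<bar> \<le> norm (affine_op (k n) 1 (l2_of (?A n))) * norm ?V" by (rule Cauchy_Schwarz_ineq2)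
        finally show ?thesis by (simp add: norm_translation)
      qed
      have "(\<lambda>n. norm (l2_of (?A n)) * norm ?V) \<longlonglongrightarrow> 0" using tendsto_mult_left_zero[OF n0] .
      then have "(\<lambda>n. inner (affine_op (k n) 1 U) ?V) \<longlonglongrightarrow> 0"
        by (rule Lim_null_comparison[rotated]) (use le in simp)
      then show ?thesis by simp
    qed
  qed
  then show ?thesis by simp
qed

section \<open>Gradients of test functions are dense among square-integrable gradients\<close>

lemma integrable_lborel_imp_lebesgue:
  fixes f :: "'a::euclidean_space \<Rightarrow> real"
  assumes f: "integrable lborel f" shows "integrable lebesgue f"
  using integrable_completion[OF borel_measurable_integrable[OF f]] f by simp

text \<open>Fubini for u(y + s k) w(y) \<kappa>(k) takes place on the product of two copies of
  \<open>lborel\<close>, where joint measurability comes from Borel measurability of the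
  factors.\<close>

lemma square_integrable_borel_representative:
  fixes f :: "'a::euclidean_space \<Rightarrow> 'b::euclidean_space"
  assumes f: "square_integrable f"
  obtains g where "g \<in> borel_measurable borel" "square_integrable g" "AE x in lebesgue. f x = g x"
proof -
  have "\<exists>h. h \<in> borel_measurable borel \<and> (AE x in lborel. f x \<bullet> b = h x)" for b
  proof -
    have "(\<lambda>x. f x \<bullet> b) \<in> borel_measurable lebesgue" using f by measurable
    from completion_ex_borel_measurable_real[OF this] show ?thesis by auto
  qed
  then obtain h where h: "\<And>b. h b \<in> borel_measurable borel" "\<And>b. AE x in lborel. f x \<bullet> b = h b x" by metis
  define g where "g x = (\<Sum>b\<in>Basis. h b x *\<^sub>R b)" for x
  have gb: "g \<in> borel_measurable borel" unfolding g_def using h(1) by measurable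
  have "AE x in lborel. \<forall>b\<in>Basis. f x \<bullet> b = h b x" by (intro AE_finite_allI h(2)) auto
  then have "AE x in lborel. f x = g x"
  proof eventually_elim
    case (elim x)
    have "f x = (\<Sum>b\<in>Basis. (f x \<bullet> b) *\<^sub>R b)" by (rule euclidean_representation[symmetric])
    also have "\<dots> = g x" unfolding g_def using elim by (intro sum.cong) auto
    finally show ?case .
  qed
  then have ae: "AE x in lebesgue. f x = g x" by (rule AE_completion)
  have gm: "g \<in> borel_measurable lebesgue" using gb by (simp add: measurable_completion)
  have "integrable lebesgue (\<lambda>x. (norm (g x))\<^sup>2) \<longleftrightarrow> integrable lebesgue (\<lambda>x. (norm (f x))\<^sup>2)"
    using ae f gm by (intro integrable_cong_AE) (auto intro!: borel_measurable_power borel_measurable_norm square_integrable_measurable)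
  then have "square_integrable g" using f gm by (simp add: square_integrable_def)
  with gb ae show ?thesis using that by blast
qed

text \<open>For fixed k, Cauchy-Schwarz and translation invariance bound the integral over y by |u|
  |w| |\<kappa>(k)| with L2 norms of u and w, so the double integral converges absolutely. The sign
  s = 1 translates the first field forward, s = -1 serves after the substitution that moves the
  translation to the second field.\<close>

lemma
  fixes u w \<kappa> :: "'a::euclidean_space \<Rightarrow> real"
  assumes [measurable]: "u \<in> borel_measurable borel" "w \<in> borel_measurable borel" "\<kappa> \<in> borel_measurable borel"
    and u: "square_integrable u" and w: "square_integrable w" and \<kappa>: "integrable lebesgue \<kappa>"
  shows swap_correlation_integral:
      "(LINT k|lebesgue. LINT y|lebesgue. u (y + s *\<^sub>R k) * w y * \<kappa> k) = (LINT y|lebesgue. LINT k|lebesgue. u (y + s *\<^sub>R k) * w y * \<kappa> k)"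
    and integrable_correlation_fst: "integrable lebesgue (\<lambda>k. LINT y|lebesgue. u (y + s *\<^sub>R k) * w y * \<kappa> k)"
    and integrable_correlation_snd: "integrable lebesgue (\<lambda>y. LINT k|lebesgue. u (y + s *\<^sub>R k) * w y * \<kappa> k)"
proof -
  let ?f = "\<lambda>k y. u (y + s *\<^sub>R k) * w y * \<kappa> k"
  define A where "A = norm (l2_of (\<lambda>x. \<bar>u x\<bar>)) * norm (l2_of (\<lambda>x. \<bar>w x\<bar>))"
  have su: "square_integrable (\<lambda>x. \<bar>u x\<bar>)" "square_integrable (\<lambda>x. \<bar>w x\<bar>)"
    using u w unfolding square_integrable_def by (auto intro: borel_measurable_abs)
  have inner_le: "(\<integral>\<^sup>+y. ennreal (norm (?f k y)) \<partial>lborel) \<le> ennreal (A * \<bar>\<kappa> k\<bar>)" for k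
  proof -
    let ?U = "\<lambda>y. \<bar>u (y + s *\<^sub>R k)\<bar>"
    have sU: "square_integrable ?U"
      using square_integrable_affine[OF su(1), of 1 "s *\<^sub>R k"] by (simp add: add.commute)
    have i: "integrable lebesgue (\<lambda>y. ?U y * \<bar>w y\<bar>)" by (rule square_integrable_mult_integrable[OF sU su(2)])
    have "(LINT y|lebesgue. ?U y * \<bar>w y\<bar>) = inner (affine_op (s *\<^sub>R k) 1 (l2_of (\<lambda>x. \<bar>u x\<bar>))) (l2_of (\<lambda>x. \<bar>w x\<bar>))"
      using sU by (simp add: affine_op_l2_of su inner_l2_of add.commute)
    also have "\<dots> \<le> A" unfolding A_def using norm_cauchy_schwarz[of "affine_op (s *\<^sub>R k) 1 (l2_of (\<lambda>x. \<bar>u x\<bar>))" "l2_of (\<lambda>x. \<bar>w x\<bar>)"]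
      by (simp add: norm_translation)
    finally have le: "(LINT y|lebesgue. ?U y * \<bar>w y\<bar>) \<le> A" .
    have "(\<integral>\<^sup>+y. ennreal (norm (?f k y)) \<partial>lborel) = (\<integral>\<^sup>+y. ennreal (?U y * \<bar>w y\<bar>) * ennreal \<bar>\<kappa> k\<bar> \<partial>lebesgue)"
      by (simp add: nn_integral_completion abs_mult ennreal_mult)
    also have "\<dots> = (\<integral>\<^sup>+y. ennreal (?U y * \<bar>w y\<bar>) \<partial>lebesgue) * ennreal \<bar>\<kappa> k\<bar>"
      using i by (intro nn_integral_multc) auto
    also have "(\<integral>\<^sup>+y. ennreal (?U y * \<bar>w y\<bar>) \<partial>lebesgue) = ennreal (LINT y|lebesgue. ?U y * \<bar>w y\<bar>)"
      by (rule nn_integral_eq_integral[OF i]) simp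
    also have "\<dots> * ennreal \<bar>\<kappa> k\<bar> \<le> ennreal A * ennreal \<bar>\<kappa> k\<bar>"
      by (intro mult_right_mono ennreal_leI le) simp
    also have "\<dots> = ennreal (A * \<bar>\<kappa> k\<bar>)" by (simp add: A_def ennreal_mult)
    finally show ?thesis .
  qed
  have int: "integrable (lborel \<Otimes>\<^sub>M lborel) (case_prod ?f)"
  proof (rule integrableI_bounded)
    show m: "case_prod ?f \<in> borel_measurable (lborel \<Otimes>\<^sub>M lborel)" by measurable
    have "(\<integral>\<^sup>+p. ennreal (norm (case_prod ?f p)) \<partial>(lborel \<Otimes>\<^sub>M lborel)) = (\<integral>\<^sup>+k. \<integral>\<^sup>+y. ennreal (norm (?f k y)) \<partial>lborel \<partial>lborel)"
      using lborel.nn_integral_fst[OF measurable_compose[OF measurable_compose[OF m borel_measurable_norm] measurable_ennreal]] by simp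
    also have "\<dots> \<le> (\<integral>\<^sup>+k. ennreal (A * \<bar>\<kappa> k\<bar>) \<partial>lborel)" by (intro nn_integral_mono inner_le)
    also have "\<dots> = (\<integral>\<^sup>+k. ennreal (A * \<bar>\<kappa> k\<bar>) \<partial>lebesgue)" by (simp add: nn_integral_completion)
    also have "\<dots> = ennreal (LINT k|lebesgue. A * \<bar>\<kappa> k\<bar>)"
      by (rule nn_integral_eq_integral) (auto simp: A_def intro!: integrable_mult_right integrable_abs \<kappa>)
    also have "\<dots> < \<infinity>" by simp
    finally show "(\<integral>\<^sup>+p. ennreal (norm (case_prod ?f p)) \<partial>(lborel \<Otimes>\<^sub>M lborel)) < \<infinity>" .
  qed
  have c1: "(LINT y|lebesgue. ?f k y) = (LINT y|lborel. ?f k y)" for k by (rule integral_completion) measurable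
  have c2: "(LINT k|lebesgue. ?f k y) = (LINT k|lborel. ?f k y)" for y by (rule integral_completion) measurable
  have i1: "integrable lborel (\<lambda>k. LINT y|lborel. ?f k y)" by (rule lborel_pair.integrable_fst[OF int])
  have i2: "integrable lborel (\<lambda>y. LINT k|lborel. ?f k y)" by (rule lborel_pair.integrable_snd[OF int])
  show "integrable lebesgue (\<lambda>k. LINT y|lebesgue. ?f k y)" "integrable lebesgue (\<lambda>y. LINT k|lebesgue. ?f k y)"
    unfolding c1 c2 using i1 i2 by (auto intro: integrable_lborel_imp_lebesgue)
  show "(LINT k|lebesgue. LINT y|lebesgue. ?f k y) = (LINT y|lebesgue. LINT k|lebesgue. ?f k y)"
    unfolding c1 c2 integral_completion[OF borel_measurable_integrable[OF i1]] integral_completion[OF borel_measurable_integrable[OF i2]]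
    by (rule lborel_pair.Fubini_integral[OF int, symmetric])
qed

text \<open>The shift by h is cut into N = n + 1 equal steps. In each step the difference quotient
  may be replaced by its error against the derivative, since the derivative integrates to 0 against
  C. A step then costs M/N times the L1 norm of that error, so the total is at most M times this
  norm, which tends to 0.\<close>

lemma correlation_translation_invariant:
  fixes C :: "real^'n \<Rightarrow> real"
  assumes C_meas: "C \<in> borel_measurable lebesgue" and C_bd: "\<And>k. \<bar>C k\<bar> \<le> M"
    and \<sigma>: "test_fun U \<sigma>" and zero: "\<And>t. (LINT k|lebesgue. C k * (grad \<sigma> (k + t) \<bullet> h)) = 0"
  shows "(LINT k|lebesgue. C k * \<sigma> (k + h)) = (LINT k|lebesgue. C k * \<sigma> k)"
proof -
  have M: "0 \<le> M" using C_bd[of 0] by linarith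
  have iC: "integrable lebesgue (\<lambda>k. C k * f (k + t))" if "integrable lebesgue f" for f :: "real^'n \<Rightarrow> real" and t
  proof (rule Bochner_Integration.integrable_bound)
    have ft: "integrable lebesgue (\<lambda>k. f (k + t))"
      using integrable_lebesgue_affine[OF borel_measurable_integrable[OF that], of 1 t] that by (simp add: add.commute)
    then show "integrable lebesgue (\<lambda>k. M * f (k + t))" by simp
    show "(\<lambda>k. C k * f (k + t)) \<in> borel_measurable lebesgue"
      using C_meas borel_measurable_integrable[OF ft] by (rule borel_measurable_times)
    show "AE k in lebesgue. norm (C k * f (k + t)) \<le> norm (M * f (k + t))"
      using C_bd M by (intro AE_I2) (auto simp: abs_mult intro!: mult_right_mono)
  qed
  let ?D = "\<lambda>n k. diff_quot \<sigma> h n k - grad \<sigma> k \<bullet> h"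
  have iq: "integrable lebesgue (diff_quot \<sigma> h n)" for n
    using integral_diff_quot_tendsto(2)[OF \<sigma>, of "\<lambda>x. 1" h n]
    by (simp add: integrable_real_indicator fmeasurableD2[OF lmeasurable_ball] top.not_eq_extremum[symmetric] del: emeasure_completion)
  have ig: "integrable lebesgue (\<lambda>k. grad \<sigma> k \<bullet> h)" by (intro integrable_inner_left test_fun_grad_integrable[OF \<sigma>])
  have iD: "integrable lebesgue (?D n)" for n by (intro Bochner_Integration.integrable_diff iq ig)
  obtain B R where B: "B > 0" "\<And>n x. \<bar>diff_quot \<sigma> h n x\<bar> \<le> B * indicator (ball 0 R) x"
    "\<And>n. continuous_on UNIV (diff_quot \<sigma> h n)"
    using \<sigma> by (rule diff_quot_bound[of _ _ h]) blast
  have L1: "(\<lambda>n. LINT k|lebesgue. \<bar>?D n k\<bar>) \<longlonglongrightarrow> (LINT k::real^'n|lebesgue. 0)"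
  proof (rule Bochner_Integration.integral_dominated_convergence[where w="\<lambda>x. B * indicator (ball 0 R) x + \<bar>grad \<sigma> x \<bullet> h\<bar>"])
    show "integrable lebesgue (\<lambda>x. B * indicator (ball 0 R) x + \<bar>grad \<sigma> x \<bullet> h\<bar>)"
      by (intro Bochner_Integration.integrable_add integrable_mult_right integrable_real_indicator integrable_abs ig)
         (simp_all add: fmeasurableD2[OF lmeasurable_ball] top.not_eq_extremum[symmetric] del: emeasure_completion)
    show "AE x in lebesgue. (\<lambda>n. \<bar>?D n x\<bar>) \<longlonglongrightarrow> 0"
      by (intro AE_I2 tendsto_rabs_zero LIM_zero diff_quot_tendsto test_fun_smooth[OF \<sigma>])
    show "AE x in lebesgue. norm \<bar>?D n x\<bar> \<le> B * indicator (ball 0 R) x + \<bar>grad \<sigma> x \<bullet> h\<bar>" for n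
    proof (rule AE_I2)
      fix x show "norm \<bar>?D n x\<bar> \<le> B * indicator (ball 0 R) x + \<bar>grad \<sigma> x \<bullet> h\<bar>"
        using B(2)[of n x] abs_triangle_ineq4[of "diff_quot \<sigma> h n x" "grad \<sigma> x \<bullet> h"] by simp
    qed
  qed (use iD in \<open>auto intro: borel_measurable_integrable\<close>)
  have le: "\<bar>(LINT k|lebesgue. C k * \<sigma> (k + h)) - (LINT k|lebesgue. C k * \<sigma> k)\<bar> \<le> M * (LINT k|lebesgue. \<bar>?D n k\<bar>)" for n
  proof -
    let ?N = "real (Suc n)"
    define a where "a m = (LINT k|lebesgue. C k * \<sigma> (k + (real m / ?N) *\<^sub>R h))" for m :: nat
    have step: "\<bar>a (Suc m) - a m\<bar> \<le> (1 / ?N) * (M * (LINT k|lebesgue. \<bar>?D n k\<bar>))" for m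
    proof -
      let ?t = "(real m / ?N) *\<^sub>R h"
      have sh: "k + (real (Suc m) / ?N) *\<^sub>R h = (k + ?t) + (1 / ?N) *\<^sub>R h" for k
        by (simp add: add_divide_distrib scaleR_add_left algebra_simps)
      have i1: "integrable lebesgue (\<lambda>k. C k * \<sigma> (k + s))" for s by (intro iC test_fun_integrable[OF \<sigma>])
      have "a (Suc m) - a m = (LINT k|lebesgue. C k * \<sigma> (k + (real (Suc m) / ?N) *\<^sub>R h) - C k * \<sigma> (k + ?t))"
        unfolding a_def by (rule Bochner_Integration.integral_diff[OF i1 i1, symmetric])
      also have "\<dots> = (LINT k|lebesgue. (1 / ?N) * (C k * diff_quot \<sigma> h n (k + ?t)))"
        unfolding sh by (rule Bochner_Integration.integral_cong) (auto simp: diff_quot_def algebra_simps simp del: of_nat_Suc)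
      also have "\<dots> = (1 / ?N) * (LINT k|lebesgue. C k * diff_quot \<sigma> h n (k + ?t))" by simp
      \<comment> \<open>The translated hypothesis \<open>zero\<close> is what permits subtracting
        the derivative here, for every intermediate shift \<open>?t\<close>.\<close>
      also have "(LINT k|lebesgue. C k * diff_quot \<sigma> h n (k + ?t)) = (LINT k|lebesgue. C k * ?D n (k + ?t))"
        using Bochner_Integration.integral_diff[OF iC[OF iq[of n], of ?t] iC[OF ig, of ?t]] zero[of ?t]
        by (simp add: right_diff_distrib)
      finally have eq: "a (Suc m) - a m = (1 / ?N) * (LINT k|lebesgue. C k * ?D n (k + ?t))" .
      have "\<bar>LINT k|lebesgue. C k * ?D n (k + ?t)\<bar> \<le> (LINT k|lebesgue. M * \<bar>?D n (k + ?t)\<bar>)"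
      proof (rule order_trans[OF integral_abs_bound integral_mono])
        show "integrable lebesgue (\<lambda>k. \<bar>C k * ?D n (k + ?t)\<bar>)" by (intro integrable_abs iC iD)
        show "integrable lebesgue (\<lambda>k. M * \<bar>?D n (k + ?t)\<bar>)"
          using integrable_lebesgue_affine[OF borel_measurable_integrable[OF iD[of n]], of 1 ?t] iD[of n]
          by (intro integrable_mult_right integrable_abs) (simp add: add.commute)
        show "\<bar>C k * ?D n (k + ?t)\<bar> \<le> M * \<bar>?D n (k + ?t)\<bar>" for k
          unfolding abs_mult by (intro mult_right_mono C_bd) simp
      qed
      also have "\<dots> = M * (LINT k|lebesgue. \<bar>?D n (k + ?t)\<bar>)" by simp
      also have "(LINT k|lebesgue. \<bar>?D n (k + ?t)\<bar>) = (LINT k|lebesgue. \<bar>?D n k\<bar>)"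
        by (rule integral_translation[OF borel_measurable_integrable[OF integrable_abs[OF iD]]])
      finally show ?thesis unfolding eq by (simp add: abs_mult divide_right_mono)
    qed
    have "\<bar>a m - a 0\<bar> \<le> real m * ((1 / ?N) * (M * (LINT k|lebesgue. \<bar>?D n k\<bar>)))" for m
    proof (induction m)
      case (Suc m)
      have "\<bar>a (Suc m) - a 0\<bar> \<le> \<bar>a (Suc m) - a m\<bar> + \<bar>a m - a 0\<bar>" by linarith
      also have "\<dots> \<le> (1 / ?N) * (M * (LINT k|lebesgue. \<bar>?D n k\<bar>)) + real m * ((1 / ?N) * (M * (LINT k|lebesgue. \<bar>?D n k\<bar>)))"
        by (intro add_mono step Suc)
      finally show ?case unfolding of_nat_Suc[of m] distrib_right by simp
    qed simp
    from this[of "Suc n"] show ?thesis by (simp add: a_def)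
  qed
  have "(\<lambda>n. M * (LINT k|lebesgue. \<bar>?D n k\<bar>)) \<longlonglongrightarrow> M * 0" using L1 by (intro tendsto_mult tendsto_const) simp
  then have "\<bar>(LINT k|lebesgue. C k * \<sigma> (k + h)) - (LINT k|lebesgue. C k * \<sigma> k)\<bar> \<le> M * 0"
    by (rule LIMSEQ_le_const) (use le in blast)
  then show ?thesis by simp
qed

lemma borel_measurable_nth:
  "f \<in> borel_measurable M \<Longrightarrow> (\<lambda>x. f x $ i) \<in> borel_measurable M" for f :: "_ \<Rightarrow> real^'n"
  by (rule measurable_compose[OF _ borel_measurable_continuous_onI[OF linear_continuous_on[OF bounded_linear_vec_nth]]])

lemma square_integrable_nth:
  "square_integrable f \<Longrightarrow> square_integrable (\<lambda>x. f x $ i)" for f :: "_ \<Rightarrow> real^'n"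
  by (rule square_integrable_bound_norm[of f _ 1])
     (simp_all add: borel_measurable_nth square_integrable_measurable component_le_norm_cart)

lemma test_fun_translate: "test_fun UNIV \<phi> \<Longrightarrow> test_fun UNIV (\<lambda>x. \<phi> (x + t))"
  using test_fun_affine[of UNIV \<phi> 1 t UNIV 1] by (simp add: add.commute)

lemma grad_translate: "smooth_fun \<phi> \<Longrightarrow> grad (\<lambda>x. \<phi> (x + t)) x = grad \<phi> (x + t)"
  using grad_affine[of \<phi> 1 t 1 x] by (simp add: add.commute)

text \<open>For curl-free \<open>g\<close> and divergence-free \<open>h\<close>, the correlation \<open>C(k) = \<integral> g(y + k) \<cdot> h(y) dy\<close> has
  vanishing weak gradient: the derivative \<open>\<partial>\<^sub>i\<close> is first turned into \<open>\<partial>\<^sub>j\<close> on the factor \<open>g\<close>, exchanging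
  \<open>g\<^sub>j\<close> for \<open>g\<^sub>i\<close>, and then thrown onto \<open>h\<close>, where the sum over \<open>j\<close> is a divergence.\<close>

lemma correlation_weak_gradient_0:
  fixes g h :: "real^'n \<Rightarrow> real^'n"
  assumes gb: "g \<in> borel_measurable borel" and hb: "h \<in> borel_measurable borel"
    and sg: "square_integrable g" and sh: "square_integrable h"
    and curl: "\<And>y i j. (LINT x|lebesgue. g x $ j * grad \<sigma> (x - y) $ i) = (LINT x|lebesgue. g x $ i * grad \<sigma> (x - y) $ j)"
    and div: "\<And>\<psi>. test_fun UNIV \<psi> \<Longrightarrow> (LINT x|lebesgue. h x \<bullet> grad \<psi> x) = 0"
    and \<sigma>: "test_fun UNIV \<sigma>"
  shows "(LINT k|lebesgue. inner (affine_op k 1 (l2_of g)) (l2_of h) * grad \<sigma> k $ i) = 0"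
proof -
  have gi: "(\<lambda>x. g x $ i) \<in> borel_measurable borel" "(\<lambda>x. h x $ i) \<in> borel_measurable borel" for i
    using gb hb by (auto intro: borel_measurable_nth)
  note s = square_integrable_nth[OF sg] square_integrable_nth[OF sh]
  let ?\<kappa> = "\<lambda>i k. grad \<sigma> k $ i"
  have \<kappa>: "test_fun UNIV (?\<kappa> i)" for i by (rule test_fun_grad_nth[OF \<sigma>])
  have \<kappa>b: "?\<kappa> i \<in> borel_measurable borel" for i
    by (rule borel_measurable_continuous_onI[OF smooth_fun_continuous[OF test_fun_smooth[OF \<kappa>]]])
  have \<kappa>i: "integrable lebesgue (?\<kappa> i)" for i by (rule test_fun_integrable[OF \<kappa>])
  have SW: "(LINT k|lebesgue. LINT y|lebesgue. g (y + k) $ j * h y $ l * ?\<kappa> m k)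
      = (LINT y|lebesgue. LINT k|lebesgue. g (y + k) $ j * h y $ l * ?\<kappa> m k)"
    and SWi: "integrable lebesgue (\<lambda>k. LINT y|lebesgue. g (y + k) $ j * h y $ l * ?\<kappa> m k)" for j l m
    using swap_correlation_integral[where s=1, OF gi(1)[of j] gi(2)[of l] \<kappa>b[of m] s(1) s(2) \<kappa>i]
      integrable_correlation_fst[where s=1, OF gi(1)[of j] gi(2)[of l] \<kappa>b[of m] s(1) s(2) \<kappa>i]
    by (simp_all only: scaleR_one)
  have SW': "(LINT k|lebesgue. LINT y|lebesgue. h (y - k) $ j * g y $ l * ?\<kappa> m k)
      = (LINT y|lebesgue. LINT k|lebesgue. h (y - k) $ j * g y $ l * ?\<kappa> m k)"
    and SWi': "integrable lebesgue (\<lambda>y. LINT k|lebesgue. h (y - k) $ j * g y $ l * ?\<kappa> m k)" for j l m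
    using swap_correlation_integral[where s="-1", OF gi(2)[of j] gi(1)[of l] \<kappa>b[of m] s(2) s(1) \<kappa>i]
      integrable_correlation_snd[where s="-1", OF gi(2)[of j] gi(1)[of l] \<kappa>b[of m] s(2) s(1) \<kappa>i]
    by (simp_all only: scaleR_minus1_left add_uminus_conv_diff)
  have shift: "square_integrable (\<lambda>y. g (y + k) $ j)" for k j
    using square_integrable_affine[OF s(1)[of j], of 1 k] by (simp add: add.commute)
  have "inner (affine_op k 1 (l2_of g)) (l2_of h) = (\<Sum>j\<in>UNIV. LINT y|lebesgue. g (y + k) $ j * h y $ j)" for k
  proof -
    have sgk: "square_integrable (\<lambda>y. g (y + k))" using square_integrable_affine[OF sg, of 1 k] by (simp add: add.commute)
    have "inner (affine_op k 1 (l2_of g)) (l2_of h) = (LINT y|lebesgue. g (y + k) \<bullet> h y)"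
      using sgk by (simp add: affine_op_l2_of sg inner_l2_of sh add.commute)
    also have "\<dots> = (LINT y|lebesgue. (\<Sum>j\<in>UNIV. g (y + k) $ j * h y $ j))" by (simp add: inner_vec_def)
    also have "\<dots> = (\<Sum>j\<in>UNIV. LINT y|lebesgue. g (y + k) $ j * h y $ j)"
      by (rule Bochner_Integration.integral_sum) (intro square_integrable_mult_integrable shift s)
    finally show ?thesis .
  qed
  then have "(LINT k|lebesgue. inner (affine_op k 1 (l2_of g)) (l2_of h) * ?\<kappa> i k)
      = (LINT k|lebesgue. (\<Sum>j\<in>UNIV. LINT y|lebesgue. g (y + k) $ j * h y $ j * ?\<kappa> i k))"
    by (simp add: sum_distrib_right)
  also have "\<dots> = (\<Sum>j\<in>UNIV. LINT k|lebesgue. LINT y|lebesgue. g (y + k) $ j * h y $ j * ?\<kappa> i k)"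
    using SWi by (intro Bochner_Integration.integral_sum)
  also have "\<dots> = (\<Sum>j\<in>UNIV. LINT x|lebesgue. LINT k|lebesgue. h (x - k) $ j * g x $ i * ?\<kappa> j k)"
  proof (rule sum.cong[OF refl])
    fix j
    have cu: "(LINT k|lebesgue. g (y + k) $ j * ?\<kappa> i k) = (LINT k|lebesgue. g (y + k) $ i * ?\<kappa> j k)" for y
    proof -
      have tr: "(LINT k|lebesgue. g (y + k) $ j * ?\<kappa> i k) = (LINT x|lebesgue. g x $ j * ?\<kappa> i (x - y))" for i j
      proof -
        have sk: "square_integrable (\<lambda>x. ?\<kappa> i (x - y))"
          using square_integrable_affine[OF test_fun_square_integrable[OF \<kappa>[of i]], of 1 "- y"] by simp
        have "(LINT k|lebesgue. g (k + y) $ j * ?\<kappa> i ((k + y) - y)) = (LINT x|lebesgue. g x $ j * ?\<kappa> i (x - y))"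
          by (rule integral_translation[OF borel_measurable_integrable[OF square_integrable_mult_integrable[OF s(1) sk]]])
        then show ?thesis by (simp add: add.commute)
      qed
      show ?thesis unfolding tr by (rule curl)
    qed
    have "(LINT k|lebesgue. LINT y|lebesgue. g (y + k) $ j * h y $ j * ?\<kappa> i k)
        = (LINT y|lebesgue. LINT k|lebesgue. g (y + k) $ j * h y $ j * ?\<kappa> i k)" by (rule SW)
    also have "\<dots> = (LINT y|lebesgue. h y $ j * (LINT k|lebesgue. g (y + k) $ j * ?\<kappa> i k))"
      by (simp flip: integral_mult_right_zero add: mult.commute mult.left_commute)
    also have "\<dots> = (LINT y|lebesgue. LINT k|lebesgue. g (y + k) $ i * h y $ j * ?\<kappa> j k)"
      unfolding cu by (simp flip: integral_mult_right_zero add: mult.commute mult.left_commute)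
    also have "\<dots> = (LINT k|lebesgue. LINT y|lebesgue. g (y + k) $ i * h y $ j * ?\<kappa> j k)" by (rule SW[symmetric])
    also have "\<dots> = (LINT k|lebesgue. LINT x|lebesgue. h (x - k) $ j * g x $ i * ?\<kappa> j k)"
    proof (rule Bochner_Integration.integral_cong[OF refl])
      fix k
      have "square_integrable (\<lambda>x. h (x - k) $ j)" using square_integrable_affine[OF s(2)[of j], of 1 "- k"] by simp
      then have "integrable lebesgue (\<lambda>x. h (x - k) $ j * g x $ i * ?\<kappa> j k)"
        by (intro integrable_mult_left square_integrable_mult_integrable s)
      from integral_translation[OF borel_measurable_integrable[OF this], of k]
      show "(LINT y|lebesgue. g (y + k) $ i * h y $ j * ?\<kappa> j k) = (LINT x|lebesgue. h (x - k) $ j * g x $ i * ?\<kappa> j k)"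
        by (simp add: mult.commute mult.left_commute)
    qed
    also have "\<dots> = (LINT x|lebesgue. LINT k|lebesgue. h (x - k) $ j * g x $ i * ?\<kappa> j k)" by (rule SW')
    finally show "(LINT k|lebesgue. LINT y|lebesgue. g (y + k) $ j * h y $ j * ?\<kappa> i k)
      = (LINT x|lebesgue. LINT k|lebesgue. h (x - k) $ j * g x $ i * ?\<kappa> j k)" .
  qed
  also have "\<dots> = (LINT x|lebesgue. (\<Sum>j\<in>UNIV. LINT k|lebesgue. h (x - k) $ j * g x $ i * ?\<kappa> j k))"
    using SWi' by (intro Bochner_Integration.integral_sum[symmetric])
  also have "\<dots> = (LINT x::real^'n|lebesgue. 0)"
  proof (rule Bochner_Integration.integral_cong[OF refl])
    fix x
    \<comment> \<open>For fixed x the derivatives of \<sigma> at x - y are, up to sign, those of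
      this reflected function of y; the divergence condition is applied to it once for every
      x.\<close>
    let ?\<psi> = "\<lambda>y. 1 * \<sigma> (x + (-1) *\<^sub>R y)"
    have \<psi>: "test_fun UNIV ?\<psi>" by (rule test_fun_affine[OF \<sigma>]) auto
    have g\<psi>: "grad ?\<psi> y = - grad \<sigma> (x - y)" for y using grad_affine[OF test_fun_smooth[OF \<sigma>], of 1 x "-1" y] by simp
    have sk: "square_integrable (\<lambda>y. ?\<kappa> j (x - y))" for j
      using square_integrable_affine[OF test_fun_square_integrable[OF \<kappa>[of j]], of "-1" x] by simp
    have i: "integrable lebesgue (\<lambda>y. h y $ j * ?\<kappa> j (x - y))" for j by (intro square_integrable_mult_integrable s sk)
    have refl_int: "(LINT k|lebesgue. h (x - k) $ j * ?\<kappa> j k) = (LINT y|lebesgue. h y $ j * ?\<kappa> j (x - y))" for j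
      using integral_lebesgue_affine[OF borel_measurable_integrable[OF i[of j]], of "-1" x] by simp
    have "(\<Sum>j\<in>UNIV. LINT k|lebesgue. h (x - k) $ j * g x $ i * ?\<kappa> j k)
        = g x $ i * (\<Sum>j\<in>UNIV. LINT k|lebesgue. h (x - k) $ j * ?\<kappa> j k)"
      by (simp add: sum_distrib_left mult.commute mult.left_commute flip: integral_mult_right_zero)
    also have "(\<Sum>j\<in>UNIV. LINT k|lebesgue. h (x - k) $ j * ?\<kappa> j k) = (LINT y|lebesgue. (\<Sum>j\<in>UNIV. h y $ j * ?\<kappa> j (x - y)))"
      unfolding refl_int by (rule Bochner_Integration.integral_sum[symmetric]) (rule i)
    also have "\<dots> = (LINT y|lebesgue. - (h y \<bullet> grad ?\<psi> y))" unfolding g\<psi> by (simp add: inner_vec_def sum_negf)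
    also have "\<dots> = 0" using div[OF \<psi>] by simp
    finally show "(\<Sum>j\<in>UNIV. LINT k|lebesgue. h (x - k) $ j * g x $ i * ?\<kappa> j k) = 0" by simp
  qed
  finally show ?thesis by simp
qed

text \<open>By \<open>weak_gradient_in_grad_space\<close> and \<open>Hdot_of_grad_space\<close>
  these are exactly the classes of gradients of \<open>Hdot\<close> functions: a closed subspace
  that represents the homogeneous Sobolev space modulo constants.\<close>

definition grad_space :: "((real^'n, real^'n) l2) set" where
  "grad_space = closure {l2_of (grad \<phi>) |\<phi>. test_fun UNIV \<phi>}"

lemma closed_grad_space: "closed grad_space" by (simp add: grad_space_def)

lemma grad_test_fun_in_grad_space: "test_fun UNIV \<phi> \<Longrightarrow> l2_of (grad \<phi>) \<in> grad_space"
  unfolding grad_space_def by (rule subsetD[OF closure_subset]) blast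

lemma subspace_closure: "subspace S \<Longrightarrow> subspace (closure S)" for S :: "'a::real_normed_vector set"
  unfolding subspace_def
proof (intro conjI ballI allI)
  assume S: "0 \<in> S \<and> (\<forall>x\<in>S. \<forall>y\<in>S. x + y \<in> S) \<and> (\<forall>c. \<forall>x\<in>S. c *\<^sub>R x \<in> S)"
  then show "0 \<in> closure S" using closure_subset by blast
  show "x + y \<in> closure S" if "x \<in> closure S" "y \<in> closure S" for x y
  proof -
    obtain f g where "\<forall>n. f n \<in> S" "f \<longlonglongrightarrow> x" "\<forall>n. g n \<in> S" "g \<longlonglongrightarrow> y"
      using \<open>x \<in> closure S\<close> \<open>y \<in> closure S\<close> unfolding closure_sequential by metis
    then show ?thesis unfolding closure_sequential
      using S by (intro exI[of _ "\<lambda>n. f n + g n"]) (auto intro: tendsto_add)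
  qed
  show "c *\<^sub>R x \<in> closure S" if "x \<in> closure S" for c x
  proof -
    obtain f where "\<forall>n. f n \<in> S" "f \<longlonglongrightarrow> x" using \<open>x \<in> closure S\<close> unfolding closure_sequential by metis
    then show ?thesis unfolding closure_sequential
      using S by (intro exI[of _ "\<lambda>n. c *\<^sub>R f n"]) (auto intro: tendsto_scaleR)
  qed
qed

lemma test_fun_scale: "test_fun U \<phi> \<Longrightarrow> test_fun U (\<lambda>x. c * \<phi> x)"
  using test_fun_affine[of U \<phi> 1 0 U c] by simp

lemma grad_scale: "smooth_fun \<phi> \<Longrightarrow> grad (\<lambda>x. c * \<phi> x) x = c *\<^sub>R grad \<phi> x"
  using grad_affine[of \<phi> c 0 1 x] by simp

lemma test_fun_zero: "test_fun U (\<lambda>x. 0)"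
proof (rule test_funI[of _ "{}"])
  show "smooth_fun (\<lambda>x::real^'a. 0)"
    by (rule smooth_fun_coinduct_derivative[of "\<lambda>f. f = (\<lambda>x. 0)"]) (auto intro!: exI[of _ "\<lambda>x h. 0"])
qed auto

lemma grad_zero: "grad (\<lambda>x. 0) x = 0" by (rule grad_eqI) simp

lemma subspace_grad_space: "subspace (grad_space :: ((real^'n, real^'n) l2) set)"
  unfolding grad_space_def
proof (rule subspace_closure, unfold subspace_def, intro conjI ballI allI)
  let ?S = "{l2_of (grad \<phi>) |\<phi> :: real^'n \<Rightarrow> real. test_fun UNIV \<phi>}"
  have "grad (\<lambda>x::real^'n. 0) = (\<lambda>x. 0)" by (rule ext) (rule grad_zero)
  then have "0 = l2_of (grad (\<lambda>x::real^'n. 0))" by (simp only: l2_of_zero)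
  then show "0 \<in> ?S" by (intro CollectI exI[of _ "\<lambda>x. 0"] conjI test_fun_zero)
  show "x + y \<in> ?S" if xy: "x \<in> ?S" "y \<in> ?S" for x y :: "(real^'n, real^'n) l2"
  proof -
    obtain \<phi> \<psi> where *: "test_fun UNIV \<phi>" "x = l2_of (grad \<phi>)" "test_fun UNIV \<psi>" "y = l2_of (grad \<psi>)" using xy by blast
    have "grad (\<lambda>x. \<phi> x + \<psi> x) = (\<lambda>x. grad \<phi> x + grad \<psi> x)"
      using grad_add[OF test_fun_smooth[OF *(1)] test_fun_smooth[OF *(3)]] by blast
    then have "x + y = l2_of (grad (\<lambda>x. \<phi> x + \<psi> x))" using * by (simp add: l2_of_add test_fun_grad_square_integrable)
    with test_fun_add[OF *(1,3)] show ?thesis by blast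
  qed
  show "c *\<^sub>R x \<in> ?S" if xS: "x \<in> ?S" for c and x :: "(real^'n, real^'n) l2"
  proof -
    obtain \<phi> where *: "test_fun UNIV \<phi>" "x = l2_of (grad \<phi>)" using xS by blast
    have "grad (\<lambda>x. c * \<phi> x) = (\<lambda>x. c *\<^sub>R grad \<phi> x)" using grad_scale[OF test_fun_smooth[OF *(1)]] by blast
    then have "c *\<^sub>R x = l2_of (grad (\<lambda>x. c * \<phi> x))" using * by (simp add: l2_of_scaleR test_fun_grad_square_integrable)
    with test_fun_scale[OF *(1)] show ?thesis by blast
  qed
qed

lemma AE_eq_integral_mult:
  fixes f g \<phi> :: "'a::euclidean_space \<Rightarrow> real"
  assumes "AE x in lebesgue. f x = g x" "f \<in> borel_measurable lebesgue" "g \<in> borel_measurable lebesgue" "\<phi> \<in> borel_measurable lebesgue"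
  shows "(LINT x|lebesgue. f x * \<phi> x) = (LINT x|lebesgue. g x * \<phi> x)"
  using assms by (intro integral_cong_AE) auto

text \<open>Let H be the component of g orthogonal to \<open>grad_space\<close>; it is weakly
  divergence-free. The correlation C(k) of the translated g with H is bounded, continuous and
  vanishes at infinity, and its averages against a bump do not change under translation. So these
  averages are 0, hence C(0) = 0, which says that g is orthogonal to H and forces H = 0.\<close>

theorem weak_gradient_in_grad_space:
  fixes g :: "real^'n \<Rightarrow> real^'n"
  assumes wg: "weak_grad UNIV v g" and sg: "square_integrable g"
  shows "l2_of g \<in> grad_space"
proof -
  obtain p where p: "p \<in> grad_space" "\<And>u. u \<in> grad_space \<Longrightarrow> inner (l2_of g - p) u = 0"
    using orthogonal_projection_exists[OF subspace_grad_space closed_grad_space] by blast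
  define H where "H = l2_of g - p"
  obtain g' where g': "g' \<in> borel_measurable borel" "square_integrable g'" "AE x in lebesgue. g x = g' x"
    using square_integrable_borel_representative[OF sg] by blast
  have gg': "l2_of g = l2_of g'" using l2_of_eq_iff[OF sg g'(2)] g'(3) by simp
  obtain h where h: "h \<in> borel_measurable borel" "square_integrable h" "AE x in lebesgue. fun_of H x = h x"
    using square_integrable_borel_representative[OF fun_of(1)[of H]] by blast
  have H: "H = l2_of h" using l2_of_eq_iff[OF fun_of(1) h(2)] h(3) fun_of(2) by metis
  have div: "(LINT x|lebesgue. h x \<bullet> grad \<psi> x) = 0" if "test_fun UNIV \<psi>" for \<psi>
    using p(2)[OF grad_test_fun_in_grad_space[OF that]]
    unfolding H_def[symmetric] H inner_l2_of[OF h(2) test_fun_grad_square_integrable[OF that]] .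
  define C where "C k = inner (affine_op k 1 (l2_of g')) (l2_of h)" for k
  define M where "M = norm (l2_of g') * norm (l2_of h)"
  have C_bd: "\<bar>C k\<bar> \<le> M" for k
    unfolding C_def M_def using Cauchy_Schwarz_ineq2[of "affine_op k 1 (l2_of g')" "l2_of h"] by (simp add: norm_translation)
  have C_cont: "(\<lambda>n. C (x + k n)) \<longlonglongrightarrow> C x" if "k \<longlonglongrightarrow> 0" for k x
  proof -
    have "affine_op (x + t) 1 (l2_of g') = affine_op t 1 (affine_op x 1 (l2_of g'))" for t
      using square_integrable_affine[OF g'(2), of 1 x] by (simp add: affine_op_l2_of g' add.assoc)
    then show ?thesis unfolding C_def using translation_weakly_continuous[OF that] by simp
  qed
  have "continuous_on UNIV C"
    unfolding continuous_on_sequentially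
  proof (intro allI ballI impI)
    fix k and x :: "real^'n" assume *: "(\<forall>n. k n \<in> UNIV) \<and> k \<longlonglongrightarrow> x"
    then have "(\<lambda>n. k n - x) \<longlonglongrightarrow> 0" by (simp add: LIM_zero)
    from C_cont[OF this, of x] show "(C \<circ> k) \<longlonglongrightarrow> C x" by (simp add: o_def)
  qed
  then have C_meas: "C \<in> borel_measurable lebesgue" by (rule borel_measurable_lebesgue_continuous)
  let ?e = "axis (SOME i. True) 1 :: real^'n"
  \<comment> \<open>Bumps of every width 1/c are treated, so that they can afterwards be
    concentrated at 0.\<close>
  have zero: "(LINT k|lebesgue. C k * bump (c *\<^sub>R k)) = 0" if c: "c > 0" for c
  proof -
    define \<sigma> where "\<sigma> k = 1 * bump (0 + c *\<^sub>R k)" for k :: "real^'n"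
    have \<sigma>: "test_fun UNIV \<sigma>" unfolding \<sigma>_def using c by (intro test_fun_affine[OF test_fun_bump]) auto
    have g\<sigma>: "grad \<sigma> = (\<lambda>k. c *\<^sub>R grad bump (c *\<^sub>R k))"
      unfolding \<sigma>_def by (rule ext, subst grad_affine[OF bump_smooth]) simp
    have mixed: "grad (\<lambda>x. grad \<sigma> x $ i) x $ j = grad (\<lambda>x. grad \<sigma> x $ j) x $ i" for i j x
    proof -
      have "grad (\<lambda>x. grad \<sigma> x $ i) x = (c * c) *\<^sub>R grad (\<lambda>x. grad bump x $ i) (c *\<^sub>R x)" for i
        unfolding g\<sigma> using grad_affine[OF smooth_fun_grad_nth[OF bump_smooth, of i], of c 0 c x] by simp
      then show ?thesis using bump_mixed_partials[where i=i and j=j and x="c *\<^sub>R x"] by simp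
    qed
    have curl: "(LINT x|lebesgue. g' x $ j * grad \<tau> (x - y) $ i) = (LINT x|lebesgue. g' x $ i * grad \<tau> (x - y) $ j)"
      if \<tau>: "\<tau> = (\<lambda>x. \<sigma> (x + t))" for \<tau> t y i j
    proof -
      have gt: "grad \<tau> (x - y) = grad \<sigma> (x + (t - y))" for x
        unfolding \<tau> grad_translate[OF test_fun_smooth[OF \<sigma>]] by (simp add: algebra_simps)
      \<comment> \<open>The weak gradient identity with a first derivative of \<sigma> as test
        function turns both sides of the curl relation into second derivatives tested with v, where
        their order is irrelevant.\<close>
      have "(LINT x|lebesgue. g' x $ j * grad \<tau> (x - y) $ i) = - (LINT x|lebesgue. v x * grad (\<lambda>x. grad \<sigma> x $ i) (x + (t - y)) $ j)" for i j
      proof -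
        let ?\<psi> = "\<lambda>x. grad \<sigma> (x + (t - y)) $ i"
        have \<psi>: "test_fun UNIV ?\<psi>" by (rule test_fun_translate[OF test_fun_grad_nth[OF \<sigma>]])
        have "integral\<^sup>L (lebesgue_on UNIV) (\<lambda>x. v x * grad ?\<psi> x $ j) = - integral\<^sup>L (lebesgue_on UNIV) (\<lambda>x. g x $ j * ?\<psi> x)"
          using wg \<psi> unfolding weak_grad_def by blast
        then have "(LINT x|lebesgue. v x * grad ?\<psi> x $ j) = - (LINT x|lebesgue. g x $ j * ?\<psi> x)" by (simp add: lebesgue_on_UNIV_eq)
        also have "(LINT x|lebesgue. g x $ j * ?\<psi> x) = (LINT x|lebesgue. g' x $ j * ?\<psi> x)"
          using g'(3) sg g'(2) test_fun_square_integrable[OF \<psi>]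
          by (intro AE_eq_integral_mult)
            (auto elim: eventually_mono intro!: square_integrable_nth square_integrable_measurable)
        finally show ?thesis
          unfolding gt grad_translate[OF smooth_fun_grad_nth[OF test_fun_smooth[OF \<sigma>]]] by simp
      qed
      then show ?thesis by (simp add: mixed[of i])
    qed
    have inv: "(LINT k|lebesgue. C k * \<sigma> (k + s)) = (LINT k|lebesgue. C k * \<sigma> k)" for s
    proof (rule correlation_translation_invariant[OF C_meas C_bd \<sigma>])
      fix t
      have \<tau>: "test_fun UNIV (\<lambda>x. \<sigma> (x + t))" by (rule test_fun_translate[OF \<sigma>])
      note ci = correlation_weak_gradient_0[OF g'(1) h(1) g'(2) h(2) curl[OF refl, where t=t] div \<tau>]
      have sumeq: "C k * (grad \<sigma> (k + t) \<bullet> s) = (\<Sum>i\<in>UNIV. (C k * grad (\<lambda>x. \<sigma> (x + t)) k $ i) * s $ i)" for k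
        unfolding grad_translate[OF test_fun_smooth[OF \<sigma>]] by (simp add: inner_vec_def sum_distrib_left mult.assoc)
      have "integrable lebesgue (\<lambda>k. C k * grad (\<lambda>x. \<sigma> (x + t)) k $ i)" for i
      proof (rule Bochner_Integration.integrable_bound)
        note gi = test_fun_integrable[OF test_fun_grad_nth[OF \<tau>, of i]]
        show "integrable lebesgue (\<lambda>k. M * grad (\<lambda>x. \<sigma> (x + t)) k $ i)" using gi by simp
        show "(\<lambda>k. C k * grad (\<lambda>x. \<sigma> (x + t)) k $ i) \<in> borel_measurable lebesgue"
          by (rule borel_measurable_times[OF C_meas borel_measurable_integrable[OF gi]])
        show "AE k in lebesgue. norm (C k * grad (\<lambda>x. \<sigma> (x + t)) k $ i) \<le> norm (M * grad (\<lambda>x. \<sigma> (x + t)) k $ i)"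
          using order_trans[OF C_bd abs_ge_self] by (intro AE_I2) (auto simp: abs_mult intro!: mult_right_mono)
      qed
      then show "(LINT k|lebesgue. C k * (grad \<sigma> (k + t) \<bullet> s)) = 0"
        unfolding sumeq using ci by (subst Bochner_Integration.integral_sum) (auto simp: C_def)
    qed
    have i1: "integrable lebesgue (\<lambda>k. M * \<bar>\<sigma> k\<bar>)" using test_fun_integrable[OF \<sigma>] by (intro integrable_mult_right integrable_abs)
    \<comment> \<open>Translating to infinity along a coordinate axis: C tends to 0 pointwise there,
      while by \<open>inv\<close> the integral stays the same.\<close>
    have "(\<lambda>n. LINT k|lebesgue. C (k - real n *\<^sub>R ?e) * \<sigma> k) \<longlonglongrightarrow> (LINT k::real^'n|lebesgue. 0)"
    proof (rule Bochner_Integration.integral_dominated_convergence[OF _ _ i1])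
      show "(\<lambda>k. C (k - real n *\<^sub>R ?e) * \<sigma> k) \<in> borel_measurable lebesgue" for n
        using borel_measurable_affine[OF C_meas, of 1 "- real n *\<^sub>R ?e"] borel_measurable_integrable[OF test_fun_integrable[OF \<sigma>]]
        by (intro borel_measurable_times) auto
      show "AE k in lebesgue. norm (C (k - real n *\<^sub>R ?e) * \<sigma> k) \<le> M * \<bar>\<sigma> k\<bar>" for n
        using C_bd by (intro AE_I2) (auto simp: abs_mult intro!: mult_right_mono)
      show "AE k in lebesgue. (\<lambda>n. C (k - real n *\<^sub>R ?e) * \<sigma> k) \<longlonglongrightarrow> 0"
      proof (rule AE_I2)
        fix k :: "real^'n"
        have "filterlim (\<lambda>n. real n + - norm k) at_top sequentially"
          by (rule filterlim_tendsto_add_at_top[OF tendsto_const filterlim_real_sequentially, of "- norm k", simplified add.commute])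
        then have "filterlim (\<lambda>n. norm (k - real n *\<^sub>R ?e)) at_top sequentially"
        proof (rule filterlim_at_top_mono)
          show "\<forall>\<^sub>F n in sequentially. real n + - norm k \<le> norm (k - real n *\<^sub>R ?e)"
            using norm_triangle_ineq2[of "_ *\<^sub>R ?e" k] by (intro always_eventually allI) (metis norm_minus_commute norm_scaleR norm_axis_1 mult.right_neutral abs_of_nat add_uminus_conv_diff)
        qed
        from translation_weakly_null[OF this, of "l2_of g'" "l2_of h"]
        show "(\<lambda>n. C (k - real n *\<^sub>R ?e) * \<sigma> k) \<longlonglongrightarrow> 0" unfolding C_def by (rule tendsto_mult_left_zero)
      qed
    qed simp
    moreover have "(LINT k|lebesgue. C (k - real n *\<^sub>R ?e) * \<sigma> k) = (LINT k|lebesgue. C k * \<sigma> k)" for n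
    proof -
      let ?t = "real n *\<^sub>R ?e"
      have "(\<lambda>k. C (k - ?t) * \<sigma> k) \<in> borel_measurable lebesgue"
        using borel_measurable_affine[OF C_meas, of 1 "- ?t"] borel_measurable_integrable[OF test_fun_integrable[OF \<sigma>]]
        by (intro borel_measurable_times) auto
      from integral_translation[OF this, of ?t] show ?thesis by (simp add: inv)
    qed
    ultimately have "(LINT k|lebesgue. C k * \<sigma> k) = 0" using LIMSEQ_unique[OF _ tendsto_const] by fastforce
    then show ?thesis by (simp add: \<sigma>_def)
  qed
  \<comment> \<open>Rescaling k transfers the concentration from the bump to the argument of C;
    continuity of C then extracts the value C(0).\<close>
  have "(LINT k|lebesgue. C ((1 / real (Suc n)) *\<^sub>R k) * bump k) = 0" for n
  proof -
    have "(\<lambda>k. C k * bump (real (Suc n) *\<^sub>R k)) \<in> borel_measurable lebesgue"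
      by (intro borel_measurable_times[OF C_meas] borel_measurable_lebesgue_continuous continuous_on_compose2[OF smooth_fun_continuous[OF bump_smooth, of UNIV]] continuous_intros) auto
    from integral_lebesgue_affine[OF this, of "1 / real (Suc n)" 0] show ?thesis
      using zero[of "real (Suc n)"] by (simp del: of_nat_Suc)
  qed
  moreover have "(\<lambda>n. LINT k|lebesgue. C ((1 / real (Suc n)) *\<^sub>R k) * bump k) \<longlonglongrightarrow> (LINT k::real^'n|lebesgue. C 0 * bump k)"
  proof (rule Bochner_Integration.integral_dominated_convergence)
    show "integrable lebesgue (\<lambda>k::real^'n. M * \<bar>bump k\<bar>)" using test_fun_integrable[OF test_fun_bump] by (intro integrable_mult_right integrable_abs)
    show "(\<lambda>k. C ((1 / real (Suc n)) *\<^sub>R k) * bump k) \<in> borel_measurable lebesgue" for n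
      using borel_measurable_affine[OF C_meas, of "1 / real (Suc n)" 0]
      by (intro borel_measurable_times borel_measurable_integrable[OF test_fun_integrable[OF test_fun_bump]]) simp
    show "(\<lambda>k::real^'n. C 0 * bump k) \<in> borel_measurable lebesgue"
      by (rule borel_measurable_times[OF borel_measurable_const borel_measurable_integrable[OF test_fun_integrable[OF test_fun_bump]]])
    show "AE k in lebesgue. norm (C ((1 / real (Suc n)) *\<^sub>R k) * bump k) \<le> M * \<bar>bump k\<bar>" for n
      using C_bd by (intro AE_I2) (auto simp: abs_mult intro!: mult_right_mono)
    show "AE k in lebesgue. (\<lambda>n. C ((1 / real (Suc n)) *\<^sub>R k) * bump k) \<longlonglongrightarrow> C 0 * bump k"
    proof (rule AE_I2)
      fix k :: "real^'n"
      have "(\<lambda>n. (1 / real (Suc n)) *\<^sub>R k) \<longlonglongrightarrow> 0 *\<^sub>R k"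
        using LIMSEQ_inverse_real_of_nat by (intro tendsto_scaleR tendsto_const) (simp add: inverse_eq_divide)
      from C_cont[of _ 0, OF this[simplified]] show "(\<lambda>n. C ((1 / real (Suc n)) *\<^sub>R k) * bump k) \<longlonglongrightarrow> C 0 * bump k"
        by (intro tendsto_mult tendsto_const) simp
    qed
  qed
  ultimately have "C 0 * (LINT k::real^'n|lebesgue. bump k) = 0" using LIMSEQ_unique[OF _ tendsto_const] by fastforce
  moreover have "(LINT k::real^'n|lebesgue. bump k) \<noteq> 0"
  proof
    assume "(LINT k::real^'n|lebesgue. bump k) = 0"
    then have "AE k::real^'n in lebesgue. bump k = 0"
      using integral_nonneg_eq_0_iff_AE[OF test_fun_integrable[OF test_fun_bump]] bump_nonneg by auto
    then have "AE k::real^'n in lebesgue. k \<notin> ball 0 1" by eventually_elim (use bump_pos in force)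
    then have "ball (0::real^'n) 1 \<in> null_sets lebesgue" by (simp add: AE_iff_null_sets)
    then show False using lmeasurable_ball_pos[of 1 "0::real^'n"] by (simp add: null_sets_def measure_def)
  qed
  \<comment> \<open>This inner product is C(0). Since p is orthogonal to H as well, H = g - p is
    orthogonal to itself.\<close>
  ultimately have "inner (l2_of g) H = 0" using g' by (simp add: C_def affine_op_l2_of gg' H)
  moreover have "inner p H = 0" using p(2)[OF p(1)] by (simp add: H_def inner_commute)
  ultimately have "inner H H = 0" by (simp add: H_def inner_diff_left)
  then have "l2_of g = p" by (simp add: H_def)
  with p(1) show ?thesis by simp
qed

section \<open>Square-integrable limits of gradients are weak gradients\<close>

lemma square_integrable_linear:
  "bounded_linear h \<Longrightarrow> square_integrable f \<Longrightarrow> square_integrable (\<lambda>x. h (f x))"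
  using bounded_field_const square_integrable_field by blast

lemma integrable_lebesgue_on_iff:
  fixes f :: "'a::euclidean_space \<Rightarrow> 'b::{banach,second_countable_topology}"
  assumes "S \<in> sets lebesgue"
  shows "integrable (lebesgue_on S) f \<longleftrightarrow> integrable lebesgue (\<lambda>x. indicator S x *\<^sub>R f x)"
    and "integral\<^sup>L (lebesgue_on S) f = integral\<^sup>L lebesgue (\<lambda>x. indicator S x *\<^sub>R f x)"
  using assms by (simp_all add: integrable_restrict_space integral_restrict_space)

lemma square_integrable_on_iff:
  fixes f :: "'a::euclidean_space \<Rightarrow> 'b::euclidean_space"
  assumes S: "S \<in> sets lebesgue"
  shows "square_integrable (\<lambda>x. indicator S x *\<^sub>R f x) \<longleftrightarrow>
    f \<in> borel_measurable (lebesgue_on S) \<and> integrable (lebesgue_on S) (\<lambda>x. (norm (f x))\<^sup>2)"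
proof -
  have eq: "(\<lambda>x. (norm (indicator S x *\<^sub>R f x))\<^sup>2) = (\<lambda>x. indicator S x *\<^sub>R (norm (f x))\<^sup>2)"
    by (auto simp: indicator_def)
  show ?thesis
    unfolding square_integrable_def eq integrable_lebesgue_on_iff(1)[OF S]
    using S borel_measurable_restrict_space_iff[of S lebesgue f] by simp
qed

lemma L2_iff: "S \<in> sets lebesgue \<Longrightarrow> L2 S u \<longleftrightarrow> square_integrable (\<lambda>x. indicator S x *\<^sub>R u x)"
  unfolding L2_def square_integrable_on_iff real_norm_def power2_abs ..

lemma L2v_iff: "S \<in> sets lebesgue \<Longrightarrow> L2v S g \<longleftrightarrow> square_integrable (\<lambda>x. indicator S x *\<^sub>R g x)"
  by (simp add: L2v_def square_integrable_on_iff)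

lemma L2v_UNIV: "L2v UNIV g \<longleftrightarrow> square_integrable g"
  by (simp add: L2v_iff)

lemma square_integrable_on_integrable:
  fixes f :: "'a::euclidean_space \<Rightarrow> 'b::euclidean_space"
  assumes S: "S \<in> lmeasurable" and f: "square_integrable (\<lambda>x. indicator S x *\<^sub>R f x)"
  shows "integrable (lebesgue_on S) f"
proof -
  have "integrable lebesgue (\<lambda>x. indicator S x *\<^sub>R f x)"
  proof (rule Bochner_Integration.integrable_bound)
    show "integrable lebesgue (\<lambda>x. indicator S x + (norm (indicator S x *\<^sub>R f x))\<^sup>2 :: real)"
      using f fmeasurableD[OF S] fmeasurableD2[OF S]
      by (intro Bochner_Integration.integrable_add integrable_real_indicator)
         (auto simp: square_integrable_def top.not_eq_extremum simp del: emeasure_completion)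
    show "(\<lambda>x. indicator S x *\<^sub>R f x) \<in> borel_measurable lebesgue" using f by (rule square_integrable_measurable)
    have "t \<le> 1 + t\<^sup>2" for t :: real
      using zero_le_power2[of "t - 1"] zero_le_power2[of t] unfolding power2_diff by (simp only: power_one mult_1_right)
    then show "AE x in lebesgue. norm (indicator S x *\<^sub>R f x) \<le> norm (indicator S x + (norm (indicator S x *\<^sub>R f x))\<^sup>2 :: real)"
      by (intro AE_I2) (auto simp: indicator_def)
  qed
  then show ?thesis using S by (simp add: integrable_lebesgue_on_iff)
qed

section \<open>A Poincare inequality on balls modulo constants\<close>

definition ball_mean :: "(real^'n \<Rightarrow> real) \<Rightarrow> real" where
  "ball_mean \<phi> = (LINT y|lebesgue. indicator (ball 0 1) y * \<phi> y) / measure lebesgue (ball (0::real^'n) 1)"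

text \<open>Cauchy-Schwarz against the indicator of the unit ball: the deviation from the mean is
  the average of the pointwise differences.\<close>

lemma square_deviation_le:
  fixes \<phi> :: "real^'n \<Rightarrow> real"
  assumes \<phi>: "test_fun UNIV \<phi>"
  shows "ennreal ((\<phi> x - ball_mean \<phi>)\<^sup>2 * measure lebesgue (ball (0::real^'n) 1))
    \<le> (\<integral>\<^sup>+y. ennreal (indicator (ball 0 1) y * (\<phi> x - \<phi> y)\<^sup>2) \<partial>lebesgue)"
proof -
  let ?B = "ball (0::real^'n) 1" let ?b = "measure lebesgue ?B"
  have b: "?b > 0" by (rule lmeasurable_ball_pos) simp
  have s1: "square_integrable (\<lambda>y. indicator ?B y *\<^sub>R (1::real))" by (rule square_integrable_indicator_const) simp
  have s2: "square_integrable (\<lambda>y. indicator ?B y *\<^sub>R (\<phi> x - \<phi> y))"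
    using square_integrable_diff[OF square_integrable_indicator_const[of ?B "\<phi> x"] square_integrable_indicator[OF _ test_fun_square_integrable[OF \<phi>], of ?B]]
    by (simp add: right_diff_distrib)
  have i\<phi>: "integrable lebesgue (\<lambda>y. indicator ?B y * \<phi> y)"
    by (intro integrable_indicator_mult test_fun_integrable[OF \<phi>]) simp
  have i1: "integrable lebesgue (\<lambda>y. indicator ?B y * \<phi> x)"
    by (intro integrable_mult_left integrable_real_indicator)
       (simp_all add: fmeasurableD2[OF lmeasurable_ball] top.not_eq_extremum[symmetric] del: emeasure_completion)
  have "inner (l2_of (\<lambda>y. indicator ?B y *\<^sub>R (1::real))) (l2_of (\<lambda>y. indicator ?B y *\<^sub>R (\<phi> x - \<phi> y)))
      = (LINT y|lebesgue. indicator ?B y * \<phi> x - indicator ?B y * \<phi> y)"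
    unfolding inner_l2_of[OF s1 s2] by (rule Bochner_Integration.integral_cong) (auto simp: indicator_def)
  also have "\<dots> = (\<phi> x - ball_mean \<phi>) * ?b"
    unfolding Bochner_Integration.integral_diff[OF i1 i\<phi>] using b by (simp add: ball_mean_def field_simps)
  finally have "((\<phi> x - ball_mean \<phi>) * ?b)\<^sup>2 \<le> (norm (l2_of (\<lambda>y. indicator ?B y *\<^sub>R (1::real))))\<^sup>2 * (norm (l2_of (\<lambda>y. indicator ?B y *\<^sub>R (\<phi> x - \<phi> y))))\<^sup>2"
    using Cauchy_Schwarz_ineq[of "l2_of (\<lambda>y. indicator ?B y *\<^sub>R (1::real))" "l2_of (\<lambda>y. indicator ?B y *\<^sub>R (\<phi> x - \<phi> y))"]
    by (simp add: power2_norm_eq_inner)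
  also have "(norm (l2_of (\<lambda>y. indicator ?B y *\<^sub>R (1::real))))\<^sup>2 = ?b"
  proof -
    have "(\<lambda>y. (norm (indicator ?B y *\<^sub>R (1::real)))\<^sup>2) = indicator ?B" by (auto simp: indicator_def)
    then show ?thesis unfolding norm_l2_of[OF s1] by simp
  qed
  finally have "(\<phi> x - ball_mean \<phi>)\<^sup>2 * ?b \<le> (norm (l2_of (\<lambda>y. indicator ?B y *\<^sub>R (\<phi> x - \<phi> y))))\<^sup>2"
    using b by (simp add: power2_eq_square)
  then have "ennreal ((\<phi> x - ball_mean \<phi>)\<^sup>2 * ?b) \<le> ennreal ((norm (l2_of (\<lambda>y. indicator ?B y *\<^sub>R (\<phi> x - \<phi> y))))\<^sup>2)" by (rule ennreal_leI)
  also have "\<dots> = (\<integral>\<^sup>+y. ennreal (indicator ?B y * (\<phi> x - \<phi> y)\<^sup>2) \<partial>lebesgue)"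
    unfolding nn_norm_l2_of[OF s2] by (rule nn_integral_cong) (auto simp: indicator_def)
  finally show ?thesis .
qed

text \<open>After \<open>square_deviation_le\<close>, the substitution x = y + h and Fubini leave an
  integral over |h| < R + 1 of the squared L2 norm of \<phi>(. + h) - \<phi>, which
  \<open>norm_translation_diff_le\<close> controls. The constant depends on R alone.\<close>

lemma local_poincare:
  fixes R :: real
  assumes R: "R > 0"
  obtains C where "C > 0" "\<And>\<phi> :: real^'n \<Rightarrow> real. test_fun UNIV \<phi> \<Longrightarrow>
    norm (l2_of (\<lambda>x. indicator (ball 0 R) x *\<^sub>R (\<phi> x - ball_mean \<phi>))) \<le> C * norm (l2_of (grad \<phi>))"
proof -
  let ?b = "measure lebesgue (ball (0::real^'n) 1)" and ?V = "measure lebesgue (ball (0::real^'n) (R + 1))"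
  have b: "?b > 0" "?V > 0" using R by (auto intro!: lmeasurable_ball_pos)
  show ?thesis
  proof (rule that[of "sqrt (?V / ?b) * (R + 1)"])
    show "sqrt (?V / ?b) * (R + 1) > 0" using b R by simp
    fix \<phi> :: "real^'n \<Rightarrow> real" assume \<phi>: "test_fun UNIV \<phi>"
    let ?D = "norm (l2_of (grad \<phi>))"
    have \<phi>b[measurable]: "\<phi> \<in> borel_measurable borel"
      by (rule borel_measurable_continuous_onI[OF smooth_fun_continuous[OF test_fun_smooth[OF \<phi>]]])
    have s: "square_integrable (\<lambda>x. indicator (ball 0 R) x *\<^sub>R (\<phi> x - ball_mean \<phi>))"
      using square_integrable_diff[OF square_integrable_indicator[OF _ test_fun_square_integrable[OF \<phi>], of "ball 0 R"] square_integrable_indicator_const[of "ball 0 R" "ball_mean \<phi>"]]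
      by (simp add: right_diff_distrib)
    define iR i1 iV :: "real^'n \<Rightarrow> real"
      where "iR = indicator (ball 0 R)" and "i1 = indicator (ball 0 1)" and "iV = indicator (ball 0 (R + 1))"
    have [measurable]: "iR \<in> borel_measurable borel" "i1 \<in> borel_measurable borel" "iV \<in> borel_measurable borel"
      by (auto simp: iR_def i1_def iV_def intro!: borel_measurable_indicator)
    let ?f = "\<lambda>x y. ennreal (iR x * (i1 y * (\<phi> x - \<phi> y)\<^sup>2))"
    have tr: "(\<integral>\<^sup>+x. F x \<partial>lborel) = (\<integral>\<^sup>+h. F (y + h) \<partial>lborel)" if [measurable]: "F \<in> borel_measurable borel" for F and y :: "real^'n"
      by (subst lborel_distr_plus[of y, symmetric], subst nn_integral_distr) auto
    have sh: "square_integrable (\<lambda>y. \<phi> (y + h) - \<phi> y)" for h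
      using square_integrable_affine[OF test_fun_square_integrable[OF \<phi>], of 1 h] test_fun_square_integrable[OF \<phi>]
      by (simp add: add.commute)
    have "ennreal ((norm (l2_of (\<lambda>x. indicator (ball 0 R) x *\<^sub>R (\<phi> x - ball_mean \<phi>))))\<^sup>2 * ?b)
        = (\<integral>\<^sup>+x. ennreal (indicator (ball 0 R) x * ((\<phi> x - ball_mean \<phi>)\<^sup>2 * ?b)) \<partial>lebesgue)"
    proof -
      have "ennreal ((norm (l2_of (\<lambda>x. indicator (ball 0 R) x *\<^sub>R (\<phi> x - ball_mean \<phi>))))\<^sup>2 * ?b)
        = (\<integral>\<^sup>+x. ennreal ((norm (indicator (ball 0 R) x *\<^sub>R (\<phi> x - ball_mean \<phi>)))\<^sup>2) \<partial>lebesgue) * ennreal ?b"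
        unfolding nn_norm_l2_of[OF s, symmetric] by (simp add: ennreal_mult)
      also have "\<dots> = (\<integral>\<^sup>+x. ennreal ((norm (indicator (ball 0 R) x *\<^sub>R (\<phi> x - ball_mean \<phi>)))\<^sup>2) * ennreal ?b \<partial>lebesgue)"
        by (rule nn_integral_multc[symmetric]) (use s in \<open>auto intro!: borel_measurable_power borel_measurable_norm square_integrable_measurable measurable_compose[OF _ measurable_ennreal]\<close>)
      also have "\<dots> = (\<integral>\<^sup>+x. ennreal (indicator (ball 0 R) x * ((\<phi> x - ball_mean \<phi>)\<^sup>2 * ?b)) \<partial>lebesgue)"
        by (rule nn_integral_cong) (auto simp: indicator_def ennreal_mult)
      finally show ?thesis .
    qed
    also have "\<dots> \<le> (\<integral>\<^sup>+x. \<integral>\<^sup>+y. ?f x y \<partial>lborel \<partial>lborel)"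
      unfolding nn_integral_completion
    proof (rule nn_integral_mono)
      fix x
      show "ennreal (indicator (ball 0 R) x * ((\<phi> x - ball_mean \<phi>)\<^sup>2 * ?b)) \<le> (\<integral>\<^sup>+y. ?f x y \<partial>lborel)"
        using square_deviation_le[OF \<phi>, of x] by (auto simp: iR_def i1_def indicator_def nn_integral_completion)
    qed
    also have "\<dots> = (\<integral>\<^sup>+y. \<integral>\<^sup>+x. ?f x y \<partial>lborel \<partial>lborel)"
      by (rule lborel_pair.Fubini'[symmetric]) measurable
    also have "\<dots> = (\<integral>\<^sup>+y. \<integral>\<^sup>+h. ?f (y + h) y \<partial>lborel \<partial>lborel)"
      by (rule nn_integral_cong, rule tr) measurable
    also have "\<dots> \<le> (\<integral>\<^sup>+y. \<integral>\<^sup>+h. ennreal (iV h * (\<phi> (y + h) - \<phi> y)\<^sup>2) \<partial>lborel \<partial>lborel)"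
    proof (intro nn_integral_mono ennreal_leI)
      fix y h :: "real^'n"
      have "h \<in> ball 0 (R + 1)" if "y + h \<in> ball 0 R" "y \<in> ball 0 1"
        using that norm_triangle_ineq4[of "y + h" y] by simp
      then show "iR (y + h) * (i1 y * (\<phi> (y + h) - \<phi> y)\<^sup>2)
         \<le> iV h * (\<phi> (y + h) - \<phi> y)\<^sup>2" by (auto simp: iR_def i1_def iV_def indicator_def)
    qed
    also have "\<dots> = (\<integral>\<^sup>+h. \<integral>\<^sup>+y. ennreal (iV h * (\<phi> (y + h) - \<phi> y)\<^sup>2) \<partial>lborel \<partial>lborel)"
      by (rule lborel_pair.Fubini'[symmetric]) measurable
    also have "\<dots> \<le> (\<integral>\<^sup>+h. ennreal (((R + 1) * ?D)\<^sup>2) * indicator (ball (0::real^'n) (R + 1)) h \<partial>lborel)"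
    proof (rule nn_integral_mono)
      fix h :: "real^'n"
      show "(\<integral>\<^sup>+y. ennreal (iV h * (\<phi> (y + h) - \<phi> y)\<^sup>2) \<partial>lborel) \<le> ennreal (((R + 1) * ?D)\<^sup>2) * indicator (ball 0 (R + 1)) h"
      proof (cases "h \<in> ball 0 (R + 1)")
        case True
        have "(\<integral>\<^sup>+y. ennreal ((\<phi> (y + h) - \<phi> y)\<^sup>2) \<partial>lborel) = ennreal ((norm (l2_of (\<lambda>y. \<phi> (y + h) - \<phi> y)))\<^sup>2)"
          using nn_norm_l2_of[OF sh[of h]] by (simp add: nn_integral_completion)
        also have "\<dots> \<le> ennreal (((R + 1) * ?D)\<^sup>2)"
        proof (intro ennreal_leI power_mono)
          have st: "square_integrable (\<lambda>y. \<phi> (y + h))"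
            using square_integrable_affine[OF test_fun_square_integrable[OF \<phi>], of 1 h] by (simp add: add.commute)
          have "norm (l2_of (\<lambda>y. \<phi> (y + h) - \<phi> y)) \<le> norm h * ?D"
            using norm_translation_diff_le[OF \<phi>, of h] by (simp add: l2_of_diff st test_fun_square_integrable[OF \<phi>])
          also have "\<dots> \<le> (R + 1) * ?D" using True by (intro mult_right_mono) auto
          finally show "norm (l2_of (\<lambda>y. \<phi> (y + h) - \<phi> y)) \<le> (R + 1) * ?D" .
        qed simp
        finally show ?thesis using True by (simp add: iV_def)
      qed (simp add: iV_def)
    qed
    also have "\<dots> = ennreal (((R + 1) * ?D)\<^sup>2) * emeasure lborel (ball (0::real^'n) (R + 1))"
      by (rule nn_integral_cmult_indicator) simp
    also have "\<dots> = ennreal (((R + 1) * ?D)\<^sup>2 * ?V)"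
      using emeasure_eq_ennreal_measure[of lborel "ball (0::real^'n) (R + 1)"] emeasure_lborel_ball_finite[of "0::real^'n" "R + 1"]
      by (simp add: ennreal_mult)
    finally have "(norm (l2_of (\<lambda>x. indicator (ball 0 R) x *\<^sub>R (\<phi> x - ball_mean \<phi>))))\<^sup>2 * ?b \<le> ((R + 1) * ?D)\<^sup>2 * ?V"
      by (subst (asm) ennreal_le_iff) auto
    then have "(norm (l2_of (\<lambda>x. indicator (ball 0 R) x *\<^sub>R (\<phi> x - ball_mean \<phi>))))\<^sup>2 \<le> ((R + 1) * ?D)\<^sup>2 * ?V / ?b"
      using b by (simp add: pos_le_divide_eq)
    also have "\<dots> = (sqrt (?V / ?b) * (R + 1) * ?D)\<^sup>2" using b by (simp add: power_mult_distrib)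
    finally show "norm (l2_of (\<lambda>x. indicator (ball 0 R) x *\<^sub>R (\<phi> x - ball_mean \<phi>))) \<le> sqrt (?V / ?b) * (R + 1) * ?D"
      by (rule power2_le_imp_le) (use b R in simp)
  qed
qed

lemma ball_mean_diff:
  assumes "test_fun UNIV \<phi>" "test_fun UNIV \<psi>"
  shows "ball_mean (\<lambda>x. \<phi> x + (-1) * \<psi> x) = ball_mean \<phi> - ball_mean \<psi>"
proof -
  have i: "integrable lebesgue (\<lambda>y. indicator (ball 0 1) y * f y)" if "test_fun UNIV f" for f :: "real^'a \<Rightarrow> real"
    by (intro integrable_indicator_mult test_fun_integrable[OF that]) simp
  show ?thesis
    using Bochner_Integration.integral_diff[OF i[OF assms(1)] i[OF assms(2)]]
    by (simp add: ball_mean_def right_diff_distrib diff_divide_distrib)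
qed

lemma test_fun_diff: "test_fun U \<phi> \<Longrightarrow> test_fun U \<psi> \<Longrightarrow> test_fun U (\<lambda>x. \<phi> x + (-1) * \<psi> x)"
  by (intro test_fun_add test_fun_scale)

lemma grad_diff:
  "smooth_fun \<phi> \<Longrightarrow> smooth_fun \<psi> \<Longrightarrow> grad (\<lambda>x. \<phi> x + (-1) * \<psi> x) x = grad \<phi> x - grad \<psi> x"
  using grad_add[of \<phi> "\<lambda>x. (-1) * \<psi> x" x] smooth_fun_affine[of \<psi> "-1" 0 1] grad_scale[of \<psi> "-1" x] by simp

text \<open>Test functions whose gradients converge may themselves drift by constants. Subtracting
  the mean over the unit ball makes them Cauchy in L2 on every ball by
  \<open>local_poincare\<close>; the local limits agree and are glued to Q. The weak gradient
  identity passes to the limit because additive constants integrate to 0 against derivatives of test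
  functions.\<close>

theorem Hdot_of_grad_space:
  fixes G :: "(real^'n, real^'n) l2"
  assumes G: "G \<in> grad_space"
  shows "\<exists>Q. Hdot Q (fun_of G)"
proof -
  have sG: "square_integrable (fun_of G)" "l2_of (fun_of G) = G" by (simp_all add: fun_of)
  obtain u where u: "\<And>k. u k \<in> {l2_of (grad \<phi>) |\<phi>. test_fun UNIV \<phi>}" "u \<longlonglongrightarrow> G"
    using G unfolding grad_space_def closure_sequential by blast
  then have "\<forall>k. \<exists>\<phi>. test_fun UNIV \<phi> \<and> u k = l2_of (grad \<phi>)" by blast
  then obtain \<phi> where \<phi>: "\<And>k. test_fun UNIV (\<phi> k)" "\<And>k. u k = l2_of (grad (\<phi> k))" by metis
  have uC: "Cauchy (\<lambda>k. l2_of (grad (\<phi> k)))" using LIMSEQ_imp_Cauchy[OF u(2)] by (simp only: \<phi>(2)[symmetric])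
  define B where "B m = ball (0::real^'n) (real (Suc m))" for m
  have B[simp]: "B m \<in> sets lebesgue" "B m \<in> lmeasurable" for m by (auto simp: B_def)
  define W where "W m k = (\<lambda>x. indicator (B m) x *\<^sub>R (\<phi> k x - ball_mean (\<phi> k)))" for m k
  have sW: "square_integrable (W m k)" for m k
    unfolding W_def using square_integrable_diff[OF square_integrable_indicator[OF _ test_fun_square_integrable[OF \<phi>(1)[of k]], of "B m"] square_integrable_indicator_const[of "B m" "ball_mean (\<phi> k)"]]
    by (simp add: right_diff_distrib)
  have "\<exists>q. (\<lambda>k. l2_of (W m k)) \<longlonglongrightarrow> q" for m
  proof -
    obtain C where C: "C > 0" "\<And>\<phi> :: real^'n \<Rightarrow> real. test_fun UNIV \<phi> \<Longrightarrow>
      norm (l2_of (\<lambda>x. indicator (B m) x *\<^sub>R (\<phi> x - ball_mean \<phi>))) \<le> C * norm (l2_of (grad \<phi>))"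
      unfolding B_def by (rule local_poincare[of "real (Suc m)"]) auto
    have dist: "dist (l2_of (W m k)) (l2_of (W m l)) \<le> C * dist (l2_of (grad (\<phi> k))) (l2_of (grad (\<phi> l)))" for k l
    proof -
      let ?\<psi> = "\<lambda>x. \<phi> k x + (-1) * \<phi> l x"
      have "dist (l2_of (W m k)) (l2_of (W m l)) = norm (l2_of (\<lambda>x. indicator (B m) x *\<^sub>R (?\<psi> x - ball_mean ?\<psi>)))"
        unfolding dist_norm l2_of_diff[OF sW sW] ball_mean_diff[OF \<phi>(1) \<phi>(1)] by (simp add: W_def algebra_simps)
      also have "\<dots> \<le> C * norm (l2_of (grad ?\<psi>))" by (rule C(2)[OF test_fun_diff[OF \<phi>(1) \<phi>(1)]])
      also have "grad ?\<psi> = (\<lambda>x. grad (\<phi> k) x - grad (\<phi> l) x)"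
        using grad_diff[OF test_fun_smooth[OF \<phi>(1)] test_fun_smooth[OF \<phi>(1)]] by blast
      finally show ?thesis by (simp add: dist_norm l2_of_diff test_fun_grad_square_integrable[OF \<phi>(1)])
    qed
    have "Cauchy (\<lambda>k. l2_of (W m k))"
    proof (rule metric_CauchyI)
      fix e :: real assume "e > 0"
      then have "e / C > 0" using C(1) by simp
      then obtain N where "\<And>k l. k \<ge> N \<Longrightarrow> l \<ge> N \<Longrightarrow> dist (l2_of (grad (\<phi> k))) (l2_of (grad (\<phi> l))) < e / C"
        using metric_CauchyD[OF uC] by blast
      then have "dist (l2_of (W m k)) (l2_of (W m l)) < e" if "k \<ge> N" "l \<ge> N" for k l
        using le_less_trans[OF dist] that C(1) by (simp add: pos_less_divide_eq mult.commute)
      then show "\<exists>M. \<forall>k\<ge>M. \<forall>l\<ge>M. dist (l2_of (W m k)) (l2_of (W m l)) < e" by blast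
    qed
    then show ?thesis by (simp add: Cauchy_convergent_iff convergent_def)
  qed
  then obtain q where q: "\<And>m. (\<lambda>k. l2_of (W m k)) \<longlonglongrightarrow> q m" by metis
  have cons: "AE x in lebesgue. x \<in> B m \<longrightarrow> fun_of (q m') x = fun_of (q m) x" if "m \<le> m'" for m m'
  proof -
    let ?P = "pointwise_op (\<lambda>x v. indicator (B m) x *\<^sub>R (v::real))"
    note bl = bounded_linear_pointwise_op[OF bounded_field_indicator[OF B(1)[of m]]]
    have BB: "B m \<subseteq> B m'" using that by (auto simp: B_def)
    have "?P (l2_of (W m' k)) = l2_of (W m k)" for k
      unfolding pointwise_op_l2_of[OF bounded_field_indicator[OF B(1)] sW] using BB
      by (intro arg_cong[of _ _ l2_of] ext) (auto simp: W_def indicator_def)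
    moreover have "?P (l2_of (W m k)) = l2_of (W m k)" for k
      unfolding pointwise_op_l2_of[OF bounded_field_indicator[OF B(1)] sW]
      by (intro arg_cong[of _ _ l2_of] ext) (auto simp: W_def indicator_def)
    ultimately have "(\<lambda>k. l2_of (W m k)) \<longlonglongrightarrow> ?P (q m')" "(\<lambda>k. l2_of (W m k)) \<longlonglongrightarrow> ?P (q m)"
      using bounded_linear.tendsto[OF bl q[of m']] bounded_linear.tendsto[OF bl q[of m]] by simp_all
    then have "?P (q m') = ?P (q m)" by (rule LIMSEQ_unique)
    then have "AE x in lebesgue. indicator (B m) x *\<^sub>R fun_of (q m') x = indicator (B m) x *\<^sub>R fun_of (q m) x"
      unfolding pointwise_op_def by (subst (asm) l2_of_eq_iff) (intro square_integrable_indicator fun_of(1) B(1))+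
    then show ?thesis by eventually_elim (auto simp: indicator_def)
  qed
  \<comment> \<open>For almost every x this sequence is constant from the first ball containing x
    on.\<close>
  define Q where "Q x = lim (\<lambda>m. fun_of (q m) x)" for x
  have "AE x in lebesgue. \<forall>m m'. m \<le> m' \<longrightarrow> x \<in> B m \<longrightarrow> fun_of (q m') x = fun_of (q m) x"
    unfolding AE_all_countable using cons by auto
  then have Qq: "AE x in lebesgue. \<forall>m. x \<in> B m \<longrightarrow> Q x = fun_of (q m) x"
  proof eventually_elim
    case (elim x)
    show ?case
    proof (intro allI impI)
      fix m assume "x \<in> B m"
      with elim have "\<forall>\<^sub>F m' in sequentially. fun_of (q m') x = fun_of (q m) x"
        by (intro eventually_sequentiallyI[of m]) auto
      then have "(\<lambda>m'. fun_of (q m') x) \<longlonglongrightarrow> fun_of (q m) x" by (rule tendsto_eventually)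
      then show "Q x = fun_of (q m) x" unfolding Q_def by (rule limI)
    qed
  qed
  have Q_meas: "Q \<in> borel_measurable lebesgue"
    unfolding Q_def by (rule borel_measurable_lim_metric) (rule square_integrable_measurable[OF fun_of(1)])
  have QB: "AE x in lebesgue. indicator (B m) x *\<^sub>R Q x = indicator (B m) x *\<^sub>R fun_of (q m) x" for m
    using Qq by eventually_elim (auto simp: indicator_def)
  have sQ: "square_integrable (\<lambda>x. indicator (B m) x *\<^sub>R Q x)" for m
  proof -
    have s: "square_integrable (\<lambda>x. indicator (B m) x *\<^sub>R fun_of (q m) x)" by (intro square_integrable_indicator fun_of) simp
    have m: "(\<lambda>x. indicator (B m) x *\<^sub>R Q x) \<in> borel_measurable lebesgue"
      by (intro borel_measurable_scaleR borel_measurable_indicator Q_meas) simp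
    have "integrable lebesgue (\<lambda>x. (norm (indicator (B m) x *\<^sub>R Q x))\<^sup>2) \<longleftrightarrow> integrable lebesgue (\<lambda>x. (norm (indicator (B m) x *\<^sub>R fun_of (q m) x))\<^sup>2)"
      by (rule integrable_cong_AE) (use QB[of m] m s in \<open>auto elim: eventually_mono intro!: borel_measurable_power borel_measurable_norm square_integrable_measurable\<close>)
    then show ?thesis using s m unfolding square_integrable_def by blast
  qed
  have compact_B: "\<exists>m. K \<subseteq> B m" if cK: "compact K" for K
  proof -
    obtain R where R: "K \<subseteq> ball 0 R" using compact_imp_bounded[OF cK] bounded_subset_ballD by blast
    obtain m where "R \<le> real m" using real_arch_simple by blast
    with R show ?thesis by (intro exI[of _ m]) (auto simp: B_def)
  qed
  have sQK: "square_integrable (\<lambda>x. indicator K x *\<^sub>R Q x)" if K: "compact K" for K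
  proof -
    obtain m where m: "K \<subseteq> B m" using compact_B[OF K] by blast
    have "(\<lambda>x. indicator K x *\<^sub>R (indicator (B m) x *\<^sub>R Q x)) = (\<lambda>x. indicator K x *\<^sub>R Q x)"
      using m by (auto simp: indicator_def fun_eq_iff)
    moreover have "K \<in> sets lebesgue" using lmeasurable_compact[OF K] by (rule fmeasurableD)
    ultimately show ?thesis using square_integrable_indicator[OF _ sQ[of m], of K] by simp
  qed
  have weak: "(LINT x|lebesgue. Q x * grad \<psi> x $ i) = - (LINT x|lebesgue. fun_of G x $ i * \<psi> x)" if \<psi>: "test_fun UNIV \<psi>" for \<psi> i
  proof -
    obtain K where K: "compact K" "\<And>x. x \<notin> K \<Longrightarrow> \<psi> x = 0" "\<And>x. x \<notin> K \<Longrightarrow> grad \<psi> x = 0"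
      using \<psi> by (rule test_fun_support) blast
    obtain m where m: "K \<subseteq> B m" using compact_B[OF K(1)] by blast
    let ?d = "\<lambda>x. grad \<psi> x $ i"
    have d: "test_fun UNIV ?d" by (rule test_fun_grad_nth[OF \<psi>])
    have sa: "square_integrable (\<lambda>x. \<psi> x *\<^sub>R axis i (1::real))"
      by (rule square_integrable_linear[OF bounded_linear_scaleR_left test_fun_square_integrable[OF \<psi>]])
    have E: "inner (l2_of (W m k)) (l2_of ?d) = - inner (l2_of (grad (\<phi> k))) (l2_of (\<lambda>x. \<psi> x *\<^sub>R axis i 1))" for k
    proof -
      have "inner (l2_of (W m k)) (l2_of ?d) = (LINT x|lebesgue. \<phi> k x * ?d x - ball_mean (\<phi> k) * ?d x)"
        unfolding inner_l2_of[OF sW test_fun_square_integrable[OF d]]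
      proof (rule Bochner_Integration.integral_cong[OF refl])
        show "W m k x \<bullet> ?d x = \<phi> k x * ?d x - ball_mean (\<phi> k) * ?d x" for x
          using K(3)[of x] m by (cases "x \<in> K") (auto simp: W_def left_diff_distrib)
      qed
      also have "\<dots> = (LINT x|lebesgue. \<phi> k x * ?d x) - ball_mean (\<phi> k) * (LINT x|lebesgue. ?d x)"
        using square_integrable_mult_integrable[OF test_fun_square_integrable[OF \<phi>(1)] test_fun_square_integrable[OF d]] test_fun_integrable[OF d]
        by simp
      \<comment> \<open>Here the subtracted mean drops out.\<close>
      also have "(LINT x|lebesgue. ?d x) = 0" using integral_grad_eq_0[OF \<psi>, of "axis i 1"] by (simp add: inner_axis)
      also have "(LINT x|lebesgue. \<phi> k x * ?d x) = - (LINT x|lebesgue. (grad (\<phi> k) x \<bullet> axis i 1) * \<psi> x)"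
        using integration_by_parts[OF \<phi>(1)[of k] \<psi>, of "axis i 1"] by (simp add: inner_axis)
      also have "(LINT x|lebesgue. (grad (\<phi> k) x \<bullet> axis i 1) * \<psi> x) = inner (l2_of (grad (\<phi> k))) (l2_of (\<lambda>x. \<psi> x *\<^sub>R axis i 1))"
        unfolding inner_l2_of[OF test_fun_grad_square_integrable[OF \<phi>(1)] sa] by (simp add: mult.commute)
      finally show ?thesis by simp
    qed
    have l1: "(\<lambda>k. inner (l2_of (W m k)) (l2_of ?d)) \<longlonglongrightarrow> inner (q m) (l2_of ?d)" by (intro tendsto_inner q tendsto_const)
    have l2: "(\<lambda>k. - inner (l2_of (grad (\<phi> k))) (l2_of (\<lambda>x. \<psi> x *\<^sub>R axis i 1))) \<longlonglongrightarrow> - inner G (l2_of (\<lambda>x. \<psi> x *\<^sub>R axis i 1))"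
      using u(2) unfolding \<phi>(2) by (intro tendsto_minus tendsto_inner tendsto_const)
    have "inner (q m) (l2_of ?d) = - inner G (l2_of (\<lambda>x. \<psi> x *\<^sub>R axis i 1))"
      by (rule LIMSEQ_unique[OF l1[unfolded E] l2])
    moreover have "inner (q m) (l2_of ?d) = (LINT x|lebesgue. Q x * ?d x)"
    proof -
      have "inner (q m) (l2_of ?d) = (LINT x|lebesgue. fun_of (q m) x * ?d x)"
        using inner_l2_of[OF fun_of(1)[of "q m"] test_fun_square_integrable[OF d]] by (simp add: fun_of)
      also have "\<dots> = (LINT x|lebesgue. Q x * ?d x)"
      proof (rule integral_cong_AE)
        show "AE x in lebesgue. fun_of (q m) x * ?d x = Q x * ?d x"
          using Qq
        proof eventually_elim
          case (elim x)
          then show ?case using K(3)[of x] m by (cases "x \<in> K") auto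
        qed
      qed (intro borel_measurable_times Q_meas square_integrable_measurable[OF fun_of(1)]
          square_integrable_measurable[OF test_fun_square_integrable[OF d]])+
      finally show ?thesis .
    qed
    moreover have "inner G (l2_of (\<lambda>x. \<psi> x *\<^sub>R axis i 1)) = (LINT x|lebesgue. fun_of G x $ i * \<psi> x)"
      using inner_l2_of[OF sG(1) sa] sG(2) by (simp add: inner_axis mult.commute)
    ultimately show ?thesis by simp
  qed
  have "weak_grad UNIV Q (fun_of G)"
    unfolding weak_grad_def loc_integrable_def
  proof (intro conjI allI impI)
    fix K :: "(real^'n) set" assume "compact K \<and> K \<subseteq> UNIV"
    then have K: "compact K" by simp
    have Kl: "K \<in> lmeasurable" by (rule lmeasurable_compact[OF K])
    show "integrable (lebesgue_on K) Q" by (rule square_integrable_on_integrable[OF Kl sQK[OF K]])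
    show "integrable (lebesgue_on K) (fun_of G)"
      using Kl by (intro square_integrable_on_integrable square_integrable_indicator sG) auto
  next
    fix \<psi> :: "real^'n \<Rightarrow> real" and i assume "test_fun UNIV \<psi>"
    then show "integral\<^sup>L (lebesgue_on UNIV) (\<lambda>x. Q x * grad \<psi> x $ i) = - integral\<^sup>L (lebesgue_on UNIV) (\<lambda>x. fun_of G x $ i * \<psi> x)"
      using weak by (simp add: lebesgue_on_UNIV_eq)
  qed
  moreover have "L2 K Q" if K: "compact K" for K
    using sQK[OF K] fmeasurableD[OF lmeasurable_compact[OF K]] by (simp add: L2_iff)
  ultimately have "Hdot Q (fun_of G)" using sG(1) by (auto simp: Hdot_def L2v_UNIV)
  then show ?thesis by (intro exI[of _ Q])
qed

lemma Hdot_square_integrable: "Hdot v g \<Longrightarrow> square_integrable g"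
  by (simp add: Hdot_def L2v_UNIV)

lemma Hdot_in_grad_space: "Hdot v g \<Longrightarrow> l2_of g \<in> grad_space"
  using weak_gradient_in_grad_space Hdot_square_integrable by (auto simp: Hdot_def)

section \<open>Matrix fields and the corrector problem\<close>

lemma bounded_bilinear_matrix_vector_mult:
  "bounded_bilinear ((*v) :: real^'n^'m \<Rightarrow> real^'n \<Rightarrow> real^'m)"
  unfolding bilinear_conv_bounded_bilinear[symmetric] bilinear_def
  by (auto simp: matrix_vector_mul_linear matrix_vector_mult_add_rdistrib scaleR_matrix_vector_assoc intro!: linearI)

definition bounded_matrix_field :: "('a::euclidean_space \<Rightarrow> real^'n^'n) \<Rightarrow> bool" where
  "bounded_matrix_field M \<longleftrightarrow> M \<in> borel_measurable lebesgue \<and> (\<exists>C. \<forall>x. norm (M x) \<le> C)"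

lemma bounded_matrix_field_bounded_field:
  fixes M :: "'a::euclidean_space \<Rightarrow> real^'n^'n"
  assumes "bounded_matrix_field M" shows "\<exists>C. bounded_field C (\<lambda>x v. M x *v v)"
proof -
  obtain K where K: "K > 0" "\<And>A :: real^'n^'n. \<And>v. norm (A *v v) \<le> norm A * norm v * K"
    using bounded_bilinear.pos_bounded[OF bounded_bilinear_matrix_vector_mult] by blast
  obtain C where C: "\<And>x. norm (M x) \<le> C" and M: "M \<in> borel_measurable lebesgue"
    using assms by (auto simp: bounded_matrix_field_def)
  have C0: "0 \<le> C" using C norm_ge_zero order_trans by blast
  have "bounded_field (C * K) (\<lambda>x v. M x *v v)"
    unfolding bounded_field_def
  proof (intro conjI allI impI)
    show "0 \<le> C * K" using C0 K(1) by simp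
    show "linear ((*v) (M x))" for x by (rule matrix_vector_mul_linear)
    show "norm (M x *v v) \<le> C * K * norm v" for x v
    proof -
      have "norm (M x) * norm v * K \<le> C * norm v * K" using C K(1) by (intro mult_right_mono) auto
      with K(2)[of "M x" v] show ?thesis by (simp add: mult.commute mult.left_commute)
    qed
    show "(\<lambda>x. M x *v f x) \<in> borel_measurable lebesgue" if "f \<in> borel_measurable lebesgue" for f
      by (rule borel_measurable_continuous_Pair[OF M that])
         (intro bounded_bilinear.continuous_on[OF bounded_bilinear_matrix_vector_mult] continuous_intros)
  qed
  then show ?thesis by blast
qed

definition matrix_op :: "('a::euclidean_space \<Rightarrow> real^'n^'n) \<Rightarrow> ('a, real^'n) l2 \<Rightarrow> ('a, real^'n) l2" where
  "matrix_op M = pointwise_op (\<lambda>x v. M x *v v)"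

lemma
  assumes "bounded_matrix_field M"
  shows bounded_linear_matrix_op: "bounded_linear (matrix_op M)"
    and matrix_op_l2_of: "square_integrable f \<Longrightarrow> matrix_op M (l2_of f) = l2_of (\<lambda>x. M x *v f x)"
    and square_integrable_matrix: "square_integrable f \<Longrightarrow> square_integrable (\<lambda>x. M x *v f x)"
  using bounded_matrix_field_bounded_field[OF assms] bounded_linear_pointwise_op pointwise_op_l2_of square_integrable_field
  unfolding matrix_op_def by blast+

lemma bounded_matrix_field_transpose:
  fixes M :: "'a::euclidean_space \<Rightarrow> real^'n^'n"
  assumes "bounded_matrix_field M" shows "bounded_matrix_field (\<lambda>x. transpose (M x))"
proof -
  have "linear (transpose :: real^'n^'n \<Rightarrow> _)" by (rule linearI) (auto simp: transpose_def vec_eq_iff)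
  then have bl: "bounded_linear (transpose :: real^'n^'n \<Rightarrow> _)" by (simp add: linear_conv_bounded_linear)
  obtain K where K: "K > 0" "\<And>A :: real^'n^'n. norm (transpose A) \<le> norm A * K" using bounded_linear.pos_bounded[OF bl] by blast
  obtain C where C: "\<And>x. norm (M x) \<le> C" and M: "M \<in> borel_measurable lebesgue"
    using assms by (auto simp: bounded_matrix_field_def)
  have "norm (transpose (M x)) \<le> C * K" for x
    using K(2)[of "M x"] mult_right_mono[OF C[of x], of K] K(1) by linarith
  then show ?thesis unfolding bounded_matrix_field_def
    using borel_measurable_continuous_on[OF linear_continuous_on[OF bl] M] by blast
qed

lemma inner_transpose: "(A *v x) \<bullet> y = x \<bullet> (transpose A *v y)" for A :: "real^'n^'n"
  by (simp add: dot_lmul_matrix[symmetric] inner_commute)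

lemma inner_matrix_op_transpose:
  assumes M: "bounded_matrix_field M"
  shows "inner (matrix_op M U) W = inner U (matrix_op (\<lambda>x. transpose (M x)) W)"
proof (cases U rule: l2_cases, cases W rule: l2_cases)
  note MT = bounded_matrix_field_transpose[OF M]
  fix f g assume *: "square_integrable f" "U = l2_of f" "square_integrable g" "W = l2_of g"
  show ?thesis
    unfolding *(2,4) matrix_op_l2_of[OF M *(1)] matrix_op_l2_of[OF MT *(3)]
      inner_l2_of[OF square_integrable_matrix[OF M *(1)] *(3)] inner_l2_of[OF *(1) square_integrable_matrix[OF MT *(3)]] inner_transpose ..
qed

lemma coercive_matrix_op:
  assumes M: "bounded_matrix_field M" and coer: "\<And>x. coercive_mat \<alpha> (M x)"
  shows "\<alpha> * (norm U)\<^sup>2 \<le> inner (matrix_op M U) U"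
proof (cases U rule: l2_cases)
  case (1 f)
  note f = 1(1)
  have "\<alpha> * (norm U)\<^sup>2 = (LINT x|lebesgue. \<alpha> * (norm (f x))\<^sup>2)" using 1 by (simp add: norm_l2_of)
  also have "\<dots> \<le> (LINT x|lebesgue. (M x *v f x) \<bullet> f x)"
  proof (rule integral_mono)
    show "integrable lebesgue (\<lambda>x. \<alpha> * (norm (f x))\<^sup>2)" using f by (simp add: square_integrable_def)
    show "integrable lebesgue (\<lambda>x. (M x *v f x) \<bullet> f x)" by (intro square_integrable_inner square_integrable_matrix[OF M] f)
    show "\<alpha> * (norm (f x))\<^sup>2 \<le> (M x *v f x) \<bullet> f x" for x using coer[of x] by (simp add: coercive_mat_def inner_commute)
  qed
  also have "\<dots> = inner (matrix_op M U) U"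
    unfolding 1(2) matrix_op_l2_of[OF M f] by (rule inner_l2_of[symmetric]) (intro square_integrable_matrix[OF M] f)+
  finally show ?thesis .
qed

lemma coercive_mat_transpose: "coercive_mat \<alpha> A \<Longrightarrow> coercive_mat \<alpha> (transpose A)"
  unfolding coercive_mat_def by (metis inner_commute inner_transpose)

lemma bounded_matrix_field_atilde:
  assumes "\<omega> \<in> sets lebesgue" shows "bounded_matrix_field (atilde A b \<omega>)"
  unfolding bounded_matrix_field_def
proof
  show "atilde A b \<omega> \<in> borel_measurable lebesgue"
    unfolding atilde_def[abs_def] using assms
    by (intro borel_measurable_add borel_measurable_scaleR borel_measurable_indicator borel_measurable_const) auto
  show "\<exists>C. \<forall>x. norm (atilde A b \<omega> x) \<le> C"
    by (rule exI[of _ "max (norm A) (norm b)"]) (auto simp: atilde_def indicator_def)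
qed

lemma coercive_atilde: "coercive_mat \<alpha> A \<Longrightarrow> coercive_mat \<alpha> b \<Longrightarrow> coercive_mat \<alpha> (atilde A b \<omega> x)"
  by (auto simp: atilde_def indicator_def)

text \<open>The Hilbert space form of the corrector problem: the integral of the test gradient over
  \<omega> becomes the inner product with a constant vector times the indicator. One direction needs
  a potential for every element of \<open>grad_space\<close>, the other the density of gradients of
  test functions.\<close>

lemma corrector_eq_iff:
  fixes \<omega> :: "(real^'n) set"
  assumes \<omega>: "\<omega> \<in> lmeasurable" and Q: "Hdot Q gQ"
  shows "corrector_eq A b P \<omega> Q gQ \<longleftrightarrow> (\<forall>V\<in>grad_space. inner (matrix_op (atilde A b \<omega>) V) (l2_of gQ)
    = - inner V (l2_of (\<lambda>x. indicator \<omega> x *\<^sub>R (transpose (b - A) *v P))))"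
proof -
  let ?M = "atilde A b \<omega>" and ?c = "transpose (b - A) *v P"
  have M: "bounded_matrix_field ?M" using \<omega> by (intro bounded_matrix_field_atilde) auto
  have sc: "square_integrable (\<lambda>x. indicator \<omega> x *\<^sub>R ?c)" by (rule square_integrable_indicator_const[OF \<omega>])
  have eq: "(integral\<^sup>L lebesgue (\<lambda>x. (?M x *v gv x) \<bullet> gQ x) + ((b - A) *v integral\<^sup>L (lebesgue_on \<omega>) gv) \<bullet> P = 0)
      \<longleftrightarrow> inner (matrix_op ?M (l2_of gv)) (l2_of gQ) = - inner (l2_of gv) (l2_of (\<lambda>x. indicator \<omega> x *\<^sub>R ?c))"
    if sg: "square_integrable gv" for gv
  proof -
    have ig: "integrable lebesgue (\<lambda>x. indicator \<omega> x *\<^sub>R gv x)"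
      using square_integrable_on_integrable[OF \<omega> square_integrable_indicator[OF fmeasurableD[OF \<omega>] sg]] \<omega>
      by (simp add: integrable_lebesgue_on_iff)
    have "((b - A) *v integral\<^sup>L (lebesgue_on \<omega>) gv) \<bullet> P = (LINT x|lebesgue. indicator \<omega> x *\<^sub>R gv x) \<bullet> ?c"
      using \<omega> by (simp add: inner_transpose integrable_lebesgue_on_iff)
    also have "\<dots> = (LINT x|lebesgue. gv x \<bullet> (indicator \<omega> x *\<^sub>R ?c))"
      using integral_inner_left[OF ig, of ?c] by simp
    also have "\<dots> = inner (l2_of gv) (l2_of (\<lambda>x. indicator \<omega> x *\<^sub>R ?c))" by (rule inner_l2_of[OF sg sc, symmetric])
    finally show ?thesis
      unfolding matrix_op_l2_of[OF M sg]
        inner_l2_of[OF square_integrable_matrix[OF M sg] Hdot_square_integrable[OF Q]] by linarith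
  qed
  show ?thesis unfolding corrector_eq_def
  proof (intro iffI conjI ballI allI impI Q)
    assume *: "Hdot Q gQ \<and> (\<forall>v gv. Hdot v gv \<longrightarrow>
        integral\<^sup>L lebesgue (\<lambda>x. (?M x *v gv x) \<bullet> gQ x) + ((b - A) *v integral\<^sup>L (lebesgue_on \<omega>) gv) \<bullet> P = 0)"
    fix V :: "(real^'n, real^'n) l2" assume "V \<in> grad_space"
    then obtain v where "Hdot v (fun_of V)" using Hdot_of_grad_space by blast
    with * eq[OF fun_of(1)[of V]]
    show "inner (matrix_op ?M V) (l2_of gQ) = - inner V (l2_of (\<lambda>x. indicator \<omega> x *\<^sub>R ?c))" by (simp add: fun_of)
  next
    assume *: "\<forall>V\<in>grad_space. inner (matrix_op ?M V) (l2_of gQ) = - inner V (l2_of (\<lambda>x. indicator \<omega> x *\<^sub>R ?c))"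
    fix v and gv :: "real^'n \<Rightarrow> real^'n" assume v: "Hdot v gv"
    then show "integral\<^sup>L lebesgue (\<lambda>x. (?M x *v gv x) \<bullet> gQ x) + ((b - A) *v integral\<^sup>L (lebesgue_on \<omega>) gv) \<bullet> P = 0"
      using * eq[OF Hdot_square_integrable[OF v]] Hdot_in_grad_space[OF v] by blast
  qed
qed

text \<open>The unknown stands in the second slot of the form and the test function under the
  coefficient, so Lax-Milgram is applied to the transposed field.\<close>

lemma corrector_exists:
  fixes \<omega> :: "(real^'n) set"
  assumes \<omega>: "\<omega> \<in> lmeasurable" and \<alpha>: "\<alpha> > 0" and A: "coercive_mat \<alpha> A" and b: "coercive_mat \<alpha> b"
  shows "\<exists>Q gQ. corrector_eq A b P \<omega> Q gQ"
proof -
  let ?M = "atilde A b \<omega>" and ?F = "l2_of (\<lambda>x. indicator \<omega> x *\<^sub>R (transpose (b - A) *v P))"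
  have M: "bounded_matrix_field ?M" using \<omega> by (intro bounded_matrix_field_atilde) auto
  note MT = bounded_matrix_field_transpose[OF M]
  have "\<exists>G\<in>grad_space. \<forall>V\<in>grad_space. inner (matrix_op (\<lambda>x. transpose (?M x)) G) V = inner (- ?F) V"
    by (rule lax_milgram[OF subspace_grad_space closed_grad_space bounded_linear_matrix_op[OF MT] \<alpha>])
       (intro coercive_matrix_op[OF MT] coercive_mat_transpose coercive_atilde A b)
  then obtain G where G: "G \<in> grad_space" "\<And>V. V \<in> grad_space \<Longrightarrow> inner (matrix_op (\<lambda>x. transpose (?M x)) G) V = - inner ?F V"
    by auto
  obtain Q where Q: "Hdot Q (fun_of G)" using Hdot_of_grad_space[OF G(1)] by blast
  have "corrector_eq A b P \<omega> Q (fun_of G)"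
    unfolding corrector_eq_iff[OF \<omega> Q]
  proof
    fix V :: "(real^'n, real^'n) l2" assume V: "V \<in> grad_space"
    have "inner (matrix_op ?M V) G = inner (matrix_op (\<lambda>x. transpose (?M x)) G) V"
      by (subst inner_matrix_op_transpose[OF M]) (rule inner_commute)
    then show "inner (matrix_op ?M V) (l2_of (fun_of G)) = - inner V ?F" using G(2)[OF V] by (simp add: fun_of inner_commute)
  qed
  then show ?thesis by blast
qed

lemma corrector_unique:
  fixes \<omega> :: "(real^'n) set"
  assumes \<omega>: "\<omega> \<in> lmeasurable" and \<alpha>: "\<alpha> > 0" and A: "coercive_mat \<alpha> A" and b: "coercive_mat \<alpha> b"
    and Q1: "corrector_eq A b P \<omega> Q1 g1" and Q2: "corrector_eq A b P \<omega> Q2 g2"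
  shows "AE x in lebesgue. g1 x = g2 x"
proof -
  let ?M = "atilde A b \<omega>"
  have M: "bounded_matrix_field ?M" using \<omega> by (intro bounded_matrix_field_atilde) auto
  have H: "Hdot Q1 g1" "Hdot Q2 g2" using Q1 Q2 by (auto simp: corrector_eq_def)
  define D where "D = l2_of g1 - l2_of g2"
  have D: "D \<in> grad_space" unfolding D_def by (intro subspace_diff subspace_grad_space Hdot_in_grad_space[OF H(1)] Hdot_in_grad_space[OF H(2)])
  have "inner (matrix_op ?M D) D = 0"
    using Q1 Q2 D unfolding corrector_eq_iff[OF \<omega> H(1)] corrector_eq_iff[OF \<omega> H(2)] by (simp add: D_def inner_diff_right)
  moreover have "\<alpha> * (norm D)\<^sup>2 \<le> inner (matrix_op ?M D) D"
    by (intro coercive_matrix_op[OF M] coercive_atilde A b)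
  ultimately have "D = 0" using \<alpha> by (simp add: mult_le_0_iff)
  then show ?thesis unfolding D_def using l2_of_eq_iff[OF Hdot_square_integrable[OF H(1)] Hdot_square_integrable[OF H(2)]] by simp
qed

section \<open>The Sobolev space with zero boundary values\<close>

text \<open>The Sobolev space as a subspace of a single L2 space of pairs, with the graph norm and
  extension by zero built in.\<close>

definition H10_space :: "(real^'n) set \<Rightarrow> ((real^'n, real \<times> (real^'n)) l2) set" where
  "H10_space \<Omega> = closure {l2_of (\<lambda>x. (\<phi> x, grad \<phi> x)) |\<phi>. test_fun \<Omega> \<phi>}"

definition fst_op :: "('a::euclidean_space, 'b::euclidean_space \<times> 'c::euclidean_space) l2 \<Rightarrow> ('a, 'b) l2" where
  "fst_op = pointwise_op (\<lambda>x. fst)"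

definition snd_op :: "('a::euclidean_space, 'b::euclidean_space \<times> 'c::euclidean_space) l2 \<Rightarrow> ('a, 'c) l2" where
  "snd_op = pointwise_op (\<lambda>x. snd)"

lemma bounded_linear_fst_op: "bounded_linear fst_op" and bounded_linear_snd_op: "bounded_linear snd_op"
  unfolding fst_op_def snd_op_def
  using bounded_field_const[OF bounded_linear_fst] bounded_field_const[OF bounded_linear_snd] bounded_linear_pointwise_op by blast+

lemma
  assumes "square_integrable (\<lambda>x. (u x, g x))"
  shows fst_op_l2_of: "fst_op (l2_of (\<lambda>x. (u x, g x))) = l2_of u" and snd_op_l2_of: "snd_op (l2_of (\<lambda>x. (u x, g x))) = l2_of g"
    and square_integrable_fst: "square_integrable u" and square_integrable_snd: "square_integrable g"
proof -
  obtain C C' where C: "bounded_field C (\<lambda>x::'a. fst :: 'b \<times> 'c \<Rightarrow> 'b)" "bounded_field C' (\<lambda>x::'a. snd :: 'b \<times> 'c \<Rightarrow> 'c)"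
    using bounded_field_const[OF bounded_linear_fst] bounded_field_const[OF bounded_linear_snd] by blast
  show "fst_op (l2_of (\<lambda>x. (u x, g x))) = l2_of u" "snd_op (l2_of (\<lambda>x. (u x, g x))) = l2_of g"
    unfolding fst_op_def snd_op_def pointwise_op_l2_of[OF C(1) assms] pointwise_op_l2_of[OF C(2) assms] by simp_all
  show "square_integrable u" "square_integrable g"
    using square_integrable_field[OF C(1) assms] square_integrable_field[OF C(2) assms] by simp_all
qed

lemma square_integrable_Pair:
  assumes "square_integrable u" "square_integrable g" shows "square_integrable (\<lambda>x. (u x, g x))"
proof -
  have 1: "bounded_linear (\<lambda>v::'b. (v, 0::'c))" and 2: "bounded_linear (\<lambda>v::'c. (0::'b, v))"
    by (intro bounded_linear_Pair bounded_linear_ident bounded_linear_zero)+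
  show ?thesis using square_integrable_add[OF square_integrable_linear[OF 1 assms(1)] square_integrable_linear[OF 2 assms(2)]] by simp
qed

lemma inner_fst_snd_op: "inner U W = inner (fst_op U) (fst_op W) + inner (snd_op U) (snd_op W)"
proof (cases U rule: l2_cases, cases W rule: l2_cases)
  fix f h assume "square_integrable f" "U = l2_of f" "square_integrable h" "W = l2_of h"
  moreover obtain u g where f: "f = (\<lambda>x. (u x, g x))" using that[of "fst \<circ> f" "snd \<circ> f"] by simp
  moreover obtain v k where h: "h = (\<lambda>x. (v x, k x))" using that[of "fst \<circ> h" "snd \<circ> h"] by simp
  ultimately have s: "square_integrable (\<lambda>x. (u x, g x))" "square_integrable (\<lambda>x. (v x, k x))"
    and U: "U = l2_of (\<lambda>x. (u x, g x))" "W = l2_of (\<lambda>x. (v x, k x))" by auto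
  note s' = square_integrable_fst[OF s(1)] square_integrable_snd[OF s(1)] square_integrable_fst[OF s(2)] square_integrable_snd[OF s(2)]
  show ?thesis unfolding U fst_op_l2_of[OF s(1)] fst_op_l2_of[OF s(2)] snd_op_l2_of[OF s(1)] snd_op_l2_of[OF s(2)]
      inner_l2_of[OF s] inner_l2_of[OF s'(1,3)] inner_l2_of[OF s'(2,4)] inner_Pair
    by (intro Bochner_Integration.integral_add square_integrable_inner s')
qed

lemma norm_fst_snd_op: "(norm U)\<^sup>2 = (norm (fst_op U))\<^sup>2 + (norm (snd_op U))\<^sup>2"
  by (simp add: power2_norm_eq_inner inner_fst_snd_op[of U U])

lemma closed_H10_space: "closed (H10_space \<Omega>)" by (simp add: H10_space_def)

lemma test_fun_pair_square_integrable: "test_fun U \<phi> \<Longrightarrow> square_integrable (\<lambda>x. (\<phi> x, grad \<phi> x))"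
  by (intro square_integrable_Pair test_fun_square_integrable test_fun_grad_square_integrable)

lemma test_fun_in_H10_space: "test_fun \<Omega> \<phi> \<Longrightarrow> l2_of (\<lambda>x. (\<phi> x, grad \<phi> x)) \<in> H10_space \<Omega>"
  unfolding H10_space_def by (rule subsetD[OF closure_subset]) blast

lemma subspace_H10_space: "subspace (H10_space (\<Omega> :: (real^'n) set))"
  unfolding H10_space_def
proof (rule subspace_closure, unfold subspace_def, intro conjI ballI allI)
  let ?S = "{l2_of (\<lambda>x. (\<phi> x, grad \<phi> x)) |\<phi> :: real^'n \<Rightarrow> real. test_fun \<Omega> \<phi>}"
  have "l2_of (\<lambda>x. (0, grad (\<lambda>x::real^'n. 0) x)) = (0 :: (real^'n, real \<times> (real^'n)) l2)"
    unfolding grad_zero zero_prod_def[symmetric] by (rule l2_of_zero)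
  then show "0 \<in> ?S" using test_fun_zero[of \<Omega>] by (intro CollectI exI[of _ "\<lambda>x. 0"]) simp
  show "x + y \<in> ?S" if xy: "x \<in> ?S" "y \<in> ?S" for x y
  proof -
    obtain \<phi> \<psi> where *: "test_fun \<Omega> \<phi>" "x = l2_of (\<lambda>x. (\<phi> x, grad \<phi> x))" "test_fun \<Omega> \<psi>" "y = l2_of (\<lambda>x. (\<psi> x, grad \<psi> x))"
      using xy by blast
    have "x + y = l2_of (\<lambda>z. (\<phi> z + \<psi> z, grad (\<lambda>x. \<phi> x + \<psi> x) z))"
      unfolding grad_add[OF test_fun_smooth[OF *(1)] test_fun_smooth[OF *(3)]]
      using * by (simp add: l2_of_add test_fun_pair_square_integrable)
    with test_fun_add[OF *(1,3)] show ?thesis by (intro CollectI exI[of _ "\<lambda>x. \<phi> x + \<psi> x"]) simp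
  qed
  show "c *\<^sub>R x \<in> ?S" if xS: "x \<in> ?S" for c x
  proof -
    obtain \<phi> where *: "test_fun \<Omega> \<phi>" "x = l2_of (\<lambda>x. (\<phi> x, grad \<phi> x))" using xS by blast
    have "c *\<^sub>R x = l2_of (\<lambda>z. (c * \<phi> z, grad (\<lambda>x. c * \<phi> x) z))"
      unfolding grad_scale[OF test_fun_smooth[OF *(1)]] using * by (simp add: l2_of_scaleR test_fun_pair_square_integrable)
    with test_fun_scale[OF *(1)] show ?thesis by (intro CollectI exI[of _ "\<lambda>x. c * \<phi> x"]) simp
  qed
qed

lemma H10_space_induct:
  assumes U: "U \<in> H10_space \<Omega>" and cl: "closed {U. P U}"
    and test: "\<And>\<phi>. test_fun \<Omega> \<phi> \<Longrightarrow> P (l2_of (\<lambda>x. (\<phi> x, grad \<phi> x)))"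
  shows "P U"
proof -
  have "H10_space \<Omega> \<subseteq> {U. P U}" unfolding H10_space_def by (rule closure_minimal[OF _ cl]) (use test in blast)
  with U show ?thesis by blast
qed

lemma poincare_H10_space:
  fixes \<Omega> :: "(real^'n) set"
  assumes "bounded \<Omega>"
  obtains C where "C > 0" "\<And>U. U \<in> H10_space \<Omega> \<Longrightarrow> norm (fst_op U) \<le> C * norm (snd_op U)"
proof -
  obtain C where C: "C > 0" "\<And>\<phi>. test_fun \<Omega> \<phi> \<Longrightarrow> norm (l2_of \<phi>) \<le> C * norm (l2_of (grad \<phi>))"
    using poincare_test_fun[OF assms] by blast
  have "norm (fst_op U) \<le> C * norm (snd_op U)" if "U \<in> H10_space \<Omega>" for U
    using that
  proof (rule H10_space_induct)
    show "closed {U :: (real^'n, real \<times> (real^'n)) l2. norm (fst_op U) \<le> C * norm (snd_op U)}"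
      by (intro closed_Collect_le continuous_intros linear_continuous_on bounded_linear_fst_op bounded_linear_snd_op)
    show "norm (fst_op (l2_of (\<lambda>x. (\<phi> x, grad \<phi> x)))) \<le> C * norm (snd_op (l2_of (\<lambda>x. (\<phi> x, grad \<phi> x))))" if "test_fun \<Omega> \<phi>" for \<phi>
      using C(2)[OF that] by (simp add: fst_op_l2_of snd_op_l2_of test_fun_pair_square_integrable[OF that])
  qed
  with C(1) show ?thesis using that by blast
qed

lemma snd_op_in_grad_space:
  assumes "U \<in> H10_space \<Omega>" shows "snd_op U \<in> grad_space"
  using assms
proof (rule H10_space_induct)
  have "closed (snd_op -` grad_space)"
    by (rule continuous_closed_vimage[OF closed_grad_space]) (simp add: linear_continuous_at bounded_linear_snd_op)
  then show "closed {U. snd_op U \<in> grad_space}" by (simp add: vimage_def)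
  show "snd_op (l2_of (\<lambda>x. (\<phi> x, grad \<phi> x))) \<in> grad_space" if "test_fun \<Omega> \<phi>" for \<phi>
    using grad_test_fun_in_grad_space[OF test_fun_mono[OF that]] by (simp add: snd_op_l2_of test_fun_pair_square_integrable[OF that])
qed

definition ext_pair :: "(real^'n) set \<Rightarrow> (real^'n \<Rightarrow> real) \<Rightarrow> (real^'n \<Rightarrow> real^'n) \<Rightarrow> (real^'n, real \<times> (real^'n)) l2" where
  "ext_pair \<Omega> u g = l2_of (\<lambda>x. (indicator \<Omega> x *\<^sub>R u x, indicator \<Omega> x *\<^sub>R g x))"

lemma H10_square_integrable:
  assumes "H10 \<Omega> u g" "open \<Omega>"
  shows "square_integrable (\<lambda>x. indicator \<Omega> x *\<^sub>R u x)" "square_integrable (\<lambda>x. indicator \<Omega> x *\<^sub>R g x)"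
    "square_integrable (\<lambda>x. (indicator \<Omega> x *\<^sub>R u x, indicator \<Omega> x *\<^sub>R g x))"
proof -
  have "\<Omega> \<in> sets lebesgue" using assms(2) by auto
  then show 1: "square_integrable (\<lambda>x. indicator \<Omega> x *\<^sub>R u x)" "square_integrable (\<lambda>x. indicator \<Omega> x *\<^sub>R g x)"
    using assms(1) L2_iff[of \<Omega> u] L2v_iff[of \<Omega> g] by (auto simp: H10_def)
  show "square_integrable (\<lambda>x. (indicator \<Omega> x *\<^sub>R u x, indicator \<Omega> x *\<^sub>R g x))" by (intro square_integrable_Pair 1)
qed

lemma
  assumes "H10 \<Omega> u g" "open \<Omega>"
  shows fst_op_ext_pair: "fst_op (ext_pair \<Omega> u g) = l2_of (\<lambda>x. indicator \<Omega> x *\<^sub>R u x)"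
    and snd_op_ext_pair: "snd_op (ext_pair \<Omega> u g) = l2_of (\<lambda>x. indicator \<Omega> x *\<^sub>R g x)"
  unfolding ext_pair_def using fst_op_l2_of[OF H10_square_integrable(3)[OF assms]] snd_op_l2_of[OF H10_square_integrable(3)[OF assms]] by auto

lemma ext_pair_in_H10_space:
  assumes H: "H10 \<Omega> u g" and \<Omega>: "open \<Omega>"
  shows "ext_pair \<Omega> u g \<in> H10_space \<Omega>"
proof -
  obtain \<phi> where \<phi>: "\<And>k. test_fun \<Omega> (\<phi> k)"
    "(\<lambda>k. integral\<^sup>L (lebesgue_on \<Omega>) (\<lambda>x. (u x - \<phi> k x)\<^sup>2 + (norm (g x - grad (\<phi> k) x))\<^sup>2)) \<longlonglongrightarrow> 0"
    using H by (auto simp: H10_def)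
  have \<Omega>m: "\<Omega> \<in> sets lebesgue" using \<Omega> by auto
  let ?u = "\<lambda>k. l2_of (\<lambda>x. (\<phi> k x, grad (\<phi> k) x))"
  have d: "(dist (?u k) (ext_pair \<Omega> u g))\<^sup>2 = integral\<^sup>L (lebesgue_on \<Omega>) (\<lambda>x. (u x - \<phi> k x)\<^sup>2 + (norm (g x - grad (\<phi> k) x))\<^sup>2)" for k
  proof -
    obtain K where K: "K \<subseteq> \<Omega>" "\<And>x. x \<notin> K \<Longrightarrow> \<phi> k x = 0" "\<And>x. x \<notin> K \<Longrightarrow> grad (\<phi> k) x = 0"
      using \<phi>(1)[of k] by (rule test_fun_support) blast
    have z: "\<phi> k x = 0" "grad (\<phi> k) x = 0" if "x \<notin> \<Omega>" for x using K that by blast+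
    show ?thesis
      unfolding ext_pair_def dist_l2_of[OF test_fun_pair_square_integrable[OF \<phi>(1)] H10_square_integrable(3)[OF H \<Omega>]]
        integrable_lebesgue_on_iff(2)[OF \<Omega>m]
      by (rule Bochner_Integration.integral_cong)
         (auto simp: indicator_def norm_Pair z norm_minus_commute power2_commute)
  qed
  have "(\<lambda>k. sqrt ((dist (?u k) (ext_pair \<Omega> u g))\<^sup>2)) \<longlonglongrightarrow> sqrt 0" unfolding d by (rule tendsto_real_sqrt[OF \<phi>(2)])
  then have "?u \<longlonglongrightarrow> ext_pair \<Omega> u g" by (subst tendsto_dist_iff) simp
  then show ?thesis using \<phi>(1) unfolding H10_space_def closure_sequential by (intro exI[of _ ?u]) blast
qed

text \<open>Cutting off outside the domain is continuous and fixes test functions, hence their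
  closure. So restricting to the domain and extending by zero loses nothing.\<close>

lemma H10_space_vanishes_outside:
  assumes U: "U \<in> H10_space \<Omega>" and \<Omega>: "open \<Omega>"
  shows "pointwise_op (\<lambda>x v. indicator \<Omega> x *\<^sub>R v) U = U"
  using U
proof (rule H10_space_induct)
  have \<Omega>m: "\<Omega> \<in> sets lebesgue" using \<Omega> by auto
  note bl = bounded_linear_pointwise_op[OF bounded_field_indicator[OF \<Omega>m]]
  show "closed {U :: (real^'a, real \<times> (real^'a)) l2. pointwise_op (\<lambda>x v. indicator \<Omega> x *\<^sub>R v) U = U}"
    by (intro closed_Collect_eq linear_continuous_on bl continuous_on_id)
  fix \<phi> assume \<phi>: "test_fun \<Omega> \<phi>"
  obtain K where K: "K \<subseteq> \<Omega>" "\<And>x. x \<notin> K \<Longrightarrow> \<phi> x = 0" "\<And>x. x \<notin> K \<Longrightarrow> grad \<phi> x = 0"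
    using \<phi> by (rule test_fun_support) blast
  have z: "\<phi> x = 0" "grad \<phi> x = 0" if "x \<notin> \<Omega>" for x using K that by blast+
  show "pointwise_op (\<lambda>x v. indicator \<Omega> x *\<^sub>R v) (l2_of (\<lambda>x. (\<phi> x, grad \<phi> x))) = l2_of (\<lambda>x. (\<phi> x, grad \<phi> x))"
    unfolding pointwise_op_l2_of[OF bounded_field_indicator[OF \<Omega>m] test_fun_pair_square_integrable[OF \<phi>]]
    by (intro arg_cong[of _ _ l2_of] ext) (auto simp: indicator_def z zero_prod_def)
qed

text \<open>Together with \<open>ext_pair_in_H10_space\<close> this turns quantification over
  \<open>H10\<close> functions into quantification over a closed subspace, where projection and
  Lax-Milgram are available.\<close>

lemma H10_of_H10_space:
  fixes \<Omega> :: "(real^'n) set"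
  assumes U: "U \<in> H10_space \<Omega>" and \<Omega>: "open \<Omega>"
  obtains u g where "H10 \<Omega> u g" "ext_pair \<Omega> u g = U"
proof -
  have \<Omega>m: "\<Omega> \<in> sets lebesgue" using \<Omega> by auto
  define u g where "u x = fst (fun_of U x)" and "g x = snd (fun_of U x)" for x
  have fU: "fun_of U = (\<lambda>x. (u x, g x))" by (simp add: u_def g_def)
  have s: "square_integrable (\<lambda>x. (u x, g x))" "U = l2_of (\<lambda>x. (u x, g x))" unfolding fU[symmetric] by (simp_all add: fun_of)
  note s' = square_integrable_fst[OF s(1)] square_integrable_snd[OF s(1)]
  have "ext_pair \<Omega> u g = pointwise_op (\<lambda>x v. indicator \<Omega> x *\<^sub>R v) U"
    unfolding s(2) pointwise_op_l2_of[OF bounded_field_indicator[OF \<Omega>m] s(1)] by (simp add: ext_pair_def)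
  also have "\<dots> = U" by (rule H10_space_vanishes_outside[OF U \<Omega>])
  finally have ext: "ext_pair \<Omega> u g = U" .
  have loc: "loc_integrable \<Omega> u" "loc_integrable \<Omega> g"
    unfolding loc_integrable_def using s'
    by (auto intro!: square_integrable_on_integrable square_integrable_indicator lmeasurable_compact fmeasurableD[OF lmeasurable_compact])
  have weak: "integral\<^sup>L (lebesgue_on \<Omega>) (\<lambda>x. u x * grad \<psi> x $ i) = - integral\<^sup>L (lebesgue_on \<Omega>) (\<lambda>x. g x $ i * \<psi> x)"
    if \<psi>: "test_fun \<Omega> \<psi>" for \<psi> i
  proof -
    obtain K where K: "K \<subseteq> \<Omega>" "\<And>x. x \<notin> K \<Longrightarrow> \<psi> x = 0" "\<And>x. x \<notin> K \<Longrightarrow> grad \<psi> x = 0"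
      using \<psi> by (rule test_fun_support) blast
    have z: "\<psi> x = 0" "grad \<psi> x = 0" if "x \<notin> \<Omega>" for x using K that by blast+
    have d: "test_fun \<Omega> (\<lambda>x. grad \<psi> x $ i)" by (rule test_fun_grad_nth[OF \<psi>])
    let ?T = "\<lambda>x. (grad \<psi> x $ i, \<psi> x *\<^sub>R axis i (1::real))"
    have sT: "square_integrable ?T"
      by (intro square_integrable_Pair test_fun_square_integrable[OF d] square_integrable_linear[OF bounded_linear_scaleR_left] test_fun_square_integrable[OF \<psi>])
    have pair: "inner (l2_of (\<lambda>x. (v x, h x))) (l2_of ?T) = (LINT x|lebesgue. v x * grad \<psi> x $ i) + (LINT x|lebesgue. h x $ i * \<psi> x)"
      if sv: "square_integrable (\<lambda>x. (v x, h x))" for v h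
    proof -
      note sv' = square_integrable_fst[OF sv] square_integrable_snd[OF sv]
      have "inner (l2_of (\<lambda>x. (v x, h x))) (l2_of ?T) = (LINT x|lebesgue. v x * grad \<psi> x $ i + h x $ i * \<psi> x)"
        unfolding inner_l2_of[OF sv sT] by (simp add: inner_axis mult.commute)
      also have "\<dots> = (LINT x|lebesgue. v x * grad \<psi> x $ i) + (LINT x|lebesgue. h x $ i * \<psi> x)"
        by (intro Bochner_Integration.integral_add square_integrable_mult_integrable sv' test_fun_square_integrable[OF d] test_fun_square_integrable[OF \<psi>] square_integrable_nth)
      finally show ?thesis .
    qed
    \<comment> \<open>The weak gradient identity for fixed \<psi> is orthogonality to one element of
      the pair space, a closed condition that integration by parts provides for test
      functions.\<close>
    have "inner U (l2_of ?T) = 0" using U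
    proof (rule H10_space_induct)
      show "closed {U. inner U (l2_of ?T) = 0}" by (intro closed_Collect_eq continuous_intros)
      show "inner (l2_of (\<lambda>x. (\<phi> x, grad \<phi> x))) (l2_of ?T) = 0" if \<phi>: "test_fun \<Omega> \<phi>" for \<phi>
        using integration_by_parts[OF \<phi> \<psi>, of "axis i 1"] unfolding pair[OF test_fun_pair_square_integrable[OF \<phi>]] by (simp add: inner_axis)
    qed
    then have "(LINT x|lebesgue. u x * grad \<psi> x $ i) = - (LINT x|lebesgue. g x $ i * \<psi> x)"
      unfolding s(2) pair[OF s(1)] by simp
    moreover have "integral\<^sup>L (lebesgue_on \<Omega>) (\<lambda>x. u x * grad \<psi> x $ i) = (LINT x|lebesgue. u x * grad \<psi> x $ i)"
      "integral\<^sup>L (lebesgue_on \<Omega>) (\<lambda>x. g x $ i * \<psi> x) = (LINT x|lebesgue. g x $ i * \<psi> x)"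
      unfolding integrable_lebesgue_on_iff(2)[OF \<Omega>m]
      by (auto intro!: Bochner_Integration.integral_cong simp: indicator_def z)
    ultimately show ?thesis by simp
  qed
  have "H10 \<Omega> u g" unfolding H10_def
  proof (intro conjI)
    show "weak_grad \<Omega> u g" unfolding weak_grad_def using loc weak by blast
    show "L2 \<Omega> u" "L2v \<Omega> g" unfolding L2_iff[OF \<Omega>m] L2v_iff[OF \<Omega>m] by (intro square_integrable_indicator \<Omega>m s')+
    obtain w where w: "\<And>k. w k \<in> {l2_of (\<lambda>x. (\<phi> x, grad \<phi> x)) |\<phi>. test_fun \<Omega> \<phi>}" "w \<longlonglongrightarrow> U"
      using U unfolding H10_space_def closure_sequential by blast
    then have "\<forall>k. \<exists>\<phi>. test_fun \<Omega> \<phi> \<and> w k = l2_of (\<lambda>x. (\<phi> x, grad \<phi> x))" by blast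
    then obtain \<phi> where \<phi>: "\<And>k. test_fun \<Omega> (\<phi> k)" "\<And>k. w k = l2_of (\<lambda>x. (\<phi> k x, grad (\<phi> k) x))" by metis
    have "(\<lambda>k. (dist (w k) U)\<^sup>2) \<longlonglongrightarrow> 0\<^sup>2" using w(2) by (intro tendsto_power) (simp add: tendsto_dist_iff[symmetric])
    then have lim: "(\<lambda>k. (dist (w k) U)\<^sup>2) \<longlonglongrightarrow> 0" by simp
    have le: "integral\<^sup>L (lebesgue_on \<Omega>) (\<lambda>x. (u x - \<phi> k x)\<^sup>2 + (norm (g x - grad (\<phi> k) x))\<^sup>2) \<le> (dist (w k) U)\<^sup>2" for k
    proof -
      let ?h = "\<lambda>x. (norm ((\<phi> k x, grad (\<phi> k) x) - (u x, g x)))\<^sup>2"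
      have "integrable lebesgue ?h"
        using square_integrable_diff[OF test_fun_pair_square_integrable[OF \<phi>(1)] s(1)] by (simp add: square_integrable_def)
      then have "(LINT x|lebesgue. indicator \<Omega> x * ?h x) \<le> (LINT x|lebesgue. ?h x)"
        by (intro integral_mono integrable_indicator_mult \<Omega>m) (auto simp: indicator_def)
      also have "(LINT x|lebesgue. ?h x) = (dist (w k) U)\<^sup>2"
        unfolding \<phi>(2) s(2) by (rule dist_l2_of[OF test_fun_pair_square_integrable[OF \<phi>(1)] s(1), symmetric])
      also have "(LINT x|lebesgue. indicator \<Omega> x * ?h x) = integral\<^sup>L (lebesgue_on \<Omega>) (\<lambda>x. (u x - \<phi> k x)\<^sup>2 + (norm (g x - grad (\<phi> k) x))\<^sup>2)"
        unfolding integrable_lebesgue_on_iff(2)[OF \<Omega>m]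
        by (rule Bochner_Integration.integral_cong) (auto simp: norm_Pair norm_minus_commute power2_commute)
      finally show ?thesis .
    qed
    have "(\<lambda>k. integral\<^sup>L (lebesgue_on \<Omega>) (\<lambda>x. (u x - \<phi> k x)\<^sup>2 + (norm (g x - grad (\<phi> k) x))\<^sup>2)) \<longlonglongrightarrow> 0"
      by (rule tendsto_sandwich[OF _ _ tendsto_const lim]) (auto intro!: always_eventually le integral_nonneg_AE)
    with \<phi>(1) show "\<exists>\<phi>. (\<forall>k. test_fun \<Omega> (\<phi> k)) \<and>
        (\<lambda>k. integral\<^sup>L (lebesgue_on \<Omega>) (\<lambda>x. (u x - \<phi> k x)\<^sup>2 + (norm (g x - grad (\<phi> k) x))\<^sup>2)) \<longlonglongrightarrow> 0" by blast
  qed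
  with ext show ?thesis using that by blast
qed

section \<open>Weak solutions\<close>

definition weak_solution :: "(real^'n) set \<Rightarrow> (real^'n \<Rightarrow> real^'n^'n) \<Rightarrow> (real^'n, real) l2 \<Rightarrow> (real^'n, real \<times> (real^'n)) l2 \<Rightarrow> bool" where
  "weak_solution \<Omega> M F U \<longleftrightarrow> U \<in> H10_space \<Omega> \<and>
     (\<forall>W\<in>H10_space \<Omega>. inner (matrix_op M (snd_op U)) (snd_op W) = inner F (fst_op W))"

definition adjoint_solution :: "(real^'n) set \<Rightarrow> (real^'n \<Rightarrow> real^'n^'n) \<Rightarrow> (real^'n, real) l2 \<Rightarrow> (real^'n, real \<times> (real^'n)) l2 \<Rightarrow> bool" where
  "adjoint_solution \<Omega> M F P \<longleftrightarrow> P \<in> H10_space \<Omega> \<and>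
     (\<forall>W\<in>H10_space \<Omega>. inner (matrix_op M (snd_op W)) (snd_op P) = inner F (fst_op W))"

lemma fst_op_add: "fst_op (U + W) = fst_op U + fst_op W" and fst_op_diff: "fst_op (U - W) = fst_op U - fst_op W"
  and snd_op_add: "snd_op (U + W) = snd_op U + snd_op W" and snd_op_diff: "snd_op (U - W) = snd_op U - snd_op W"
  by (simp_all add: bounded_linear.linear[OF bounded_linear_fst_op] bounded_linear.linear[OF bounded_linear_snd_op] linear_add linear_diff)

lemma matrix_op_diff: "bounded_matrix_field M \<Longrightarrow> matrix_op M (U - W) = matrix_op M U - matrix_op M W"
  by (simp add: bounded_linear.linear[OF bounded_linear_matrix_op] linear_diff)

lemma weak_solution_exists:
  assumes \<Omega>: "bounded \<Omega>" and \<alpha>: "\<alpha> > 0" and M: "bounded_matrix_field M" and coer: "\<And>x. coercive_mat \<alpha> (M x)"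
  shows "\<exists>U. weak_solution \<Omega> M F U"
proof -
  obtain C where C: "C > 0" "\<And>U. U \<in> H10_space \<Omega> \<Longrightarrow> norm (fst_op U) \<le> C * norm (snd_op U)"
    using poincare_H10_space[OF \<Omega>] by blast
  have bl: "bounded_linear (Pair 0 :: real^'a \<Rightarrow> real \<times> (real^'a))" "bounded_linear ((\<lambda>u. (u, 0)) :: real \<Rightarrow> real \<times> (real^'a))"
    by (intro bounded_linear_Pair bounded_linear_ident bounded_linear_zero)+
  obtain K1 where emb1: "bounded_field K1 (\<lambda>x::real^'a. Pair 0 :: real^'a \<Rightarrow> real \<times> (real^'a))"
    using bounded_field_const[OF bl(1)] by blast
  obtain K2 where emb2: "bounded_field K2 (\<lambda>x::real^'a. (\<lambda>u. (u, 0)) :: real \<Rightarrow> real \<times> (real^'a))"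
    using bounded_field_const[OF bl(2)] by blast
  note emb = emb1 emb2
  \<comment> \<open>\<open>E\<close> and \<open>E0\<close> are the adjoints of \<open>snd_op\<close>
    and \<open>fst_op\<close>. They express the bilinear form and the source as inner products on
    the pair space, as \<open>lax_milgram\<close> requires.\<close>
  define E where "E = pointwise_op (\<lambda>x::real^'a. Pair 0 :: real^'a \<Rightarrow> real \<times> (real^'a))"
  define E0 where "E0 = pointwise_op (\<lambda>x::real^'a. (\<lambda>u. (u, 0)) :: real \<Rightarrow> real \<times> (real^'a))"
  have fs: "fst_op (E G) = 0 \<and> snd_op (E G) = G" for G
  proof (cases G rule: l2_cases)
    case (1 g)
    have s: "square_integrable (\<lambda>x. (0::real, g x))" by (intro square_integrable_Pair square_integrable_zero 1)
    show ?thesis unfolding 1(2) E_def pointwise_op_l2_of[OF emb(1) 1(1)] fst_op_l2_of[OF s] snd_op_l2_of[OF s] by (simp add: l2_of_zero)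
  qed
  have fs0: "fst_op (E0 G) = G \<and> snd_op (E0 G) = 0" for G
  proof (cases G rule: l2_cases)
    case (1 g)
    have s: "square_integrable (\<lambda>x. (g x, 0::real^'a))" by (intro square_integrable_Pair square_integrable_zero 1)
    show ?thesis unfolding 1(2) E0_def pointwise_op_l2_of[OF emb(2) 1(1)] fst_op_l2_of[OF s] snd_op_l2_of[OF s] by (simp add: l2_of_zero)
  qed
  define A where "A U = E (matrix_op M (snd_op U))" for U :: "(real^'a, real \<times> (real^'a)) l2"
  have inA: "inner (A U) W = inner (matrix_op M (snd_op U)) (snd_op W)" for U W
    unfolding A_def inner_fst_snd_op[of "E _" W] using fs by simp
  have inF: "inner (E0 F) W = inner F (fst_op W)" for W
    unfolding inner_fst_snd_op[of "E0 _" W] using fs0 by simp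
  have "bounded_linear E" unfolding E_def by (rule bounded_linear_pointwise_op[OF emb(1)])
  then have A: "bounded_linear A" unfolding A_def
    by (intro bounded_linear_compose[OF _ bounded_linear_compose[OF bounded_linear_matrix_op[OF M] bounded_linear_snd_op]])
  have "\<exists>U\<in>H10_space \<Omega>. \<forall>W\<in>H10_space \<Omega>. inner (A U) W = inner (E0 F) W"
  proof (rule lax_milgram[OF subspace_H10_space closed_H10_space A])
    \<comment> \<open>Coercivity holds for the gradient part only; Poincare bounds the full squared
      norm by C^2 + 1 times it.\<close>
    show "\<alpha> / (C\<^sup>2 + 1) > 0" using \<alpha> by (simp add: add_nonneg_pos)
    fix U assume U: "U \<in> H10_space \<Omega>"
    have "(norm U)\<^sup>2 \<le> (C\<^sup>2 + 1) * (norm (snd_op U))\<^sup>2"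
      using power_mono[OF C(2)[OF U] norm_ge_zero, of 2] by (simp add: norm_fst_snd_op power_mult_distrib algebra_simps)
    then have "\<alpha> / (C\<^sup>2 + 1) * (norm U)\<^sup>2 \<le> \<alpha> / (C\<^sup>2 + 1) * ((C\<^sup>2 + 1) * (norm (snd_op U))\<^sup>2)"
      using \<alpha> by (intro mult_left_mono) (auto simp: add_nonneg_pos)
    also have "\<dots> = \<alpha> * (norm (snd_op U))\<^sup>2" using add_nonneg_pos[of "C\<^sup>2" 1] by simp
    also have "\<dots> \<le> inner (A U) U" unfolding inA by (rule coercive_matrix_op[OF M coer])
    finally show "\<alpha> / (C\<^sup>2 + 1) * (norm U)\<^sup>2 \<le> inner (A U) U" .
  qed
  then show ?thesis unfolding weak_solution_def inA inF by blast
qed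

lemma adjoint_solution_exists:
  assumes \<Omega>: "bounded \<Omega>" and \<alpha>: "\<alpha> > 0" and M: "bounded_matrix_field M" and coer: "\<And>x. coercive_mat \<alpha> (M x)"
  shows "\<exists>P. adjoint_solution \<Omega> M F P"
proof -
  obtain P where "weak_solution \<Omega> (\<lambda>x. transpose (M x)) F P"
    using weak_solution_exists[OF \<Omega> \<alpha> bounded_matrix_field_transpose[OF M] coercive_mat_transpose[OF coer]] by blast
  then have "adjoint_solution \<Omega> M F P"
    unfolding weak_solution_def adjoint_solution_def inner_matrix_op_transpose[OF M] by (simp add: inner_commute)
  then show ?thesis by blast
qed

lemma weak_solution_unique:
  assumes \<Omega>: "bounded \<Omega>" and \<alpha>: "\<alpha> > 0" and M: "bounded_matrix_field M" and coer: "\<And>x. coercive_mat \<alpha> (M x)"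
    and U: "weak_solution \<Omega> M F U" and W: "weak_solution \<Omega> M F W"
  shows "U = W"
proof -
  obtain C where C: "C > 0" "\<And>U. U \<in> H10_space \<Omega> \<Longrightarrow> norm (fst_op U) \<le> C * norm (snd_op U)"
    using poincare_H10_space[OF \<Omega>] by blast
  have D: "U - W \<in> H10_space \<Omega>" using U W by (auto simp: weak_solution_def intro: subspace_diff[OF subspace_H10_space])
  have "inner (matrix_op M (snd_op U)) (snd_op (U - W)) = inner (matrix_op M (snd_op W)) (snd_op (U - W))"
    using U W D by (simp only: weak_solution_def)
  then have "inner (matrix_op M (snd_op (U - W))) (snd_op (U - W)) = 0"
    by (simp add: snd_op_diff[of U W] matrix_op_diff[OF M] inner_diff_left)
  with coercive_matrix_op[OF M coer, of "snd_op (U - W)"] \<alpha> have s: "snd_op (U - W) = 0" by (simp add: mult_le_0_iff)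
  with C(2)[OF D] have "fst_op (U - W) = 0" by simp
  with s have "norm (U - W) = 0" using norm_fst_snd_op[of "U - W"] by simp
  then show ?thesis by simp
qed

section \<open>Asymptotics of the state under a shrinking perturbation\<close>

lemma norm_affine_op:
  fixes U :: "('a::euclidean_space, 'b::euclidean_space) l2"
  assumes c: "c \<noteq> 0"
  shows "norm U = sqrt (\<bar>c\<bar> ^ DIM('a)) * norm (affine_op t c U)"
  using inner_affine_op[OF c, of U U t] by (simp add: norm_eq_sqrt_inner real_sqrt_mult)

text \<open>Both norms scale by the same power of |c|, whatever the value spaces, so energy
  estimates survive the blow-up with unchanged constants.\<close>

lemma norm_affine_op_le:
  fixes U :: "('a::euclidean_space, 'b::euclidean_space) l2" and W :: "('a, 'c::euclidean_space) l2"
  assumes c: "c \<noteq> 0" and le: "norm U \<le> K * norm W"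
  shows "norm (affine_op t c U) \<le> K * norm (affine_op t c W)"
proof -
  let ?s = "sqrt (\<bar>c\<bar> ^ DIM('a))"
  have s: "?s > 0" using c by simp
  have "?s * norm (affine_op t c U) \<le> ?s * (K * norm (affine_op t c W))"
    using le unfolding norm_affine_op[OF c, of U t] norm_affine_op[OF c, of W t] by (simp add: mult.left_commute)
  then show ?thesis using s by (simp only: mult_le_cancel_left_pos)
qed

lemma affine_op_grad_space:
  assumes c: "c \<noteq> 0" and G: "G \<in> grad_space"
  shows "affine_op t c G \<in> grad_space"
proof -
  let ?S = "{l2_of (grad \<phi>) |\<phi> :: real^'a \<Rightarrow> real. test_fun UNIV \<phi>}"
  have bl: "bounded_linear (affine_op t c :: (real^'a, real^'a) l2 \<Rightarrow> _)" by (rule bounded_linear_affine_op[OF c])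
  have "grad_space \<subseteq> affine_op t c -` grad_space"
    unfolding grad_space_def[where 'n='a]
  proof (rule closure_minimal)
    show "closed (affine_op t c -` closure ?S)"
      by (rule continuous_closed_vimage) (simp_all add: linear_continuous_at bl)
    show "?S \<subseteq> affine_op t c -` closure ?S"
    proof
      fix x assume "x \<in> ?S"
      then obtain \<phi> where \<phi>: "test_fun UNIV \<phi>" "x = l2_of (grad \<phi>)" by blast
      \<comment> \<open>The factor 1/c compensates the chain rule, so that the gradient itself is
        only composed with the affine map.\<close>
      let ?\<psi> = "\<lambda>x. (1 / c) * \<phi> (t + c *\<^sub>R x)"
      have \<psi>: "test_fun UNIV ?\<psi>" by (rule test_fun_affine[OF \<phi>(1) c]) simp
      have "grad ?\<psi> = (\<lambda>x. grad \<phi> (t + c *\<^sub>R x))"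
        using grad_affine[OF test_fun_smooth[OF \<phi>(1)], of "1 / c" t c] c by (simp add: fun_eq_iff)
      then have "affine_op t c x = l2_of (grad ?\<psi>)"
        unfolding \<phi>(2) affine_op_l2_of[OF c test_fun_grad_square_integrable[OF \<phi>(1)]] by simp
      with \<psi> have "affine_op t c x \<in> ?S" by blast
      then show "x \<in> affine_op t c -` closure ?S" by (intro vimageI2 subsetD[OF closure_subset])
    qed
  qed
  with G show ?thesis by blast
qed

text \<open>The eventual bound on \<open>f\<close> makes the error of replacing \<open>Z\<close> by
  a nearby element of \<open>D\<close> uniform in r.\<close>

lemma tendsto_inner_of_dense:
  fixes f :: "'r \<Rightarrow> 'h::real_inner"
  assumes bd: "\<forall>\<^sub>F r in F. norm (f r) \<le> K" and A: "bounded_linear A" and Z: "Z \<in> closure D"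
    and conv: "\<And>\<delta>. \<delta> \<in> D \<Longrightarrow> ((\<lambda>r. inner (A \<delta>) (f r)) \<longlongrightarrow> 0) F"
  shows "((\<lambda>r. inner (A Z) (f r)) \<longlongrightarrow> 0) F"
proof (rule tendstoI)
  fix e :: real assume e: "e > 0"
  obtain M where M: "M > 0" "\<And>x. norm (A x) \<le> norm x * M" using bounded_linear.pos_bounded[OF A] by blast
  define K' where "K' = max K 1"
  have K': "K' > 0" by (simp add: K'_def)
  have "e / (2 * (M * K')) > 0" using e M K' by simp
  then obtain \<delta> where \<delta>: "\<delta> \<in> D" "dist \<delta> Z < e / (2 * (M * K'))"
    using Z unfolding closure_approachable by blast
  have "\<forall>\<^sub>F r in F. dist (inner (A \<delta>) (f r)) 0 < e / 2" using conv[OF \<delta>(1)] e by (intro tendstoD) auto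
  with bd show "\<forall>\<^sub>F r in F. dist (inner (A Z) (f r)) 0 < e"
  proof eventually_elim
    case (elim r)
    have "\<bar>inner (A (Z - \<delta>)) (f r)\<bar> \<le> norm (A (Z - \<delta>)) * norm (f r)" by (rule Cauchy_Schwarz_ineq2)
    also have "\<dots> \<le> (norm (Z - \<delta>) * M) * K'" using M(2)[of "Z - \<delta>"] elim(1) M(1) by (intro mult_mono) (auto simp: K'_def)
    also have "\<dots> = norm (Z - \<delta>) * (M * K')" by simp
    also have "\<dots> \<le> (e / (2 * (M * K'))) * (M * K')" using \<delta>(2) M(1) K' by (intro mult_right_mono) (auto simp: dist_norm norm_minus_commute)
    also have "\<dots> = e / 2" using M(1) K' by simp
    finally have "\<bar>inner (A (Z - \<delta>)) (f r)\<bar> \<le> e / 2" .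
    moreover have "inner (A Z) (f r) = inner (A (Z - \<delta>)) (f r) + inner (A \<delta>) (f r)"
      by (simp add: linear_diff[OF bounded_linear.linear[OF A]] inner_diff_left)
    ultimately show ?case using elim(2) by (simp add: dist_real_def)
  qed
qed

lemma bounded_matrix_field_const_diff:
  assumes "bounded_matrix_field M" shows "bounded_matrix_field (\<lambda>x. b - M x)"
proof -
  obtain C where C: "\<And>x. norm (M x) \<le> C" and M: "M \<in> borel_measurable lebesgue" using assms by (auto simp: bounded_matrix_field_def)
  have "norm (b - M x) \<le> norm b + C" for x using norm_triangle_ineq4[of b "M x"] C[of x] by linarith
  with M show ?thesis unfolding bounded_matrix_field_def by auto
qed

lemma square_integrable_indicator_bounded_matrix_field:
  assumes "bounded_matrix_field M" and S: "S \<in> lmeasurable"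
  shows "square_integrable (\<lambda>x. indicator S x *\<^sub>R M x)"
proof -
  obtain C where C: "\<And>x. norm (M x) \<le> C" and M: "M \<in> borel_measurable lebesgue" using assms by (auto simp: bounded_matrix_field_def)
  show ?thesis
  proof (rule square_integrable_bound_norm[OF square_integrable_indicator_const[OF S, of "1::real"], of _ C])
    show "(\<lambda>x. indicator S x *\<^sub>R M x) \<in> borel_measurable lebesgue"
      using M fmeasurableD[OF S] by (intro borel_measurable_scaleR borel_measurable_indicator)
    show "norm (indicator S x *\<^sub>R M x) \<le> C * norm (indicator S x *\<^sub>R (1::real))" for x using C[of x] by (simp add: indicator_def)
  qed
qed

lemma sets_lebesgue_scaled_open:
  fixes \<omega> :: "(real^'n) set"
  assumes "open \<omega>" "r > 0" shows "(\<lambda>z. x0 + r *\<^sub>R z) ` \<omega> \<in> sets lebesgue"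
proof -
  have "(\<lambda>z. x0 + r *\<^sub>R z) ` \<omega> = (+) x0 ` ((*\<^sub>R) r ` \<omega>)" by (auto simp: image_image)
  moreover have "open ((+) x0 ` ((*\<^sub>R) r ` \<omega>))" using assms by (intro open_translation open_scaling) auto
  ultimately show ?thesis by auto
qed

lemma perturbed_eq: "perturbed M b x0 \<omega> r x = (if x \<in> (\<lambda>z. x0 + r *\<^sub>R z) ` \<omega> then b else M x)"
  by (simp add: perturbed_def indicator_def)

lemma bounded_matrix_field_perturbed:
  assumes "bounded_matrix_field M" "open \<omega>" "r > 0"
  shows "bounded_matrix_field (perturbed M b x0 \<omega> r)"
proof -
  obtain C where C: "\<And>x. norm (M x) \<le> C" and M: "M \<in> borel_measurable lebesgue" using assms by (auto simp: bounded_matrix_field_def)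
  have "perturbed M b x0 \<omega> r \<in> borel_measurable lebesgue"
    unfolding perturbed_def[abs_def] using M sets_lebesgue_scaled_open[OF assms(2,3)]
    by (intro borel_measurable_add borel_measurable_scaleR borel_measurable_indicator borel_measurable_diff borel_measurable_const)
  moreover have "norm (perturbed M b x0 \<omega> r x) \<le> max C (norm b)" for x using C[of x] by (simp add: perturbed_eq max.coboundedI1)
  ultimately show ?thesis unfolding bounded_matrix_field_def by blast
qed

text \<open>The situation at one centre \<open>x0\<close>. \<open>M\<close> is a representative of
  the coefficient that is bounded and coercive everywhere, \<open>gy\<close> and \<open>gp\<close>
  are gradients extended by zero, and \<open>Ur r\<close> is the perturbed state. The Lebesgue point
  conditions name the four fields whose blow-ups must converge strongly; products appear as separate
  fields since their strong convergence does not follow from that of the factors.\<close>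

locale inclusion =
  fixes \<Omega> \<omega> :: "(real^'n) set" and M :: "real^'n \<Rightarrow> real^'n^'n" and b :: "real^'n^'n" and \<alpha> :: real
    and U P :: "(real^'n, real \<times> (real^'n)) l2" and F Yd :: "(real^'n, real) l2"
    and gy gp :: "real^'n \<Rightarrow> real^'n" and x0 :: "real^'n" and Ur :: "real \<Rightarrow> (real^'n, real \<times> (real^'n)) l2"
  assumes \<Omega>_open: "open \<Omega>" and \<Omega>_bounded: "bounded \<Omega>" and \<alpha>_pos: "\<alpha> > 0"
    and \<omega>_open: "open \<omega>" and \<omega>_bounded: "bounded \<omega>"
    and M_field: "bounded_matrix_field M" and M_coercive: "\<And>x. coercive_mat \<alpha> (M x)" and b_coercive: "coercive_mat \<alpha> b"
    and U_sol: "weak_solution \<Omega> M F U" and P_sol: "adjoint_solution \<Omega> M (fst_op U - Yd) P"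
    and gy: "square_integrable gy" "snd_op U = l2_of gy" and gp: "square_integrable gp" "snd_op P = l2_of gp"
    and x0: "x0 \<in> \<Omega>"
    and x0_M: "lebesgue_point (\<lambda>x. indicator \<Omega> x *\<^sub>R M x) x0"
    and x0_gy: "lebesgue_point (\<lambda>x. (b - M x) *v gy x) x0"
    and x0_gp: "lebesgue_point (\<lambda>x. transpose (b - M x) *v gp x) x0" "lebesgue_point gp x0"
    and Ur_sol: "\<And>r. r > 0 \<Longrightarrow> weak_solution \<Omega> (perturbed M b x0 \<omega> r) F (Ur r)"
begin

section \<open>Blow-up of the data on the inclusion\<close>

definition "\<omega>r r = (\<lambda>z. x0 + r *\<^sub>R z) ` \<omega>"
definition "Mr r = perturbed M b x0 \<omega> r"
text \<open>The change of the flux of the fixed state caused by the perturbation; \<open>Y r\<close>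
  is the corresponding change for the fixed adjoint state under the transposed coefficient.\<close>

definition "X r = l2_of (\<lambda>x. indicator (\<omega>r r) x *\<^sub>R ((b - M x) *v gy x))"
definition "Y r = l2_of (\<lambda>x. indicator (\<omega>r r) x *\<^sub>R (transpose (b - M x) *v gp x))"
abbreviation "S r \<equiv> affine_op x0 r"

lemma \<omega>_lmeasurable: "\<omega> \<in> lmeasurable"
  using \<omega>_open \<omega>_bounded by (simp add: lmeasurable_open)

lemma \<omega>r_measurable: "r > 0 \<Longrightarrow> \<omega>r r \<in> sets lebesgue"
  unfolding \<omega>r_def by (rule sets_lebesgue_scaled_open[OF \<omega>_open])

lemma indicator_\<omega>r: "r > 0 \<Longrightarrow> indicator (\<omega>r r) (x0 + r *\<^sub>R z) = indicator \<omega> z"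
  by (auto simp: \<omega>r_def indicator_def)

lemma mem_\<omega>r: "r > 0 \<Longrightarrow> x0 + r *\<^sub>R z \<in> \<omega>r r \<longleftrightarrow> z \<in> \<omega>"
  by (auto simp: \<omega>r_def)

lemma Mr_eq: "Mr r x = (if x \<in> \<omega>r r then b else M x)"
  by (simp add: Mr_def \<omega>r_def perturbed_eq)

lemma Mr_field: "r > 0 \<Longrightarrow> bounded_matrix_field (Mr r)"
  unfolding Mr_def by (rule bounded_matrix_field_perturbed[OF M_field \<omega>_open])

lemma Mr_coercive: "coercive_mat \<alpha> (Mr r x)"
  using M_coercive b_coercive by (simp add: Mr_eq)

lemmas bM_field = bounded_matrix_field_const_diff[OF M_field, of b]

lemma Fy_sq: "square_integrable (\<lambda>x. (b - M x) *v gy x)" and Fp_sq: "square_integrable (\<lambda>x. transpose (b - M x) *v gp x)"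
  using square_integrable_matrix[OF bM_field gy(1)] square_integrable_matrix[OF bounded_matrix_field_transpose[OF bM_field] gp(1)] by auto

lemma X_eq: assumes r: "r > 0" shows "matrix_op (Mr r) (snd_op U) - matrix_op M (snd_op U) = X r"
  unfolding gy(2) matrix_op_l2_of[OF Mr_field[OF r] gy(1)] matrix_op_l2_of[OF M_field gy(1)]
    l2_of_diff[OF square_integrable_matrix[OF Mr_field[OF r] gy(1)] square_integrable_matrix[OF M_field gy(1)]] X_def
  by (intro arg_cong[of _ _ l2_of] ext) (simp add: Mr_eq matrix_vector_mult_diff_rdistrib)

lemma Y_eq: assumes r: "r > 0" shows "inner (matrix_op (Mr r) G) (snd_op P) - inner (matrix_op M G) (snd_op P) = inner G (Y r)"
proof -
  have "matrix_op (\<lambda>x. transpose (Mr r x)) (l2_of gp) - matrix_op (\<lambda>x. transpose (M x)) (l2_of gp) = Y r"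
    unfolding matrix_op_l2_of[OF bounded_matrix_field_transpose[OF Mr_field[OF r]] gp(1)] matrix_op_l2_of[OF bounded_matrix_field_transpose[OF M_field] gp(1)]
    l2_of_diff[OF square_integrable_matrix[OF bounded_matrix_field_transpose[OF Mr_field[OF r]] gp(1)] square_integrable_matrix[OF bounded_matrix_field_transpose[OF M_field] gp(1)]] Y_def
  proof (intro arg_cong[of _ _ l2_of] ext)
    have "transpose (b - M x) = transpose b - transpose (M x)" for x by (simp add: transpose_def vec_eq_iff)
    then show "transpose (Mr r x) *v gp x - transpose (M x) *v gp x = indicator (\<omega>r r) x *\<^sub>R (transpose (b - M x) *v gp x)" for x
      by (simp add: Mr_eq matrix_vector_mult_diff_rdistrib)
  qed
  then show ?thesis unfolding inner_matrix_op_transpose[OF Mr_field[OF r]] inner_matrix_op_transpose[OF M_field] gp(2)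
    by (simp add: inner_diff_right[symmetric])
qed

lemma SX_tendsto: "((\<lambda>r. S r (X r)) \<longlongrightarrow> l2_of (\<lambda>z. indicator \<omega> z *\<^sub>R ((b - M x0) *v gy x0))) (at_right 0)"
proof -
  have "((\<lambda>r. l2_of (\<lambda>z. indicator \<omega> z *\<^sub>R ((b - M (x0 + r *\<^sub>R z)) *v gy (x0 + r *\<^sub>R z)))) \<longlongrightarrow> l2_of (\<lambda>z. indicator \<omega> z *\<^sub>R ((b - M x0) *v gy x0))) (at_right 0)"
    using x0_gy \<omega>_bounded fmeasurableD[OF \<omega>_lmeasurable] unfolding lebesgue_point_def by blast
  then show ?thesis
  proof (rule Lim_transform_eventually)
    show "\<forall>\<^sub>F r in at_right 0. l2_of (\<lambda>z. indicator \<omega> z *\<^sub>R ((b - M (x0 + r *\<^sub>R z)) *v gy (x0 + r *\<^sub>R z))) = S r (X r)"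
      using eventually_at_right_less[of "0::real"]
    proof eventually_elim
      case (elim r)
      then show ?case unfolding X_def
        by (subst affine_op_l2_of[OF _ square_integrable_indicator[OF \<omega>r_measurable Fy_sq]]) (simp_all add: indicator_\<omega>r)
    qed
  qed
qed

lemma SY_tendsto: "((\<lambda>r. S r (Y r)) \<longlongrightarrow> l2_of (\<lambda>z. indicator \<omega> z *\<^sub>R (transpose (b - M x0) *v gp x0))) (at_right 0)"
proof -
  have "((\<lambda>r. l2_of (\<lambda>z. indicator \<omega> z *\<^sub>R (transpose (b - M (x0 + r *\<^sub>R z)) *v gp (x0 + r *\<^sub>R z)))) \<longlongrightarrow> l2_of (\<lambda>z. indicator \<omega> z *\<^sub>R (transpose (b - M x0) *v gp x0))) (at_right 0)"
    using x0_gp(1) \<omega>_bounded fmeasurableD[OF \<omega>_lmeasurable] unfolding lebesgue_point_def by blast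
  then show ?thesis
  proof (rule Lim_transform_eventually)
    show "\<forall>\<^sub>F r in at_right 0. l2_of (\<lambda>z. indicator \<omega> z *\<^sub>R (transpose (b - M (x0 + r *\<^sub>R z)) *v gp (x0 + r *\<^sub>R z))) = S r (Y r)"
      using eventually_at_right_less[of "0::real"]
    proof eventually_elim
      case (elim r)
      then show ?case unfolding Y_def
        by (subst affine_op_l2_of[OF _ square_integrable_indicator[OF \<omega>r_measurable Fp_sq]]) (simp_all add: indicator_\<omega>r)
    qed
  qed
qed

text \<open>The averaged adjoint state: with source \<open>(y\<^sub>r + y)/2 - y\<^sub>d\<close> the cost difference is exactly linear in
  the perturbation of the coefficient, with no quadratic remainder.\<close>

definition "Pr r = (SOME Q. adjoint_solution \<Omega> (Mr r) ((1/2) *\<^sub>R (fst_op (Ur r) + fst_op U) - Yd) Q)"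
definition "D r = snd_op (Pr r) - snd_op P"
definition "e r = fst_op (Ur r) - fst_op U"

lemma Pr_sol: "r > 0 \<Longrightarrow> adjoint_solution \<Omega> (Mr r) ((1/2) *\<^sub>R (fst_op (Ur r) + fst_op U) - Yd) (Pr r)"
  unfolding Pr_def using adjoint_solution_exists[OF \<Omega>_bounded \<alpha>_pos Mr_field Mr_coercive] by (rule someI_ex)

lemma mem_H10_space: "U \<in> H10_space \<Omega>" "P \<in> H10_space \<Omega>" "r > 0 \<Longrightarrow> Ur r \<in> H10_space \<Omega>" "r > 0 \<Longrightarrow> Pr r \<in> H10_space \<Omega>"
  using U_sol P_sol Ur_sol Pr_sol by (auto simp: weak_solution_def adjoint_solution_def)

section \<open>Difference identities and energy bounds\<close>

lemma state_difference:
  assumes r: "r > 0" and W: "W \<in> H10_space \<Omega>"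
  shows "inner (matrix_op (Mr r) (snd_op (Ur r) - snd_op U)) (snd_op W) = - inner (X r) (snd_op W)"
proof -
  have "inner (matrix_op (Mr r) (snd_op (Ur r))) (snd_op W) = inner (matrix_op M (snd_op U)) (snd_op W)"
    using Ur_sol[OF r] U_sol W by (simp add: weak_solution_def Mr_def)
  then show ?thesis unfolding X_eq[OF r, symmetric] by (simp add: matrix_op_diff[OF Mr_field[OF r]] inner_diff_left)
qed

text \<open>A difference of squares factors into the average minus the target times the state
  difference. The first factor is the source of the equation for \<open>Pr r\<close>, so testing
  that equation with the state difference and then using \<open>state_difference\<close> gives the
  identity.\<close>

lemma cost_difference:
  assumes r: "r > 0"
  shows "1/2 * (norm (fst_op (Ur r) - Yd))\<^sup>2 - 1/2 * (norm (fst_op U - Yd))\<^sup>2 = - inner (X r) (snd_op (Pr r))"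
proof -
  have W: "Ur r - U \<in> H10_space \<Omega>" by (intro subspace_diff[OF subspace_H10_space] mem_H10_space r)
  have "1/2 * (norm (fst_op (Ur r) - Yd))\<^sup>2 - 1/2 * (norm (fst_op U - Yd))\<^sup>2
      = inner ((1/2) *\<^sub>R (fst_op (Ur r) + fst_op U) - Yd) (fst_op (Ur r) - fst_op U)"
    unfolding power2_norm_eq_inner by (simp add: inner_simps inner_commute algebra_simps)
  also have "\<dots> = inner (matrix_op (Mr r) (snd_op (Ur r) - snd_op U)) (snd_op (Pr r))"
    using Pr_sol[OF r] W unfolding adjoint_solution_def fst_op_diff[symmetric] snd_op_diff[symmetric] by simp
  also have "\<dots> = - inner (X r) (snd_op (Pr r))" by (rule state_difference[OF r mem_H10_space(4)[OF r]])
  finally show ?thesis .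
qed

text \<open>Subtracting the two adjoint equations leaves half the state difference from the averaged
  sources, and the flux change \<open>Y r\<close> from the coefficients.\<close>

lemma adjoint_difference:
  assumes r: "r > 0" and W: "W \<in> H10_space \<Omega>"
  shows "inner (matrix_op (Mr r) (snd_op W)) (D r) = 1/2 * inner (e r) (fst_op W) - inner (snd_op W) (Y r)"
proof -
  have "inner (matrix_op (Mr r) (snd_op W)) (snd_op (Pr r)) = inner ((1/2) *\<^sub>R (fst_op (Ur r) + fst_op U) - Yd) (fst_op W)"
    using Pr_sol[OF r] W by (simp add: adjoint_solution_def)
  moreover have "inner (matrix_op M (snd_op W)) (snd_op P) = inner (fst_op U - Yd) (fst_op W)"
    using P_sol W by (simp add: adjoint_solution_def)
  ultimately show ?thesis using Y_eq[OF r, of "snd_op W"]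
    unfolding D_def e_def by (simp add: inner_diff_right inner_diff_left inner_add_left field_simps)
qed

text \<open>Each difference equation is tested with its own solution. Poincare bounds
  \<open>e r\<close> by the gradient of the state difference and also absorbs the source term in the
  estimate for \<open>D r\<close>.\<close>

lemma difference_bounds:
  obtains C where "C > 0" "\<And>r. r > 0 \<Longrightarrow> norm (e r) \<le> C * norm (X r)"
    "\<And>r. r > 0 \<Longrightarrow> norm (D r) \<le> C * (norm (X r) + norm (Y r))"
proof -
  obtain C where C: "C > 0" "\<And>U. U \<in> H10_space \<Omega> \<Longrightarrow> norm (fst_op U) \<le> C * norm (snd_op U)"
    using poincare_H10_space[OF \<Omega>_bounded] by blast
  have E: "norm (snd_op (Ur r) - snd_op U) \<le> norm (X r) / \<alpha>" if r: "r > 0" for r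
  proof -
    let ?E = "snd_op (Ur r) - snd_op U"
    have W: "Ur r - U \<in> H10_space \<Omega>" by (intro subspace_diff[OF subspace_H10_space] mem_H10_space r)
    have "\<alpha> * (norm ?E)\<^sup>2 \<le> inner (matrix_op (Mr r) ?E) ?E" by (rule coercive_matrix_op[OF Mr_field[OF r] Mr_coercive])
    also have "\<dots> = - inner (X r) ?E" using state_difference[OF r W] by (simp add: snd_op_diff)
    also have "\<dots> \<le> norm (X r) * norm ?E" using Cauchy_Schwarz_ineq2[of "X r" ?E] by linarith
    finally have "\<alpha> * norm ?E \<le> norm (X r)" by (cases "norm ?E = 0") (simp_all add: power2_eq_square)
    then show ?thesis using \<alpha>_pos by (simp add: pos_le_divide_eq mult.commute)
  qed
  have e: "norm (e r) \<le> C / \<alpha> * norm (X r)" if r: "r > 0" for r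
  proof -
    have W: "Ur r - U \<in> H10_space \<Omega>" by (intro subspace_diff[OF subspace_H10_space] mem_H10_space r)
    have "norm (e r) \<le> C * norm (snd_op (Ur r) - snd_op U)" using C(2)[OF W] by (simp add: e_def fst_op_diff snd_op_diff)
    also have "\<dots> \<le> C * (norm (X r) / \<alpha>)" using C(1) by (intro mult_left_mono E r) simp
    finally show ?thesis by simp
  qed
  have D: "norm (D r) \<le> (C * C / \<alpha> * norm (X r) + norm (Y r)) / \<alpha>" if r: "r > 0" for r
  proof -
    have W: "Pr r - P \<in> H10_space \<Omega>" by (intro subspace_diff[OF subspace_H10_space] mem_H10_space r)
    have sW: "snd_op (Pr r - P) = D r" by (simp add: D_def snd_op_diff)
    have "\<alpha> * (norm (D r))\<^sup>2 \<le> inner (matrix_op (Mr r) (D r)) (D r)" by (rule coercive_matrix_op[OF Mr_field[OF r] Mr_coercive])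
    also have "\<dots> = 1/2 * inner (e r) (fst_op (Pr r - P)) - inner (D r) (Y r)" using adjoint_difference[OF r W] by (simp add: sW)
    also have "\<dots> \<le> norm (e r) * norm (fst_op (Pr r - P)) + norm (D r) * norm (Y r)"
    proof -
      have "\<bar>inner (e r) (fst_op (Pr r - P))\<bar> \<le> norm (e r) * norm (fst_op (Pr r - P))" by (rule Cauchy_Schwarz_ineq2)
      moreover have "\<bar>inner (D r) (Y r)\<bar> \<le> norm (D r) * norm (Y r)" by (rule Cauchy_Schwarz_ineq2)
      ultimately show ?thesis by linarith
    qed
    also have "\<dots> \<le> (C / \<alpha> * norm (X r)) * (C * norm (D r)) + norm (D r) * norm (Y r)"
      using C(2)[OF W] e[OF r] C(1) \<alpha>_pos by (intro add_mono mult_mono order_refl) (auto simp: sW)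
    also have "\<dots> = (C * C / \<alpha> * norm (X r) + norm (Y r)) * norm (D r)" by (simp add: algebra_simps)
    finally have "\<alpha> * norm (D r) \<le> C * C / \<alpha> * norm (X r) + norm (Y r)"
      using C(1) \<alpha>_pos by (cases "norm (D r) = 0") (simp_all add: power2_eq_square)
    then show ?thesis using \<alpha>_pos by (simp add: pos_le_divide_eq mult.commute)
  qed
  define K where "K = C / \<alpha> + C * C / \<alpha> / \<alpha> + 1 / \<alpha>"
  have K: "C / \<alpha> \<le> K" "C * C / \<alpha> / \<alpha> \<le> K" "1 / \<alpha> \<le> K" "K > 0"
    using C(1) \<alpha>_pos by (auto simp: K_def add_pos_pos add_nonneg_nonneg)
  show ?thesis
  proof (rule that[OF K(4)])
    fix r :: real assume r: "r > 0"
    show "norm (e r) \<le> K * norm (X r)" using e[OF r] mult_right_mono[OF K(1) norm_ge_zero[of "X r"]] by linarith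
    have "norm (D r) \<le> C * C / \<alpha> / \<alpha> * norm (X r) + 1 / \<alpha> * norm (Y r)" using D[OF r] by (simp add: add_divide_distrib)
    then show "norm (D r) \<le> K * (norm (X r) + norm (Y r))"
      using mult_right_mono[OF K(2) norm_ge_zero[of "X r"]] mult_right_mono[OF K(3) norm_ge_zero[of "Y r"]]
      by (simp add: distrib_left)
  qed
qed

text \<open>The blow-ups of \<open>X r\<close> and \<open>Y r\<close> converge and are therefore
  bounded; the energy bounds are invariant under rescaling.\<close>

lemma scaled_bounds:
  obtains C where "\<forall>\<^sub>F r in at_right 0. norm (S r (D r)) \<le> C" "\<forall>\<^sub>F r in at_right 0. norm (S r (e r)) \<le> C"
proof -
  obtain C where C: "C > 0" "\<And>r. r > 0 \<Longrightarrow> norm (e r) \<le> C * norm (X r)"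
    "\<And>r. r > 0 \<Longrightarrow> norm (D r) \<le> C * (norm (X r) + norm (Y r))"
    using difference_bounds by blast
  let ?x = "norm (l2_of (\<lambda>z. indicator \<omega> z *\<^sub>R ((b - M x0) *v gy x0))) + 1"
  let ?y = "norm (l2_of (\<lambda>z. indicator \<omega> z *\<^sub>R (transpose (b - M x0) *v gp x0))) + 1"
  have x: "\<forall>\<^sub>F r in at_right 0. norm (S r (X r)) < ?x" using order_tendstoD(2)[OF tendsto_norm[OF SX_tendsto], of ?x] by simp
  have y: "\<forall>\<^sub>F r in at_right 0. norm (S r (Y r)) < ?y" using order_tendstoD(2)[OF tendsto_norm[OF SY_tendsto], of ?y] by simp
  have De: "norm (S r (D r)) \<le> C * (norm (S r (X r)) + norm (S r (Y r)))" "norm (S r (e r)) \<le> C * norm (S r (X r))" if r: "r > 0" for r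
  proof -
    have r0: "r \<noteq> 0" using r by simp
    show "norm (S r (e r)) \<le> C * norm (S r (X r))" by (rule norm_affine_op_le[OF r0 C(2)[OF r]])
    let ?s = "sqrt (\<bar>r\<bar> ^ DIM(real^'n))"
    have s: "?s > 0" using r by simp
    have "?s * norm (S r (D r)) \<le> ?s * (C * (norm (S r (X r)) + norm (S r (Y r))))"
      using C(3)[OF r] unfolding norm_affine_op[OF r0, of "D r" x0] norm_affine_op[OF r0, of "X r" x0] norm_affine_op[OF r0, of "Y r" x0]
      by (simp add: algebra_simps)
    then show "norm (S r (D r)) \<le> C * (norm (S r (X r)) + norm (S r (Y r)))" using s by (simp only: mult_le_cancel_left_pos)
  qed
  show ?thesis
  proof (rule that[of "C * (?x + ?y)"])
    show "\<forall>\<^sub>F r in at_right 0. norm (S r (D r)) \<le> C * (?x + ?y)"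
      using x y eventually_at_right_less[of "0::real"]
    proof eventually_elim
      case (elim r)
      have "C * (norm (S r (X r)) + norm (S r (Y r))) \<le> C * (?x + ?y)" using elim C(1) by (intro mult_left_mono add_mono) auto
      with De(1)[OF elim(3)] show ?case by linarith
    qed
    show "\<forall>\<^sub>F r in at_right 0. norm (S r (e r)) \<le> C * (?x + ?y)"
      using x y eventually_at_right_less[of "0::real"]
    proof eventually_elim
      case (elim r)
      have "norm (S r (X r)) \<le> ?x + ?y"
        using elim(1) norm_ge_zero[of "l2_of (\<lambda>z. indicator \<omega> z *\<^sub>R (transpose (b - M x0) *v gp x0))"] by linarith
      then have "C * norm (S r (X r)) \<le> C * (?x + ?y)" using C(1) by (intro mult_left_mono) auto
      with De(2)[OF elim(3)] show ?case by linarith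
    qed
  qed
qed

section \<open>Passage to the limit in the rescaled adjoint difference\<close>

lemma SD_in_grad_space: "r > 0 \<Longrightarrow> S r (D r) \<in> grad_space"
  unfolding D_def
  by (intro affine_op_grad_space subspace_diff[OF subspace_grad_space] snd_op_in_grad_space[OF mem_H10_space(4)] snd_op_in_grad_space[OF mem_H10_space(2)]) auto

lemma eventually_ball_subset: "\<forall>\<^sub>F r in at_right 0. \<forall>z\<in>ball 0 R. x0 + r *\<^sub>R z \<in> \<Omega>"
proof (cases "R > 0")
  case True
  obtain d where d: "d > 0" "ball x0 d \<subseteq> \<Omega>" using \<Omega>_open x0 openE by blast
  have "\<forall>z\<in>ball 0 R. x0 + r *\<^sub>R z \<in> \<Omega>" if "0 < r" "r < d / R" for r
  proof
    fix z :: "real^'n" assume "z \<in> ball 0 R"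
    then have "r * norm z < r * R" using that(1) by simp
    also have "\<dots> < d" using that True by (simp add: pos_less_divide_eq)
    finally have "x0 + r *\<^sub>R z \<in> ball x0 d" using that(1) by (simp add: dist_norm)
    with d show "x0 + r *\<^sub>R z \<in> \<Omega>" by blast
  qed
  then show ?thesis using d True by (auto simp: eventually_at_right_field intro!: exI[of _ "d / R"])
qed (simp add: ball_eq_empty[THEN iffD2])

text \<open>On \<omega> both coefficients equal b exactly. Elsewhere on the support of the test
  gradient the difference is the oscillation of M around x0, which tends to 0 in L2, and the test
  gradient is bounded.\<close>

lemma corrector_coefficient_tendsto:
  assumes \<phi>: "test_fun UNIV \<phi>"
  shows "((\<lambda>r. l2_of (\<lambda>z. Mr r (x0 + r *\<^sub>R z) *v grad \<phi> z)) \<longlongrightarrow> matrix_op (atilde (M x0) b \<omega>) (l2_of (grad \<phi>))) (at_right 0)"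
proof -
  obtain B where B: "B > 0" "\<And>x. norm (grad \<phi> x) \<le> B" using \<phi> by (rule test_fun_bounded) blast
  obtain Kp where Kp: "compact Kp" "\<And>x. x \<notin> Kp \<Longrightarrow> grad \<phi> x = 0" using \<phi> by (rule test_fun_support) blast
  obtain R where R: "Kp \<subseteq> ball 0 R" using compact_imp_bounded[OF Kp(1)] bounded_subset_ballD by blast
  obtain K where K: "K > 0" "\<And>A :: real^'n^'n. \<And>v. norm (A *v v) \<le> norm A * norm v * K"
    using bounded_bilinear.pos_bounded[OF bounded_bilinear_matrix_vector_mult] by blast
  let ?B = "ball (0::real^'n) R"
  \<comment> \<open>Cutting M off outside the bounded domain makes it square-integrable, so
    \<open>AE_lebesgue_point\<close> can apply; for small r the blown-up ball lies inside the domain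
    and the cut-off is invisible.\<close>
  let ?M1 = "\<lambda>x. indicator \<Omega> x *\<^sub>R M x"
  have At: "bounded_matrix_field (atilde (M x0) b \<omega>)" by (rule bounded_matrix_field_atilde[OF fmeasurableD[OF \<omega>_lmeasurable]])
  have sg: "square_integrable (grad \<phi>)" by (rule test_fun_grad_square_integrable[OF \<phi>])
  have \<Omega>l: "\<Omega> \<in> lmeasurable" using \<Omega>_open \<Omega>_bounded by (simp add: lmeasurable_open)
  note sM1 = square_integrable_indicator_bounded_matrix_field[OF M_field \<Omega>l]
  have "((\<lambda>r. l2_of (\<lambda>z. indicator ?B z *\<^sub>R ?M1 (x0 + r *\<^sub>R z))) \<longlongrightarrow> l2_of (\<lambda>z. indicator ?B z *\<^sub>R ?M1 x0)) (at_right 0)"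
    using x0_M unfolding lebesgue_point_def by (rule allE[of _ ?B]) simp
  then have l: "((\<lambda>r. K * B * dist (l2_of (\<lambda>z. indicator ?B z *\<^sub>R ?M1 (x0 + r *\<^sub>R z))) (l2_of (\<lambda>z. indicator ?B z *\<^sub>R ?M1 x0))) \<longlongrightarrow> K * B * 0) (at_right 0)"
    by (intro tendsto_mult tendsto_const) (simp add: tendsto_dist_iff[symmetric])
  have "\<forall>\<^sub>F r in at_right 0. dist (l2_of (\<lambda>z. Mr r (x0 + r *\<^sub>R z) *v grad \<phi> z)) (matrix_op (atilde (M x0) b \<omega>) (l2_of (grad \<phi>)))
     \<le> K * B * dist (l2_of (\<lambda>z. indicator ?B z *\<^sub>R ?M1 (x0 + r *\<^sub>R z))) (l2_of (\<lambda>z. indicator ?B z *\<^sub>R ?M1 x0))"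
    using eventually_ball_subset[of R] eventually_at_right_less[of "0::real"]
  proof eventually_elim
    case (elim r)
    have r: "r > 0" by (rule elim(2))
    have MS: "bounded_matrix_field (\<lambda>z. Mr r (x0 + r *\<^sub>R z))"
      using Mr_field[OF r] borel_measurable_affine[of "Mr r" r x0] r unfolding bounded_matrix_field_def by auto
    have s1: "square_integrable (\<lambda>z. Mr r (x0 + r *\<^sub>R z) *v grad \<phi> z)" by (rule square_integrable_matrix[OF MS sg])
    have s2: "square_integrable (\<lambda>z. atilde (M x0) b \<omega> z *v grad \<phi> z)" by (rule square_integrable_matrix[OF At sg])
    have s3: "square_integrable (\<lambda>z. indicator ?B z *\<^sub>R ?M1 (x0 + r *\<^sub>R z))"
      using r by (intro square_integrable_indicator square_integrable_affine[OF sM1]) auto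
    have s4: "square_integrable (\<lambda>z. indicator ?B z *\<^sub>R ?M1 x0)" by (rule square_integrable_indicator_const) simp
    show ?case
      unfolding matrix_op_l2_of[OF At sg] dist_norm l2_of_diff[OF s1 s2] l2_of_diff[OF s3 s4]
    proof (rule norm_l2_of_le[OF square_integrable_diff[OF s1 s2] square_integrable_diff[OF s3 s4]])
      show "0 \<le> K * B" using K B by simp
      fix z
      show "norm (Mr r (x0 + r *\<^sub>R z) *v grad \<phi> z - atilde (M x0) b \<omega> z *v grad \<phi> z)
        \<le> K * B * norm (indicator ?B z *\<^sub>R ?M1 (x0 + r *\<^sub>R z) - indicator ?B z *\<^sub>R ?M1 x0)"
      proof (cases "z \<in> ?B \<and> z \<notin> \<omega>")
        case True
        have "x0 + r *\<^sub>R z \<notin> \<omega>r r" using True by (simp add: mem_\<omega>r[OF r])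
        then have "Mr r (x0 + r *\<^sub>R z) *v grad \<phi> z - atilde (M x0) b \<omega> z *v grad \<phi> z = (M (x0 + r *\<^sub>R z) - M x0) *v grad \<phi> z"
          using True by (simp add: Mr_eq atilde_def matrix_vector_mult_diff_rdistrib)
        also have "norm \<dots> \<le> norm (M (x0 + r *\<^sub>R z) - M x0) * norm (grad \<phi> z) * K" by (rule K(2))
        also have "\<dots> \<le> norm (M (x0 + r *\<^sub>R z) - M x0) * B * K" using B K(1) by (intro mult_right_mono mult_left_mono) auto
        also have "M (x0 + r *\<^sub>R z) - M x0 = indicator ?B z *\<^sub>R ?M1 (x0 + r *\<^sub>R z) - indicator ?B z *\<^sub>R ?M1 x0"
          using True elim(1) x0 by simp
        finally show ?thesis by (simp add: mult.commute mult.left_commute)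
      next
        case False
        have "Mr r (x0 + r *\<^sub>R z) *v grad \<phi> z - atilde (M x0) b \<omega> z *v grad \<phi> z = 0"
        proof (cases "z \<in> \<omega>")
          case True
          then have "x0 + r *\<^sub>R z \<in> \<omega>r r" by (auto simp: \<omega>r_def)
          with True show ?thesis by (simp add: Mr_eq atilde_def)
        next
          case F: False
          with False R have "z \<notin> Kp" by blast
          then show ?thesis by (simp add: Kp(2))
        qed
        then show ?thesis using K B by simp
      qed
    qed
  qed
  then have "((\<lambda>r. dist (l2_of (\<lambda>z. Mr r (x0 + r *\<^sub>R z) *v grad \<phi> z)) (matrix_op (atilde (M x0) b \<omega>) (l2_of (grad \<phi>)))) \<longlongrightarrow> 0) (at_right 0)"
  proof (rule tendsto_sandwich[OF _ _ tendsto_const, rotated])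
    show "((\<lambda>r. K * B * dist (l2_of (\<lambda>z. indicator ?B z *\<^sub>R ?M1 (x0 + r *\<^sub>R z))) (l2_of (\<lambda>z. indicator ?B z *\<^sub>R ?M1 x0))) \<longlongrightarrow> 0) (at_right 0)"
      using l by simp
  qed simp
  then show ?thesis by (subst tendsto_dist_iff)
qed

text \<open>A test function of the blown-up variable is shrunk to a test function near x0, whose
  support lies in the domain for small r. In the rescaled difference equation the source term
  carries an extra factor r and vanishes, leaving the limit of \<open>Y r\<close>.\<close>

lemma tested_adjoint_difference_tendsto:
  assumes \<phi>: "test_fun UNIV \<phi>"
  shows "((\<lambda>r. inner (l2_of (\<lambda>z. Mr r (x0 + r *\<^sub>R z) *v grad \<phi> z)) (S r (D r)))
    \<longlongrightarrow> - inner (l2_of (grad \<phi>)) (l2_of (\<lambda>z. indicator \<omega> z *\<^sub>R (transpose (b - M x0) *v gp x0)))) (at_right 0)"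
proof -
  obtain Kp where Kp: "compact Kp" "\<And>x. x \<notin> Kp \<Longrightarrow> \<phi> x = 0" using \<phi> by (rule test_fun_support) blast
  obtain R where R: "Kp \<subseteq> ball 0 R" using compact_imp_bounded[OF Kp(1)] bounded_subset_ballD by blast
  have sg: "square_integrable (grad \<phi>)" by (rule test_fun_grad_square_integrable[OF \<phi>])
  obtain C where C: "\<forall>\<^sub>F r in at_right 0. norm (S r (e r)) \<le> C" using scaled_bounds by blast
  have eq: "\<forall>\<^sub>F r in at_right 0. inner (l2_of (\<lambda>z. Mr r (x0 + r *\<^sub>R z) *v grad \<phi> z)) (S r (D r))
     = 1/2 * (r * inner (S r (e r)) (l2_of \<phi>)) - inner (l2_of (grad \<phi>)) (S r (Y r))"
    using eventually_ball_subset[of R] eventually_at_right_less[of "0::real"]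
  proof eventually_elim
    case (elim r)
    have r: "r > 0" "r \<noteq> 0" using elim(2) by auto
    define t where "t = - (1 / r) *\<^sub>R x0"
    \<comment> \<open>The factor r makes the blown-up gradient of v equal to the gradient of \<phi>,
      while v itself is of order r.\<close>
    define v where "v x = r * \<phi> (t + (1 / r) *\<^sub>R x)" for x
    have tz: "t + (1 / r) *\<^sub>R (x0 + r *\<^sub>R z) = z" for z using r by (simp add: t_def scaleR_add_right)
    have xz: "x = x0 + r *\<^sub>R (t + (1 / r) *\<^sub>R x)" for x using r by (simp add: t_def scaleR_add_right scaleR_diff_right)
    have tR: "test_fun (ball 0 R) \<phi>" by (rule test_funI[OF test_fun_smooth[OF \<phi>] Kp(1) R Kp(2)])
    have v: "test_fun \<Omega> v" unfolding v_def
    proof (rule test_fun_affine[OF tR])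
      show "1 / r \<noteq> 0" using r by simp
      show "x \<in> \<Omega>" if "t + (1 / r) *\<^sub>R x \<in> ball 0 R" for x
        using bspec[OF elim(1) that] unfolding xz[symmetric] .
    qed
    have gv: "grad v x = grad \<phi> (t + (1 / r) *\<^sub>R x)" for x
      unfolding v_def using grad_affine[OF test_fun_smooth[OF \<phi>], of r t "1 / r" x] r by simp
    let ?W = "l2_of (\<lambda>x. (v x, grad v x))"
    note sW = test_fun_pair_square_integrable[OF v]
    have W: "?W \<in> H10_space \<Omega>" by (rule test_fun_in_H10_space[OF v])
    note Mrf = Mr_field[OF r(1)]
    have "inner (matrix_op (Mr r) (l2_of (grad v))) (D r) = 1/2 * inner (e r) (l2_of v) - inner (l2_of (grad v)) (Y r)"
      using adjoint_difference[OF r(1) W] by (simp add: fst_op_l2_of[OF sW] snd_op_l2_of[OF sW])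
    moreover have "S r (matrix_op (Mr r) (l2_of (grad v))) = l2_of (\<lambda>z. Mr r (x0 + r *\<^sub>R z) *v grad \<phi> z)"
      unfolding matrix_op_l2_of[OF Mrf test_fun_grad_square_integrable[OF v]]
        affine_op_l2_of[OF r(2) square_integrable_matrix[OF Mrf test_fun_grad_square_integrable[OF v]]]
      unfolding gv tz ..
    moreover have "S r (l2_of v) = r *\<^sub>R l2_of \<phi>"
      unfolding affine_op_l2_of[OF r(2) test_fun_square_integrable[OF v]] l2_of_scaleR[OF test_fun_square_integrable[OF \<phi>]]
      unfolding v_def tz by simp
    moreover have "S r (l2_of (grad v)) = l2_of (grad \<phi>)"
      unfolding affine_op_l2_of[OF r(2) test_fun_grad_square_integrable[OF v]] unfolding gv tz by simp
    ultimately have "\<bar>r\<bar> ^ DIM(real^'n) * inner (l2_of (\<lambda>z. Mr r (x0 + r *\<^sub>R z) *v grad \<phi> z)) (S r (D r))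
      = \<bar>r\<bar> ^ DIM(real^'n) * (1/2 * (r * inner (S r (e r)) (l2_of \<phi>)) - inner (l2_of (grad \<phi>)) (S r (Y r)))"
      using inner_affine_op[OF r(2), of "matrix_op (Mr r) (l2_of (grad v))" "D r" x0]
        inner_affine_op[OF r(2), of "e r" "l2_of v" x0] inner_affine_op[OF r(2), of "l2_of (grad v)" "Y r" x0]
      by (simp add: right_diff_distrib)
    then show ?case using r by simp
  qed
  have small: "((\<lambda>r. 1/2 * (r * inner (S r (e r)) (l2_of \<phi>))) \<longlongrightarrow> 0) (at_right 0)"
  proof (rule Lim_null_comparison)
    show "\<forall>\<^sub>F r in at_right 0. norm (1/2 * (r * inner (S r (e r)) (l2_of \<phi>))) \<le> r * (C * norm (l2_of \<phi>))"
      using C eventually_at_right_less[of "0::real"]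
    proof eventually_elim
      case (elim r)
      have "\<bar>inner (S r (e r)) (l2_of \<phi>)\<bar> \<le> norm (S r (e r)) * norm (l2_of \<phi>)" by (rule Cauchy_Schwarz_ineq2)
      also have "\<dots> \<le> C * norm (l2_of \<phi>)" using elim(1) by (intro mult_right_mono) auto
      finally have "r * \<bar>inner (S r (e r)) (l2_of \<phi>)\<bar> \<le> r * (C * norm (l2_of \<phi>))" using elim(2) by (intro mult_left_mono) auto
      moreover have "0 \<le> r * \<bar>inner (S r (e r)) (l2_of \<phi>)\<bar>" using elim(2) by simp
      ultimately show ?case using elim(2) by (simp add: abs_mult)
    qed
    show "((\<lambda>r. r * (C * norm (l2_of \<phi>))) \<longlongrightarrow> 0) (at_right 0)"
      by (rule tendsto_mult_left_zero) (simp add: tendsto_ident_at)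
  qed
  have "((\<lambda>r. 1/2 * (r * inner (S r (e r)) (l2_of \<phi>)) - inner (l2_of (grad \<phi>)) (S r (Y r)))
    \<longlongrightarrow> 0 - inner (l2_of (grad \<phi>)) (l2_of (\<lambda>z. indicator \<omega> z *\<^sub>R (transpose (b - M x0) *v gp x0)))) (at_right 0)"
    by (intro tendsto_diff small tendsto_inner tendsto_const SY_tendsto)
  then have "((\<lambda>r. 1/2 * (r * inner (S r (e r)) (l2_of \<phi>)) - inner (l2_of (grad \<phi>)) (S r (Y r)))
    \<longlongrightarrow> - inner (l2_of (grad \<phi>)) (l2_of (\<lambda>z. indicator \<omega> z *\<^sub>R (transpose (b - M x0) *v gp x0)))) (at_right 0)" by simp
  then show ?thesis by (rule Lim_transform_eventually) (use eq in eventually_elim, simp)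
qed

text \<open>Only weak convergence of the rescaled gradients is needed. It is tested against \<open>\<eta> \<chi>\<^sub>\<omega>\<close> by writing this
  functional as \<open>v \<mapsto> \<integral> (corrector coefficient) Z \<cdot> \<nabla>v\<close> and approximating \<open>Z\<close> by gradients of test functions.\<close>

lemma rescaled_adjoint_weak_limit:
  assumes Q: "corrector_eq (M x0) b (gp x0) \<omega> Q gQ"
  shows "((\<lambda>r. inner (l2_of (\<lambda>z. indicator \<omega> z *\<^sub>R \<eta>)) (S r (D r))) \<longlongrightarrow> inner (l2_of (\<lambda>z. indicator \<omega> z *\<^sub>R \<eta>)) (l2_of gQ)) (at_right 0)"
proof -
  let ?A = "matrix_op (atilde (M x0) b \<omega>)" and ?X0 = "l2_of (\<lambda>z. indicator \<omega> z *\<^sub>R \<eta>)" and ?q = "l2_of gQ"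
  have At: "bounded_matrix_field (atilde (M x0) b \<omega>)" by (rule bounded_matrix_field_atilde[OF fmeasurableD[OF \<omega>_lmeasurable]])
  have H: "Hdot Q gQ" using Q by (simp add: corrector_eq_def)
  have q: "?q \<in> grad_space" by (rule Hdot_in_grad_space[OF H])
  have Qeq: "inner (?A V) ?q = - inner V (l2_of (\<lambda>x. indicator \<omega> x *\<^sub>R (transpose (b - M x0) *v gp x0)))" if "V \<in> grad_space" for V
    using Q that unfolding corrector_eq_iff[OF \<omega>_lmeasurable H] by blast
  obtain Z where Z: "Z \<in> grad_space" "\<And>G. G \<in> grad_space \<Longrightarrow> inner (?A Z) G = inner ?X0 G"
    using lax_milgram[OF subspace_grad_space closed_grad_space bounded_linear_matrix_op[OF At] \<alpha>_pos
        coercive_matrix_op[OF At coercive_atilde[OF M_coercive b_coercive]], of ?X0] by blast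
  obtain C where C: "\<forall>\<^sub>F r in at_right 0. norm (S r (D r)) \<le> C" using scaled_bounds by blast
  have "((\<lambda>r. inner (?A Z) (S r (D r) - ?q)) \<longlongrightarrow> 0) (at_right 0)"
  proof (rule tendsto_inner_of_dense[OF _ bounded_linear_matrix_op[OF At]])
    show "\<forall>\<^sub>F r in at_right 0. norm (S r (D r) - ?q) \<le> C + norm ?q"
      using C by eventually_elim (use norm_triangle_ineq4 order_trans add_right_mono in blast)
    show "Z \<in> closure {l2_of (grad \<phi>) |\<phi>. test_fun UNIV \<phi>}" using Z(1) by (simp add: grad_space_def)
    fix \<delta> assume "\<delta> \<in> {l2_of (grad \<phi>) |\<phi> :: real^'n \<Rightarrow> real. test_fun UNIV \<phi>}"
    then obtain \<phi> where \<phi>: "test_fun UNIV \<phi>" "\<delta> = l2_of (grad \<phi>)" by blast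
    \<comment> \<open>The flux that occurs in the rescaled equation. It differs from the limit flux
      by a term vanishing in norm, harmless against the bounded \<open>S r (D r)\<close>.\<close>
    let ?m = "\<lambda>r. l2_of (\<lambda>z. Mr r (x0 + r *\<^sub>R z) *v grad \<phi> z)"
    have "((\<lambda>r. ?A \<delta> - ?m r) \<longlongrightarrow> ?A \<delta> - ?A \<delta>) (at_right 0)"
      by (intro tendsto_diff tendsto_const) (unfold \<phi>(2), rule corrector_coefficient_tendsto[OF \<phi>(1)])
    then have "((\<lambda>r. norm (?A \<delta> - ?m r) * C) \<longlongrightarrow> 0) (at_right 0)"
      by (intro tendsto_mult_left_zero tendsto_norm_zero) simp
    then have "((\<lambda>r. inner (?A \<delta> - ?m r) (S r (D r))) \<longlongrightarrow> 0) (at_right 0)"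
    proof (rule Lim_null_comparison[rotated])
      show "\<forall>\<^sub>F r in at_right 0. norm (inner (?A \<delta> - ?m r) (S r (D r))) \<le> norm (?A \<delta> - ?m r) * C"
        using C
      proof eventually_elim
        case (elim r)
        have "\<bar>inner (?A \<delta> - ?m r) (S r (D r))\<bar> \<le> norm (?A \<delta> - ?m r) * norm (S r (D r))" by (rule Cauchy_Schwarz_ineq2)
        also have "\<dots> \<le> norm (?A \<delta> - ?m r) * C" using elim by (intro mult_left_mono) auto
        finally show ?case by simp
      qed
    qed
    from tendsto_add[OF this tested_adjoint_difference_tendsto[OF \<phi>(1)]]
    have "((\<lambda>r. inner (?A \<delta>) (S r (D r))) \<longlongrightarrow> inner (?A \<delta>) ?q) (at_right 0)"
      using Qeq[OF grad_test_fun_in_grad_space[OF \<phi>(1)]] unfolding \<phi>(2) by (simp add: inner_diff_left)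
    then show "((\<lambda>r. inner (?A \<delta>) (S r (D r) - ?q)) \<longlongrightarrow> 0) (at_right 0)"
      by (simp add: inner_diff_right LIM_zero)
  qed
  then have "((\<lambda>r. inner (?A Z) (S r (D r))) \<longlongrightarrow> inner (?A Z) ?q) (at_right 0)"
    by (simp add: inner_diff_right LIM_zero_iff)
  then have "((\<lambda>r. inner (?A Z) (S r (D r))) \<longlongrightarrow> inner ?X0 ?q) (at_right 0)" by (simp only: Z(2)[OF q])
  then show ?thesis
  proof (rule Lim_transform_eventually)
    show "\<forall>\<^sub>F r in at_right 0. inner (?A Z) (S r (D r)) = inner ?X0 (S r (D r))"
      using eventually_at_right_less[of "0::real"] by eventually_elim (simp add: Z(2) SD_in_grad_space)
  qed
qed

text \<open>The Jacobian of the blow-up cancels the factor r^d. What remains is the blow-up of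
  \<open>X r\<close> paired with those of the gradient of p and of \<open>D r\<close>: strong
  against strong convergence in the first case, strong against weak in the second.\<close>

theorem topological_derivative:
  assumes Q: "corrector_eq (M x0) b (gp x0) \<omega> Q gQ"
  shows "((\<lambda>r. (1/2 * (norm (fst_op (Ur r) - Yd))\<^sup>2 - 1/2 * (norm (fst_op U - Yd))\<^sup>2) / r ^ CARD('n))
    \<longlongrightarrow> - (((b - M x0) *v gy x0) \<bullet> (measure lebesgue \<omega> *\<^sub>R gp x0 + integral\<^sup>L (lebesgue_on \<omega>) gQ))) (at_right 0)"
proof -
  let ?\<eta> = "(b - M x0) *v gy x0"
  let ?X0 = "l2_of (\<lambda>z. indicator \<omega> z *\<^sub>R ?\<eta>)"
  let ?g = "\<lambda>r. l2_of (\<lambda>z. indicator \<omega> z *\<^sub>R gp (x0 + r *\<^sub>R z))"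
  have H: "Hdot Q gQ" using Q by (simp add: corrector_eq_def)
  have s\<eta>: "square_integrable (\<lambda>z. indicator \<omega> z *\<^sub>R v)" for v :: "real^'n" by (rule square_integrable_indicator_const[OF \<omega>_lmeasurable])
  obtain C where C: "\<forall>\<^sub>F r in at_right 0. norm (S r (D r)) \<le> C" using scaled_bounds by blast
  have 1: "((\<lambda>r. inner (S r (X r)) (?g r)) \<longlongrightarrow> inner ?X0 (l2_of (\<lambda>z. indicator \<omega> z *\<^sub>R gp x0))) (at_right 0)"
    using x0_gp(2) \<omega>_bounded fmeasurableD[OF \<omega>_lmeasurable] unfolding lebesgue_point_def
    by (intro tendsto_inner SX_tendsto) blast
  have "((\<lambda>r. norm (S r (X r) - ?X0) * C) \<longlongrightarrow> 0) (at_right 0)"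
    by (intro tendsto_mult_left_zero tendsto_norm_zero LIM_zero SX_tendsto)
  then have 2: "((\<lambda>r. inner (S r (X r) - ?X0) (S r (D r))) \<longlongrightarrow> 0) (at_right 0)"
  proof (rule Lim_null_comparison[rotated])
    show "\<forall>\<^sub>F r in at_right 0. norm (inner (S r (X r) - ?X0) (S r (D r))) \<le> norm (S r (X r) - ?X0) * C"
      using C
    proof eventually_elim
      case (elim r)
      have "\<bar>inner (S r (X r) - ?X0) (S r (D r))\<bar> \<le> norm (S r (X r) - ?X0) * norm (S r (D r))" by (rule Cauchy_Schwarz_ineq2)
      also have "\<dots> \<le> norm (S r (X r) - ?X0) * C" using elim by (intro mult_left_mono) auto
      finally show ?case by simp
    qed
  qed
  have lim: "((\<lambda>r. - (inner (S r (X r)) (?g r) + (inner (S r (X r) - ?X0) (S r (D r)) + inner ?X0 (S r (D r)))))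
      \<longlongrightarrow> - (inner ?X0 (l2_of (\<lambda>z. indicator \<omega> z *\<^sub>R gp x0)) + (0 + inner ?X0 (l2_of gQ)))) (at_right 0)"
    by (intro tendsto_minus tendsto_add 1 2 rescaled_adjoint_weak_limit[OF Q])
  have i1: "inner ?X0 (l2_of (\<lambda>z. indicator \<omega> z *\<^sub>R gp x0)) = ?\<eta> \<bullet> (measure lebesgue \<omega> *\<^sub>R gp x0)"
  proof -
    have "inner ?X0 (l2_of (\<lambda>z. indicator \<omega> z *\<^sub>R gp x0)) = (LINT z|lebesgue. indicator \<omega> z * (?\<eta> \<bullet> gp x0))"
      unfolding inner_l2_of[OF s\<eta> s\<eta>] by (rule Bochner_Integration.integral_cong) (auto simp: indicator_def)
    also have "\<dots> = measure lebesgue \<omega> * (?\<eta> \<bullet> gp x0)" using \<omega>_lmeasurable by simp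
    finally show ?thesis by simp
  qed
  have i2: "inner ?X0 (l2_of gQ) = ?\<eta> \<bullet> integral\<^sup>L (lebesgue_on \<omega>) gQ"
  proof -
    note sQ = Hdot_square_integrable[OF H]
    have ig: "integrable lebesgue (\<lambda>x. indicator \<omega> x *\<^sub>R gQ x)"
      using square_integrable_on_integrable[OF \<omega>_lmeasurable square_integrable_indicator[OF fmeasurableD[OF \<omega>_lmeasurable] sQ]] \<omega>_lmeasurable
      by (simp add: integrable_lebesgue_on_iff)
    have "inner ?X0 (l2_of gQ) = (LINT z|lebesgue. ?\<eta> \<bullet> (indicator \<omega> z *\<^sub>R gQ z))"
      unfolding inner_l2_of[OF s\<eta> sQ] by simp
    also have "\<dots> = ?\<eta> \<bullet> (LINT z|lebesgue. indicator \<omega> z *\<^sub>R gQ z)" by (rule integral_inner_right) (rule ig)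
    finally show ?thesis using \<omega>_lmeasurable by (simp add: integrable_lebesgue_on_iff)
  qed
  have "- (inner ?X0 (l2_of (\<lambda>z. indicator \<omega> z *\<^sub>R gp x0)) + (0 + inner ?X0 (l2_of gQ)))
      = - (?\<eta> \<bullet> (measure lebesgue \<omega> *\<^sub>R gp x0 + integral\<^sup>L (lebesgue_on \<omega>) gQ))"
    unfolding i1 i2 by (simp add: inner_add_right)
  with lim have "((\<lambda>r. - (inner (S r (X r)) (?g r) + (inner (S r (X r) - ?X0) (S r (D r)) + inner ?X0 (S r (D r)))))
      \<longlongrightarrow> - (?\<eta> \<bullet> (measure lebesgue \<omega> *\<^sub>R gp x0 + integral\<^sup>L (lebesgue_on \<omega>) gQ))) (at_right 0)" by simp
  then show ?thesis
  proof (rule Lim_transform_eventually)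
    show "\<forall>\<^sub>F r in at_right 0. - (inner (S r (X r)) (?g r) + (inner (S r (X r) - ?X0) (S r (D r)) + inner ?X0 (S r (D r))))
      = (1/2 * (norm (fst_op (Ur r) - Yd))\<^sup>2 - 1/2 * (norm (fst_op U - Yd))\<^sup>2) / r ^ CARD('n)"
      using eventually_at_right_less[of "0::real"]
    proof eventually_elim
      case (elim r)
      have r: "r > 0" "r \<noteq> 0" using elim by auto
      have sF: "square_integrable (\<lambda>x. indicator (\<omega>r r) x *\<^sub>R ((b - M x) *v gy x))"
        by (rule square_integrable_indicator[OF \<omega>r_measurable[OF r(1)] Fy_sq])
      have sgp: "square_integrable (\<lambda>z. gp (x0 + r *\<^sub>R z))" by (rule square_integrable_affine[OF gp(1) r(2)])
      have sgp': "square_integrable (\<lambda>z. indicator \<omega> z *\<^sub>R gp (x0 + r *\<^sub>R z))"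
        by (rule square_integrable_indicator[OF fmeasurableD[OF \<omega>_lmeasurable] sgp])
      \<comment> \<open>The blow-up of \<open>X r\<close> is supported in \<omega>, so the gradient
        of p may be cut off there; only this localised version converges by the Lebesgue point
        property.\<close>
      have "inner (S r (X r)) (S r (snd_op P)) = inner (S r (X r)) (?g r)"
        unfolding X_def gp(2) affine_op_l2_of[OF r(2) sF] affine_op_l2_of[OF r(2) gp(1)]
          inner_l2_of[OF square_integrable_affine[OF sF r(2)] sgp] inner_l2_of[OF square_integrable_affine[OF sF r(2)] sgp']
        by (rule Bochner_Integration.integral_cong) (auto simp: mem_\<omega>r[OF r(1)] indicator_def)
      moreover have "inner (X r) (snd_op (Pr r)) = r ^ CARD('n) * (inner (S r (X r)) (S r (snd_op P)) + inner (S r (X r)) (S r (D r)))"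
      proof -
        have "inner (X r) (snd_op (Pr r)) = inner (X r) (snd_op P) + inner (X r) (D r)" by (simp add: D_def inner_diff_right)
        then show ?thesis using inner_affine_op[OF r(2), of "X r" "snd_op P" x0] inner_affine_op[OF r(2), of "X r" "D r" x0] r(1)
          by (simp add: distrib_left)
      qed
      ultimately show ?case unfolding cost_difference[OF r(1)] using r by (simp add: inner_diff_left)
    qed
  qed
qed

end

section \<open>The topological derivative of the cost\<close>

text \<open>Bridge from integrals over the domain to the operator form. The given coefficient and
  its everywhere coercive representative differ on a null set, which the integral does not
  see.\<close>

lemma weak_form_integral:
  fixes \<Omega> :: "(real^'n) set"
  assumes \<Omega>: "open \<Omega>" and M: "bounded_matrix_field M"
    and a: "a \<in> borel_measurable (lebesgue_on \<Omega>)" and aM: "AE x in lebesgue. x \<in> \<Omega> \<longrightarrow> a x = M x"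
    and y: "H10 \<Omega> y gy" and v: "H10 \<Omega> v gv"
  shows "integral\<^sup>L (lebesgue_on \<Omega>) (\<lambda>x. (a x *v gy x) \<bullet> gv x)
    = inner (matrix_op M (snd_op (ext_pair \<Omega> y gy))) (snd_op (ext_pair \<Omega> v gv))"
proof -
  have \<Omega>m: "\<Omega> \<in> sets lebesgue" using \<Omega> by auto
  note s = H10_square_integrable(2)[OF y \<Omega>] H10_square_integrable(2)[OF v \<Omega>]
  have g: "gy \<in> borel_measurable (lebesgue_on \<Omega>)" "gv \<in> borel_measurable (lebesgue_on \<Omega>)"
    using y v by (auto simp: H10_def L2v_def)
  have "(\<lambda>x. a x *v gy x) \<in> borel_measurable (lebesgue_on \<Omega>)"
    by (rule borel_measurable_continuous_Pair[OF a g(1)])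
       (intro bounded_bilinear.continuous_on[OF bounded_bilinear_matrix_vector_mult] continuous_intros)
  then have "(\<lambda>x. (a x *v gy x) \<bullet> gv x) \<in> borel_measurable (lebesgue_on \<Omega>)" using g(2) by (rule borel_measurable_inner)
  then have m: "(\<lambda>x. indicator \<Omega> x *\<^sub>R ((a x *v gy x) \<bullet> gv x)) \<in> borel_measurable lebesgue"
    using borel_measurable_restrict_space_iff[of \<Omega> lebesgue "\<lambda>x. (a x *v gy x) \<bullet> gv x"] \<Omega>m by simp
  have "integral\<^sup>L (lebesgue_on \<Omega>) (\<lambda>x. (a x *v gy x) \<bullet> gv x) = (LINT x|lebesgue. indicator \<Omega> x *\<^sub>R ((a x *v gy x) \<bullet> gv x))"
    by (rule integrable_lebesgue_on_iff(2)[OF \<Omega>m])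
  also have "\<dots> = (LINT x|lebesgue. (M x *v (indicator \<Omega> x *\<^sub>R gy x)) \<bullet> (indicator \<Omega> x *\<^sub>R gv x))"
  proof (rule integral_cong_AE[OF m])
    show "(\<lambda>x. (M x *v (indicator \<Omega> x *\<^sub>R gy x)) \<bullet> (indicator \<Omega> x *\<^sub>R gv x)) \<in> borel_measurable lebesgue"
      by (intro borel_measurable_inner square_integrable_measurable square_integrable_matrix[OF M] s)
    show "AE x in lebesgue. indicator \<Omega> x *\<^sub>R ((a x *v gy x) \<bullet> gv x) = (M x *v (indicator \<Omega> x *\<^sub>R gy x)) \<bullet> (indicator \<Omega> x *\<^sub>R gv x)"
      using aM by eventually_elim (auto simp: indicator_def)
  qed
  also have "\<dots> = inner (matrix_op M (snd_op (ext_pair \<Omega> y gy))) (snd_op (ext_pair \<Omega> v gv))"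
    unfolding snd_op_ext_pair[OF y \<Omega>] snd_op_ext_pair[OF v \<Omega>] matrix_op_l2_of[OF M s(1)]
    by (rule inner_l2_of[symmetric]) (intro square_integrable_matrix[OF M] s)+
  finally show ?thesis .
qed

lemma source_integral:
  fixes \<Omega> :: "(real^'n) set"
  assumes \<Omega>: "open \<Omega>" and f: "L2 \<Omega> f" and v: "H10 \<Omega> v gv"
  shows "integral\<^sup>L (lebesgue_on \<Omega>) (\<lambda>x. f x * v x) = inner (l2_of (\<lambda>x. indicator \<Omega> x *\<^sub>R f x)) (fst_op (ext_pair \<Omega> v gv))"
proof -
  have \<Omega>m: "\<Omega> \<in> sets lebesgue" using \<Omega> by auto
  have sf: "square_integrable (\<lambda>x. indicator \<Omega> x *\<^sub>R f x)" using f by (simp only: L2_iff[OF \<Omega>m])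
  show ?thesis
    unfolding fst_op_ext_pair[OF v \<Omega>] inner_l2_of[OF sf H10_square_integrable(1)[OF v \<Omega>]] integrable_lebesgue_on_iff(2)[OF \<Omega>m]
    by (rule Bochner_Integration.integral_cong) (auto simp: indicator_def)
qed

lemma state_eq_iff_weak_solution:
  fixes \<Omega> :: "(real^'n) set"
  assumes \<Omega>: "open \<Omega>" and M: "bounded_matrix_field M"
    and a: "a \<in> borel_measurable (lebesgue_on \<Omega>)" and aM: "AE x in lebesgue. x \<in> \<Omega> \<longrightarrow> a x = M x"
    and f: "L2 \<Omega> f" and y: "H10 \<Omega> y gy"
  shows "state_eq \<Omega> a f y gy \<longleftrightarrow> weak_solution \<Omega> M (l2_of (\<lambda>x. indicator \<Omega> x *\<^sub>R f x)) (ext_pair \<Omega> y gy)"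
  unfolding state_eq_def weak_solution_def
proof (intro iffI conjI ballI allI impI y ext_pair_in_H10_space[OF y \<Omega>])
  assume *: "H10 \<Omega> y gy \<and> (\<forall>v gv. H10 \<Omega> v gv \<longrightarrow>
     integral\<^sup>L (lebesgue_on \<Omega>) (\<lambda>x. (a x *v gy x) \<bullet> gv x) = integral\<^sup>L (lebesgue_on \<Omega>) (\<lambda>x. f x * v x))"
  fix W assume "W \<in> H10_space \<Omega>"
  then obtain v gv where v: "H10 \<Omega> v gv" "ext_pair \<Omega> v gv = W" using H10_of_H10_space[OF _ \<Omega>] by blast
  show "inner (matrix_op M (snd_op (ext_pair \<Omega> y gy))) (snd_op W) = inner (l2_of (\<lambda>x. indicator \<Omega> x *\<^sub>R f x)) (fst_op W)"
    unfolding v(2)[symmetric] weak_form_integral[OF \<Omega> M a aM y v(1), symmetric] source_integral[OF \<Omega> f v(1), symmetric]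
    using * v(1) by blast
next
  assume *: "ext_pair \<Omega> y gy \<in> H10_space \<Omega> \<and> (\<forall>W\<in>H10_space \<Omega>. inner (matrix_op M (snd_op (ext_pair \<Omega> y gy))) (snd_op W)
     = inner (l2_of (\<lambda>x. indicator \<Omega> x *\<^sub>R f x)) (fst_op W))"
  fix v gv assume v: "H10 \<Omega> v gv"
  show "integral\<^sup>L (lebesgue_on \<Omega>) (\<lambda>x. (a x *v gy x) \<bullet> gv x) = integral\<^sup>L (lebesgue_on \<Omega>) (\<lambda>x. f x * v x)"
    unfolding weak_form_integral[OF \<Omega> M a aM y v] source_integral[OF \<Omega> f v]
    using * ext_pair_in_H10_space[OF v \<Omega>] by blast
qed

lemma adjoint_eq_adjoint_solution:
  fixes \<Omega> :: "(real^'n) set"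
  assumes \<Omega>: "open \<Omega>" and M: "bounded_matrix_field M"
    and a: "a \<in> borel_measurable (lebesgue_on \<Omega>)" and aM: "AE x in lebesgue. x \<in> \<Omega> \<longrightarrow> a x = M x"
    and y: "H10 \<Omega> y gy" and yd: "L2 \<Omega> yd" and p: "adjoint_eq \<Omega> a y yd p gp"
  shows "adjoint_solution \<Omega> M (fst_op (ext_pair \<Omega> y gy) - l2_of (\<lambda>x. indicator \<Omega> x *\<^sub>R yd x)) (ext_pair \<Omega> p gp)"
proof -
  have \<Omega>m: "\<Omega> \<in> sets lebesgue" using \<Omega> by auto
  have pH: "H10 \<Omega> p gp" using p by (simp add: adjoint_eq_def)
  have s: "square_integrable (\<lambda>x. indicator \<Omega> x *\<^sub>R y x)" "square_integrable (\<lambda>x. indicator \<Omega> x *\<^sub>R yd x)"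
    using H10_square_integrable(1)[OF y \<Omega>] yd by (simp_all only: L2_iff[OF \<Omega>m])
  have eq: "fst_op (ext_pair \<Omega> y gy) - l2_of (\<lambda>x. indicator \<Omega> x *\<^sub>R yd x) = l2_of (\<lambda>x. indicator \<Omega> x *\<^sub>R (y x - yd x))"
    unfolding fst_op_ext_pair[OF y \<Omega>] l2_of_diff[OF s] by (simp add: right_diff_distrib)
  have L: "L2 \<Omega> (\<lambda>x. y x - yd x)"
    unfolding L2_iff[OF \<Omega>m] using square_integrable_diff[OF s] by (simp add: right_diff_distrib)
  show ?thesis unfolding adjoint_solution_def eq
  proof (intro conjI ballI ext_pair_in_H10_space[OF pH \<Omega>])
    fix W assume "W \<in> H10_space \<Omega>"
    then obtain v gv where v: "H10 \<Omega> v gv" "ext_pair \<Omega> v gv = W" using H10_of_H10_space[OF _ \<Omega>] by blast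
    show "inner (matrix_op M (snd_op W)) (snd_op (ext_pair \<Omega> p gp)) = inner (l2_of (\<lambda>x. indicator \<Omega> x *\<^sub>R (y x - yd x))) (fst_op W)"
      unfolding v(2)[symmetric] weak_form_integral[OF \<Omega> M a aM v(1) pH, symmetric] source_integral[OF \<Omega> L v(1), symmetric]
      using p v(1) by (simp add: adjoint_eq_def)
  qed
qed

lemma cost_integral:
  fixes \<Omega> :: "(real^'n) set"
  assumes \<Omega>: "open \<Omega>" and y: "H10 \<Omega> y gy" and yd: "L2 \<Omega> yd"
  shows "integral\<^sup>L (lebesgue_on \<Omega>) (\<lambda>x. (y x - yd x)\<^sup>2) = (norm (fst_op (ext_pair \<Omega> y gy) - l2_of (\<lambda>x. indicator \<Omega> x *\<^sub>R yd x)))\<^sup>2"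
proof -
  have \<Omega>m: "\<Omega> \<in> sets lebesgue" using \<Omega> by auto
  have s: "square_integrable (\<lambda>x. indicator \<Omega> x *\<^sub>R y x)" "square_integrable (\<lambda>x. indicator \<Omega> x *\<^sub>R yd x)"
    using H10_square_integrable(1)[OF y \<Omega>] yd by (simp_all only: L2_iff[OF \<Omega>m])
  show ?thesis
    unfolding fst_op_ext_pair[OF y \<Omega>] l2_of_diff[OF s] norm_l2_of[OF square_integrable_diff[OF s]] integrable_lebesgue_on_iff(2)[OF \<Omega>m]
    by (rule Bochner_Integration.integral_cong) (auto simp: indicator_def)
qed

text \<open>The definite description in \<open>Jcost\<close> has a value because the weak solution
  exists and is unique as a class, so all admissible representatives of the state yield the same
  cost.\<close>

lemma Jcost_eq:
  fixes \<Omega> :: "(real^'n) set"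
  assumes \<Omega>: "open \<Omega>" "bounded \<Omega>" and \<alpha>: "\<alpha> > 0" and M: "bounded_matrix_field M" and coer: "\<And>x. coercive_mat \<alpha> (M x)"
    and a: "a \<in> borel_measurable (lebesgue_on \<Omega>)" and aM: "AE x in lebesgue. x \<in> \<Omega> \<longrightarrow> a x = M x"
    and f: "L2 \<Omega> f" and yd: "L2 \<Omega> yd" and U: "weak_solution \<Omega> M (l2_of (\<lambda>x. indicator \<Omega> x *\<^sub>R f x)) U"
  shows "Jcost \<Omega> f yd a = 1/2 * (norm (fst_op U - l2_of (\<lambda>x. indicator \<Omega> x *\<^sub>R yd x)))\<^sup>2"
  unfolding Jcost_def
proof (rule the_equality)
  have "U \<in> H10_space \<Omega>" using U by (simp add: weak_solution_def)
  then obtain y gy where y: "H10 \<Omega> y gy" "ext_pair \<Omega> y gy = U" using H10_of_H10_space[OF _ \<Omega>(1)] by blast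
  have "state_eq \<Omega> a f y gy" unfolding state_eq_iff_weak_solution[OF \<Omega>(1) M a aM f y(1)] y(2) by (rule U)
  then show "\<exists>y gy. state_eq \<Omega> a f y gy \<and> 1/2 * (norm (fst_op U - l2_of (\<lambda>x. indicator \<Omega> x *\<^sub>R yd x)))\<^sup>2
      = 1/2 * integral\<^sup>L (lebesgue_on \<Omega>) (\<lambda>x. (y x - yd x)\<^sup>2)"
    using cost_integral[OF \<Omega>(1) y(1) yd] y(2) by auto
  fix j assume "\<exists>y gy. state_eq \<Omega> a f y gy \<and> j = 1/2 * integral\<^sup>L (lebesgue_on \<Omega>) (\<lambda>x. (y x - yd x)\<^sup>2)"
  then obtain y gy where y: "state_eq \<Omega> a f y gy" "j = 1/2 * integral\<^sup>L (lebesgue_on \<Omega>) (\<lambda>x. (y x - yd x)\<^sup>2)" by blast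
  have yH: "H10 \<Omega> y gy" using y(1) by (simp add: state_eq_def)
  have "weak_solution \<Omega> M (l2_of (\<lambda>x. indicator \<Omega> x *\<^sub>R f x)) (ext_pair \<Omega> y gy)"
    using y(1) unfolding state_eq_iff_weak_solution[OF \<Omega>(1) M a aM f yH] .
  then have "ext_pair \<Omega> y gy = U" by (rule weak_solution_unique[OF \<Omega>(2) \<alpha> M coer _ U])
  then show "j = 1/2 * (norm (fst_op U - l2_of (\<lambda>x. indicator \<Omega> x *\<^sub>R yd x)))\<^sup>2"
    unfolding y(2) cost_integral[OF \<Omega>(1) yH yd] by simp
qed

text \<open>Closedness makes the set of points with coercive coefficient measurable, which the
  choice of a representative relies on.\<close>

lemma closed_coercive_mat: "closed {A :: real^'n^'n. coercive_mat \<alpha> A}"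
  unfolding coercive_mat_def
  by (intro closed_Collect_all closed_Collect_le continuous_intros
      bounded_bilinear.continuous_on[OF bounded_bilinear_matrix_vector_mult])

text \<open>Outside the set where the pointwise bounds hold, the coefficient is replaced by the coercive matrix \<open>b\<close>.\<close>

lemma admissible_representative:
  fixes a :: "real^'n \<Rightarrow> real^'n^'n" and b :: "real^'n^'n"
  assumes \<Omega>: "open \<Omega>" and a: "admissible \<alpha> \<Omega> a" and b: "coercive_mat \<alpha> b"
  obtains M where "bounded_matrix_field M" "\<And>x. coercive_mat \<alpha> (M x)" "AE x in lebesgue. x \<in> \<Omega> \<longrightarrow> a x = M x"
proof -
  have \<Omega>m: "\<Omega> \<in> sets lebesgue" using \<Omega> by auto
  obtain C where C: "AE x in lebesgue_on \<Omega>. norm (a x) \<le> C" "AE x in lebesgue_on \<Omega>. coercive_mat \<alpha> (a x)"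
    and am: "a \<in> borel_measurable (lebesgue_on \<Omega>)" using a by (auto simp: admissible_def)
  define a1 where "a1 x = indicator \<Omega> x *\<^sub>R a x" for x
  have a1m: "a1 \<in> borel_measurable lebesgue"
    unfolding a1_def[abs_def] using am borel_measurable_restrict_space_iff[of \<Omega> lebesgue a] \<Omega>m by simp
  define K where "K = {A :: real^'n^'n. coercive_mat \<alpha> A} \<inter> cball 0 C"
  define G where "G = \<Omega> \<inter> a1 -` K"
  have "closed K" unfolding K_def by (intro closed_Int closed_coercive_mat closed_cball)
  then have "a1 -` K \<inter> space lebesgue \<in> sets lebesgue" by (intro measurable_sets[OF a1m]) auto
  then have G: "G \<in> sets lebesgue" unfolding G_def using \<Omega>m by auto
  define M where "M x = (if x \<in> G then a1 x else b)" for x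
  show ?thesis
  proof (rule that[of M])
    have "M = (\<lambda>x. indicator G x *\<^sub>R a1 x + indicator (- G) x *\<^sub>R b)" by (auto simp: M_def indicator_def)
    moreover have "- G \<in> sets lebesgue" using sets.compl_sets[OF G] by (simp add: Compl_eq_Diff_UNIV)
    ultimately have "M \<in> borel_measurable lebesgue" using G a1m
      by (simp only:) (intro borel_measurable_add borel_measurable_scaleR borel_measurable_indicator borel_measurable_const)
    moreover have "norm (M x) \<le> max C (norm b)" for x by (auto simp: M_def G_def K_def)
    ultimately show "bounded_matrix_field M" unfolding bounded_matrix_field_def by blast
    show "coercive_mat \<alpha> (M x)" for x using b by (auto simp: M_def G_def K_def)
    have "AE x in lebesgue. x \<in> \<Omega> \<longrightarrow> norm (a x) \<le> C" "AE x in lebesgue. x \<in> \<Omega> \<longrightarrow> coercive_mat \<alpha> (a x)"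
      using C \<Omega>m by (simp_all add: AE_restrict_space_iff)
    then show "AE x in lebesgue. x \<in> \<Omega> \<longrightarrow> a x = M x"
      by eventually_elim (auto simp: M_def G_def K_def a1_def)
  qed
qed

lemma measure_open_pos:
  fixes \<omega> :: "'a::euclidean_space set"
  assumes "open \<omega>" "\<omega> \<in> lmeasurable" "x \<in> \<omega>" shows "measure lebesgue \<omega> > 0"
proof -
  obtain d where "d > 0" "ball x d \<subseteq> \<omega>" using assms openE by blast
  then have "measure lebesgue (ball x d) \<le> measure lebesgue \<omega>"
    by (intro measure_mono_fmeasurable assms(2)) auto
  with lmeasurable_ball_pos[OF \<open>d > 0\<close>, of x] show ?thesis by linarith
qed

text \<open>Uniqueness modulo constants is expressed as equality of gradients almost everywhere.
  That Q depends only on a(x0), b, the gradient of p at x0 and \<omega> is visible from the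
  parameters of \<open>corrector_eq\<close>. The unperturbed cost is written with the given state
  y.\<close>

theorem mainTheorem7:
  fixes \<Omega> \<omega> :: "(real^'n) set"
    and \<alpha> :: real
    and yd f y p :: "real^'n \<Rightarrow> real"
    and gy gp :: "real^'n \<Rightarrow> real^'n"
    and a :: "real^'n \<Rightarrow> real^'n^'n"
    and b :: "real^'n^'n"
  assumes \<Omega>_open: "open \<Omega>" and \<Omega>_conn: "connected \<Omega>" and \<Omega>_bdd: "bounded \<Omega>"
    and \<alpha>_pos: "\<alpha> > 0"
    and yd_L2: "L2 \<Omega> yd" and f_L2: "L2 \<Omega> f"
    and a_adm: "admissible \<alpha> \<Omega> a"
    and y_state: "state_eq \<Omega> a f y gy"
    and p_adj: "adjoint_eq \<Omega> a y yd p gp"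
    and \<omega>_open: "open \<omega>" and \<omega>_bdd: "bounded \<omega>" and \<omega>_0: "0 \<in> \<omega>"
    and b_M: "coercive_mat \<alpha> b"
  shows "AE x0 in lebesgue_on \<Omega>.
     (\<exists>Q gQ. corrector_eq (a x0) b (gp x0) \<omega> Q gQ) \<and>
     (\<forall>Q1 g1 Q2 g2. corrector_eq (a x0) b (gp x0) \<omega> Q1 g1 \<and> corrector_eq (a x0) b (gp x0) \<omega> Q2 g2
         \<longrightarrow> (AE x in lebesgue. g1 x = g2 x)) \<and>
     (\<forall>Q gQ. corrector_eq (a x0) b (gp x0) \<omega> Q gQ \<longrightarrow>
        ((\<lambda>r. (Jcost \<Omega> f yd (perturbed a b x0 \<omega> r)
               - 1/2 * integral\<^sup>L (lebesgue_on \<Omega>) (\<lambda>x. (y x - yd x)\<^sup>2))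
              / (r ^ CARD('n) * measure lebesgue \<omega>))
         \<longlongrightarrow> - (((b - a x0) *v gy x0) \<bullet>
                 (gp x0 + (1 / measure lebesgue \<omega>) *\<^sub>R integral\<^sup>L (lebesgue_on \<omega>) gQ)))
        (at_right 0))"
proof -
  have \<Omega>m: "\<Omega> \<in> sets lebesgue" and \<Omega>l: "\<Omega> \<in> lmeasurable" using \<Omega>_open \<Omega>_bdd by (auto simp: lmeasurable_open)
  have \<omega>l: "\<omega> \<in> lmeasurable" using \<omega>_open \<omega>_bdd by (simp add: lmeasurable_open)
  have \<omega>pos: "measure lebesgue \<omega> > 0" by (rule measure_open_pos[OF \<omega>_open \<omega>l \<omega>_0])
  obtain M where M: "bounded_matrix_field M" "\<And>x. coercive_mat \<alpha> (M x)" "AE x in lebesgue. x \<in> \<Omega> \<longrightarrow> a x = M x"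
    using admissible_representative[OF \<Omega>_open a_adm b_M] by blast
  have am: "a \<in> borel_measurable (lebesgue_on \<Omega>)" using a_adm by (simp add: admissible_def)
  have yH: "H10 \<Omega> y gy" and pH: "H10 \<Omega> p gp" using y_state p_adj by (auto simp: state_eq_def adjoint_eq_def)
  let ?F = "l2_of (\<lambda>x. indicator \<Omega> x *\<^sub>R f x)" and ?Yd = "l2_of (\<lambda>x. indicator \<Omega> x *\<^sub>R yd x)"
  let ?U = "ext_pair \<Omega> y gy" and ?P = "ext_pair \<Omega> p gp"
  let ?gy = "\<lambda>x. indicator \<Omega> x *\<^sub>R gy x" and ?gp = "\<lambda>x. indicator \<Omega> x *\<^sub>R gp x"
  have U: "weak_solution \<Omega> M ?F ?U"
    using y_state unfolding state_eq_iff_weak_solution[OF \<Omega>_open M(1) am M(3) f_L2 yH] .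
  have P: "adjoint_solution \<Omega> M (fst_op ?U - ?Yd) ?P"
    by (rule adjoint_eq_adjoint_solution[OF \<Omega>_open M(1) am M(3) yH yd_L2 p_adj])
  note sgy = H10_square_integrable(2)[OF yH \<Omega>_open] and sgp = H10_square_integrable(2)[OF pH \<Omega>_open]
  note bM = bounded_matrix_field_const_diff[OF M(1), of b]
  note sM = square_integrable_indicator_bounded_matrix_field[OF M(1) \<Omega>l]
  \<comment> \<open>These four conditions and the equality of a with M hold off one common null set,
    chosen before r and Q enter.\<close>
  have "AE x in lebesgue. lebesgue_point (\<lambda>x. indicator \<Omega> x *\<^sub>R M x) x"
    by (rule AE_lebesgue_point[OF sM])
  moreover have "AE x in lebesgue. lebesgue_point (\<lambda>x. (b - M x) *v ?gy x) x"
    by (rule AE_lebesgue_point[OF square_integrable_matrix[OF bM sgy]])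
  moreover have "AE x in lebesgue. lebesgue_point (\<lambda>x. transpose (b - M x) *v ?gp x) x"
    by (rule AE_lebesgue_point[OF square_integrable_matrix[OF bounded_matrix_field_transpose[OF bM] sgp]])
  moreover have "AE x in lebesgue. lebesgue_point ?gp x" by (rule AE_lebesgue_point[OF sgp])
  ultimately have "AE x0 in lebesgue. x0 \<in> \<Omega> \<longrightarrow>
     (\<exists>Q gQ. corrector_eq (a x0) b (gp x0) \<omega> Q gQ) \<and>
     (\<forall>Q1 g1 Q2 g2. corrector_eq (a x0) b (gp x0) \<omega> Q1 g1 \<and> corrector_eq (a x0) b (gp x0) \<omega> Q2 g2
         \<longrightarrow> (AE x in lebesgue. g1 x = g2 x)) \<and>
     (\<forall>Q gQ. corrector_eq (a x0) b (gp x0) \<omega> Q gQ \<longrightarrow>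
        ((\<lambda>r. (Jcost \<Omega> f yd (perturbed a b x0 \<omega> r)
               - 1/2 * integral\<^sup>L (lebesgue_on \<Omega>) (\<lambda>x. (y x - yd x)\<^sup>2))
              / (r ^ CARD('n) * measure lebesgue \<omega>))
         \<longlongrightarrow> - (((b - a x0) *v gy x0) \<bullet>
                 (gp x0 + (1 / measure lebesgue \<omega>) *\<^sub>R integral\<^sup>L (lebesgue_on \<omega>) gQ)))
        (at_right 0))"
    using M(3)
  proof eventually_elim
    case (elim x0)
    show ?case
    proof (intro impI conjI allI)
      assume x0: "x0 \<in> \<Omega>"
      then have ax0: "a x0 = M x0" using elim(5) by simp
      have cA: "coercive_mat \<alpha> (a x0)" unfolding ax0 by (rule M(2))
      show "\<exists>Q gQ. corrector_eq (a x0) b (gp x0) \<omega> Q gQ" by (rule corrector_exists[OF \<omega>l \<alpha>_pos cA b_M])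
      show "AE x in lebesgue. g1 x = g2 x"
        if "corrector_eq (a x0) b (gp x0) \<omega> Q1 g1 \<and> corrector_eq (a x0) b (gp x0) \<omega> Q2 g2" for Q1 g1 Q2 g2
        using that corrector_unique[OF \<omega>l \<alpha>_pos cA b_M] by blast
      fix Q gQ assume Q: "corrector_eq (a x0) b (gp x0) \<omega> Q gQ"
      let ?Mr = "\<lambda>r. perturbed M b x0 \<omega> r"
      have field: "bounded_matrix_field (?Mr r)" "\<And>x. coercive_mat \<alpha> (?Mr r x)"
        "perturbed a b x0 \<omega> r \<in> borel_measurable (lebesgue_on \<Omega>)"
        "AE x in lebesgue. x \<in> \<Omega> \<longrightarrow> perturbed a b x0 \<omega> r x = ?Mr r x" if r: "r > 0" for r
      proof -
        let ?w = "(\<lambda>z. x0 + r *\<^sub>R z) ` \<omega>"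
        have w: "?w \<in> sets lebesgue" by (rule sets_lebesgue_scaled_open[OF \<omega>_open r])
        show "bounded_matrix_field (?Mr r)" by (rule bounded_matrix_field_perturbed[OF M(1) \<omega>_open r])
        show "coercive_mat \<alpha> (?Mr r x)" for x using M(2) b_M by (simp add: perturbed_eq)
        have "(indicator ?w :: _ \<Rightarrow> real) \<in> borel_measurable (lebesgue_on \<Omega>)"
          by (rule measurable_restrict_space1) (rule borel_measurable_indicator[OF w])
        then show "perturbed a b x0 \<omega> r \<in> borel_measurable (lebesgue_on \<Omega>)" unfolding perturbed_def[abs_def] using am
          by (intro borel_measurable_add borel_measurable_scaleR borel_measurable_diff borel_measurable_const)
        show "AE x in lebesgue. x \<in> \<Omega> \<longrightarrow> perturbed a b x0 \<omega> r x = ?Mr r x"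
          using M(3) by eventually_elim (simp add: perturbed_def)
      qed
      \<comment> \<open>For r \<le> 0 this is an arbitrary element; the limit from the right sees
        only r > 0, where a solution exists.\<close>
      define Ur where "Ur r = (SOME V. weak_solution \<Omega> (?Mr r) ?F V)" for r
      have Ur: "weak_solution \<Omega> (?Mr r) ?F (Ur r)" if "r > 0" for r
        unfolding Ur_def using weak_solution_exists[OF \<Omega>_bdd \<alpha>_pos field(1,2)[OF that]] by (rule someI_ex)
      interpret inclusion \<Omega> \<omega> M b \<alpha> ?U ?P ?F ?Yd ?gy ?gp x0 Ur
        by unfold_locales
          (fact \<Omega>_open \<Omega>_bdd \<alpha>_pos \<omega>_open \<omega>_bdd M(1) M(2) b_M U P sgy snd_op_ext_pair[OF yH \<Omega>_open] sgp
            snd_op_ext_pair[OF pH \<Omega>_open] x0 elim(1) elim(2) elim(3) elim(4) Ur)+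
      \<comment> \<open>At a point of the domain the zero extensions and the representative M have
        the original values, so the corrector problem is the same one.\<close>
      have Q': "corrector_eq (M x0) b (?gp x0) \<omega> Q gQ" using Q x0 ax0 by simp
      have "((\<lambda>r. (1/2 * (norm (fst_op (Ur r) - ?Yd))\<^sup>2 - 1/2 * (norm (fst_op ?U - ?Yd))\<^sup>2) / r ^ CARD('n) / measure lebesgue \<omega>)
        \<longlongrightarrow> - (((b - M x0) *v ?gy x0) \<bullet> (measure lebesgue \<omega> *\<^sub>R ?gp x0 + integral\<^sup>L (lebesgue_on \<omega>) gQ)) / measure lebesgue \<omega>) (at_right 0)"
        using \<omega>pos by (intro tendsto_divide topological_derivative[OF Q'] tendsto_const) simp
      also have "- (((b - M x0) *v ?gy x0) \<bullet> (measure lebesgue \<omega> *\<^sub>R ?gp x0 + integral\<^sup>L (lebesgue_on \<omega>) gQ)) / measure lebesgue \<omega>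
        = - (((b - a x0) *v gy x0) \<bullet> (gp x0 + (1 / measure lebesgue \<omega>) *\<^sub>R integral\<^sup>L (lebesgue_on \<omega>) gQ))"
        using \<omega>pos x0 ax0 by (simp add: inner_add_right field_simps)
      finally show "((\<lambda>r. (Jcost \<Omega> f yd (perturbed a b x0 \<omega> r) - 1/2 * integral\<^sup>L (lebesgue_on \<Omega>) (\<lambda>x. (y x - yd x)\<^sup>2))
              / (r ^ CARD('n) * measure lebesgue \<omega>))
         \<longlongrightarrow> - (((b - a x0) *v gy x0) \<bullet> (gp x0 + (1 / measure lebesgue \<omega>) *\<^sub>R integral\<^sup>L (lebesgue_on \<omega>) gQ))) (at_right 0)"
      proof (rule Lim_transform_eventually)
        show "\<forall>\<^sub>F r in at_right 0. (1/2 * (norm (fst_op (Ur r) - ?Yd))\<^sup>2 - 1/2 * (norm (fst_op ?U - ?Yd))\<^sup>2) / r ^ CARD('n) / measure lebesgue \<omega>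
          = (Jcost \<Omega> f yd (perturbed a b x0 \<omega> r) - 1/2 * integral\<^sup>L (lebesgue_on \<Omega>) (\<lambda>x. (y x - yd x)\<^sup>2)) / (r ^ CARD('n) * measure lebesgue \<omega>)"
          using eventually_at_right_less[of "0::real"]
        proof eventually_elim
          case (elim r)
          show ?case
            unfolding Jcost_eq[OF \<Omega>_open \<Omega>_bdd \<alpha>_pos field(1,2)[OF elim] field(3,4)[OF elim] f_L2 yd_L2 Ur[OF elim]]
              cost_integral[OF \<Omega>_open yH yd_L2] by simp
        qed
      qed
    qed
  qed
  moreover have "\<Omega> \<inter> space lebesgue \<in> sets lebesgue" using \<Omega>m by simp
  ultimately show ?thesis by (simp only: AE_restrict_space_iff)
qed

end
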